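(* Let $D$ be a two-dimensional regular local ring with quotient field $F$, and let $A$ be an integrally closed local overring of $D$. Then the only nonempty patch closed subset $Z$ of $\operatorname{Val}(A)$ with $A = A(Z)$ is $\operatorname{Val}(A)$ itself.
   Context: An overring of $D$ is a ring $R$ with $D \subseteq R \subseteq F$; "local" means having a unique maximal ideal (not necessarily Noetherian). "Integrally closed" means integrally closed in $F$. $\operatorname{Val}(A)$ is the set of valuation rings of $F$ (valuation rings with quotient field $F$, where $F$ itself counts as a valuation ring) that contain and dominate $A$, i.e., whose maximal ideal contains the maximal ideal of $A$. For a nonempty set $Z$ of valuation rings, $A(Z)$ denotes the intersection of the rings in $Z$. Let $\operatorname{Zar}(D)$ be the set of all valuation rings of $F$ containing $D$. The patch topology on $\operatorname{Zar}(D)$ is the topology having as a basis of clopen sets the sets of the form $\{V \in \operatorname{Zar}(D) : x_1,\ldots,x_n \in V,\ y \notin V\}$ with $x_1,\ldots,x_n,y \in F$, together with their finite intersections and the sets $\{V \in \operatorname{Zar}(D) : x_1,\ldots,x_n \in V\}$ (equivalently, the coarsest topology in which every set $\{V \in \operatorname{Zar}(D): x \in V\}$, $x \in F$, is both open and closed). Patch closed subsets of $\operatorname{Val}(A)$ are those closed in the subspace topology induced from the patch topology. *)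

theory Defs
  imports "HOL-Algebra.Algebra" "HOL-Analysis.Abstract_Topology" "HOL-Library.Extended_Nat"
begin

(* Subrings of a field F are represented by their carriers D, A, V, ...; the corresponding ring
   is the record F\<lparr>carrier := D\<rparr>. *)

definition local_ring :: "('a, 'b) ring_scheme \<Rightarrow> bool" where
  "local_ring R \<longleftrightarrow> cring R \<and> (\<exists>!M. maximalideal M R)"

(* Only meaningful for local rings. *)
definition the_max_ideal :: "('a, 'b) ring_scheme \<Rightarrow> 'a set" where
  "the_max_ideal R = (THE M. maximalideal M R)"

(* Supremum of the lengths n of strict chains P_0 < P_1 < ... < P_n of prime ideals. *)
definition krull_dim :: "('a, 'b) ring_scheme \<Rightarrow> enat" where
  "krull_dim R = Sup {enat n | n. \<exists>P :: nat \<Rightarrow> 'a set.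
     (\<forall>i\<le>n. primeideal (P i) R) \<and> (\<forall>i<n. P i \<subset> P (Suc i))}"

(* Only meaningful for finitely generated ideals. *)
definition min_num_generators :: "('a, 'b) ring_scheme \<Rightarrow> 'a set \<Rightarrow> nat" where
  "min_num_generators R I =
     (LEAST n. \<exists>S \<subseteq> carrier R. finite S \<and> card S = n \<and> I = Idl\<^bsub>R\<^esub> S)"

definition regular_local_ring :: "('a, 'b) ring_scheme \<Rightarrow> bool" where
  "regular_local_ring R \<longleftrightarrow> noetherian_ring R \<and> local_ring R \<and>
     enat (min_num_generators R (the_max_ideal R)) = krull_dim R"

definition is_quotient_field :: "('a, 'b) ring_scheme \<Rightarrow> 'a set \<Rightarrow> bool" where
  "is_quotient_field F D \<longleftrightarrow> field F \<and> subring D F \<and>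
     (\<forall>x\<in>carrier F. \<exists>a\<in>D. \<exists>b\<in>D - {\<zero>\<^bsub>F\<^esub>}. x = a \<otimes>\<^bsub>F\<^esub> inv\<^bsub>F\<^esub> b)"

definition overring :: "('a, 'b) ring_scheme \<Rightarrow> 'a set \<Rightarrow> 'a set \<Rightarrow> bool" where
  "overring F D R \<longleftrightarrow> subring R F \<and> D \<subseteq> R"

(* In HOL-Algebra a polynomial is a list of coefficients, leading coefficient first. *)
definition integral_over :: "('a, 'b) ring_scheme \<Rightarrow> 'a set \<Rightarrow> 'a \<Rightarrow> bool" where
  "integral_over F A x \<longleftrightarrow>
     (\<exists>p. polynomial\<^bsub>F\<^esub> A p \<and> p \<noteq> [] \<and> hd p = \<one>\<^bsub>F\<^esub> \<and> ring.eval F p x = \<zero>\<^bsub>F\<^esub>)"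

definition integrally_closed_in :: "('a, 'b) ring_scheme \<Rightarrow> 'a set \<Rightarrow> bool" where
  "integrally_closed_in F A \<longleftrightarrow> (\<forall>x\<in>carrier F. integral_over F A x \<longrightarrow> x \<in> A)"

(* Valuation rings with quotient field F; carrier F is one of them. *)
definition valuation_ring_of :: "('a, 'b) ring_scheme \<Rightarrow> 'a set \<Rightarrow> bool" where
  "valuation_ring_of F V \<longleftrightarrow> subring V F \<and>
     (\<forall>x\<in>carrier F - {\<zero>\<^bsub>F\<^esub>}. x \<in> V \<or> inv\<^bsub>F\<^esub> x \<in> V)"

definition Zar :: "('a, 'b) ring_scheme \<Rightarrow> 'a set \<Rightarrow> 'a set set" where
  "Zar F D = {V. valuation_ring_of F V \<and> D \<subseteq> V}"

definition Val :: "('a, 'b) ring_scheme \<Rightarrow> 'a set \<Rightarrow> 'a set set" where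
  "Val F A = {V. valuation_ring_of F V \<and> A \<subseteq> V \<and>
     the_max_ideal (F\<lparr>carrier := A\<rparr>) \<subseteq> the_max_ideal (F\<lparr>carrier := V\<rparr>)}"

definition patch_topology :: "('a, 'b) ring_scheme \<Rightarrow> 'a set \<Rightarrow> 'a set topology" where
  "patch_topology F D = topology_generated_by
     ({{V \<in> Zar F D. S \<subseteq> V \<and> y \<notin> V} | S y. finite S \<and> S \<subseteq> carrier F \<and> y \<in> carrier F} \<union>
      {{V \<in> Zar F D. S \<subseteq> V} | S. finite S \<and> S \<subseteq> carrier F})"

end

theory Submission
  imports Defs
begin

text \<open>
Let \<open>V\<close> be a valuation ring dominating \<open>A\<close>. The theorem says two things. First,
\<open>A\<close> is the intersection of all valuation rings dominating it, because \<open>A\<close> is integrally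
closed (\<open>ex_Dom\<close>, a consequence of Chevalley's extension theorem \<open>ex_dominating\<close>).
Second, a set \<open>Z\<close> of such rings with intersection \<open>A\<close> is dense for the patch
topology. As a patch neighbourhood of \<open>V\<close> is given by a finite set of
elements of \<open>V\<close> that have to stay in a ring and, if they are nonunits, to stay nonunits
(\<open>patch_neighbourhood\<close>), the second part is the lemma \<open>density\<close>.

To prove it, suppose that no member of \<open>Z\<close> is in the neighbourhood \<open>W\<close> of \<open>V\<close>. It is enough to
find an element of \<open>F\<close> that lies in every valuation ring dominating \<open>D\<close> outside \<open>W\<close>, but not in some
valuation ring \<open>V'\<close> dominating \<open>A\<close>: it is in every member of \<open>Z\<close>, therefore in \<open>A\<close>, and yet not in
\<open>V'\<close>. Such elements are found with quadratic transforms. Let \<open>D = D_0\<close>, and let \<open>D_(i+1)\<close> be the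
local ring of the center of \<open>V\<close> on the blowup of the closed point of \<open>D_i\<close>; this is again a
two-dimensional regular local ring (\<open>reg_D1\<close>) as long as \<open>V\<close> is not the order valuation of \<open>D_i\<close>. If \<open>G\<close>
is a form of least degree \<open>d\<close> vanishing at the center, then \<open>x^d / G\<close> has poles only at valuation
rings dominating the transform (\<open>sep_base\<close>). Elements with confined poles found over some \<open>D_i\<close> can be
replaced by quotients of elements of \<open>D\<close> whose poles are confined in the same way (\<open>sep_pull\<close>); that is
the technical core of the proof.

Every element of \<open>F\<close> is a quotient of two elements of \<open>D\<close> generating an ideal of finite colength
(\<open>fin_of_fractions\<close>), and this colength drops with each transform (\<open>co_step\<close>). Hence each element of
\<open>V\<close> is in some \<open>D_i\<close>, or \<open>V\<close> is the order valuation of some \<open>D_i\<close> (\<open>reach\<close>). In the first case, applied to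
the finitely many elements that describe \<open>W\<close>, all valuation rings dominating \<open>D_i\<close> are in \<open>W\<close>, and \<open>V' = V\<close>
can be taken. In the second case \<open>V\<close> has to be replaced by a composite valuation ring \<open>V' \<subseteq> V\<close>
near \<open>V\<close> (\<open>near_order_valuation\<close>), and it must be shown that \<open>V'\<close> still dominates \<open>A\<close>. Unless \<open>A\<close> is a
valuation ring, when there is nothing to do, at some stage \<open>i\<close> neither \<open>x/y\<close> nor \<open>y/x\<close> is in \<open>A\<close> for the
parameters \<open>x, y\<close> of \<open>D_i\<close>. An argument of Kaplansky on homogeneous relations then gives \<open>A = D_i + m_A\<close>
(\<open>form_zero_mx\<close>, \<open>residue_trivial\<close>), where \<open>m_A\<close> is the maximal ideal of \<open>A\<close>, and so \<open>A \<subseteq> V'\<close>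
because \<open>m_A\<close> is contained in the maximal ideal of \<open>V\<close>, which is contained in that of \<open>V'\<close>.

Throughout, a valuation ring is represented by its divisibility preorder. The computations take
place in a commutative ring type into which the given field is embedded (\<open>ring_family\<close>).
\<close>

section \<open>Subrings of a field inside a commutative ring\<close>

text \<open>The ambient type is a commutative ring that need not have a unit; the field is a subset
with its own unit \<open>e\<close>. In this setting polynomial identities between field elements are
identities of the type class, so that the simplifier proves them without membership conditions,
and every field given by a carrier can be placed in such an ambient type.\<close>
locale field_in_ring =
  fixes K :: "'r::comm_ring set" and e :: 'r
  assumes zero_K [simp, intro]: "0 \<in> K"
    and e_K [simp, intro]: "e \<in> K"
    and add_K [simp, intro]: "a \<in> K \<Longrightarrow> b \<in> K \<Longrightarrow> a + b \<in> K"
    and uminus_K [simp, intro]: "a \<in> K \<Longrightarrow> - a \<in> K"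
    and mult_K [simp, intro]: "a \<in> K \<Longrightarrow> b \<in> K \<Longrightarrow> a * b \<in> K"
    and e_mult [simp]: "a \<in> K \<Longrightarrow> e * a = a"
    and e_nonzero [simp]: "e \<noteq> 0"
    and ex_inverse: "a \<in> K \<Longrightarrow> a \<noteq> 0 \<Longrightarrow> \<exists>b\<in>K. a * b = e"
begin

lemma mult_e [simp]: "a \<in> K \<Longrightarrow> a * e = a"
  by (metis e_mult mult.commute)

lemma diff_K [simp, intro]: "a \<in> K \<Longrightarrow> b \<in> K \<Longrightarrow> a - b \<in> K"
  by (metis add_K uminus_K diff_conv_add_uminus)

lemma cancel: 
  assumes "c \<in> K" "c \<noteq> 0" "a \<in> K" "b \<in> K" "c * a = c * b"
  shows "a = b"
proof -
  obtain d where "d \<in> K" and d: "d * c = e" using ex_inverse[OF assms(1,2)] by (auto simp: mult.commute)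
  have "(d * c) * a = (d * c) * b" using assms(5) by (simp add: mult.assoc)
  then show ?thesis using d assms by simp
qed

lemma mult_eq_zero: "a \<in> K \<Longrightarrow> b \<in> K \<Longrightarrow> a * b = 0 \<longleftrightarrow> a = 0 \<or> b = 0"
  using cancel[of a b 0] by auto

definition inverse_K :: "'r \<Rightarrow> 'r" where
  "inverse_K a = (SOME b. b \<in> K \<and> a * b = e)"

lemma inverse_K:
  assumes "a \<in> K" "a \<noteq> 0"
  shows "inverse_K a \<in> K" "a * inverse_K a = e" "inverse_K a * a = e" "inverse_K a \<noteq> 0"
proof -
  have "inverse_K a \<in> K \<and> a * inverse_K a = e"
    unfolding inverse_K_def using ex_inverse[OF assms] by (metis (mono_tags, lifting) someI_ex)
  then show "inverse_K a \<in> K" "a * inverse_K a = e" "inverse_K a * a = e" "inverse_K a \<noteq> 0"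
    by (auto simp: mult.commute)
qed

lemma ex_quot:
  assumes "a \<in> K" "b \<in> K" "b \<noteq> 0"
  obtains c where "c \<in> K" "c * b = a"
proof
  show "a * inverse_K b \<in> K" using assms inverse_K by auto
  show "(a * inverse_K b) * b = a" using assms inverse_K[OF assms(2,3)] by (simp add: mult.assoc)
qed

primrec pw :: "'r \<Rightarrow> nat \<Rightarrow> 'r" where
  "pw x 0 = e"
| "pw x (Suc n) = x * pw x n"

lemma pw_K [simp, intro]: "x \<in> K \<Longrightarrow> pw x n \<in> K"
  by (induction n) auto

lemma pw_nonzero [simp]: "x \<in> K \<Longrightarrow> x \<noteq> 0 \<Longrightarrow> pw x n \<noteq> 0"
  by (induction n) (auto simp: mult_eq_zero)

lemma pw_add: "x \<in> K \<Longrightarrow> pw x (m + n) = pw x m * pw x n"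
  by (induction m) (auto simp: mult.assoc)

lemma pw_mult: "x \<in> K \<Longrightarrow> pw x (m * n) = pw (pw x m) n"
  by (induction n) (auto simp: pw_add)

lemma pw_times: "x \<in> K \<Longrightarrow> y \<in> K \<Longrightarrow> pw (x * y) n = pw x n * pw y n"
  by (induction n) (auto simp: mult_ac)

definition is_subring :: "'r set \<Rightarrow> bool" where
  "is_subring D \<longleftrightarrow> D \<subseteq> K \<and> e \<in> D \<and> (\<forall>a\<in>D. \<forall>b\<in>D. a - b \<in> D \<and> a * b \<in> D)"

lemma sringD:
  assumes "is_subring D"
  shows "D \<subseteq> K" "e \<in> D" "0 \<in> D" "a \<in> D \<Longrightarrow> a \<in> K" "a \<in> D \<Longrightarrow> - a \<in> D" 
    "a \<in> D \<Longrightarrow> b \<in> D \<Longrightarrow> a + b \<in> D" "a \<in> D \<Longrightarrow> b \<in> D \<Longrightarrow> a - b \<in> D" "a \<in> D \<Longrightarrow> b \<in> D \<Longrightarrow> a * b \<in> D"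
    "a \<in> D \<Longrightarrow> pw a n \<in> D"
proof -
  show 1: "D \<subseteq> K" "e \<in> D" "a \<in> D \<Longrightarrow> a \<in> K" and m: "\<And>a b. a \<in> D \<Longrightarrow> b \<in> D \<Longrightarrow> a * b \<in> D"
    and s: "\<And>a b. a \<in> D \<Longrightarrow> b \<in> D \<Longrightarrow> a - b \<in> D"
    using assms by (auto simp: is_subring_def)
  then show z: "0 \<in> D" using s[of e e] by simp
  show u: "\<And>a. a \<in> D \<Longrightarrow> - a \<in> D" using s[OF z] by force
  show "a \<in> D \<Longrightarrow> b \<in> D \<Longrightarrow> a + b \<in> D" using s[OF _ u, of a b] by simp
  show "a \<in> D \<Longrightarrow> pw a n \<in> D" by (induction n) (use 1 m in auto)
qed

definition unit_in :: "'r set \<Rightarrow> 'r \<Rightarrow> bool" where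
  "unit_in D a \<longleftrightarrow> a \<in> D \<and> (\<exists>b\<in>D. a * b = e)"

definition nonunits_of :: "'r set \<Rightarrow> 'r set" where
  "nonunits_of D = {a \<in> D. \<not> unit_in D a}"

text \<open>Divisibility with quotient in \<open>U\<close>. For a valuation ring \<open>U\<close> with valuation \<open>v\<close> this is
\<open>v b \<le> v a\<close>, and the abbreviation below is \<open>v b < v a\<close>, expressed without a value group.\<close>
definition le :: "'r set \<Rightarrow> 'r \<Rightarrow> 'r \<Rightarrow> bool" where
  "le U b a \<longleftrightarrow> (\<exists>c\<in>U. a = b * c)"

abbreviation lt :: "'r set \<Rightarrow> 'r \<Rightarrow> 'r \<Rightarrow> bool" where
  "lt U b a \<equiv> \<not> le U a b"

definition val_ring :: "'r set \<Rightarrow> bool" where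
  "val_ring U \<longleftrightarrow> is_subring U \<and> (\<forall>a\<in>K. \<forall>b\<in>K. le U a b \<or> le U b a)"

definition dominators :: "'r set \<Rightarrow> 'r set set" where
  "dominators D = {U. val_ring U \<and> D \<subseteq> U \<and> nonunits_of D \<subseteq> nonunits_of U}"

lemma un_e: "is_subring D \<Longrightarrow> unit_in D e"
  using sringD unit_in_def by (metis e_K e_mult)

lemma unE:
  assumes "unit_in D a" obtains b where "b \<in> D" "a * b = e" "unit_in D b"
  using assms unfolding unit_in_def by (metis mult.commute)

lemma un_mult:
  assumes "is_subring D" "unit_in D a" "unit_in D b" shows "unit_in D (a * b)"
proof -
  obtain a' b' where "a' \<in> D" "a * a' = e" "b' \<in> D" "b * b' = e" "a \<in> D" "b \<in> D"
    using assms by (auto simp: unit_in_def)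
  moreover from this have "a * b * (a' * b') = e"
    using sringD(4)[OF assms(1)] by (metis e_mult mult.assoc mult.commute)
  ultimately show ?thesis using sringD[OF assms(1)] unfolding unit_in_def by metis
qed

lemma un_multD:
  assumes "is_subring D" "unit_in D (a * b)" "a \<in> D" "b \<in> D" shows "unit_in D a" "unit_in D b"
proof -
  obtain c where c: "c \<in> D" "a * b * c = e" using assms(2) by (auto simp: unit_in_def)
  then have "a * (b * c) = e" "b * (a * c) = e" by (simp_all add: mult_ac)
  then show "unit_in D a" "unit_in D b" using assms(3,4) c(1) sringD(8)[OF assms(1)] unfolding unit_in_def by blast+
qed

lemma mx_mult:
  assumes "is_subring D" "a \<in> nonunits_of D" "b \<in> D" shows "a * b \<in> nonunits_of D"
  using assms(2,3) un_multD(1)[OF assms(1), of a b] sringD(8)[OF assms(1), of a b] unfolding nonunits_of_def by blast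

lemma le_refl: "is_subring U \<Longrightarrow> a \<in> K \<Longrightarrow> le U a a"
  unfolding le_def using sringD(2)[of U] mult_e[of a] by (intro bexI[of _ e]) auto

lemma le_zero [simp]: "is_subring U \<Longrightarrow> le U a 0"
  unfolding le_def using sringD(3) mult_zero_right by metis

lemma le_trans: "is_subring U \<Longrightarrow> le U a b \<Longrightarrow> le U b c \<Longrightarrow> le U a c"
  unfolding le_def using sringD(8) mult.assoc by metis

lemma le_add: "is_subring U \<Longrightarrow> le U a b \<Longrightarrow> le U a c \<Longrightarrow> le U a (b + c)"
  unfolding le_def using sringD(6) distrib_left by metis

lemma le_diff: "is_subring U \<Longrightarrow> le U a b \<Longrightarrow> le U a c \<Longrightarrow> le U a (b - c)"
  unfolding le_def using sringD(7) by (metis right_diff_distrib)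

lemma le_mult: "is_subring U \<Longrightarrow> le U a b \<Longrightarrow> le U c d \<Longrightarrow> le U (a * c) (b * d)"
  unfolding le_def by (metis mult.assoc mult.left_commute sringD(8))

lemma le_mult_right: "is_subring U \<Longrightarrow> le U a b \<Longrightarrow> c \<in> U \<Longrightarrow> le U a (b * c)"
  unfolding le_def by (metis mult.assoc sringD(8))

lemma le_mult_left: "is_subring U \<Longrightarrow> le U a b \<Longrightarrow> c \<in> U \<Longrightarrow> le U a (c * b)"
  using le_mult_right by (metis mult.commute)

lemma le_cancel: 
  assumes "is_subring U" "c \<in> K" "c \<noteq> 0" "a \<in> K" "b \<in> K" "le U (c * a) (c * b)"
  shows "le U a b"
proof -
  obtain d where "d \<in> U" "c * b = c * (a * d)" using assms(6) by (auto simp: le_def mult.assoc)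
  then show ?thesis unfolding le_def using assms cancel sringD(4)[OF assms(1)] by (metis mult_K)
qed

lemma le_pw: "is_subring U \<Longrightarrow> le U a b \<Longrightarrow> le U (pw a n) (pw b n)"
  by (induction n) (auto intro: le_mult le_refl)

lemma mem_iff_le: "is_subring U \<Longrightarrow> z \<in> U \<longleftrightarrow> le U e z"
  unfolding le_def using sringD(4)[of U] by auto

lemma vr_sring [simp]: "val_ring U \<Longrightarrow> is_subring U"
  by (simp add: val_ring_def)

lemma lt_imp_le: "val_ring U \<Longrightarrow> a \<in> K \<Longrightarrow> b \<in> K \<Longrightarrow> lt U a b \<Longrightarrow> le U a b"
  by (auto simp: val_ring_def)

lemma lt_le_trans: "val_ring U \<Longrightarrow> lt U a b \<Longrightarrow> le U b c \<Longrightarrow> lt U a c"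
  using le_trans vr_sring by blast

lemma le_lt_trans: "val_ring U \<Longrightarrow> le U a b \<Longrightarrow> lt U b c \<Longrightarrow> lt U a c"
  using le_trans vr_sring by blast

lemma lt_add: 
  assumes "val_ring U" "b \<in> K" "c \<in> K" "lt U a b" "lt U a c" shows "lt U a (b + c)"
proof (cases "le U b c")
  case True
  then have "le U b (b + c)" using assms le_add le_refl by auto
  then show ?thesis using assms lt_le_trans by blast
next
  case False
  then have "le U c b" using assms lt_imp_le by auto
  then have "le U c (b + c)" using assms le_add le_refl by auto
  then show ?thesis using assms lt_le_trans by blast
qed

lemma le_uminus_left: "is_subring U \<Longrightarrow> le U (- b) a \<longleftrightarrow> le U b a"
proof -
  assume U: "is_subring U"
  have "le U (- b) a \<Longrightarrow> le U b a" for b a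
    using sringD(5)[OF U] unfolding le_def by (metis minus_mult_commute)
  from this[of b a] this[of "- b" a] show ?thesis by auto
qed

lemma lt_uminus: "val_ring U \<Longrightarrow> lt U a b \<Longrightarrow> lt U a (- b)"
  by (simp add: le_uminus_left)

lemma lt_diff: "val_ring U \<Longrightarrow> b \<in> K \<Longrightarrow> c \<in> K \<Longrightarrow> lt U a b \<Longrightarrow> lt U a c \<Longrightarrow> lt U a (b - c)"
  using lt_add[of U b "- c"] lt_uminus by auto

lemma lt_mult: 
  assumes "val_ring U" "a \<in> K" "b \<in> K" "c \<in> K" "d \<in> K" "lt U a b" "le U c d" "c \<noteq> 0"
  shows "lt U (a * c) (b * d)"
proof
  assume "le U (b * d) (a * c)"
  moreover have "le U (b * c) (b * d)" using assms le_mult le_refl by auto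
  ultimately have "le U (c * b) (c * a)" using assms le_trans vr_sring by (metis mult.commute)
  then show False using assms le_cancel vr_sring by blast
qed

lemma un_iff_le: "is_subring U \<Longrightarrow> z \<in> U \<Longrightarrow> unit_in U z \<longleftrightarrow> le U z e"
  unfolding unit_in_def le_def by metis

lemma mx_iff_lt: "val_ring U \<Longrightarrow> z \<in> K \<Longrightarrow> z \<in> nonunits_of U \<longleftrightarrow> lt U e z"
  using un_iff_le[of U z] mem_iff_le[of U z] lt_imp_le[of U e z] unfolding nonunits_of_def by auto

lemma mx_add_vr: "val_ring U \<Longrightarrow> a \<in> nonunits_of U \<Longrightarrow> b \<in> nonunits_of U \<Longrightarrow> a + b \<in> nonunits_of U"
proof -
  assume a: "val_ring U" "a \<in> nonunits_of U" "b \<in> nonunits_of U"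
  then have "a \<in> K" "b \<in> K" using sringD(4)[of U] by (auto simp: nonunits_of_def)
  then show ?thesis using a mx_iff_lt lt_add by auto
qed

lemma DomD:
  assumes "U \<in> dominators D"
  shows "val_ring U" "is_subring U" "D \<subseteq> U" "nonunits_of D \<subseteq> nonunits_of U" "a \<in> D \<Longrightarrow> a \<in> U" "a \<in> nonunits_of D \<Longrightarrow> a \<in> nonunits_of U"
  using assms by (auto simp: dominators_def)

end

section \<open>Regular systems of parameters\<close>

context field_in_ring begin
text \<open>The power \<open>m^n\<close> of the ideal \<open>m = (x, y)\<close>. The recursion uses only the two generators, so that
inductions on \<open>n\<close> produce two summands.\<close>
primrec max_power :: "'r set \<Rightarrow> 'r \<Rightarrow> 'r \<Rightarrow> nat \<Rightarrow> 'r set" where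
  "max_power D x y 0 = D"
| "max_power D x y (Suc n) = {x * a + y * b | a b. a \<in> max_power D x y n \<and> b \<in> max_power D x y n}"
end

locale two_parameters = field_in_ring K e for K :: "'r::comm_ring set" and e +
  fixes D :: "'r set" and x y :: 'r
  assumes is_subring: "is_subring D" and x [simp]: "x \<in> D" and y [simp]: "y \<in> D"
begin

abbreviation I :: "nat \<Rightarrow> 'r set" where "I n \<equiv> max_power D x y n"

lemmas D_K = sringD(4)[OF is_subring] and D_e [simp] = sringD(2)[OF is_subring]
  and D_0 [simp] = sringD(3)[OF is_subring] and D_uminus = sringD(5)[OF is_subring]
  and D_add = sringD(6)[OF is_subring] and D_diff = sringD(7)[OF is_subring]
  and D_mult = sringD(8)[OF is_subring] and D_pw = sringD(9)[OF is_subring]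

lemma x_K [simp]: "x \<in> K" and y_K [simp]: "y \<in> K"
  using x y D_K by auto

lemma I_D: "a \<in> I n \<Longrightarrow> a \<in> D"
  by (induction n arbitrary: a) (auto intro!: D_add D_mult)

lemma I_K: "a \<in> I n \<Longrightarrow> a \<in> K"
  using I_D D_K by blast

lemma I_SucI: "a \<in> I n \<Longrightarrow> b \<in> I n \<Longrightarrow> x * a + y * b \<in> I (Suc n)"
  by auto

lemma I_SucE:
  assumes "c \<in> I (Suc n)" obtains a b where "a \<in> I n" "b \<in> I n" "c = x * a + y * b"
  using assms by auto

declare max_power.simps(2) [simp del]

lemma I_add: "a \<in> I n \<Longrightarrow> b \<in> I n \<Longrightarrow> a + b \<in> I n"
proof (induction n arbitrary: a b)
  case (Suc n)
  then obtain a1 a2 b1 b2 where "a1 \<in> I n" "a2 \<in> I n" "b1 \<in> I n" "b2 \<in> I n" 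
    "a = x * a1 + y * a2" "b = x * b1 + y * b2" by (metis I_SucE)
  moreover from this have "a + b = x * (a1 + b1) + y * (a2 + b2)" by (simp add: algebra_simps)
  ultimately show ?case using Suc.IH I_SucI by metis
qed (simp add: D_add)

lemma I_mult: "a \<in> I n \<Longrightarrow> d \<in> D \<Longrightarrow> d * a \<in> I n"
proof (induction n arbitrary: a)
  case (Suc n)
  then obtain a1 a2 where "a1 \<in> I n" "a2 \<in> I n" "a = x * a1 + y * a2" by (metis I_SucE)
  moreover from this have "d * a = x * (d * a1) + y * (d * a2)" by (simp add: algebra_simps)
  ultimately show ?case using Suc I_SucI by metis
qed (simp add: D_mult)

lemma I_mult': "a \<in> I n \<Longrightarrow> d \<in> D \<Longrightarrow> a * d \<in> I n"
  using I_mult by (metis mult.commute)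

lemma I_uminus: "a \<in> I n \<Longrightarrow> - a \<in> I n"
  using I_mult[of a n "- e"] D_uminus[OF D_e] e_mult[OF I_K] by (metis mult_minus_left)

lemma I_diff: "a \<in> I n \<Longrightarrow> b \<in> I n \<Longrightarrow> a - b \<in> I n"
  using I_add[of a n "- b"] I_uminus by simp

lemma I_zero [simp]: "0 \<in> I n"
  by (induction n) (use I_SucI[of 0 _ 0] in auto)

lemma I_x: "a \<in> I n \<Longrightarrow> x * a \<in> I (Suc n)"
  using I_SucI[of a n 0] by simp

lemma I_y: "a \<in> I n \<Longrightarrow> y * a \<in> I (Suc n)"
  using I_SucI[of 0 n a] by simp

lemma I_Suc_sub: "a \<in> I (Suc n) \<Longrightarrow> a \<in> I n"
  using I_SucE I_add I_mult x y by metis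

lemma I_antimono: "m \<le> n \<Longrightarrow> a \<in> I n \<Longrightarrow> a \<in> I m"
proof (induction n)
  case (Suc n)
  then show ?case using I_Suc_sub le_Suc_eq by metis
qed simp

lemma I_mult2: "a \<in> I m \<Longrightarrow> b \<in> I n \<Longrightarrow> a * b \<in> I (m + n)"
proof (induction m arbitrary: a)
  case 0 then show ?case using I_mult by simp
next
  case (Suc m)
  then obtain a1 a2 where "a1 \<in> I m" "a2 \<in> I m" "a = x * a1 + y * a2" by (metis I_SucE)
  moreover from this have "a * b = x * (a1 * b) + y * (a2 * b)" by (simp add: algebra_simps)
  ultimately show ?case using Suc.IH Suc.prems(2) I_SucI by simp
qed

lemma I_pw: "a \<in> I m \<Longrightarrow> pw a n \<in> I (n * m)"
  by (induction n) (auto intro: I_mult2)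

lemma I_pw_x: "pw x n \<in> I n" and I_pw_y: "pw y n \<in> I n"
  by (induction n) (auto intro: I_x I_y)

lemma I_swap: "max_power D y x n = I n"
proof (induction n)
  case (Suc n)
  then show ?case by (auto simp: max_power.simps(2) add.commute)
qed simp

lemma I_1_iff: "a \<in> I 1 \<longleftrightarrow> (\<exists>b\<in>D. \<exists>c\<in>D. a = x * b + y * c)"
  by (auto simp: max_power.simps(2))

text \<open>Every monomial of degree \<open>n + 1\<close> other than the power of \<open>y\<close> is a multiple of \<open>x\<close>. This
asymmetric form of homogeneous expansion drives all division arguments below.\<close>
lemma I_Suc_decomp:
  assumes "a \<in> I (Suc n)"
  obtains b d where "b \<in> I n" "d \<in> D" "a = x * b + pw y (Suc n) * d"
proof -
  have "\<exists>b d. b \<in> I n \<and> d \<in> D \<and> a = x * b + pw y (Suc n) * d" using assms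
  proof (induction n arbitrary: a)
    case 0
    then show ?case by (auto simp: max_power.simps(2)) 
  next
    case (Suc n)
    then obtain a1 a2 where a: "a1 \<in> I (Suc n)" "a2 \<in> I (Suc n)" "a = x * a1 + y * a2" by (metis I_SucE)
    then obtain b d where b: "b \<in> I n" "d \<in> D" "a2 = x * b + pw y (Suc n) * d" using Suc.IH by metis
    have "a = x * (a1 + y * b) + pw y (Suc (Suc n)) * d"
      using a b by (simp add: algebra_simps)
    then show ?case using a b I_add I_y by metis
  qed
  then show ?thesis using that by blast
qed

lemma I_decomp_D:
  assumes "a \<in> I n"
  obtains b d where "b \<in> D" "d \<in> D" "a = x * b + pw y n * d"
proof (cases n)
  case 0
  show ?thesis using that[of 0 a] assms 0 D_K by auto
next
  case (Suc m)
  then show ?thesis using that I_Suc_decomp[of a m] assms I_D by metis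
qed

end

text \<open>A two-dimensional regular local ring, described by its graded ring: \<open>(x, y)\<close> is the ideal of
nonunits, the associated graded ring has no zero divisors, the powers of \<open>m\<close> intersect
in \<open>0\<close>, and the initial form of a power of one parameter is not a multiple of the other one. These
conditions pass to quadratic transforms by direct computation.\<close>
locale regular2 = two_parameters +
  assumes loc: "d \<in> D \<Longrightarrow> unit_in D d \<or> d \<in> I 1"
    and nonunit: "d \<in> I 1 \<Longrightarrow> \<not> unit_in D d"
    and gr: "a \<in> I m \<Longrightarrow> a \<notin> I (Suc m) \<Longrightarrow> b \<in> I n \<Longrightarrow> b \<notin> I (Suc n) \<Longrightarrow> a * b \<notin> I (Suc (m + n))"
    and sep: "(\<And>n. a \<in> I n) \<Longrightarrow> a = 0"
    and nx: "d \<in> D \<Longrightarrow> pw y n - x * d \<notin> I (Suc n)"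
    and ny: "d \<in> D \<Longrightarrow> pw x n - y * d \<notin> I (Suc n)"
begin

lemma mx_eq: "nonunits_of D = I 1"
  using loc nonunit I_D by (auto simp: nonunits_of_def)

lemma ex_order:
  assumes "a \<in> D" "a \<noteq> 0"
  obtains n where "a \<in> I n" "a \<notin> I (Suc n)"
proof -
  obtain m where m: "a \<notin> I m" using sep assms by blast
  define k where "k = (LEAST m. a \<notin> I m)"
  have k: "a \<notin> I k" unfolding k_def using m by (rule LeastI)
  then obtain n where n: "k = Suc n" using assms by (cases k) auto
  then have "a \<in> I n" using not_less_Least[of n "\<lambda>m. a \<notin> I m"] k_def by auto
  then show ?thesis using that k n by blast
qed

lemma x_1: "x \<in> I 1" "x \<notin> I (Suc 1)" and y_1: "y \<in> I 1" "y \<notin> I (Suc 1)"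
  using ny[of 0 1] nx[of 0 1] I_pw_x[of 1] I_pw_y[of 1] by auto

lemma x_nonzero [simp]: "x \<noteq> 0" and y_nonzero [simp]: "y \<noteq> 0"
  using x_1(2) y_1(2) I_zero by metis+

lemma gr_le:
  assumes "a \<in> I m" "a \<notin> I (Suc m)" "b \<in> D" "a * b \<in> I (m + n)" shows "b \<in> I n"
proof (rule ccontr)
  assume b: "b \<notin> I n"
  then have "b \<noteq> 0" by auto
  then obtain k where k: "b \<in> I k" "b \<notin> I (Suc k)" using ex_order assms by metis
  then have "k < n" using b I_antimono[of n k b] by force
  moreover have "a * b \<notin> I (Suc (m + k))" using gr assms k by blast
  ultimately show False using assms(4) I_antimono[of "Suc (m + k)" "m + n"] by simp
qed

lemma x_cancel: "z \<in> D \<Longrightarrow> x * z \<in> I (Suc n) \<Longrightarrow> z \<in> I n"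
  using gr_le[of x 1 z n] x_1 by simp

lemma y_cancel: "z \<in> D \<Longrightarrow> y * z \<in> I (Suc n) \<Longrightarrow> z \<in> I n"
  using gr_le[of y 1 z n] y_1 by simp

lemma pw_gr: 
  assumes "a \<in> I m" "a \<notin> I (Suc m)" shows "pw a n \<notin> I (Suc (n * m))"
proof (induction n)
  case 0
  then show ?case using nonunit un_e[OF is_subring] by auto
next
  case (Suc n)
  then show ?case using gr[OF assms I_pw[OF assms(1), of n]] by simp
qed

lemma pw_x_notin: "pw x n \<notin> I (Suc n)" 
  using ny[of 0 n] by simp

lemma swap: "regular2 K e D y x"
  using loc nonunit gr sep nx ny by unfold_locales (simp_all add: I_swap is_subring)

end

section \<open>A criterion for regularity\<close>

text \<open>Regularity follows when \<open>D/xD\<close> is a discrete valuation ring with uniformizer \<open>y\<close> and \<open>D\<close> is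
\<open>x\<close>-adically separated. These conditions can be checked both for a Noetherian local ring of
dimension two and for a quadratic transform.\<close>
locale regular2_criterion = two_parameters +
  assumes loc: "d \<in> D \<Longrightarrow> unit_in D d \<or> d \<in> I 1"
    and e_I: "e \<notin> I 1"
    and x_nz: "x \<noteq> 0"
    and dvr: "a \<in> D \<Longrightarrow> (\<exists>d\<in>D. a = x * d) \<or> (\<exists>r c d. unit_in D c \<and> d \<in> D \<and> a = c * pw y r + x * d)"
    and pw_y: "d \<in> D \<Longrightarrow> pw y r \<noteq> x * d"
    and sep_x: "(\<And>n. \<exists>d\<in>D. a = pw x n * d) \<Longrightarrow> a = 0"
begin

lemma nonunit: "d \<in> I 1 \<Longrightarrow> \<not> unit_in D d"
  using e_I I_mult' unfolding unit_in_def by metis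

lemma un_add: "unit_in D c \<Longrightarrow> m \<in> I 1 \<Longrightarrow> unit_in D (c + m)"
  using loc[of "c + m"] nonunit I_diff[of "c + m" 1 m] I_D[of m 1] D_add[of c m]
  by (force simp: unit_in_def)

lemma un_pw_y: assumes "unit_in D c" "d \<in> D" shows "c * pw y r \<noteq> x * d"
proof
  assume a: "c * pw y r = x * d"
  obtain b where b: "b \<in> D" "c * b = e" using assms by (auto simp: unit_in_def)
  have "pw y r = (c * b) * pw y r" using b by simp
  also have "\<dots> = x * (d * b)" using a by (simp add: mult_ac)
  finally show False using pw_y D_mult b assms by blast
qed

lemma y_reg: assumes "d \<in> D" "b \<in> D" "pw y n * d = x * b" obtains c where "c \<in> D" "d = x * c"
proof -
  have "\<not> (unit_in D c \<and> d' \<in> D \<and> d = c * pw y r + x * d')" for c r d'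
  proof
    assume a: "unit_in D c \<and> d' \<in> D \<and> d = c * pw y r + x * d'"
    then have "c \<in> K" using D_K by (auto simp: unit_in_def)
    then have "c * pw y (n + r) = x * (b - pw y n * d')"
      using a assms(3) by (simp add: pw_add algebra_simps)
    then show False using un_pw_y a assms D_diff D_mult D_pw y by metis
  qed
  then show ?thesis using dvr[OF assms(1)] that by blast
qed

lemma x_cancel:
  assumes "s \<in> D" "x * s \<in> I (Suc n)" shows "s \<in> I n"
proof -
  obtain b d where b: "b \<in> I n" "d \<in> D" "x * s = x * b + pw y (Suc n) * d"
    using I_Suc_decomp[OF assms(2)] by metis
  then have "pw y (Suc n) * d = x * (s - b)" by (simp add: algebra_simps)
  then obtain c where c: "c \<in> D" "d = x * c" using y_reg b assms I_D D_diff by metis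
  have "x * s = x * (b + pw y (Suc n) * c)" using b c by (simp add: algebra_simps)
  then have "s = b + pw y (Suc n) * c"
    using cancel[of x s] x_nz assms b c I_K D_K by auto
  then show ?thesis using I_add b c I_mult' I_Suc_sub I_pw_y by metis
qed

text \<open>An element of \<open>m^(n+1)\<close> is congruent modulo \<open>x\<close> to a multiple of \<open>y^(n+1)\<close>, whose value in
the discrete valuation ring \<open>D/xD\<close> is too large.\<close>
lemma un_pw_y_notin:
  assumes "unit_in D c" "d \<in> D" shows "c * pw y n - x * d \<notin> I (Suc n)"
proof
  assume "c * pw y n - x * d \<in> I (Suc n)"
  then obtain b b' where b: "b \<in> D" "b' \<in> D" "c * pw y n - x * d = x * b + pw y (Suc n) * b'"
    using I_decomp_D by metis
  have "(c + - (y * b')) * pw y n = x * (d + b)" using b(3) by (simp add: algebra_simps)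
  moreover have "- (y * b') \<in> I 1" using I_uminus I_y[of b' 0] b(2) by simp
  then have "unit_in D (c + - (y * b'))" using un_add assms(1) by blast
  ultimately show False using un_pw_y D_add b assms by metis
qed

text \<open>Modulo \<open>x\<close> times a form of one degree less, a form either has a unit as coefficient of the pure
power of \<open>y\<close> or is divisible by \<open>x\<close>. In the latter case \<open>x\<close> is cancelled and the degrees
drop; if both factors are of the first kind, so is the product.\<close>
lemma gr: 
  "a \<in> I m \<Longrightarrow> a \<notin> I (Suc m) \<Longrightarrow> b \<in> I n \<Longrightarrow> b \<notin> I (Suc n) \<Longrightarrow> a * b \<notin> I (Suc (m + n))"
proof (induction "m + n" arbitrary: m n a b rule: less_induct)
  case less
  have red: "\<exists>u v. unit_in D v \<and> u \<in> D \<and> a = x * u + v * pw y m" if 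
    a: "a \<in> I m" "a \<notin> I (Suc m)" and b: "b \<in> I n" "b \<notin> I (Suc n)" "a * b \<in> I (Suc (m + n))"
    and IH: "\<And>m' a. m' < m \<Longrightarrow> a \<in> I m' \<Longrightarrow> a \<notin> I (Suc m') \<Longrightarrow> a * b \<notin> I (Suc (m' + n))"
    for a m b n
  proof (cases m)
    case 0
    then have "unit_in D a" using loc[of a] a by auto
    then show ?thesis using D_K by (intro exI[of _ 0] exI[of _ a]) (auto simp: 0 unit_in_def)
  next
    case (Suc k)
    obtain a1 d where d: "a1 \<in> I k" "d \<in> D" "a = x * a1 + pw y m * d"
      using I_Suc_decomp[of a k] a Suc by auto
    show ?thesis
    proof (cases "unit_in D d")
      case True
      then show ?thesis using d I_D by (metis mult.commute)
    next
      case False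
      then obtain d1 d2 where d12: "d1 \<in> D" "d2 \<in> D" "d = x * d1 + y * d2"
        using loc[OF d(2)] by (metis I_1_iff)
      define a' where "a' = a1 + pw y m * d1"
      have a': "a' \<in> I k" unfolding a'_def using d(1) d12 I_add I_mult' I_pw_y[of m] I_Suc_sub Suc by metis
      have eq: "a = x * a' + pw y (Suc m) * d2" using d d12 by (simp add: a'_def algebra_simps)
      have y2: "pw y (Suc m) * d2 \<in> I (Suc m)" using I_mult' I_pw_y d12 by blast
      have "a' \<notin> I (Suc k)"
      proof
        assume "a' \<in> I (Suc k)"
        then have "x * a' \<in> I (Suc m)" using I_x Suc by simp
        then show False using a eq I_add y2 by auto
      qed
      have "x * (a' * b) = a * b - (pw y (Suc m) * d2) * b" using eq by (simp add: algebra_simps)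
      also have "\<dots> \<in> I (Suc (Suc k + n))" using I_diff[OF b(3)] I_mult2[OF y2 b(1)] Suc by simp
      finally have "a' * b \<in> I (Suc k + n)" using x_cancel D_mult a' b I_D by metis
      then show ?thesis using IH[of k a'] a' \<open>a' \<notin> I (Suc k)\<close> Suc by simp
    qed
  qed
  show ?case
  proof
    assume ab: "a * b \<in> I (Suc (m + n))"
    have "\<exists>u v. unit_in D v \<and> u \<in> D \<and> a = x * u + v * pw y m"
      by (rule red[OF less.prems ab]) (use less in auto)
    moreover have "\<exists>u v. unit_in D v \<and> u \<in> D \<and> b = x * u + v * pw y n"
    proof (rule red[OF less.prems(3,4,1,2)])
      show "b * a \<in> I (Suc (n + m))" using ab by (simp add: mult.commute add.commute)
      show "a' * a \<notin> I (Suc (m' + m))" if "m' < n" "a' \<in> I m'" "a' \<notin> I (Suc m')" for m' a'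
        using less.hyps[of m m' a a'] less.prems(1,2) that by (simp add: mult.commute add.commute)
    qed
    ultimately obtain u v u' v' where uv: "unit_in D v" "u \<in> D" "a = x * u + v * pw y m"
      "unit_in D v'" "u' \<in> D" "b = x * u' + v' * pw y n" by blast
    have "a * b = (v * v') * pw y (m + n) - x * (- (u * b + v * pw y m * u'))"
      using uv by (simp add: pw_add algebra_simps)
    moreover have "unit_in D (v * v')" using un_mult is_subring uv by blast
    moreover have "- (u * b + v * pw y m * u') \<in> D"
      using D_add D_mult D_uminus D_pw uv less.prems(3) I_D y unfolding unit_in_def by metis
    ultimately show False using un_pw_y_notin[of "v * v'" _ "m + n"] ab by metis
  qed
qed

lemma sep: assumes "\<And>n. a \<in> I n" shows "a = 0"
proof (rule ccontr)
  assume nz: "a \<noteq> 0"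
  have "\<exists>n. \<not> (\<exists>d\<in>D. a = pw x n * d)" using sep_x nz by blast
  define k where "k = (LEAST n. \<not> (\<exists>d\<in>D. a = pw x n * d))"
  have k: "\<not> (\<exists>d\<in>D. a = pw x k * d)" unfolding k_def 
    using \<open>\<exists>n. \<not> (\<exists>d\<in>D. a = pw x n * d)\<close> by (rule LeastI_ex)
  have aD: "a \<in> D" using assms[of 0] by simp
  then obtain j where j: "k = Suc j" using k D_K by (cases k) auto
  then obtain a' where a': "a' \<in> D" "a = pw x j * a'" 
    using not_less_Least[of j "\<lambda>n. \<not> (\<exists>d\<in>D. a = pw x n * d)"] k_def by auto
  have "\<not> (\<exists>d\<in>D. a' = x * d)" using k a' j by (auto simp: mult_ac)
  then obtain r c d where c: "unit_in D c" "d \<in> D" "a' = c * pw y r + x * d" using dvr[OF a'(1)] by blast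
  have "a' \<in> I n" for n
  proof -
    have "pw x i * a' \<in> I (i + n) \<Longrightarrow> a' \<in> I n" for i
    proof (induction i)
      case 0 then show ?case using a' D_K by simp
    next
      case (Suc i)
      then have "pw x i * a' \<in> I (i + n)" using x_cancel[of "pw x i * a'"] D_mult D_pw a' by (simp add: mult.assoc)
      then show ?case using Suc by blast
    qed
    then show ?thesis using assms a' by metis
  qed
  then have "c * pw y r - x * (- d) \<in> I (Suc r)" using c by (simp add: algebra_simps)
  then show False using un_pw_y_notin c D_uminus by blast
qed

lemma ny: "d \<in> D \<Longrightarrow> pw x n - y * d \<notin> I (Suc n)"
proof (induction n arbitrary: d)
  case 0
  show ?case
  proof
    assume "pw x 0 - y * d \<in> I (Suc 0)"
    then have "pw x 0 - y * d + y * d \<in> I (Suc 0)" using I_add I_y[of d 0] 0 by (metis max_power.simps(1))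
    then show False using e_I by simp
  qed
next
  case (Suc n)
  show ?case
  proof
    assume "pw x (Suc n) - y * d \<in> I (Suc (Suc n))"
    then obtain b b' where b: "b \<in> I (Suc n)" "b' \<in> D" "pw x (Suc n) - y * d = x * b + pw y (Suc (Suc n)) * b'"
      using I_Suc_decomp by metis
    define d' where "d' = d + pw y (Suc n) * b'"
    have d': "d' \<in> D" using d'_def Suc b D_add D_mult D_pw y by metis
    have eq: "x * (pw x n - b) = y * d'" using b(3) by (simp add: d'_def algebra_simps)
    have "pw x n - b \<in> D" using D_diff D_pw b I_D x by metis
    then obtain c where c: "c \<in> D" "d' = x * c" using y_reg[OF d', of "pw x n - b" 1] eq D_K[OF d'] by auto
    have "x * (pw x n - b) = x * (y * c)" using eq c by (simp add: mult_ac)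
    then have "pw x n - b = y * c" using cancel[of x "pw x n - b" "y * c"] x_nz I_K[OF b(1)] D_K[OF c(1)] by auto
    then have "pw x n - y * c = b" by (simp add: algebra_simps)
    then show False using Suc.IH c b by metis
  qed
qed

lemma is_reg: "regular2 K e D x y"
proof unfold_locales
  show "pw y n - x * d \<notin> I (Suc n)" if "d \<in> D" for d n
    using un_pw_y_notin[OF un_e[OF is_subring] that, of n] by simp
qed (use loc nonunit gr sep ny in blast)+

end

section \<open>Quadratic transforms along a valuation\<close>

lemma (in field_in_ring) le_mult_same: "is_subring U \<Longrightarrow> c \<in> K \<Longrightarrow> le U a b \<Longrightarrow> le U (a * c) (b * c)"
  by (rule le_mult) (auto intro: le_refl)

context regular2 begin

text \<open>The two alternatives for an initial form of positive degree: divisible by \<open>x\<close>, or monic in \<open>y\<close>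
up to a unit.\<close>
lemma lead_cases:
  assumes "q \<in> I (Suc k)"
  obtains q' w where "q' \<in> I k" "w \<in> I (Suc (Suc k))" "q = x * q' + w"
  | q' c where "q' \<in> I k" "unit_in D c" "q = x * q' + pw y (Suc k) * c"
proof -
  obtain q' c where q: "q' \<in> I k" "c \<in> D" "q = x * q' + pw y (Suc k) * c"
    using I_Suc_decomp[OF assms] by metis
  show ?thesis
  proof (cases "unit_in D c")
    case True then show ?thesis using that(2) q by blast
  next
    case False
    then have "pw y (Suc k) * c \<in> I (Suc k + 1)" using I_mult2[OF I_pw_y[of "Suc k"]] loc q(2) by blast
    then show ?thesis using that(1) q by simp
  qed
qed

text \<open>Weierstrass-type division by an element whose initial form is monic in \<open>y\<close>: the remainder keeps
a degree below that of the divisor, at the price of a power of \<open>x\<close>.\<close>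
lemma division:
  assumes q: "q' \<in> I k" "unit_in D c" "q = x * q' + pw y (Suc k) * c"
    and a: "a \<in> I (Suc k + j)"
  shows "\<exists>b s. b \<in> I j \<and> s \<in> I k \<and> a = q * b + pw x (Suc j) * s"
proof -
  obtain c' where c': "c' \<in> D" "c * c' = e" and cD: "c \<in> D" using q(2) by (auto simp: unit_in_def)
  \<comment> \<open>Division by one degree, where the leading coefficient is simply cancelled.\<close>
  have base: "\<exists>b s. b \<in> D \<and> s \<in> I k \<and> a = q * b + x * s" if a: "a \<in> I (Suc k)" for a
  proof -
    obtain b \<delta> where b: "b \<in> I k" "\<delta> \<in> D" "a = x * b + pw y (Suc k) * \<delta>"
      using I_Suc_decomp[OF a] by metis
    have "c * (c' * \<delta>) = \<delta>" using c' D_K[OF b(2)] by (simp add: mult.assoc[symmetric])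
    then have "pw y (Suc k) * \<delta> = pw y (Suc k) * (c * (c' * \<delta>))" by simp
    also have "\<dots> = (q - x * q') * (c' * \<delta>)"
      unfolding q(3) by (simp add: algebra_simps)
    finally have "pw y (Suc k) * \<delta> = (q - x * q') * (c' * \<delta>)" .
    then have "a = q * (c' * \<delta>) + x * (b - q' * (c' * \<delta>))" 
      using b(3) by (simp add: algebra_simps)
    moreover have cd: "c' * \<delta> \<in> D" using D_mult[OF c'(1) b(2)] .
    moreover have "b - q' * (c' * \<delta>) \<in> I k" using I_diff[OF b(1) I_mult'[OF q(1) cd]] .
    ultimately show ?thesis by blast
  qed
  show ?thesis using a
  proof (induction j arbitrary: a)
    case 0
    then obtain b s where b: "b \<in> D" "s \<in> I k" "a = q * b + x * s" using base[of a] by auto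
    then have "a = q * b + pw x (Suc 0) * s" using I_K by (simp add: mult.assoc)
    then show ?case using b by (metis max_power.simps(1))
  next
    case (Suc j)
    then have "a \<in> I (Suc (Suc k + j))" by simp
    then obtain a1 a2 where a12: "a1 \<in> I (Suc k + j)" "a2 \<in> I (Suc k + j)" "a = x * a1 + y * a2"
      by (metis I_SucE)
    obtain b1 s1 where 1: "b1 \<in> I j" "s1 \<in> I k" "a1 = q * b1 + pw x (Suc j) * s1"
      using Suc.IH a12 by blast
    obtain b2 s2 where 2: "b2 \<in> I j" "s2 \<in> I k" "a2 = q * b2 + pw x (Suc j) * s2"
      using Suc.IH a12 by blast
    obtain b3 s3 where 3: "b3 \<in> D" "s3 \<in> I k" "y * s2 = q * b3 + x * s3"
      using base I_y 2 by blast
    have "a = q * (x * b1 + y * b2) + pw x (Suc (Suc j)) * s1 + pw x (Suc j) * (y * s2)"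
      unfolding a12(3) 1(3) 2(3) by (simp add: algebra_simps)
    also have "\<dots> = q * (x * b1 + y * b2 + pw x (Suc j) * b3) + pw x (Suc (Suc j)) * (s1 + s3)"
      unfolding 3(3) by (simp add: algebra_simps)
    finally have "a = q * (x * b1 + y * b2 + pw x (Suc j) * b3) + pw x (Suc (Suc j)) * (s1 + s3)" .
    moreover have "x * b1 + y * b2 + pw x (Suc j) * b3 \<in> I (Suc j)"
      using I_add[OF I_SucI[OF 1(1) 2(1)] I_mult'[OF I_pw_x 3(1)]] .
    ultimately show ?case using I_add[OF 1(2) 3(2)] by blast
  qed
qed

lemma I1_mx: "U \<in> dominators D \<Longrightarrow> a \<in> I 1 \<Longrightarrow> lt U e a"
  using mx_eq DomD mx_iff_lt I_K by blast

lemma le_x: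
  assumes "U \<in> dominators D" "le U x y" "a \<in> I n" shows "le U (pw x n) a"
  using assms(3)
proof (induction n arbitrary: a)
  case 0
  then show ?case using DomD(2,3)[OF assms(1)] mem_iff_le by auto
next
  case (Suc n)
  then obtain a1 a2 where a: "a1 \<in> I n" "a2 \<in> I n" "a = x * a1 + y * a2" by (metis I_SucE)
  have "le U (x * pw x n) (x * a1)" "le U (x * pw x n) (y * a2)"
    using Suc.IH a le_mult DomD(2)[OF assms(1)] assms(2) le_refl by auto
  then show ?case using le_add DomD(2)[OF assms(1)] a by auto
qed

lemma lt_x:
  assumes "U \<in> dominators D" "le U x y" "a \<in> I (Suc n)" shows "lt U (pw x n) a"
proof -
  have "lt U (e * pw x n) (x * pw x n)"
    using lt_mult[OF DomD(1)[OF assms(1)], of e x "pw x n" "pw x n"] I1_mx[OF assms(1) x_1(1)] 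
      le_refl[OF DomD(2)[OF assms(1)]] by simp
  then have "lt U (pw x n) (pw x (Suc n))" by simp
  then show ?thesis using lt_le_trans[OF DomD(1)[OF assms(1)]] le_x[OF assms] by blast
qed

lemma pwx_quot:
  assumes "a \<in> K" obtains z where "z \<in> K" "z * pw x n = a"
  using ex_quot[OF assms pw_K[OF x_K] pw_nonzero[OF x_K x_nonzero]] by blast

lemma pwx_cancel: "z \<in> K \<Longrightarrow> w \<in> K \<Longrightarrow> pw x n * z = pw x n * w \<Longrightarrow> z = w"
  using cancel[OF pw_K[OF x_K] pw_nonzero[OF x_K x_nonzero]] .

lemma not_un_lt: "U \<in> dominators D \<Longrightarrow> unit_in D c \<Longrightarrow> le U c e"
  using DomD[of U D] unfolding unit_in_def le_def by (metis subsetD)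

end

text \<open>The data of a quadratic transform along \<open>V\<close> when \<open>V\<close> is not the order valuation: \<open>G\<close> has the
least degree among the elements whose value in \<open>V\<close> exceeds what their order predicts. After
division by a power of \<open>x\<close>, its initial form is an irreducible equation for the residue of
\<open>y/x\<close>.\<close>
locale quadratic = regular2 +
  fixes V k G
  assumes V: "V \<in> dominators D" and xy: "le V x y"
    and G: "G \<in> I (Suc k)" "G \<notin> I (Suc (Suc k))"
    and G_lt: "lt V (pw x (Suc k)) G"
    and min: "n \<le> k \<Longrightarrow> H \<in> I n \<Longrightarrow> H \<notin> I (Suc n) \<Longrightarrow> le V H (pw x n)"

lemma (in regular2) ex_quad:
  assumes V: "V \<in> dominators D" and xy: "le V x y"
    and G: "G \<in> I n" "G \<notin> I (Suc n)" "lt V (pw x n) G"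
  shows "\<exists>k G. quadratic K e D x y V k G"
proof -
  define P where "P n \<longleftrightarrow> (\<exists>G. G \<in> I n \<and> G \<notin> I (Suc n) \<and> lt V (pw x n) G)" for n
  define m where "m = (LEAST n. P n)"
  have "P n" using G P_def by blast
  then have m: "P m" unfolding m_def by (rule LeastI)
  then obtain H where H: "H \<in> I m" "H \<notin> I (Suc m)" "lt V (pw x m) H" using P_def by blast
  have "m \<noteq> 0"
  proof
    assume "m = 0"
    then have "unit_in D H" using H loc[of H] by auto
    then show False using not_un_lt[OF V] H \<open>m = 0\<close> by auto
  qed
  then obtain k where k: "m = Suc k" by (cases m) auto
  have "quadratic K e D x y V k H"
  proof unfold_locales
    fix n H assume n: "n \<le> k" "H \<in> I n" "H \<notin> I (Suc n)"
    then have "\<not> P n" using not_less_Least[of n P] k m_def by auto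
    then show "le V H (pw x n)" using n P_def by blast
  qed (use V xy H k in auto)
  then show ?thesis by blast
qed

context quadratic begin

lemmas vrV = DomD(1)[OF V] and srV = DomD(2)[OF V]

lemma G_K [simp]: "G \<in> K" using G I_K by blast
lemma G_D [simp]: "G \<in> D" using G I_D by blast

text \<open>If the initial form of \<open>G\<close> were divisible by \<open>x\<close>, the cofactor would contradict the
minimality of the degree.\<close>
lemma G_form: obtains h c where "h \<in> I k" "unit_in D c" "G = x * h + pw y (Suc k) * c"
proof (cases rule: lead_cases[OF G(1)])
  case (1 q' w)
  have "q' \<notin> I (Suc k)" using I_add[OF I_x[of q' "Suc k"] 1(2)] 1(3) G(2) by blast
  then have "le V q' (pw x k)" using min 1 by blast
  then have "le V (x * q') (x * pw x k)" using le_mult srV le_refl by auto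
  moreover have "x * q' = G - w" using 1 by simp
  moreover have "lt V (pw x (Suc k)) (G - w)"
    using lt_diff[OF vrV G_K I_K[OF 1(2)] G_lt lt_x[OF V xy 1(2)]] .
  ultimately show ?thesis by simp
qed (use that in blast)

lemma div_G:
  assumes "a \<in> I (Suc k + j)"
  obtains b s where "b \<in> I j" "s \<in> I k" "a = G * b + pw x (Suc j) * s"
  using G_form division[OF _ _ _ assms] by metis

text \<open>The dominating valuation rings with the same center as \<open>V\<close> on the blowup of the closed
point; see \<open>Dom_D1\<close>.\<close>
definition Q :: "'a set set" where
  "Q = {U \<in> dominators D. le U x y \<and> lt U (pw x (Suc k)) G}"

lemma V_Q: "V \<in> Q" using V xy G_lt by (simp add: Q_def)

lemma QD:
  assumes "U \<in> Q"
  shows "U \<in> dominators D" "le U x y" "lt U (pw x (Suc k)) G" "val_ring U" "is_subring U"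
  using assms DomD by (auto simp: Q_def)

lemma lt_G:
  assumes "U \<in> Q" "b \<in> I j" shows "lt U (pw x (Suc k + j)) (G * b)"
proof -
  have "lt U (pw x (Suc k) * pw x j) (G * b)"
    by (rule lt_mult) (use QD[OF assms(1)] le_x assms I_K in auto)
  then show ?thesis by (metis pw_add x_K)
qed

text \<open>A form whose value is larger than expected is a multiple of the form of \<open>G\<close>: the remainder of
division by \<open>G\<close> has degree at most \<open>k\<close>, hence has the value its degree predicts.\<close>
lemma ltV_cases:
  assumes H: "H \<in> I n" "lt V (pw x n) H" "H \<notin> I (Suc n)"
  obtains j b w where "n = Suc k + j" "b \<in> I j" "w \<in> I (Suc n)" "H = G * b + w"
proof -
  have "\<not> n \<le> k" using min H by blast
  then obtain j where n: "n = Suc k + j" by (metis less_iff_Suc_add not_le add_Suc)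
  obtain b s where b: "b \<in> I j" "s \<in> I k" "H = G * b + pw x (Suc j) * s"
    using div_G H n by metis
  have "s \<in> I (Suc k)"
  proof (rule ccontr)
    assume "s \<notin> I (Suc k)"
    then have "le V s (pw x k)" using min b by blast
    then have "le V (pw x (Suc j) * s) (pw x (Suc j) * pw x k)" by (rule le_mult[OF srV le_refl[OF srV pw_K[OF x_K]]])
    then have le: "le V (pw x (Suc j) * s) (pw x n)" using n by (simp add: pw_add mult_ac)
    have "lt V (pw x n) (H - G * b)"
      by (rule lt_diff[OF vrV _ _ H(2)]) (use lt_G[OF V_Q b(1)] n b H I_K in auto)
    then show False using le b(3) by simp
  qed
  then have "pw x (Suc j) * s \<in> I (Suc n)" using I_mult2[OF I_pw_x[of "Suc j"], of s "Suc k"] n by (simp add: add.commute)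
  then show ?thesis using that n b by blast
qed

text \<open>All rings in \<open>Q\<close> see the same forms vanish. The form of \<open>G\<close> is a multiple of the minimal form
for \<open>U\<close>, and by minimality for \<open>V\<close> the cofactor has degree \<open>0\<close>, so the two minimal forms
agree up to a unit. Consequently the quadratic transform depends only on the set \<open>Q\<close>.\<close>
lemma lt_same:
  assumes U: "U \<in> Q" and H: "H \<in> I n"
  shows "lt U (pw x n) H \<longleftrightarrow> lt V (pw x n) H"
proof
  assume "lt V (pw x n) H"
  then show "lt U (pw x n) H"
  proof (cases "H \<in> I (Suc n)")
    case True
    then show ?thesis using lt_x QD U by blast
  next
    case False
    with ltV_cases[OF H \<open>lt V (pw x n) H\<close>] obtain j b w where 
      *: "n = Suc k + j" "b \<in> I j" "w \<in> I (Suc n)" "H = G * b + w" by metis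
    then show ?thesis using lt_add[OF QD(4)[OF U]] lt_G[OF U *(2)] lt_x[OF QD(1,2)[OF U] *(3)] I_K
      by (metis G_K mult_K)
  qed
next
  assume lt: "lt U (pw x n) H"
  obtain k' G' where "quadratic K e D x y U k' G'"
    using ex_quad[OF QD(1,2)[OF U] G] QD[OF U] by blast
  then interpret U: quadratic K e D x y U k' G' .
  have "\<not> Suc k \<le> k'" using U.min[OF _ G] QD(3)[OF U] by blast
  obtain j b w where jbw: "Suc k = Suc k' + j" "b \<in> I j" "w \<in> I (Suc (Suc k))" "G = G' * b + w"
    using U.ltV_cases[OF G(1) QD(3)[OF U] G(2)] by metis
  have b: "b \<notin> I (Suc j)"
  proof
    assume "b \<in> I (Suc j)"
    then have "G' * b \<in> I (Suc k' + Suc j)" by (rule I_mult2[OF U.G(1)])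
    then have "G' * b \<in> I (Suc (Suc k))" using jbw(1) by simp
    then show False using I_add[OF _ jbw(3)] jbw(4) G(2) by blast
  qed
  have "lt V (pw x (Suc k)) (G - w)"
    using lt_diff[OF vrV G_K I_K[OF jbw(3)] G_lt lt_x[OF V xy jbw(3)]] .
  then have ltV: "lt V (pw x (Suc k)) (G' * b)" using jbw by simp
  have j: "j = 0"
  proof (rule ccontr)
    assume "j \<noteq> 0"
    then have "le V G' (pw x (Suc k'))" "le V b (pw x j)"
      using min[OF _ U.G] min[OF _ jbw(2) b] jbw(1) \<open>j \<noteq> 0\<close> by auto
    then have "le V (G' * b) (pw x (Suc k') * pw x j)" by (rule le_mult[OF srV])
    then show False using ltV jbw(1) by (metis pw_add x_K)
  qed
  then obtain b' where b': "b' \<in> D" "b * b' = e" using b jbw loc[of b] by (auto simp: unit_in_def)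
  have G'K: "G' \<in> K" using U.G I_K by blast
  have "G' = (G' * b) * b'" using b' G'K by (simp add: mult.assoc)
  then have G': "G' = G * b' - w * b'" using jbw by (simp add: algebra_simps)
  show "lt V (pw x n) H"
  proof (cases "H \<in> I (Suc n)")
    case True
    then show ?thesis using lt_x V xy by blast
  next
    case False
    with U.ltV_cases[OF H lt] obtain i c w' where 
      *: "n = Suc k' + i" "c \<in> I i" "w' \<in> I (Suc n)" "H = G' * c + w'" by metis
    have Heq: "H = G * (b' * c) + (w' - w * (b' * c))" using * G' by (simp add: algebra_simps)
    have bc: "b' * c \<in> I i" using I_mult[OF *(2) b'(1)] .
    moreover have "w * (b' * c) \<in> I (Suc n)" 
      using I_mult2[OF jbw(3) bc] * j jbw by simp
    moreover have "n = Suc k + i" using *(1) j jbw(1) by simp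
    ultimately have "lt V (pw x n) (G * (b' * c))" "w' - w * (b' * c) \<in> I (Suc n)" "b' * c \<in> K"
      using lt_G[OF V_Q, of "b' * c" i] I_diff[OF *(3)] bc I_K by blast+
    then show ?thesis unfolding Heq using lt_add[OF vrV] lt_x[OF V xy] I_K by (metis G_K mult_K)
  qed
qed

text \<open>The quadratic transform: the localization of \<open>D[y/x]\<close> at the center of \<open>V\<close>, written with
homogeneous numerators and denominators so that no localization has to be formed.\<close>
definition D1 :: "'a set" where
  "D1 = {z \<in> K. \<exists>n a b. a \<in> I n \<and> b \<in> I n \<and> le V b (pw x n) \<and> z * b = a}"

definition g :: 'a where "g = G * inverse_K (pw x (Suc k))"

lemma g_K [simp]: "g \<in> K" unfolding g_def by (rule mult_K[OF G_K inverse_K(1)[OF pw_K[OF x_K] pw_nonzero[OF x_K x_nonzero]]])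

lemma g_eq: "g * pw x (Suc k) = G"
  unfolding g_def mult.assoc inverse_K(3)[OF pw_K[OF x_K] pw_nonzero[OF x_K x_nonzero]] by simp

lemma D1I: "z \<in> K \<Longrightarrow> a \<in> I n \<Longrightarrow> b \<in> I n \<Longrightarrow> le V b (pw x n) \<Longrightarrow> z * b = a \<Longrightarrow> z \<in> D1"
  by (auto simp: D1_def)

lemma le_pwx: "le V (pw x n) (pw x n)" using le_refl srV by auto

lemma D1I': "z \<in> K \<Longrightarrow> a \<in> I n \<Longrightarrow> z * pw x n = a \<Longrightarrow> z \<in> D1"
  using D1I[OF _ _ I_pw_x le_pwx] by blast

lemma D1E:
  assumes "z \<in> D1"
  obtains n a b where "a \<in> I n" "b \<in> I n" "le V b (pw x n)" "z * b = a" "b \<noteq> 0" "z \<in> K" "b \<notin> I (Suc n)"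
proof -
  obtain n a b where *: "a \<in> I n" "b \<in> I n" "le V b (pw x n)" "z * b = a" "z \<in> K"
    using assms by (auto simp: D1_def)
  moreover have "b \<notin> I (Suc n)" using lt_x[OF V xy] * by blast
  moreover have "b \<noteq> 0" using calculation by auto
  ultimately show ?thesis using that by blast
qed

lemma le_mult_pwx: "le V b (pw x n) \<Longrightarrow> le V b' (pw x n') \<Longrightarrow> le V (b * b') (pw x (n + n'))"
  using le_mult[OF srV] by (metis pw_add x_K)

lemma sring_D1: "is_subring D1"
  unfolding is_subring_def
proof (intro conjI ballI)
  show "D1 \<subseteq> K" by (auto simp: D1_def)
  show "e \<in> D1" using D1I'[of e e 0] by simp
  fix z w assume "z \<in> D1" "w \<in> D1"
  then obtain n a b n' a' b' where z: "a \<in> I n" "b \<in> I n" "le V b (pw x n)" "z * b = a" "z \<in> K"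
    and w: "a' \<in> I n'" "b' \<in> I n'" "le V b' (pw x n')" "w * b' = a'" "w \<in> K" by (metis D1E)
  have "(z - w) * (b * b') = a * b' - b * a'" using z(4) w(4) by (auto simp: algebra_simps)
  then show "z - w \<in> D1" 
    using z w by (intro D1I[of _ _ "n + n'" "b * b'"]) (auto intro: I_mult2 I_diff le_mult_pwx)
  have "(z * w) * (b * b') = a * a'" using z(4) w(4) by (auto simp: mult_ac)
  then show "z * w \<in> D1" 
    using z w by (intro D1I[of _ _ "n + n'" "b * b'"]) (auto intro: I_mult2 I_diff le_mult_pwx)
qed

lemma D_D1: "D \<subseteq> D1"
  using D1I'[of _ _ 0] D_K by auto

lemma x_D1 [simp]: "x \<in> D1" using D_D1 by auto

lemma g_D1 [simp]: "g \<in> D1" using D1I'[OF g_K G(1) g_eq] .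

lemma D1_K: "z \<in> D1 \<Longrightarrow> z \<in> K" by (simp add: D1_def)

lemma D1_unit:
  assumes "z \<in> K" "a \<in> I n" "b \<in> I n" "le V b (pw x n)" "z * b = a" "le V a (pw x n)"
  shows "unit_in D1 z"
proof -
  have "a \<noteq> 0" "b \<noteq> 0" using assms(4,6) lt_x[OF V xy I_zero, of n] by auto
  then obtain z' where z': "z' \<in> K" "z' * a = b" using ex_quot assms I_K by metis
  then have "z' \<in> D1" using assms D1I by blast
  moreover have "z * z' = e" 
  proof (rule cancel[of b])
    have "b * (z * z') = (z * b) * z'" by (simp add: mult_ac)
    also have "\<dots> = b" using assms(5) z'(2) by (simp add: mult.commute)
    finally show "b * (z * z') = b * e" using I_K[OF assms(3)] by simp
  qed (use \<open>b \<noteq> 0\<close> assms I_K z' in auto)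
  ultimately show ?thesis using D1I[OF assms(1-5)] by (auto simp: unit_in_def)
qed

lemma D1_subset: "U \<in> Q \<Longrightarrow> D1 \<subseteq> U"
proof
  fix z assume U: "U \<in> Q" and "z \<in> D1"
  then obtain n a b where z: "a \<in> I n" "b \<in> I n" "le V b (pw x n)" "z * b = a" "z \<in> K" "b \<noteq> 0" by (metis D1E)
  have "le U b (pw x n)" using lt_same[OF U z(2)] z by blast
  moreover have "le U (pw x n) a" using le_x QD[OF U] z by blast
  ultimately have "le U (b * e) (b * z)" using le_trans QD[OF U] z I_K by (metis mult.commute mult_e)
  then show "z \<in> U" using le_cancel[of U b e z] mem_iff_le QD[OF U] z I_K by auto
qed

text \<open>The nonunits of the quadratic transform are generated by \<open>x\<close> and \<open>g = G / x^(k+1)\<close>,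
because a numerator of excessive value is a multiple of \<open>G\<close> up to higher order.\<close>
lemma D1_decomp:
  assumes "z \<in> K" "a \<in> I n" "b \<in> I n" "le V b (pw x n)" "z * b = a" "lt V (pw x n) a"
  shows "\<exists>s\<in>D1. \<exists>t\<in>D1. z = x * s + g * t"
proof -
  have b0: "b \<noteq> 0" using assms(4) lt_x[OF V xy I_zero, of n] by auto
  have bK: "b \<in> K" "a \<in> K" using assms I_K by auto
  have xb: "x * b \<in> I (Suc n)" "le V (x * b) (pw x (Suc n))" "x * b \<noteq> 0"
    using I_x assms le_mult[OF srV le_refl[OF srV x_K]] b0 mult_eq_zero I_K by auto
  have quot: "\<exists>s\<in>D1. s * (x * b) = w" if "w \<in> I (Suc n)" for w
    using ex_quot[OF I_K[OF that] I_K[OF xb(1)] xb(3)] D1I[OF _ that xb(1,2)] by metis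
  show ?thesis
  proof (cases "a \<in> I (Suc n)")
    case True
    then obtain s where s: "s \<in> D1" "s * (x * b) = a" using quot by blast
    have "b * z = b * (x * s)" using s assms by (simp add: mult_ac)
    then have "z = x * s + g * 0" using cancel[of b z "x * s"] assms bK b0 s D1_K by auto
    then show ?thesis using s sringD(3)[OF sring_D1] by blast
  next
    case False
    then obtain j c w where c: "n = Suc k + j" "c \<in> I j" "w \<in> I (Suc n)" "a = G * c + w"
      using ltV_cases[OF assms(2,6) False] by metis
    obtain s where s: "s \<in> D1" "s * (x * b) = w" using quot[OF c(3)] by blast
    have Xc: "pw x (Suc k) * c \<in> I n" using I_mult2[OF I_pw_x c(2)] c(1) by blast
    obtain t where t: "t \<in> K" "t * b = pw x (Suc k) * c" using ex_quot[OF I_K[OF Xc] bK(1) b0] by metis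
    then have tD: "t \<in> D1" using D1I[OF t(1) Xc assms(3,4)] by blast
    have "b * z = b * (x * s) + g * (t * b)"
      using assms(5) c(4) s(2) t(2) g_eq by (simp add: mult_ac)
    then have "b * z = b * (x * s + g * t)" by (simp add: algebra_simps)
    then have "z = x * s + g * t" using cancel[of b z "x * s + g * t"] assms bK b0 s t D1_K by auto
    then show ?thesis using s tD by blast
  qed
qed

sublocale d1: two_parameters K e D1 x g
  by unfold_locales (use sring_D1 in auto)

lemma g_mx: assumes "U \<in> Q" shows "lt U e g"
proof
  assume "le U g e"
  then have "le U (g * pw x (Suc k)) (e * pw x (Suc k))"
    by (rule le_mult_same[OF QD(5)[OF assms] pw_K[OF x_K]])
  then show False using QD(3)[OF assms] unfolding g_eq e_mult[OF pw_K[OF x_K]] by blast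
qed

lemma d1_I1_mx: assumes "U \<in> Q" "z \<in> d1.I 1" shows "lt U e z"
proof -
  obtain s t where s: "s \<in> D1" "t \<in> D1" "z = x * s + g * t" using assms d1.I_1_iff by blast
  have sU: "s \<in> U" "t \<in> U" using s D1_subset assms by auto
  have "lt U e x" using I1_mx[OF QD(1) x_1(1)] assms by blast
  then have "lt U e (x * s)" "lt U e (g * t)"
    using lt_le_trans[OF QD(4)[OF assms(1)]] g_mx[OF assms(1)] le_mult_right[OF QD(5)[OF assms(1)]]
      le_refl[OF QD(5)[OF assms(1)]] sU by (metis x_K, metis g_K)
  then show ?thesis using lt_add QD[OF assms(1)] s D1_K by auto
qed

lemma d1_loc: assumes "z \<in> D1" shows "unit_in D1 z \<or> z \<in> d1.I 1"
proof -
  obtain n a b where *: "a \<in> I n" "b \<in> I n" "le V b (pw x n)" "z * b = a" "z \<in> K" using assms by (metis D1E)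
  show ?thesis
  proof (cases "le V a (pw x n)")
    case True then show ?thesis using D1_unit * by blast
  next
    case False then show ?thesis using D1_decomp[OF *(5,1,2,3,4)] d1.I_1_iff by blast
  qed
qed

text \<open>Divisibility by \<open>x^m\<close> in the quadratic transform raises the order of a numerator by \<open>m\<close>; the
denominators disappear since orders are additive.\<close>
lemma D1_in_x:
  assumes "z \<in> K" "a \<in> I n" "b \<in> I n" "le V b (pw x n)" "z * b = a" "s \<in> D1" "z = pw x m * s"
  shows "a \<in> I (m + n)"
proof -
  obtain n' a' b' where s: "a' \<in> I n'" "b' \<in> I n'" "le V b' (pw x n')" "s * b' = a'" "b' \<notin> I (Suc n')"
    using assms(6) by (metis D1E)
  have "b' * a = (pw x m * b) * a'" using assms(5,7) s(4) by (auto simp: mult_ac)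
  moreover have "(pw x m * b) * a' \<in> I (m + n + n')" using I_mult2[OF I_mult2[OF I_pw_x assms(3)] s(1)] .
  ultimately have "b' * a \<in> I (n' + (m + n))" by (simp add: add_ac)
  then show ?thesis using gr_le[OF s(2,5) I_D[OF assms(2)]] by blast
qed

lemma D1_in_xI:
  assumes "a \<in> I (Suc n)" "z * pw x n = a" "z \<in> K"
  shows "\<exists>s\<in>D1. z = x * s"
proof -
  obtain s where s: "s \<in> K" "s * pw x (Suc n) = a" using pwx_quot[OF I_K[OF assms(1)]] by metis
  then have "pw x n * z = pw x n * (x * s)" using assms by (simp add: mult_ac)
  then have "z = x * s" using pwx_cancel[of z "x * s" n] s assms by simp
  then show ?thesis using D1I'[OF s(1) assms(1) s(2)] by blast
qed

text \<open>Repeatedly splitting off the form of \<open>G\<close> shows that \<open>D1/xD1\<close> is a discrete valuation ring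
with uniformizer \<open>g\<close>. The bound on \<open>r\<close> records that each factor \<open>g\<close> uses up \<open>k + 1\<close>
degrees; it is what makes the colength drop.\<close>
lemma dvr_pw:
  assumes "a \<in> I n" "a \<notin> I (Suc n)" "z * pw x n = a" "z \<in> K"
  shows "\<exists>r c s. unit_in D1 c \<and> s \<in> D1 \<and> z = c * pw g r + x * s \<and> r * Suc k \<le> n"
  using assms
proof (induction n arbitrary: a z rule: less_induct)
  case (less n)
  show ?case
  proof (cases "le V a (pw x n)")
    case True
    then have "unit_in D1 z" using D1_unit[OF less.prems(4,1) I_pw_x le_pwx less.prems(3)] by blast
    then show ?thesis using less.prems sringD(3)[OF sring_D1]
      by (intro exI[of _ 0] exI[of _ z]) auto
  next
    case False
    then obtain j b w where b: "n = Suc k + j" "b \<in> I j" "w \<in> I (Suc n)" "a = G * b + w"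
      using ltV_cases[OF less.prems(1) False less.prems(2)] by metis
    have "b \<notin> I (Suc j)"
      using I_mult2[OF G(1), of b "Suc j"] I_add[OF _ b(3), of "G * b"] b(1,4) less.prems(2) by auto
    obtain z' where z': "z' \<in> K" "z' * pw x j = b" using pwx_quot[OF I_K[OF b(2)]] by metis
    obtain r c s where rcs: "unit_in D1 c" "s \<in> D1" "z' = c * pw g r + x * s" "r * Suc k \<le> j"
      using less.IH[of j b z'] b \<open>b \<notin> I (Suc j)\<close> z' by auto
    obtain z'' where z'': "z'' \<in> K" "z'' * pw x n = w" using pwx_quot[OF I_K[OF b(3)]] by metis
    obtain s' where s': "s' \<in> D1" "z'' = x * s'" using D1_in_xI[OF b(3) z''(2,1)] by blast
    have "(g * z' + z'') * pw x n = (g * pw x (Suc k)) * (z' * pw x j) + z'' * pw x n"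
      using b(1) by (simp add: pw_add algebra_simps)
    also have "\<dots> = a" using g_eq z' z'' b by simp
    finally have "pw x n * z = pw x n * (g * z' + z'')" using less.prems by (simp add: mult.commute)
    then have "z = g * z' + z''" using pwx_cancel[of z "g * z' + z''" n] less.prems z' z'' by simp
    then have "z = c * pw g (Suc r) + x * (g * s + s')" using rcs s' by (simp add: algebra_simps)
    moreover have "g * s + s' \<in> D1" using d1.D_add[OF d1.D_mult[OF g_D1 rcs(2)] s'(1)] .
    moreover have "Suc r * Suc k \<le> n" using rcs b by simp
    ultimately show ?thesis using rcs by blast
  qed
qed

lemma d1_dvr:
  assumes "z \<in> D1" 
  shows "(\<exists>s\<in>D1. z = x * s) \<or> (\<exists>r c s. unit_in D1 c \<and> s \<in> D1 \<and> z = c * pw g r + x * s)"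
proof -
  obtain n a b where *: "a \<in> I n" "b \<in> I n" "le V b (pw x n)" "z * b = a" "z \<in> K" using assms by (metis D1E)
  obtain z0 where z0: "z0 \<in> K" "z0 * pw x n = a" using pwx_quot[OF I_K[OF *(1)]] by metis
  obtain \<beta> where \<beta>: "\<beta> \<in> K" "\<beta> * pw x n = b" using pwx_quot[OF I_K[OF *(2)]] by metis
  have "unit_in D1 \<beta>" using D1_unit[OF \<beta>(1) *(2) I_pw_x le_pwx \<beta>(2) *(3)] .
  then obtain \<beta>' where \<beta>': "\<beta>' \<in> D1" "\<beta> * \<beta>' = e" "unit_in D1 \<beta>'" by (rule unE)
  have "pw x n * z0 = z * b" using z0 *(4) by (simp add: mult.commute)
  also have "\<dots> = pw x n * (z * \<beta>)" unfolding \<beta>(2)[symmetric] by (simp add: mult_ac)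
  finally have "pw x n * z0 = pw x n * (z * \<beta>)" .
  then have "z0 = z * \<beta>" using pwx_cancel[of z0 "z * \<beta>" n] z0(1) \<beta>(1) *(5) by simp
  then have "\<beta>' * z0 = z * (\<beta> * \<beta>')" by (simp add: mult_ac)
  then have z: "z = \<beta>' * z0" using \<beta>'(2) *(5) by simp
  show ?thesis
  proof (cases "a \<in> I (Suc n)")
    case True
    then obtain s where s: "s \<in> D1" "z0 = x * s" using D1_in_xI z0 by blast
    then have "z = x * (\<beta>' * s)" using z by (simp add: mult_ac)
    then show ?thesis using d1.D_mult[OF \<beta>'(1) s(1)] by blast
  next
    case False
    then obtain r c s where "unit_in D1 c" "s \<in> D1" "z0 = c * pw g r + x * s" using dvr_pw * z0 by blast
    moreover from this have "z = (\<beta>' * c) * pw g r + x * (\<beta>' * s)" using z by (simp add: algebra_simps)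
    ultimately show ?thesis using un_mult[OF sring_D1 \<beta>'(3)] d1.D_mult[OF \<beta>'(1)] by blast
  qed
qed

sublocale d1: regular2_criterion K e D1 x g
proof unfold_locales
  show "e \<notin> d1.I 1" using d1_I1_mx[OF V_Q] le_refl[OF srV] by blast
  show "pw g r \<noteq> x * s" if "s \<in> D1" for s r
  proof
    assume *: "pw g r = x * s"
    have "pw g r * pw x (r * Suc k) = pw G r"
      using pw_times[of g "pw x (Suc k)" r] g_eq by (metis g_K mult.commute pw_K pw_mult x_K)
    then have "pw G r \<in> I (1 + r * Suc k)"
      using D1_in_x[OF pw_K[OF g_K] I_pw[OF G(1)] I_pw_x le_pwx _ that, of r r 1] * by simp
    then show False using pw_gr[OF G, of r] by simp
  qed
  show "z = 0" if z: "\<And>n. \<exists>s\<in>D1. z = pw x n * s" for z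
  proof (rule ccontr)
    assume nz: "z \<noteq> 0"
    have "z \<in> D1" using z[of 0] d1.D_mult d1.D_e by auto
    then obtain n a b where *: "a \<in> I n" "b \<in> I n" "le V b (pw x n)" "z * b = a" "z \<in> K" "b \<noteq> 0" by (metis D1E)
    then have "a \<noteq> 0" using nz mult_eq_zero I_K by metis
    then obtain m where m: "a \<in> I m" "a \<notin> I (Suc m)" using ex_order * I_D by metis
    obtain s where s: "s \<in> D1" "z = pw x (Suc m) * s" using z by blast
    have "a \<in> I (Suc m + n)" using D1_in_x[OF *(5,1,2,3,4) s] .
    then show False using m I_antimono[of "Suc m" "Suc m + n"] by simp
  qed
qed (use d1_loc d1_dvr in auto)

lemma reg_D1: "regular2 K e D1 x g" by (rule d1.is_reg)

lemma mx_D1: "nonunits_of D1 = d1.I 1" using regular2.mx_eq[OF reg_D1] .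

lemma u_D1: obtains u where "u \<in> D1" "y = x * u"
proof -
  obtain u where "u \<in> K" "u * x = y" using ex_quot[of y x] by auto
  moreover from this have "u \<in> D1" using D1I'[of u y 1] y_1 by (auto simp: mult_ac)
  ultimately show ?thesis using that by (metis mult.commute)
qed

text \<open>Domination of \<open>D1\<close> makes \<open>g\<close> a nonunit and puts \<open>y/x\<close> into the ring, which are the conditions
defining \<open>Q\<close>. Conversely, \<open>D1\<close> is contained in all rings of \<open>Q\<close> by \<open>lt_same\<close>.\<close>
lemma Dom_D1: "dominators D1 = Q"
proof
  show "Q \<subseteq> dominators D1"
  proof
    fix U assume U: "U \<in> Q"
    then have "nonunits_of D1 \<subseteq> nonunits_of U" using mx_D1 d1_I1_mx mx_iff_lt[OF QD(4)[OF U]] d1.I_K by auto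
    then show "U \<in> dominators D1" using D1_subset QD U by (auto simp: dominators_def)
  qed
  show "dominators D1 \<subseteq> Q"
  proof
    fix U assume U: "U \<in> dominators D1"
    obtain u where u: "u \<in> D1" "y = x * u" using u_D1 .
    have "nonunits_of D \<subseteq> nonunits_of D1"
    proof
      fix z assume "z \<in> nonunits_of D"
      then obtain b c where z: "b \<in> D" "c \<in> D" "z = x * b + y * c" using mx_eq I_1_iff by auto
      then have "z = x * (b + u * c) + g * 0" using u by (simp add: algebra_simps)
      then show "z \<in> nonunits_of D1" unfolding mx_D1 d1.I_1_iff using z D_D1 u d1.D_add d1.D_mult d1.D_0 by blast
    qed
    then have UD: "U \<in> dominators D" using U D_D1 by (auto simp: dominators_def)
    have "le U x y" using u DomD(3)[OF U] by (auto simp: le_def)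
    have "g \<in> nonunits_of D1" unfolding mx_D1 using d1.I_1_iff[of g] d1.D_0 d1.D_e g_K by (metis add_0 mult_e mult_zero_right)
    then have "lt U e g" using DomD[OF U] mx_iff_lt by auto
    then have "lt U (e * pw x (Suc k)) (g * pw x (Suc k))"
      by (rule lt_mult[OF DomD(1)[OF U] e_K g_K pw_K[OF x_K] pw_K[OF x_K] _ le_refl[OF DomD(2)[OF U] pw_K[OF x_K]]
         pw_nonzero[OF x_K x_nonzero]])
    then show "U \<in> Q" using UD \<open>le U x y\<close> 
      unfolding Q_def g_eq e_mult[OF pw_K[OF x_K]] by blast
  qed
qed

lemma Dom_D1_sub: "dominators D1 \<subseteq> dominators D" using Dom_D1 QD by blast

end

section \<open>Confined poles and finite colength\<close>

context field_in_ring begin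

lemma ex_pw_add:
  assumes "is_subring D" "u \<in> D" "z \<in> D"
  shows "\<exists>s\<in>D. pw (u + z) n = pw z n + u * s"
proof (induction n)
  case 0
  then show ?case using sringD(3)[OF assms(1)] by (intro bexI[of _ 0]) auto
next
  case (Suc n)
  then obtain s where s: "s \<in> D" "pw (u + z) n = pw z n + u * s" by blast
  have "pw (u + z) (Suc n) = pw z (Suc n) + u * (pw z n + u * s + z * s)"
    using s(2) by (simp add: algebra_simps)
  moreover have "pw z n + u * s + z * s \<in> D" using sringD(6,8,9)[OF assms(1)] s(1) assms by metis
  ultimately show ?case by blast
qed

lemma le_of_le_add_lt:
  assumes "val_ring U" "a \<in> K" "b \<in> K" "c \<in> K" "a = b + c" "lt U a c"
  shows "le U b a"
proof (rule ccontr)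
  assume "lt U a b"
  then have "lt U a (b + c)" using lt_add assms by blast
  then show False using le_refl[OF vr_sring[OF assms(1)] assms(2)] assms(5) by simp
qed

text \<open>There is a fraction \<open>b/a\<close> outside \<open>V\<close> that lies in every dominating valuation ring not in
\<open>W\<close>: its poles are confined to \<open>W\<close>. If \<open>A\<close> is an intersection of such rings, then
\<open>b/a\<close> is in \<open>A\<close>, and \<open>A\<close> is not contained in \<open>V\<close>. The last conjunct bounds the value of the denominator
uniformly outside \<open>W\<close>, so that numerator and denominator may be perturbed by high powers of
nonunits; it is what allows the property to be pulled back along quadratic transforms.\<close>
definition pole_within :: "'r set \<Rightarrow> 'r set \<Rightarrow> 'r set set \<Rightarrow> bool" where
  "pole_within D V W \<longleftrightarrow> (\<exists>a\<in>D. \<exists>b\<in>D. lt V b a \<and> 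
     (\<exists>N. \<forall>U\<in>dominators D - W. le U a b \<and> (\<forall>c\<in>nonunits_of D. le U a (pw c N))))"

definition ideal_in :: "'r set \<Rightarrow> 'r set \<Rightarrow> bool" where
  "ideal_in D C \<longleftrightarrow> C \<subseteq> D \<and> 0 \<in> C \<and> (\<forall>a\<in>C. \<forall>b\<in>C. a + b \<in> C) \<and> (\<forall>a\<in>C. \<forall>d\<in>D. d * a \<in> C)"

text \<open>The length of \<open>D/(a, b)\<close> is at most \<open>n\<close>, expressed by chains of ideals.\<close>
definition chain_bound_pair :: "'r set \<Rightarrow> 'r \<Rightarrow> 'r \<Rightarrow> nat \<Rightarrow> bool" where
  "chain_bound_pair D a b n \<longleftrightarrow> (\<forall>C l. (\<forall>i\<le>l. ideal_in D (C i) \<and> a \<in> C i \<and> b \<in> C i) \<longrightarrow> 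
     (\<forall>i<l. C i \<subset> C (Suc i)) \<longrightarrow> l \<le> n)"

text \<open>Besides bounded length it is required that every nonunit is nilpotent modulo \<open>(a, b)\<close>: this ideal
is the whole ring or primary to the ideal of nonunits.\<close>
definition colength_le :: "'r set \<Rightarrow> 'r \<Rightarrow> 'r \<Rightarrow> nat \<Rightarrow> bool" where
  "colength_le D a b n \<longleftrightarrow> a \<in> D \<and> b \<in> D \<and> (\<forall>c\<in>nonunits_of D. \<exists>k. \<exists>s\<in>D. \<exists>t\<in>D. pw c k = a * s + b * t) \<and> chain_bound_pair D a b n"

lemma idlD:
  assumes "ideal_in D C"
  shows "C \<subseteq> D" "0 \<in> C" "a \<in> C \<Longrightarrow> b \<in> C \<Longrightarrow> a + b \<in> C" "a \<in> C \<Longrightarrow> d \<in> D \<Longrightarrow> d * a \<in> C"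
    "a \<in> C \<Longrightarrow> d \<in> D \<Longrightarrow> a * d \<in> C" "a \<in> C \<Longrightarrow> a \<in> D"
  using assms unfolding ideal_in_def by (auto simp: mult.commute)

lemma idl_diff:
  assumes "is_subring D" "ideal_in D C" "a \<in> C" "b \<in> C" shows "a - b \<in> C"
proof -
  have "- e * b \<in> C" using idlD(4)[OF assms(2,4)] sringD(2,5)[OF assms(1)] by blast
  then have "- b \<in> C" using idlD(6)[OF assms(2,4)] sringD(4)[OF assms(1)] by simp
  then show ?thesis using idlD(3)[OF assms(2,3)] by force
qed

lemma co_unit:
  assumes "is_subring D" "a \<in> D" "b \<in> D" "unit_in D a \<or> unit_in D b" shows "colength_le D a b n"
proof -
  obtain s t where st: "s \<in> D" "t \<in> D" "e = a * s + b * t"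
  proof (cases "unit_in D a")
    case True
    then obtain s where "s \<in> D" "a * s = e" by (auto simp: unit_in_def)
    then show ?thesis using that[of s 0] sringD(3)[OF assms(1)] by simp
  next
    case False
    then obtain s where "s \<in> D" "b * s = e" using assms by (auto simp: unit_in_def)
    then show ?thesis using that[of 0 s] sringD(3)[OF assms(1)] by simp
  qed
  have D: "C = D" if C: "ideal_in D C" "a \<in> C" "b \<in> C" for C
  proof -
    have "e \<in> C" unfolding st(3) using idlD(3)[OF C(1) idlD(5)[OF C(1,2) st(1)] idlD(5)[OF C(1,3) st(2)]] .
    then have "d \<in> C" if "d \<in> D" for d using idlD(4)[OF C(1) _ that, of e] sringD(4)[OF assms(1) that] by simp
    then show ?thesis using idlD(1)[OF C(1)] by blast
  qed
  have "l \<le> n" if "\<forall>i\<le>l. ideal_in D (C i) \<and> a \<in> C i \<and> b \<in> C i" "\<forall>i<l. C i \<subset> C (Suc i)" for C l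
  proof (cases l)
    case (Suc m)
    then show ?thesis using D[of "C 0"] D[of "C (Suc 0)"] that by auto
  qed simp
  then have "chain_bound_pair D a b n" unfolding chain_bound_pair_def by blast
  moreover have "pw c 0 = a * s + b * t" for c using st(3)[symmetric] by simp
  ultimately show ?thesis unfolding colength_le_def using st assms by blast
qed

end

section \<open>Residues of a quadratic transform\<close>

context regular2 begin

text \<open>The fractions \<open>h / x^n\<close> with \<open>h \<in> m^n\<close>, that is, polynomials of degree at most \<open>n\<close> in
\<open>y/x\<close> with coefficients in \<open>D\<close>.\<close>
definition fr :: "nat \<Rightarrow> 'a set" where
  "fr n = {z \<in> K. z * pw x n \<in> I n}"

lemma fr_K: "z \<in> fr n \<Longrightarrow> z \<in> K" and fr_I: "z \<in> fr n \<Longrightarrow> z * pw x n \<in> I n"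
  by (auto simp: fr_def)

lemma frI: "z \<in> K \<Longrightarrow> z * pw x n \<in> I n \<Longrightarrow> z \<in> fr n"
  by (auto simp: fr_def)

lemma I_eq_fr: assumes "h \<in> I n" obtains z where "z \<in> fr n" "z * pw x n = h"
  using pwx_quot[OF I_K[OF assms]] frI assms by metis

lemma fr_add: "z \<in> fr n \<Longrightarrow> w \<in> fr n \<Longrightarrow> z + w \<in> fr n"
  by (auto simp: fr_def distrib_right intro: I_add)

lemma fr_uminus: "z \<in> fr n \<Longrightarrow> - z \<in> fr n"
  using I_uminus by (auto simp: fr_def)

lemma fr_zero: "0 \<in> fr n" by (auto simp: fr_def)

lemma fr_mult: "z \<in> fr m \<Longrightarrow> w \<in> fr n \<Longrightarrow> z * w \<in> fr (m + n)"
proof -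
  assume z: "z \<in> fr m" and w: "w \<in> fr n"
  have "(z * w) * pw x (m + n) = (z * pw x m) * (w * pw x n)" by (simp add: pw_add mult_ac)
  then show ?thesis using I_mult2[OF fr_I[OF z] fr_I[OF w]] fr_K z w by (auto intro: frI)
qed

lemma fr_x: "z \<in> fr n \<Longrightarrow> x * z \<in> fr n"
  using I_mult[of "z * pw x n" n x] by (auto simp: fr_def mult.assoc)

lemma fr_pw_x: "z \<in> fr n \<Longrightarrow> pw x m * z \<in> fr n"
proof (induction m)
  case 0 then show ?case using fr_K[OF 0] by simp
next
  case (Suc m) then show ?case using fr_x by (simp add: mult.assoc)
qed

lemma fr_mono: "m \<le> n \<Longrightarrow> z \<in> fr m \<Longrightarrow> z \<in> fr n"
proof -
  assume mn: "m \<le> n" and z: "z \<in> fr m"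
  have "e \<in> fr (n - m)" using I_pw_x by (auto intro: frI)
  then have "z * e \<in> fr (m + (n - m))" using fr_mult z by blast
  then show ?thesis using mn fr_K[OF z] by simp
qed

lemma fr_pw: "z \<in> fr m \<Longrightarrow> pw z n \<in> fr (n * m)"
proof (induction n)
  case 0 then show ?case by (auto simp: fr_def)
next
  case (Suc n) then show ?case using fr_mult by simp
qed

lemma fr_subset:
  assumes A: "is_subring A" "D \<subseteq> A" and u: "u \<in> A" "y = x * u"
  shows "z \<in> fr n \<Longrightarrow> z \<in> A"
proof (induction n arbitrary: z)
  case 0 
  then have "z \<in> D" using fr_K[OF 0] fr_I[OF 0] by simp
  then show ?case using A(2) by blast
next
  case (Suc n)
  obtain h1 h2 where h: "h1 \<in> I n" "h2 \<in> I n" "z * pw x (Suc n) = x * h1 + y * h2" using fr_I[OF Suc.prems] by (metis I_SucE)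
  obtain z1 where z1: "z1 \<in> fr n" "z1 * pw x n = h1" using I_eq_fr[OF h(1)] .
  obtain z2 where z2: "z2 \<in> fr n" "z2 * pw x n = h2" using I_eq_fr[OF h(2)] .
  have "pw x (Suc n) * z = z * pw x (Suc n)" by (rule mult.commute)
  also have "\<dots> = pw x (Suc n) * (z1 + u * z2)" unfolding h(3) u(2) using z1(2) z2(2) by (auto simp: algebra_simps)
  finally have "z = z1 + u * z2" 
    using pwx_cancel fr_K[OF Suc.prems] fr_K[OF z1(1)] fr_K[OF z2(1)] sringD(4)[OF A(1) u(1)] by (metis add_K mult_K)
  then show ?case using sringD(6)[OF A(1) Suc.IH[OF z1(1)] sringD(8)[OF A(1) u(1) Suc.IH[OF z2(1)]]] by simp
qed

text \<open>One of the two parameters generates the extension of \<open>m\<close> to a dominating valuation ring.\<close>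
lemma min_gen:
  assumes "U \<in> dominators D"
  obtains t where "t \<in> {x, y}" "\<And>n h. h \<in> I n \<Longrightarrow> le U (pw t n) h" "\<And>n h. h \<in> I (Suc n) \<Longrightarrow> lt U (pw t n) h"
    "le U x y \<Longrightarrow> t = x" "\<not> le U x y \<Longrightarrow> t = y"
proof (cases "le U x y")
  case True
  show ?thesis
    by (rule that[of x]) (use True le_x[OF assms True] lt_x[OF assms True] in auto)
next
  case False
  interpret s: regular2 K e D y x by (rule swap)
  have "le U y x" using lt_imp_le[OF DomD(1)[OF assms]] False by auto
  then show ?thesis using that[of y] s.le_x[OF assms] s.lt_x[OF assms] False I_swap by auto
qed

end

context quadratic begin

lemma fr_D1: "z \<in> fr n \<Longrightarrow> z \<in> D1"
  using D1I'[OF _ _ refl] by (auto simp: fr_def)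

lemma g_fr: "g \<in> fr (Suc k)"
  using frI[of g "Suc k"] G(1) g_eq by simp

lemma fr_in_x: "z \<in> fr n \<Longrightarrow> z * pw x n \<in> I (Suc n) \<Longrightarrow> z \<in> d1.I 1"
  using D1_in_xI[OF _ refl fr_K] d1.I_1_iff[of z] d1.D_0 by (metis add.right_neutral mult_zero_right)

lemma M_mult: "m \<in> d1.I 1 \<Longrightarrow> z \<in> D1 \<Longrightarrow> m * z \<in> d1.I 1"
  by (rule d1.I_mult')

lemma g_M: "g \<in> d1.I 1" 
  using d1.I_y[of e 0] d1.D_e by simp

lemma x_M: "x \<in> d1.I 1" 
  using d1.I_x[of e 0] d1.D_e by simp

text \<open>The extended Euclidean algorithm with the irreducible form of \<open>G\<close>: a nonzero form of degree at
most \<open>k\<close> is invertible modulo it. If the form is divisible by \<open>x\<close>, the factor is removed, as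
\<open>x/x = 1\<close> after dehomogenizing; if it is monic in \<open>y\<close>, dividing \<open>G\<close> by it gives a remainder
of smaller degree, nonzero because otherwise one of two factors of smaller degree would have
excessive value.\<close>
lemma inverse_mod:
  assumes "\<delta> \<le> k" "z \<in> fr \<delta>" "z * pw x \<delta> \<notin> I (Suc \<delta>)"
  shows "\<exists>n. \<exists>z'\<in>fr n. z * z' - e \<in> d1.I 1"
  using assms
proof (induction \<delta> arbitrary: z rule: less_induct)
  case (less \<delta>)
  define q where "q = z * pw x \<delta>"
  have q: "q \<in> I \<delta>" "q \<notin> I (Suc \<delta>)" using less.prems q_def fr_I by auto
  note zK = fr_K[OF less.prems(2)]
  show ?case
  proof (cases \<delta>)
    case 0
    have "z = q" using q_def 0 zK by simp
    then have "unit_in D z" using q loc[of z] 0 by auto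
    then obtain z' where z': "z' \<in> D" "z * z' = e" by (auto simp: unit_in_def)
    then have "z' \<in> fr 0" using D_K by (auto simp: fr_def)
    then show ?thesis using z' d1.I_zero[of 1] by (metis diff_self)
  next
    case (Suc i)
    show ?thesis
    proof (cases rule: lead_cases[OF q(1)[unfolded Suc]])
      case (1 q' w)
      have q': "q' \<notin> I (Suc i)" using I_x[of q' "Suc i"] I_add[OF _ 1(2)] 1(3) q(2) Suc by blast
      obtain z0 where z0: "z0 \<in> fr i" "z0 * pw x i = q'" using I_eq_fr[OF 1(1)] .
      obtain n z' where z': "z' \<in> fr n" "z0 * z' - e \<in> d1.I 1"
        using less.IH[of i z0] z0 q' less.prems(1) Suc by auto
      have "w \<in> I \<delta>" using 1(2) I_Suc_sub Suc by blast
      then obtain v where v: "v \<in> fr \<delta>" "v * pw x \<delta> = w" using I_eq_fr by blast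
      have "pw x \<delta> * z = pw x \<delta> * (z0 + v)"
        using 1(3) z0(2) v(2) q_def Suc by (auto simp: algebra_simps)
      then have "z = z0 + v" using pwx_cancel[OF zK] fr_K z0 v by blast
      then have "z * z' - e = (z0 * z' - e) + v * z'" by (simp add: algebra_simps)
      moreover have "v \<in> d1.I 1" using fr_in_x[OF v(1)] v(2) 1(2) Suc by simp
      ultimately show ?thesis using d1.I_add[OF z'(2) M_mult] fr_D1[OF z'(1)] z'(1) by metis
    next
      case (2 q' c)
      have ik: "Suc k = Suc i + (k - i)" using less.prems(1) Suc by simp
      have il: "i \<le> k" using less.prems(1) Suc by simp
      have "G \<in> I (Suc i + (k - i))" unfolding ik[symmetric] by (rule G(1))
      then obtain b s where bs: "b \<in> I (k - i)" "s \<in> I i" "G = q * b + pw x (Suc (k - i)) * s"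
        using division[OF 2] by blast
      have s: "s \<notin> I (Suc i)"
      proof
        assume "s \<in> I (Suc i)"
        then have w: "pw x (Suc (k - i)) * s \<in> I (Suc (Suc k))" 
          using I_mult2[OF I_pw_x[of "Suc (k - i)"], of s "Suc i"] il by (simp add: add.commute)
        have b: "b \<notin> I (Suc (k - i))"
        proof
          assume "b \<in> I (Suc (k - i))"
          then have "q * b \<in> I (Suc (Suc k))" using I_mult2[OF q(1), of b "Suc (k - i)"] Suc il by simp
          then show False using I_add[OF _ w] bs(3) G(2) by metis
        qed
        have "le V q (pw x \<delta>)" using min q less.prems(1) by blast
        moreover have "le V b (pw x (k - i))" using min[OF _ bs(1) b] by simp
        ultimately have "le V (q * b) (pw x (\<delta> + (k - i)))" by (rule le_mult_pwx)
        moreover have "\<delta> + (k - i) = Suc k" using Suc il by simp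
        ultimately have "le V (q * b) (pw x (Suc k))" by simp
        moreover have "q * b = G - pw x (Suc (k - i)) * s" using bs(3) by simp
        moreover have "lt V (pw x (Suc k)) (G - pw x (Suc (k - i)) * s)"
          using lt_diff[OF vrV G_K I_K[OF w] G_lt lt_x[OF V xy w]] .
        ultimately show False by simp
      qed
      obtain \<sigma> where \<sigma>: "\<sigma> \<in> fr i" "\<sigma> * pw x i = s" using I_eq_fr[OF bs(2)] .
      obtain \<beta> where \<beta>: "\<beta> \<in> fr (k - i)" "\<beta> * pw x (k - i) = b" using I_eq_fr[OF bs(1)] .
      obtain n \<sigma>' where \<sigma>': "\<sigma>' \<in> fr n" "\<sigma> * \<sigma>' - e \<in> d1.I 1"
        using less.IH[of i \<sigma>] \<sigma> s less.prems(1) Suc by auto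
      have 1: "pw x (Suc k) = pw x \<delta> * pw x (k - i)" "pw x (Suc k) = pw x (Suc (k - i)) * pw x i" 
        using pw_add[OF x_K, of \<delta> "k - i"] pw_add[OF x_K, of "Suc (k - i)" i] Suc il by simp_all
      have "pw x (Suc k) * (z * \<beta> + \<sigma>) = (z * pw x \<delta>) * (\<beta> * pw x (k - i)) + pw x (Suc (k - i)) * (\<sigma> * pw x i)"
        unfolding distrib_left by (subst 1(1), subst 1(2)) (simp only: mult_ac)
      also have "\<dots> = pw x (Suc k) * g" using bs(3) q_def \<beta>(2) \<sigma>(2) g_eq by (simp add: mult.commute)
      finally have g: "g = z * \<beta> + \<sigma>" using pwx_cancel[of g "z * \<beta> + \<sigma>" "Suc k"] zK fr_K[OF \<beta>(1)] fr_K[OF \<sigma>(1)] by simp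
      have "z * (- (\<beta> * \<sigma>')) - e = (\<sigma> * \<sigma>' - e) - g * \<sigma>'" unfolding g by (simp add: algebra_simps)
      also have "\<dots> \<in> d1.I 1" using d1.I_diff[OF \<sigma>'(2) M_mult[OF g_M fr_D1[OF \<sigma>'(1)]]] .
      finally show ?thesis using fr_uminus[OF fr_mult[OF \<beta>(1) \<sigma>'(1)]] by blast
    qed
  qed
qed

text \<open>Division by \<open>G\<close>: modulo the maximal ideal, polynomials in \<open>y/x\<close> of degree at most \<open>k\<close>
suffice.\<close>
lemma fr_reduce:
  assumes "z \<in> fr n" shows "\<exists>p\<in>fr k. z - p \<in> d1.I 1"
proof (cases "n \<le> k")
  case True
  then show ?thesis using fr_mono assms d1.I_zero by (metis diff_self)
next
  case False
  then obtain j where n: "n = Suc k + j" by (metis less_iff_Suc_add not_le add_Suc)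
  obtain b s where bs: "b \<in> I j" "s \<in> I k" "z * pw x n = G * b + pw x (Suc j) * s"
    using div_G fr_I[OF assms] n by metis
  obtain \<sigma> where \<sigma>: "\<sigma> \<in> fr k" "\<sigma> * pw x k = s" using I_eq_fr[OF bs(2)] .
  obtain \<beta> where \<beta>: "\<beta> \<in> fr j" "\<beta> * pw x j = b" using I_eq_fr[OF bs(1)] .
  have 1: "pw x n = pw x (Suc k) * pw x j" "pw x n = pw x (Suc j) * pw x k" 
    using pw_add[OF x_K, of "Suc k" j] pw_add[OF x_K, of "Suc j" k] n by (simp_all add: add.commute)
  have "pw x n * (g * \<beta> + \<sigma>) = (g * pw x (Suc k)) * (\<beta> * pw x j) + pw x (Suc j) * (\<sigma> * pw x k)"
    unfolding distrib_left by (subst 1(1), subst 1(2)) (simp only: mult_ac)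
  also have "\<dots> = pw x n * z" unfolding g_eq \<beta>(2) \<sigma>(2) bs(3)[symmetric] by (simp add: mult.commute)
  finally have "z = g * \<beta> + \<sigma>" 
    using pwx_cancel[of z "g * \<beta> + \<sigma>" n] fr_K[OF assms] fr_K[OF \<beta>(1)] fr_K[OF \<sigma>(1)] by simp
  then have "z - \<sigma> \<in> d1.I 1" using M_mult[OF g_M fr_D1[OF \<beta>(1)]] by simp
  then show ?thesis using \<sigma> by blast
qed

text \<open>Denominators can be inverted modulo the maximal ideal by \<open>inverse_mod\<close>, so the residue field of
the quadratic transform consists of residues of polynomials in \<open>y/x\<close> of degree at most \<open>k\<close>.\<close>
lemma D1_mod:
  assumes "z \<in> D1" shows "\<exists>p\<in>fr k. z - p \<in> d1.I 1"
proof -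
  obtain n a b where *: "a \<in> I n" "b \<in> I n" "le V b (pw x n)" "z * b = a" "z \<in> K" using assms by (metis D1E)
  obtain \<alpha> where \<alpha>: "\<alpha> \<in> fr n" "\<alpha> * pw x n = a" using I_eq_fr[OF *(1)] .
  obtain \<beta> where \<beta>: "\<beta> \<in> fr n" "\<beta> * pw x n = b" using I_eq_fr[OF *(2)] .
  have "pw x n * \<alpha> = z * b" using \<alpha>(2) *(4) by (simp add: mult.commute)
  also have "\<dots> = pw x n * (z * \<beta>)" unfolding \<beta>(2)[symmetric] by (simp add: mult_ac)
  finally have z\<beta>: "\<alpha> = z * \<beta>" using pwx_cancel fr_K[OF \<alpha>(1)] fr_K[OF \<beta>(1)] *(5) by blast
  have "unit_in D1 \<beta>" using D1_unit[OF fr_K[OF \<beta>(1)] *(2) I_pw_x le_pwx \<beta>(2) *(3)] .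
  then have \<beta>M: "\<beta> \<notin> d1.I 1" using d1.nonunit by blast
  obtain p where p: "p \<in> fr k" "\<beta> - p \<in> d1.I 1" using fr_reduce[OF \<beta>(1)] by blast
  have "p \<notin> d1.I 1" using d1.I_add[OF p(2), of p] \<beta>M by auto
  then have "p * pw x k \<notin> I (Suc k)" using fr_in_x[OF p(1)] by blast
  then obtain m p' where p': "p' \<in> fr m" "p * p' - e \<in> d1.I 1" using inverse_mod[OF _ p(1)] by blast
  have "z - \<alpha> * p' = - (z * (p * p' - e) + z * ((\<beta> - p) * p'))"
    unfolding z\<beta> using *(5) by (simp add: algebra_simps)
  also have "\<dots> \<in> d1.I 1" 
    using d1.I_uminus[OF d1.I_add[OF d1.I_mult[OF p'(2) assms] d1.I_mult[OF M_mult[OF p(2) fr_D1[OF p'(1)]] assms]]] .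
  finally have 1: "z - \<alpha> * p' \<in> d1.I 1" .
  obtain r where "r \<in> fr k" "\<alpha> * p' - r \<in> d1.I 1" using fr_reduce[OF fr_mult[OF \<alpha>(1) p'(1)]] by blast
  moreover have "z - r = (z - \<alpha> * p') + (\<alpha> * p' - r)" by simp
  ultimately show ?thesis using d1.I_add[OF 1] by metis
qed

text \<open>Expansion in powers of \<open>g\<close> with digits from \<open>D1_mod\<close>; note that
\<open>r * (k + 1) + k = (r + 1) * (k + 1) - 1\<close>.\<close>
lemma D1_mod_pw_g:
  "z \<in> D1 \<Longrightarrow> \<exists>p\<in>fr (r * Suc k + k). \<exists>s\<in>D1. \<exists>t\<in>D1. z = p + pw g (Suc r) * s + x * t"
proof (induction r)
  case 0
  obtain p where p: "p \<in> fr k" "z - p \<in> d1.I 1" using D1_mod[OF 0] by blast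
  then obtain s t where "s \<in> D1" "t \<in> D1" "z - p = x * s + g * t" using d1.I_1_iff by blast
  moreover from this have "z = p + pw g (Suc 0) * t + x * s" by (simp add: algebra_simps)
  ultimately show ?case using p by auto
next
  case (Suc r)
  then obtain p s t where p: "p \<in> fr (r * Suc k + k)" "s \<in> D1" "t \<in> D1" "z = p + pw g (Suc r) * s + x * t" by blast
  obtain p1 where p1: "p1 \<in> fr k" "s - p1 \<in> d1.I 1" using D1_mod[OF p(2)] by blast
  then obtain s' t' where st: "s' \<in> D1" "t' \<in> D1" "s - p1 = x * s' + g * t'" using d1.I_1_iff by blast
  have s: "s = p1 + x * s' + g * t'" using st(3) by (simp add: algebra_simps)
  have "z = (p + pw g (Suc r) * p1) + pw g (Suc (Suc r)) * t' + x * (t + pw g (Suc r) * s')"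
    unfolding p(4) s by (simp add: algebra_simps)
  moreover have "pw g (Suc r) * p1 \<in> fr (Suc r * Suc k + k)" using fr_mult[OF fr_pw[OF g_fr] p1(1)] .
  moreover have "p \<in> fr (Suc r * Suc k + k)" by (rule fr_mono[OF _ p(1)]) simp
  moreover have "t + pw g (Suc r) * s' \<in> D1" using d1.D_add[OF p(3) d1.D_mult[OF d1.D_pw[OF g_D1] st(1)]] .
  ultimately show ?case using fr_add st(2) by blast
qed

text \<open>Since \<open>a\<close> is a unit times \<open>g^(r+1)\<close> modulo \<open>x\<close>, the expansion can be repeated for the
coefficient of each power of \<open>x\<close>. The number of degrees does not depend on \<open>m\<close>: every
residue modulo \<open>(a, x^m)\<close> has a representative whose denominator is the fixed power
\<open>x^(r*(k+1)+k)\<close>.\<close>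
lemma D1_mod_pw_x:
  assumes a: "a = c * pw g (Suc r) + x * w" "unit_in D1 c" "w \<in> D1" and z: "z \<in> D1"
  shows "\<exists>p\<in>fr (r * Suc k + k). \<exists>s\<in>D1. \<exists>t\<in>D1. z = p + a * s + pw x m * t"
proof (induction m)
  case 0
  have "z = 0 + a * 0 + pw x 0 * z" using d1.D_K[OF z] by simp
  then show ?case using fr_zero d1.D_0 z by blast
next
  case (Suc m)
  then obtain p s t where p: "p \<in> fr (r * Suc k + k)" "s \<in> D1" "t \<in> D1" "z = p + a * s + pw x m * t" by blast
  obtain p1 s1 t1 where p1: "p1 \<in> fr (r * Suc k + k)" "s1 \<in> D1" "t1 \<in> D1" "t = p1 + pw g (Suc r) * s1 + x * t1"
    using D1_mod_pw_g[OF p(3)] by blast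
  obtain c' where c': "c' \<in> D1" "c * c' = e" using a(2) by (auto simp: unit_in_def)
  have "pw g (Suc r) = (c * c') * pw g (Suc r)" unfolding c'(2) by simp
  also have "\<dots> = a * c' - x * (w * c')" unfolding a(1) by (simp add: algebra_simps)
  finally have g: "pw g (Suc r) = a * c' - x * (w * c')" .
  have "z = (p + pw x m * p1) + a * (s + pw x m * (c' * s1)) + pw x (Suc m) * (t1 - w * c' * s1)"
    unfolding p(4) p1(4) g by (simp add: algebra_simps)
  moreover have "p + pw x m * p1 \<in> fr (r * Suc k + k)" using fr_add[OF p(1) fr_pw_x[OF p1(1)]] .
  moreover have "s + pw x m * (c' * s1) \<in> D1" 
    using d1.D_add[OF p(2) d1.D_mult[OF d1.D_pw[OF x_D1] d1.D_mult[OF c'(1) p1(2)]]] .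
  moreover have "t1 - w * c' * s1 \<in> D1" using d1.D_diff[OF p1(3) d1.D_mult[OF d1.D_mult[OF a(3) c'(1)] p1(2)]] .
  ultimately show ?case by blast
qed

end

section \<open>Poles and colength under a quadratic transform\<close>

context quadratic begin

text \<open>Outside \<open>Q\<close> the initial form of \<open>G\<close> does not vanish at the center, so \<open>G\<close> has the value of
\<open>m^(k+1)\<close>.\<close>
lemma not_Q_le:
  assumes U: "U \<in> dominators D" "U \<notin> Q" and t: "t \<in> {x, y}" 
    "\<And>n h. h \<in> I n \<Longrightarrow> le U (pw t n) h" "\<And>n h. h \<in> I (Suc n) \<Longrightarrow> lt U (pw t n) h"
    "le U x y \<Longrightarrow> t = x" "\<not> le U x y \<Longrightarrow> t = y"
  shows "le U G (pw t (Suc k))"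
proof (cases "le U x y")
  case True
  then show ?thesis using U t by (auto simp: Q_def)
next
  case False
  note vrU = DomD(1)[OF U(1)] and srU = DomD(2)[OF U(1)]
  obtain h c where hc: "h \<in> I k" "unit_in D c" "G = x * h + pw y (Suc k) * c" by (rule G_form)
  obtain c' where c': "c' \<in> D" "c * c' = e" using hc(2) by (auto simp: unit_in_def)
  have ty: "t = y" using False t by blast
  show ?thesis
  proof (rule ccontr)
    assume "lt U (pw t (Suc k)) G"
    moreover have "lt U (pw t (Suc k)) (x * h)"
      using lt_mult[OF vrU y_K x_K pw_K[OF y_K] I_K[OF hc(1)] False, of k] t(2)[OF hc(1)] 
        pw_nonzero[OF y_K y_nonzero] unfolding ty by simp
    ultimately have "lt U (pw t (Suc k)) (G - x * h)"
      by (intro lt_diff[OF vrU G_K mult_K[OF x_K I_K[OF hc(1)]]])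
    then have *: "lt U (pw y (Suc k)) (pw y (Suc k) * c)" using hc(3) ty by simp
    have "pw y (Suc k) = (pw y (Suc k) * c) * c'" unfolding mult.assoc c'(2) by simp
    then have "le U (pw y (Suc k) * c) (pw y (Suc k))" 
      using DomD(3)[OF U(1)] c'(1) unfolding le_def by blast
    then show False using * by blast
  qed
qed

text \<open>The fraction is \<open>x^(k+1) / G\<close>: it is the inverse of the nonunit \<open>g\<close> on \<open>Q\<close>, and it has no pole
elsewhere by \<open>not_Q_le\<close>.\<close>
lemma sep_base:
  assumes "dominators D1 \<subseteq> W" "V' \<in> dominators D1" shows "pole_within D V' W"
proof -
  have "le U G (pw x (Suc k)) \<and> (\<forall>c\<in>nonunits_of D. le U G (pw c (Suc k)))" if "U \<in> dominators D - W" for U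
  proof -
    have U: "U \<in> dominators D" "U \<notin> Q" using that Dom_D1 assms by auto
    obtain t where t: "t \<in> {x, y}" 
      "\<And>n h. h \<in> I n \<Longrightarrow> le U (pw t n) h" "\<And>n h. h \<in> I (Suc n) \<Longrightarrow> lt U (pw t n) h"
      "le U x y \<Longrightarrow> t = x" "\<not> le U x y \<Longrightarrow> t = y" using min_gen[OF U(1)] by metis
    have le: "le U G h" if "h \<in> I (Suc k)" for h
      using le_trans[OF DomD(2)[OF U(1)] not_Q_le[OF U t] t(2)[OF that]] .
    have "le U G (pw c (Suc k))" if "c \<in> nonunits_of D" for c
      using le[of "pw c (Suc k)"] I_pw[of c 1 "Suc k"] that unfolding mx_eq by simp
    then show ?thesis using le[OF I_pw_x] by blast
  qed
  moreover have "lt V' (pw x (Suc k)) G" using QD Dom_D1 assms by blast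
  ultimately show ?thesis unfolding pole_within_def using G_D D_pw[OF x] by blast
qed

lemma le_mx_x: assumes "U \<in> Q" "c \<in> nonunits_of D" shows "le U x c"
  using le_x[OF QD(1,2)[OF assms(1)], of c 1] assms(2) mx_eq by simp

text \<open>A fraction \<open>b/a\<close> over the quadratic transform is turned into one over \<open>D\<close> with the same
behaviour on \<open>Q\<close> and without poles off \<open>Q\<close>. Perturbing by high powers of \<open>x\<close> and \<open>g\<close> makes
\<open>a\<close> congruent to a unit times \<open>g^(r+1)\<close> modulo \<open>x\<close>. Then \<open>D1_mod_pw_x\<close> allows \<open>a\<close> to be
replaced by \<open>g^(r+1) + x p\<close> and \<open>b\<close> by \<open>p2\<close>, where \<open>p\<close> and \<open>p2\<close> are polynomials in \<open>y/x\<close> of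
degree less than \<open>n = (r + 1) * (k + 1)\<close>. Multiplication of both by \<open>x^n\<close> gives elements
of \<open>D\<close>: the denominator has the initial form of \<open>G^(r+1)\<close>, which does not vanish off \<open>Q\<close>,
and the numerator lies in \<open>m^n\<close>.\<close>
lemma sep_pull:
  assumes V': "V' \<in> dominators D1" and sep: "pole_within D1 V' W"
  shows "pole_within D V' W"
proof -
  have V'Q: "V' \<in> Q" using V' Dom_D1 by simp
  note vrV' = QD(4)[OF V'Q] and srV' = QD(5)[OF V'Q]
  obtain a b N where ab: "a \<in> D1" "b \<in> D1" "lt V' b a" and
    abU: "\<And>U. U \<in> dominators D1 - W \<Longrightarrow> le U a b" "\<And>U c. U \<in> dominators D1 - W \<Longrightarrow> c \<in> nonunits_of D1 \<Longrightarrow> le U a (pw c N)"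
    using sep unfolding pole_within_def by blast
  have mxg: "g \<in> nonunits_of D1" "x \<in> nonunits_of D1" unfolding mx_D1 using g_M x_M .
  have mxU: "lt U e c" if "U \<in> Q" "c \<in> nonunits_of D1" for U c
    using d1_I1_mx[OF that(1)] that(2) unfolding mx_D1 .
  have ltU: "lt U a (pw c (Suc N))" if U: "U \<in> dominators D1 - W" and c: "c \<in> {x, g}" for U c
  proof -
    have UQ: "U \<in> Q" using U Dom_D1 by blast
    have cK: "c \<in> K" "c \<noteq> 0" using c g_K x_K x_nonzero g_eq G(2) I_zero[of "Suc (Suc k)"] by (auto simp del: I_zero)
    have "lt U (e * pw c N) (c * pw c N)"
      by (rule lt_mult[OF QD(4)[OF UQ] e_K cK(1) pw_K[OF cK(1)] pw_K[OF cK(1)] mxU[OF UQ] le_refl[OF QD(5)[OF UQ] pw_K[OF cK(1)]] 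
        pw_nonzero[OF cK]]) (use c mxg in auto)
    then have "lt U (pw c N) (pw c (Suc N))" using cK by simp
    then show ?thesis using le_lt_trans[OF QD(4)[OF UQ] abU(2)[OF U]] c mxg by blast
  qed
  define L where "L = Suc N"
  have K: "a \<in> K" "b \<in> K" using ab D1_K by auto
  \<comment> \<open>Replacing the numerator by a power of a parameter if that has smaller value, its value in
    \<open>V'\<close> is bounded, so that higher powers of the parameters become negligible.\<close>
  have "\<exists>b1\<in>D1. lt V' b1 a \<and> le V' b1 (pw x L) \<and> le V' b1 (pw g L) \<and> (\<forall>U\<in>dominators D1 - W. le U a b1)"
  proof -
    have upg: "\<exists>b1\<in>D1. lt V' b1 a \<and> le V' b1 b' \<and> le V' b1 (pw c L) \<and> (\<forall>U\<in>dominators D1 - W. le U a b1)"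
      if b': "b' \<in> D1" "lt V' b' a" "\<And>U. U \<in> dominators D1 - W \<Longrightarrow> le U a b'" and c: "c \<in> {x, g}" for b' c
    proof (cases "le V' b' (pw c L)")
      case True
      then show ?thesis using b' le_refl[OF srV' D1_K[OF b'(1)]] by blast
    next
      case False
      have cD: "pw c L \<in> D1" using c d1.D_pw x_D1 g_D1 by auto
      have "le V' (pw c L) b'" using lt_imp_le[OF vrV' D1_K[OF cD] D1_K[OF b'(1)] False] .
      moreover have "lt V' (pw c L) a" using le_lt_trans[OF vrV' calculation b'(2)] .
      moreover have "le U a (pw c L)" if "U \<in> dominators D1 - W" for U
        using lt_imp_le[of U a "pw c L"] ltU[OF that c] L_def DomD(1)[of U D1] that D1_K[OF cD] K by blast
      ultimately show ?thesis using cD le_refl[OF srV' D1_K[OF cD]] by blast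
    qed
    obtain b1 where b1: "b1 \<in> D1" "lt V' b1 a" "le V' b1 (pw x L)" "\<forall>U\<in>dominators D1 - W. le U a b1"
      using upg[OF ab(2,3) abU(1), of x] by blast
    obtain b2 where "b2 \<in> D1" "lt V' b2 a" "le V' b2 b1" "le V' b2 (pw g L)" "\<forall>U\<in>dominators D1 - W. le U a b2"
      using upg[OF b1(1,2), of g] b1(4) by blast
    then show ?thesis using le_trans[OF srV' _ b1(3)] by blast
  qed
  then obtain b1 where b1: "b1 \<in> D1" "lt V' b1 a" "le V' b1 (pw x L)" "le V' b1 (pw g L)" 
    "\<And>U. U \<in> dominators D1 - W \<Longrightarrow> le U a b1" by blast
  have b1K: "b1 \<in> K" using b1 D1_K by blast
  have V'lt: "lt V' b1 (pw c (Suc L))" if c: "c \<in> {x, g}" for c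
  proof -
    have cK: "c \<in> K" "c \<noteq> 0" using c g_K x_K x_nonzero g_eq G(2) I_zero[of "Suc (Suc k)"] by (auto simp del: I_zero)
    have "lt V' (e * pw c L) (c * pw c L)"
      by (rule lt_mult[OF vrV' e_K cK(1) pw_K[OF cK(1)] pw_K[OF cK(1)] mxU[OF V'Q] le_refl[OF srV' pw_K[OF cK(1)]] 
        pw_nonzero[OF cK]]) (use c mxg in auto)
    then have "lt V' (pw c L) (pw c (Suc L))" using cK by simp
    then show ?thesis using le_lt_trans[OF vrV'] b1(3,4) c by blast
  qed
  have ltU': "lt U a (pw c (Suc L))" if U: "U \<in> dominators D1 - W" and c: "c \<in> {x, g}" for U c
  proof -
    have UQ: "U \<in> Q" using U Dom_D1 by blast
    have cD: "c \<in> D1" using c by auto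
    then have "le U (pw c L) (pw c (Suc L))" 
      using le_mult_left[OF QD(5)[OF UQ] le_refl[OF QD(5)[OF UQ] pw_K[OF D1_K[OF cD]]]] D1_subset[OF UQ] by auto
    then show ?thesis using lt_le_trans[OF QD(4)[OF UQ] ltU[OF U c]] L_def by blast
  qed
  \<comment> \<open>If \<open>x\<close> divides the denominator, adding a negligible power of \<open>g\<close> destroys this, and the
    reduction modulo \<open>x\<close> becomes a power of \<open>g\<close>.\<close>
  have "\<exists>a1 c r w. a1 \<in> D1 \<and> unit_in D1 c \<and> w \<in> D1 \<and> a1 = c * pw g (Suc r) + x * w \<and> lt V' b1 a1 \<and>
    (\<forall>U\<in>dominators D1 - W. le U a1 a)"
  proof (cases "\<exists>s\<in>D1. a = x * s")
    case True
    then obtain s where s: "s \<in> D1" "a = x * s" by blast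
    define a1 where "a1 = a + pw g (Suc L)"
    have "a1 = e * pw g (Suc L) + x * s" unfolding a1_def s(2) using e_mult[OF pw_K[OF g_K]] by (metis add.commute)
    moreover have "lt V' b1 a1" unfolding a1_def using lt_add[OF vrV' K(1) pw_K[OF g_K] b1(2) V'lt] by blast
    moreover have "le U a1 a" if U: "U \<in> dominators D1 - W" for U
    proof (rule le_of_le_add_lt[of U a a1 "- pw g (Suc L)"])
      show "val_ring U" using U DomD(1) by blast
      then show "lt U a (- pw g (Suc L))" using lt_uminus ltU'[OF U] by blast
    qed (use K a1_def pw_K[OF g_K, of "Suc L"] in auto)
    moreover have "a1 \<in> D1" unfolding a1_def using d1.D_add[OF ab(1) d1.D_pw[OF g_D1]] .
    ultimately show ?thesis using s un_e[OF sring_D1] by blast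
  next
    case False
    then obtain R c s where *: "unit_in D1 c" "s \<in> D1" "a = c * pw g R + x * s" using d1_dvr[OF ab(1)] by blast
    have "R \<noteq> 0"
    proof
      assume "R = 0"
      then have "a = c + x * s" using * d1.D_K by (auto simp: unit_in_def)
      then have "unit_in D1 a" using d1.un_add[OF *(1), of "x * s"] d1.I_mult'[OF x_M *(2)] by blast
      then have "unit_in V' a" using D1_subset[OF V'Q] by (auto simp: unit_in_def)
      then obtain a' where "a' \<in> V'" "a * a' = e" by (auto simp: unit_in_def)
      then have "le V' a b1" unfolding le_def using sringD(8)[OF srV', of a' b1] D1_subset[OF V'Q] b1(1) b1K
        by (metis e_mult mult.assoc subsetD)
      then show False using b1(2) by blast
    qed
    then obtain r where "R = Suc r" by (cases R) auto
    moreover have "\<forall>U\<in>dominators D1 - W. le U a a" using le_refl DomD K by blast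
    ultimately show ?thesis using * ab(1) b1(2) by blast
  qed
  then obtain a1 c r w where a1: "a1 \<in> D1" "unit_in D1 c" "w \<in> D1" "a1 = c * pw g (Suc r) + x * w" "lt V' b1 a1"
    "\<And>U. U \<in> dominators D1 - W \<Longrightarrow> le U a1 a" by blast
  have a1K: "a1 \<in> K" using a1 D1_K by blast
  obtain c' where c': "c' \<in> D1" "c * c' = e" "unit_in D1 c'" using unE[OF a1(2)] by metis
  have c'K: "c' \<in> K" using c' D1_K by blast
  define j where "j = r * Suc k + k"
  define n where "n = Suc r * Suc k"
  have nj: "n = Suc j" by (simp add: n_def j_def)
  \<comment> \<open>Only the class modulo \<open>(a1, x^L)\<close> matters: multiples of \<open>a1\<close> change the denominator by a
    unit and the numerator by elements of larger value.\<close>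
  obtain p s t where p: "p \<in> fr j" "s \<in> D1" "t \<in> D1" "c' * w = p + a1 * s + pw x L * t"
    using D1_mod_pw_x[OF a1(4,2,3) d1.D_mult[OF c'(1) a1(3)]] j_def by metis
  obtain p2 s2 t2 where p2: "p2 \<in> fr j" "s2 \<in> D1" "t2 \<in> D1" "b1 = p2 + a1 * s2 + pw x (Suc L) * t2"
    using D1_mod_pw_x[OF a1(4,2,3) b1(1)] j_def by metis
  define a3 where "a3 = pw g (Suc r) + x * p"
  have a3D: "a3 \<in> D1" unfolding a3_def using d1.D_add[OF d1.D_pw[OF g_D1] d1.D_mult[OF x_D1 fr_D1[OF p(1)]]] .
  note pK = fr_K[OF p(1)] and p2K = fr_K[OF p2(1)]
  have tK: "t \<in> K" "t2 \<in> K" "s \<in> K" "s2 \<in> K" using p p2 D1_K by auto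
  have "c' * a1 = (c * c') * pw g (Suc r) + x * (c' * w)" unfolding a1(4) by (simp add: algebra_simps)
  then have "c' * a1 = pw g (Suc r) + x * (p + a1 * s + pw x L * t)" unfolding c'(2) p(4) by simp
  then have eq: "(c' - x * s) * a1 = a3 + pw x (Suc L) * t" unfolding a3_def by (simp add: algebra_simps)
  have "- (x * s) \<in> d1.I 1" using d1.I_uminus[OF M_mult[OF x_M p(2)]] .
  then have "unit_in D1 (c' + - (x * s))" by (rule d1.un_add[OF c'(3)])
  then obtain v where v: "v \<in> D1" "(c' - x * s) * v = e" by (auto simp: unit_in_def)
  have cs: "c' - x * s \<in> D1" using d1.D_diff[OF c'(1) d1.D_mult[OF x_D1 p(2)]] .
  define a2 where "a2 = (c' - x * s) * a1"
  have a2K: "a2 \<in> K" unfolding a2_def using mult_K[OF D1_K[OF cs] a1K] .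
  have a12: "a1 = a2 * v" unfolding a2_def using v(2) a1K by (metis e_mult mult.assoc mult.commute)
  have le12: "le U a1 a2" "le U a2 a1" if "U \<in> Q" for U
    using D1_subset[OF that] cs v(1) a12 unfolding le_def a2_def by (blast intro: mult.commute)+
  have lta: "lt V' b1 a3"
  proof -
    have 1: "lt V' b1 a2" using lt_le_trans[OF vrV' a1(5) le12(1)[OF V'Q]] .
    have "le V' (pw x (Suc L)) (pw x (Suc L) * t)" using D1_subset[OF V'Q] p(3) unfolding le_def by blast
    then have 2: "lt V' b1 (pw x (Suc L) * t)" using lt_le_trans[OF vrV' V'lt[of x]] by blast
    have "a3 = a2 - pw x (Suc L) * t" using eq a2_def by simp
    then show ?thesis using lt_diff[OF vrV' a2K mult_K[OF pw_K[OF x_K] tK(1)] 1 2] by simp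
  qed
  have leb: "le V' p2 b1"
  proof (rule le_of_le_add_lt[OF vrV' b1K p2K])
    show "b1 = p2 + (a1 * s2 + pw x (Suc L) * t2)" using p2(4) by (simp add: add.assoc)
    have "le V' a1 (a1 * s2)" "le V' (pw x (Suc L)) (pw x (Suc L) * t2)" 
      using D1_subset[OF V'Q] p2(2,3) unfolding le_def by blast+
    then have "lt V' b1 (a1 * s2)" "lt V' b1 (pw x (Suc L) * t2)" 
      using lt_le_trans[OF vrV'] a1(5) V'lt[of x] by blast+
    then show "lt V' b1 (a1 * s2 + pw x (Suc L) * t2)" 
      by (rule lt_add[OF vrV' mult_K[OF a1K tK(4)] mult_K[OF pw_K[OF x_K] tK(2)]])
  qed (use a1K tK in auto)
  have lt3: "lt V' p2 a3" using le_lt_trans[OF vrV' leb lta] .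
  have U3: "le U a3 p2 \<and> le U a3 (pw x N)" if U: "U \<in> dominators D1 - W" for U
  proof -
    have UQ: "U \<in> Q" using U Dom_D1 by blast
    note vrU = QD(4)[OF UQ] and srU = QD(5)[OF UQ]
    have "lt U a1 (pw x (Suc L))" using le_lt_trans[OF vrU a1(6)[OF U] ltU'[OF U]] by blast
    then have 1: "lt U a2 (pw x (Suc L))" "lt U a1 (pw x (Suc L))" using le_lt_trans[OF vrU le12(2)[OF UQ]] by blast+
    have 2: "le U (pw x (Suc L)) (pw x (Suc L) * t)" "le U (pw x (Suc L)) (pw x (Suc L) * t2)"
      using D1_subset[OF UQ] p(3) p2(3) unfolding le_def by blast+
    have "le U a3 a2" 
      by (rule le_of_le_add_lt[OF vrU a2K D1_K[OF a3D] mult_K[OF pw_K[OF x_K] tK(1)] _ lt_le_trans[OF vrU 1(1) 2(1)]])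
        (use eq a2_def in simp)
    then have 31: "le U a3 a1" using le_trans[OF srU _ le12(2)[OF UQ]] by blast
    then have 30: "le U a3 a" using le_trans[OF srU _ a1(6)[OF U]] by blast
    have "le U a3 (pw x N)" using le_trans[OF srU 30 abU(2)[OF U mxg(2)]] .
    moreover have "le U a3 p2"
    proof -
      have "p2 = b1 - (a1 * s2 + pw x (Suc L) * t2)" using p2(4) by simp
      moreover have "le U a3 b1" using le_trans[OF srU 30 b1(5)[OF U]] .
      moreover have "le U a3 (a1 * s2)" using le_mult_right[OF srU 31] D1_subset[OF UQ] p2(2) by blast
      moreover have "le U a1 (pw x (Suc L) * t2)" 
        using lt_imp_le[OF vrU a1K] lt_le_trans[OF vrU 1(2) 2(2)] mult_K[OF pw_K[OF x_K] tK(2)] by blast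
      ultimately show ?thesis using le_diff[OF srU] le_add[OF srU] le_trans[OF srU 31] by metis
    qed
    ultimately show ?thesis by blast
  qed
  obtain h where h: "h \<in> I j" "p * pw x j = h" using fr_I[OF p(1)] by blast
  obtain h2 where h2: "h2 \<in> I j" "p2 * pw x j = h2" using fr_I[OF p2(1)] by blast
  have gG: "pw g (Suc r) * pw x n = pw G (Suc r)"
    using pw_times[OF g_K pw_K[OF x_K], of "Suc k" "Suc r"] pw_mult[OF x_K, of "Suc k" "Suc r"] 
    unfolding g_eq n_def by (simp only: mult.commute)
  define A where "A = a3 * pw x n"
  define B where "B = p2 * pw x n"
  have xn: "pw x n = x * pw x j" using nj by simp
  have A: "A = pw G (Suc r) + x * (x * h)"
    unfolding A_def a3_def distrib_right gG using xn h(2) by (auto simp: mult_ac)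
  have B: "B = x * h2" unfolding B_def using xn h2(2) by (auto simp: mult_ac)
  have w: "x * (x * h) \<in> I (Suc n)" using I_x[OF I_x[OF h(1)]] nj by simp
  have GI: "pw G (Suc r) \<in> I n" using I_pw[OF G(1)] n_def by blast
  have AI: "A \<in> I n" unfolding A using I_add[OF GI I_Suc_sub[OF w]] .
  have BI: "B \<in> I n" unfolding B using I_x[OF h2(1)] nj by simp
  have ltAB: "lt V' B A"
    unfolding A_def B_def
    by (rule lt_mult[OF vrV' p2K D1_K[OF a3D] pw_K[OF x_K] pw_K[OF x_K] lt3 le_refl[OF srV' pw_K[OF x_K]] pw_nonzero[OF x_K x_nonzero]])
  have final: "le U A B \<and> (\<forall>c\<in>nonunits_of D. le U A (pw c (N + n)))" if U: "U \<in> dominators D - W" for U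
  proof (cases "U \<in> Q")
    case True
    then have UW: "U \<in> dominators D1 - W" using U Dom_D1 by simp
    note srU = QD(5)[OF True]
    have "le U A (pw c (N + n))" if "c \<in> nonunits_of D" for c
    proof -
      have cK: "c \<in> K" using that mx_eq I_K by blast
      have "le U (a3 * pw x n) (pw x N * pw x n)"
        using le_mult_same[OF srU pw_K[OF x_K]] U3[OF UW] by blast
      moreover have "le U (pw x N * pw x n) (pw c N * pw c n)"
        by (intro le_mult[OF srU] le_pw[OF srU] le_mx_x[OF True that])
      ultimately show ?thesis unfolding A_def pw_add[OF cK] by (rule le_trans[OF srU])
    qed
    moreover have "le U A B" unfolding A_def B_def using le_mult_same[OF srU pw_K[OF x_K]] U3[OF UW] by blast
    ultimately show ?thesis by blast
  next
    case False
    have UD: "U \<in> dominators D" using U by blast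
    note vrU = DomD(1)[OF UD] and srU = DomD(2)[OF UD]
    obtain t where t: "t \<in> {x, y}" 
      "\<And>n h. h \<in> I n \<Longrightarrow> le U (pw t n) h" "\<And>n h. h \<in> I (Suc n) \<Longrightarrow> lt U (pw t n) h"
      "le U x y \<Longrightarrow> t = x" "\<not> le U x y \<Longrightarrow> t = y" using min_gen[OF UD] by metis
    have tK: "t \<in> K" using t(1) x_K y_K by blast
    have leG: "le U (pw G (Suc r)) (pw t n)"
      using le_pw[OF srU not_Q_le[OF UD False t], of "Suc r"] unfolding n_def 
      using pw_mult[OF tK, of "Suc k" "Suc r"] by (metis mult.commute)
    have "le U A (pw G (Suc r))"
    proof (rule le_of_le_add_lt[OF vrU, of "pw G (Suc r)" A "- (x * (x * h))"])
      have "lt U (pw G (Suc r)) (x * (x * h))" using le_lt_trans[OF vrU leG t(3)[OF w]] .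
      then show "lt U (pw G (Suc r)) (- (x * (x * h)))" by (rule lt_uminus[OF vrU])
    qed (use A I_K[OF GI] I_K[OF AI] I_K[OF w] in auto)
    then have "le U A h" if "h \<in> I n" for h
      using le_trans[OF srU _ le_trans[OF srU leG t(2)[OF that]]] by blast
    moreover have "pw c (N + n) \<in> I n" if "c \<in> nonunits_of D" for c
      using I_antimono[of n "N + n"] I_pw[of c 1 "N + n"] that mx_eq by simp
    ultimately show ?thesis using BI by blast
  qed
  show ?thesis unfolding pole_within_def using I_D[OF AI] I_D[OF BI] ltAB final by blast
qed

text \<open>Dividing \<open>a\<close> and \<open>b\<close> by the power \<open>x^E\<close>, where \<open>E\<close> is the smaller of the two orders, a chain
of ideals above \<open>(a1, b1)\<close> in the quadratic transform contracts to a chain of ideals above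
\<open>(a, b)\<close> inside \<open>m^E\<close>. The contraction stays strict because the fractions with denominator \<open>x^E\<close>
represent all residues modulo \<open>(a1, b1)\<close>; this is where the degree bound of \<open>dvr_pw\<close> enters.
Unless \<open>a\<close> or \<open>b\<close> is a unit, \<open>E\<close> is positive, and adding \<open>D\<close> on top of the chain gains one step.\<close>
lemma co_step:
  assumes colength_le: "colength_le D a b n"
  shows "\<exists>a1 b1 t. t \<in> K \<and> t \<noteq> 0 \<and> a = t * a1 \<and> b = t * b1 \<and> colength_le D1 a1 b1 (n - 1)"
proof -
  have abD: "a \<in> D" "b \<in> D" using colength_le by (auto simp: colength_le_def)
  show ?thesis
  proof (cases "unit_in D a \<or> unit_in D b")
    case True
    then have "unit_in D1 a \<or> unit_in D1 b" using D_D1 by (auto simp: unit_in_def)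
    then have "colength_le D1 a b (n - 1)" using co_unit[OF sring_D1] abD D_D1 by blast
    then show ?thesis using abD D_K by (intro exI[of _ a] exI[of _ b] exI[of _ e]) auto
  next
    case False
    obtain m s t where mst: "s \<in> D" "t \<in> D" "pw x m = a * s + b * t" 
      using colength_le x_1(1) mx_eq unfolding colength_le_def by blast
    have "\<exists>E. a \<in> I E \<and> b \<in> I E \<and> (a \<notin> I (Suc E) \<or> b \<notin> I (Suc E))"
    proof (rule ccontr)
      assume no: "\<not> ?thesis"
      have all: "a \<in> I E \<and> b \<in> I E" for E by (induction E) (use abD no in auto)
      have "pw x m \<in> I (Suc m)" unfolding mst(3)
        using I_add[OF I_mult'[OF _ mst(1)] I_mult'[OF _ mst(2)]] all by blast
      then show False using pw_x_notin by blast
    qed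
    then obtain E where E: "a \<in> I E" "b \<in> I E" "a \<notin> I (Suc E) \<or> b \<notin> I (Suc E)" by blast
    have "E \<noteq> 0"
    proof
      assume "E = 0"
      then show False using E False loc[of a] loc[of b] abD by auto
    qed
    obtain a1 where a1: "a1 \<in> fr E" "a1 * pw x E = a" using I_eq_fr[OF E(1)] .
    obtain b1 where b1: "b1 \<in> fr E" "b1 * pw x E = b" using I_eq_fr[OF E(2)] .
    have ab1: "a1 \<in> D1" "b1 \<in> D1" using fr_D1 a1 b1 by auto
    have "\<exists>q R c w. q \<in> {a1, b1} \<and> unit_in D1 c \<and> w \<in> D1 \<and> q = c * pw g R + x * w \<and> R * Suc k \<le> E"
      using E(3) dvr_pw[OF E(1) _ a1(2) fr_K[OF a1(1)]] dvr_pw[OF E(2) _ b1(2) fr_K[OF b1(1)]] by blast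
    then obtain q R c w where q: "q \<in> {a1, b1}" "unit_in D1 c" "w \<in> D1" "q = c * pw g R + x * w" "R * Suc k \<le> E"
      by blast
    define J where "J = {a1 * s + b1 * t | s t. s \<in> D1 \<and> t \<in> D1}"
    have JI: "a1 * s + b1 * t \<in> J" if "s \<in> D1" "t \<in> D1" for s t using that J_def by blast
    have J_mult: "j * d \<in> J" if j: "j \<in> J" and d: "d \<in> D1" for j d
    proof -
      obtain s t where "s \<in> D1" "t \<in> D1" "j = a1 * s + b1 * t" using j J_def by blast
      then have "j * d = a1 * (s * d) + b1 * (t * d)" "s * d \<in> D1" "t * d \<in> D1"
        using d1.D_mult d by (auto simp: algebra_simps)
      then show ?thesis using JI by metis
    qed
    have J_add: "j + j' \<in> J" if j: "j \<in> J" "j' \<in> J" for j j'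
    proof -
      obtain s t s' t' where "s \<in> D1" "t \<in> D1" "j = a1 * s + b1 * t" "s' \<in> D1" "t' \<in> D1" "j' = a1 * s' + b1 * t'" 
        using j J_def by blast
      then have "j + j' = a1 * (s + s') + b1 * (t + t')" "s + s' \<in> D1" "t + t' \<in> D1"
        using d1.D_add by (auto simp: algebra_simps)
      then show ?thesis using JI by metis
    qed
    have a1J: "a1 \<in> J" using JI[OF d1.D_e d1.D_0] d1.D_K[OF ab1(1)] by simp
    have b1J: "b1 \<in> J" using JI[OF d1.D_0 d1.D_e] d1.D_K[OF ab1(2)] by simp
    have qJ: "q \<in> J" using q(1) a1J b1J by blast
    have JD: "J \<subseteq> D1" using J_def ab1 d1.D_add d1.D_mult by auto
    have xJ: "pw x m \<in> J"
    proof -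
      have "pw x m = pw x E * (a1 * s + b1 * t)" unfolding mst(3) using a1(2) b1(2) by (auto simp: algebra_simps)
      also have "\<dots> = (a1 * s + b1 * t) * pw x E" by (simp add: mult.commute)
      also have "\<dots> \<in> J" by (rule J_mult[OF JI d1.D_pw[OF x_D1]]) (use mst D_D1 in auto)
      finally show ?thesis .
    qed
    obtain c' where c': "c' \<in> D1" "c * c' = e" using q(2) by (auto simp: unit_in_def)
    have gR: "pw g R = q * c' - x * (w * c')"
    proof -
      have "pw g R = (c * c') * pw g R" unfolding c'(2) by simp
      also have "\<dots> = q * c' - x * (w * c')" unfolding q(4) by (simp add: algebra_simps)
      finally show ?thesis .
    qed
    have rad: "\<exists>i. \<exists>s\<in>D1. \<exists>t\<in>D1. pw z i = a1 * s + b1 * t" if z: "z \<in> nonunits_of D1" for z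
    proof -
      obtain \<alpha> \<beta> where \<alpha>: "\<alpha> \<in> D1" "\<beta> \<in> D1" "z = x * \<alpha> + g * \<beta>" using z mx_D1 d1.I_1_iff by blast
      have x\<alpha>: "x * \<alpha> \<in> D1" "g * \<beta> \<in> D1" using \<alpha> d1.D_mult by auto
      obtain s' where s': "s' \<in> D1" "pw z R = pw (g * \<beta>) R + (x * \<alpha>) * s'"
        using ex_pw_add[OF sring_D1 x\<alpha>] \<alpha>(3) by blast
      define \<beta>R where "\<beta>R = pw \<beta> R"
      have \<beta>R: "\<beta>R \<in> D1" unfolding \<beta>R_def using d1.D_pw \<alpha> by blast
      have "pw z R = q * (c' * \<beta>R) + x * (\<alpha> * s' - w * c' * \<beta>R)"
        unfolding s'(2) pw_times[OF g_K d1.D_K[OF \<alpha>(2)]] gR \<beta>R_def[symmetric] by (simp add: algebra_simps)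
      moreover define v where "v = \<alpha> * s' - w * c' * \<beta>R"
      ultimately have zR: "pw z R = q * (c' * \<beta>R) + x * v" by simp
      have v: "v \<in> D1" unfolding v_def 
        using d1.D_diff[OF d1.D_mult[OF \<alpha>(1) s'(1)] d1.D_mult[OF d1.D_mult[OF q(3) c'(1)] \<beta>R]] .
      have qD: "q * (c' * \<beta>R) \<in> J" using J_mult[OF qJ d1.D_mult[OF c'(1) \<beta>R]] .
      obtain s'' where s'': "s'' \<in> D1" "pw (pw z R) m = pw (x * v) m + q * (c' * \<beta>R) * s''"
        using ex_pw_add[OF sring_D1 subsetD[OF JD qD] d1.D_mult[OF x_D1 v], of m] zR by metis
      have "pw (x * v) m = pw x m * pw v m" using pw_times d1.D_K[OF v] by simp
      then have "pw (x * v) m \<in> J" using J_mult[OF xJ d1.D_pw[OF v]] by simp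
      then have "pw (pw z R) m \<in> J" unfolding s''(2) using J_add J_mult[OF qD s''(1)] by blast
      moreover have "z \<in> K" using z D1_K by (simp add: nonunits_of_def)
      ultimately have "pw z (R * m) \<in> J" using pw_mult by simp
      then show ?thesis using J_def by blast
    qed
    have "chain_bound_pair D1 a1 b1 (n - 1)"
      unfolding chain_bound_pair_def
    proof (intro allI impI)
      fix C l assume C: "\<forall>i\<le>l. ideal_in D1 (C i) \<and> a1 \<in> C i \<and> b1 \<in> C i" and st: "\<forall>i<l. C i \<subset> C (Suc i)"
      have JC: "J \<subseteq> C i" if "i \<le> l" for i
      proof
        fix z assume "z \<in> J"
        then obtain s t where "s \<in> D1" "t \<in> D1" "z = a1 * s + b1 * t" using J_def by blast
        then show "z \<in> C i" using C that idlD(3)[of D1 "C i"] idlD(5)[of D1 "C i"] by blast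
      qed
      show "l \<le> n - 1"
      proof (cases R)
        case 0
        have "q = c + x * w" using q(4) 0 d1.D_K q(2) by (auto simp: unit_in_def)
        then have "unit_in D1 q" using d1.un_add[OF q(2), of "x * w"] M_mult[OF x_M q(3)] by simp
        then have "unit_in D1 a1 \<or> unit_in D1 b1" using q(1) by blast
        then have "colength_le D1 a1 b1 (n - 1)" using co_unit[OF sring_D1 ab1] by blast
        then show ?thesis using C st unfolding colength_le_def chain_bound_pair_def by blast
      next
        case (Suc r)
        define j where "j = r * Suc k + k"
        have jE: "j \<le> E" using q(5) Suc by (simp add: j_def)
        \<comment> \<open>The chain is prolonged by \<open>D\<close>, which is larger than \<open>m^E\<close>.\<close>
        define C' where "C' i = (if i \<le> l then {h \<in> I E. \<exists>z\<in>C i. z * pw x E = h} else D)" for i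
        have C'_mem: "h \<in> C' i \<longleftrightarrow> h \<in> I E \<and> (\<exists>z. z \<in> C i \<and> z * pw x E = h)" if "i \<le> l" for i h
          using that by (auto simp: C'_def)
        have idl': "ideal_in D (C' i) \<and> a \<in> C' i \<and> b \<in> C' i" for i
        proof (cases "i \<le> l")
          case True
          then have Ci: "ideal_in D1 (C i)" "a1 \<in> C i" "b1 \<in> C i" using C by auto
          have "0 \<in> C' i" unfolding C'_mem[OF True] using idlD(2)[OF Ci(1)] by (intro conjI I_zero exI[of _ 0]) auto
          moreover have "u + v \<in> C' i" if uv: "u \<in> C' i" "v \<in> C' i" for u v
          proof -
            obtain z z' where "u \<in> I E" "v \<in> I E" "z \<in> C i" "z' \<in> C i" "z * pw x E = u" "z' * pw x E = v"
              using uv unfolding C'_mem[OF True] by blast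
            moreover from this have "(z + z') * pw x E = u + v" by (simp add: distrib_right)
            ultimately have "u + v \<in> I E" "z + z' \<in> C i" "(z + z') * pw x E = u + v" 
              using I_add idlD(3)[OF Ci(1)] by auto
            then show ?thesis unfolding C'_mem[OF True] by blast
          qed
          moreover have "d * u \<in> C' i" if ud: "u \<in> C' i" "d \<in> D" for u d
          proof -
            obtain z where "u \<in> I E" "z \<in> C i" "z * pw x E = u" using ud unfolding C'_mem[OF True] by blast
            then have "d * u \<in> I E" "d * z \<in> C i" "(d * z) * pw x E = d * u" 
              using I_mult ud(2) idlD(4)[OF Ci(1)] D_D1 by (auto simp: mult.assoc)
            then show ?thesis unfolding C'_mem[OF True] by blast
          qed
          moreover have "C' i \<subseteq> D" using I_D C'_mem[OF True] by blast
          moreover have "a \<in> C' i" "b \<in> C' i" unfolding C'_mem[OF True] using Ci(2,3) a1(2) b1(2) E(1,2) by blast+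
          ultimately show ?thesis unfolding ideal_in_def by blast
        next
          case False
          then show ?thesis using abD D_add D_mult D_0 by (auto simp: C'_def ideal_in_def)
        qed
        have "C' i \<subset> C' (Suc i)" if "i < Suc l" for i
        proof (cases "i = l")
          case True
          have "e \<notin> I E" using nonunit[OF I_antimono[of 1 E e]] un_e[OF is_subring] \<open>E \<noteq> 0\<close> by (metis One_nat_def Suc_leI neq0_conv)
          then show ?thesis using True I_D D_e by (auto simp: C'_def)
        next
          case False
          then have il: "i < l" using that by simp
          then have Ci: "ideal_in D1 (C i)" "ideal_in D1 (C (Suc i))" "C i \<subset> C (Suc i)" using C st by auto
          then obtain z where z: "z \<in> C (Suc i)" "z \<notin> C i" by blast
          have zD: "z \<in> D1" using z Ci idlD(6) by blast
          have q': "q = c * pw g (Suc r) + x * w" using q(4) Suc by simp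
          obtain p s t where p: "p \<in> fr j" "s \<in> D1" "t \<in> D1" "z = p + q * s + pw x m * t"
            using D1_mod_pw_x[OF q' q(2,3) zD] j_def by metis
          define v where "v = q * s + pw x m * t"
          have vJ: "v \<in> J" unfolding v_def using J_add[OF J_mult[OF qJ p(2)] J_mult[OF xJ p(3)]] .
          have v: "v \<in> C i" "v \<in> C (Suc i)" using JC[of i] JC[of "Suc i"] vJ il by auto
          have zpv: "z = p + v" unfolding v_def p(4) by (rule add.assoc)
          then have pv: "p = z - v" by (metis add_diff_cancel_right')
          have pC: "p \<in> C (Suc i)" using idl_diff[OF sring_D1 Ci(2) z(1) v(2)] unfolding pv .
          have pC': "p \<notin> C i" using idlD(3)[OF Ci(1) _ v(1), of p] zpv z(2) by blast
          have pE: "p \<in> fr E" using fr_mono[OF jE p(1)] .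
          have "p * pw x E \<in> C' (Suc i)" using pC fr_I[OF pE] C'_mem[of "Suc i"] il by auto
          moreover have "p * pw x E \<notin> C' i"
          proof
            assume "p * pw x E \<in> C' i"
            then obtain z' where z': "z' \<in> C i" "z' * pw x E = p * pw x E" using il C'_mem[of i] by auto
            have "z' \<in> K" using z' idlD(6)[OF Ci(1)] D1_K by blast
            then have "z' = p" using pwx_cancel[of z' p E] z'(2) fr_K[OF pE] by (simp add: mult.commute)
            then show False using z' pC' by simp
          qed
          moreover have "C' i \<subseteq> C' (Suc i)" using il Ci(3) C'_mem[of i] C'_mem[of "Suc i"] by auto
          ultimately show ?thesis by blast
        qed
        then have "Suc l \<le> n" using idl' colength_le unfolding colength_le_def chain_bound_pair_def by blast
        then show ?thesis by simp
      qed
    qed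
    then have "colength_le D1 a1 b1 (n - 1)" unfolding colength_le_def using ab1 rad by blast
    then show ?thesis using a1(2) b1(2) pw_K[OF x_K] pw_nonzero[OF x_K x_nonzero] by (metis mult.commute)
  qed
qed

text \<open>The denominators occurring in the quadratic transform become units of \<open>V\<close> after division by
\<open>x^n\<close>, hence units of \<open>A\<close>.\<close>
lemma D1_subset_A:
  assumes A: "is_subring A" "D \<subseteq> A" "A \<subseteq> V" and dom: "\<And>c. c \<in> A \<Longrightarrow> unit_in V c \<Longrightarrow> unit_in A c"
    and u: "u \<in> A" "y = x * u"
  shows "D1 \<subseteq> A"
proof -
  show ?thesis
  proof
    fix z assume "z \<in> D1"
    then obtain n a b where *: "a \<in> I n" "b \<in> I n" "le V b (pw x n)" "z * b = a" "z \<in> K" by (metis D1E)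
    obtain \<alpha> where \<alpha>: "\<alpha> \<in> fr n" "\<alpha> * pw x n = a" using I_eq_fr[OF *(1)] .
    obtain \<beta> where \<beta>: "\<beta> \<in> fr n" "\<beta> * pw x n = b" using I_eq_fr[OF *(2)] .
    have AA: "\<alpha> \<in> A" "\<beta> \<in> A" using fr_subset[OF A(1,2) u] \<alpha>(1) \<beta>(1) by blast+
    have "pw x n * \<alpha> = z * b" using \<alpha>(2) *(4) by (simp add: mult.commute)
    also have "\<dots> = pw x n * (z * \<beta>)" unfolding \<beta>(2)[symmetric] by (simp add: mult_ac)
    finally have z\<beta>: "\<alpha> = z * \<beta>" using pwx_cancel fr_K[OF \<alpha>(1)] fr_K[OF \<beta>(1)] *(5) by blast
    have "unit_in D1 \<beta>" using D1_unit[OF fr_K[OF \<beta>(1)] *(2) I_pw_x le_pwx \<beta>(2) *(3)] .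
    then have "unit_in V \<beta>" using D1_subset[OF V_Q] by (auto simp: unit_in_def)
    then obtain \<beta>' where \<beta>': "\<beta>' \<in> A" "\<beta> * \<beta>' = e" using dom[OF AA(2)] by (auto simp: unit_in_def)
    have "z = z * (\<beta> * \<beta>')" unfolding \<beta>'(2) using *(5) by simp
    then have "z = \<alpha> * \<beta>'" unfolding z\<beta> by (simp add: mult.assoc)
    then show "z \<in> A" using sringD(8)[OF A(1) AA(1) \<beta>'(1)] by simp
  qed
qed

end

section \<open>Existence of valuation rings\<close>

context field_in_ring begin

text \<open>The values at \<open>x\<close> of polynomials of degree at most \<open>n\<close> with coefficients in \<open>T\<close>. The set of
these values takes the place of a type of polynomials over \<open>T\<close>.\<close>
primrec poly_values :: "'r set \<Rightarrow> 'r \<Rightarrow> nat \<Rightarrow> 'r set" where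
  "poly_values T x 0 = T"
| "poly_values T x (Suc n) = {c + x * p | c p. c \<in> T \<and> p \<in> poly_values T x n}"

definition adjoin :: "'r set \<Rightarrow> 'r \<Rightarrow> 'r set" where
  "adjoin T x = (\<Union>n. poly_values T x n)"

lemma plI: "c \<in> T \<Longrightarrow> p \<in> poly_values T x n \<Longrightarrow> c + x * p \<in> poly_values T x (Suc n)" by auto
lemma plE: assumes "p \<in> poly_values T x (Suc n)" obtains c q where "c \<in> T" "q \<in> poly_values T x n" "p = c + x * q"
  using assms by auto

declare poly_values.simps(2) [simp del]

definition add_closed :: "'r set \<Rightarrow> bool" where
  "add_closed T \<longleftrightarrow> 0 \<in> T \<and> (\<forall>a\<in>T. \<forall>b\<in>T. a + b \<in> T)"

context
  fixes T :: "'r set" assumes T: "add_closed T"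
begin

lemma T0: "0 \<in> T" and Tadd: "a \<in> T \<Longrightarrow> b \<in> T \<Longrightarrow> a + b \<in> T"
  using T by (auto simp: add_closed_def)

lemma pl_Suc: "p \<in> poly_values T x n \<Longrightarrow> p \<in> poly_values T x (Suc n)"
proof (induction n arbitrary: p)
  case 0
  then show ?case using plI[of p T 0 x 0] T0 by simp
next
  case (Suc n)
  then obtain c q where "c \<in> T" "q \<in> poly_values T x n" "p = c + x * q" by (metis plE)
  then show ?case using plI Suc.IH by blast
qed

lemma pl_mono: "m \<le> n \<Longrightarrow> p \<in> poly_values T x m \<Longrightarrow> p \<in> poly_values T x n"
proof (induction n)
  case (Suc n)
  then show ?case using pl_Suc le_Suc_eq by metis
qed simp

lemma pl_add: "p \<in> poly_values T x n \<Longrightarrow> q \<in> poly_values T x n \<Longrightarrow> p + q \<in> poly_values T x n"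
proof (induction n arbitrary: p q)
  case (Suc n)
  then obtain c p' d q' where *: "c \<in> T" "p' \<in> poly_values T x n" "p = c + x * p'" "d \<in> T" "q' \<in> poly_values T x n" "q = d + x * q'"
    by (metis plE)
  have "p + q = (c + d) + x * (p' + q')" unfolding * by (simp add: algebra_simps)
  then show ?case using plI[OF Tadd[OF *(1,4)] Suc.IH[OF *(2,5)]] by metis
qed (simp add: Tadd)

lemma pl_x: "p \<in> poly_values T x n \<Longrightarrow> x * p \<in> poly_values T x (Suc n)"
  using plI[OF T0] by fastforce

lemma pl_top:
  assumes "T \<subseteq> K" "x \<in> K" "p \<in> poly_values T x (Suc n)"
  shows "\<exists>q\<in>poly_values T x n. \<exists>a\<in>T. p = q + pw x (Suc n) * a"
  using assms(3)
proof (induction n arbitrary: p)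
  case 0
  then obtain c q where "c \<in> T" "q \<in> poly_values T x 0" "p = c + x * q" by (metis plE)
  then show ?case using assms by auto
next
  case (Suc n)
  then obtain c p' where *: "c \<in> T" "p' \<in> poly_values T x (Suc n)" "p = c + x * p'" by (metis plE)
  then obtain q a where qa: "q \<in> poly_values T x n" "a \<in> T" "p' = q + pw x (Suc n) * a" using Suc.IH by blast
  have "p = (c + x * q) + pw x (Suc (Suc n)) * a" unfolding * qa by (simp add: algebra_simps)
  then show ?case using plI[OF *(1) qa(1)] qa(2) by blast
qed

text \<open>Reversing the coefficients of a polynomial turns its value at \<open>1/x\<close> into its value at \<open>x\<close>.\<close>
lemma pl_reverse:
  assumes "T \<subseteq> K" "x \<in> K" "x' \<in> K" "x * x' = e" "p \<in> poly_values T x' n"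
  shows "pw x n * p \<in> poly_values T x n"
  using assms(5)
proof (induction n arbitrary: p)
  case 0 
  then have "p \<in> T" "p \<in> K" using assms(1) by auto
  then show ?case by simp
next
  case (Suc n)
  then obtain c q where *: "c \<in> T" "q \<in> poly_values T x' n" "p = c + x' * q" by (metis plE)
  have cK: "c \<in> K" using * assms by blast
  have qK: "q \<in> K" using *(2) 
  proof (induction n arbitrary: q)
    case 0 then show ?case using assms(1) by auto
  next
    case (Suc n) then show ?case using plE[OF Suc.prems] assms(1,3) by (metis add_K mult_K subsetD)
  qed
  have cx: "pw x m * c \<in> poly_values T x m" for m
    by (induction m) (use *(1) cK pl_x in \<open>auto simp: mult.assoc\<close>)
  have "pw x (Suc n) * p = pw x (Suc n) * c + (x * x') * (pw x n * q)"
    unfolding *(3) by (simp add: algebra_simps)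
  also have "\<dots> = pw x (Suc n) * c + pw x n * q" unfolding assms(4) using qK assms by simp
  finally show ?case using pl_add[OF cx pl_Suc[OF Suc.IH[OF *(2)]]] by metis
qed

end

lemma pl_mult_left:
  assumes "\<And>t. t \<in> T \<Longrightarrow> s * t \<in> T'" "p \<in> poly_values T x n" shows "s * p \<in> poly_values T' x n"
  using assms(2)
proof (induction n arbitrary: p)
  case 0 then show ?case using assms by simp
next
  case (Suc n)
  then obtain c q where *: "c \<in> T" "q \<in> poly_values T x n" "p = c + x * q" by (metis plE)
  have "s * p = s * c + x * (s * q)" unfolding * by (simp add: algebra_simps)
  then show ?case using plI[OF assms(1)[OF *(1)] Suc.IH[OF *(2)]] by metis
qed

lemma pl_mult:
  assumes T': "add_closed T'"
    and ST: "\<And>s t. s \<in> S \<Longrightarrow> t \<in> T \<Longrightarrow> s * t \<in> T'"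
    and p: "p \<in> poly_values S x m" and q: "q \<in> poly_values T x n"
  shows "p * q \<in> poly_values T' x (m + n)"
  using p
proof (induction m arbitrary: p)
  case 0 then show ?case using pl_mult_left[OF ST q] by simp
next
  case (Suc m)
  then obtain c r where *: "c \<in> S" "r \<in> poly_values S x m" "p = c + x * r" by (metis plE)
  have "p * q = c * q + x * (r * q)" unfolding * by (simp add: algebra_simps)
  moreover have "c * q \<in> poly_values T' x (Suc m + n)" 
    by (rule pl_mono[OF T' _ pl_mult_left[OF ST[OF *(1)] q]]) auto
  moreover have "x * (r * q) \<in> poly_values T' x (Suc m + n)" using pl_x[OF T' Suc.IH[OF *(2)]] by simp
  ultimately show ?case using pl_add[OF T'] by metis
qed

lemma sring_adj:
  assumes S: "is_subring S" and x: "x \<in> K" shows "is_subring (adjoin S x)" "S \<subseteq> adjoin S x" "x \<in> adjoin S x"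
proof -
  note sr0 = sringD(3)[OF S]
  have S0: "add_closed S" using sr0 sringD(6)[OF S] by (auto simp: add_closed_def)
  have plK: "p \<in> poly_values S x n \<Longrightarrow> p \<in> K" for p n
  proof (induction n arbitrary: p)
    case 0 then show ?case using sringD(4)[OF S] by simp
  next
    case (Suc n) then show ?case using plE[OF Suc.prems] x sringD(4)[OF S] by (metis add_K mult_K)
  qed
  have "S = poly_values S x 0" by simp
  then show 1: "S \<subseteq> adjoin S x" unfolding adjoin_def by blast
  have "0 + x * e \<in> poly_values S x (Suc 0)" using plI[of 0 S e x 0] sr0 sringD(2)[OF S] by simp
  then have "x \<in> poly_values S x (Suc 0)" using x by simp
  then show "x \<in> adjoin S x" unfolding adjoin_def by blast
  show "is_subring (adjoin S x)" unfolding is_subring_def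
  proof (intro conjI ballI)
    show "adjoin S x \<subseteq> K" using plK by (auto simp: adjoin_def)
    show "e \<in> adjoin S x" using 1 sringD(2)[OF S] by blast
    fix a b assume "a \<in> adjoin S x" "b \<in> adjoin S x"
    then obtain m n where mn: "a \<in> poly_values S x m" "b \<in> poly_values S x n" by (auto simp: adjoin_def)
    have "- e * b \<in> poly_values S x n" using pl_mult_left[OF _ mn(2), of "- e" S] sringD(8)[OF S sringD(5)[OF S sringD(2)[OF S]]] by blast
    then have "- b \<in> poly_values S x n" using plK[OF mn(2)] by simp
    then have "a \<in> poly_values S x (max m n)" "- b \<in> poly_values S x (max m n)" using pl_mono[OF S0] mn(1) by (meson max.cobounded1 max.cobounded2)+
    then have "a + - b \<in> poly_values S x (max m n)" by (rule pl_add[OF S0])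
    then show "a - b \<in> adjoin S x" by (auto simp: adjoin_def)
    show "a * b \<in> adjoin S x" using pl_mult[OF S0 _ mn] sringD(8)[OF S] by (auto simp: adjoin_def)
  qed
qed

inductive_set gen_ideal :: "'r set \<Rightarrow> 'r set \<Rightarrow> 'r set" for S J where
  gi0: "0 \<in> gen_ideal S J"
| gi1: "a \<in> gen_ideal S J \<Longrightarrow> j \<in> J \<Longrightarrow> s \<in> S \<Longrightarrow> a + s * j \<in> gen_ideal S J"

lemma gi_add: "b \<in> gen_ideal S J \<Longrightarrow> a \<in> gen_ideal S J \<Longrightarrow> a + b \<in> gen_ideal S J"
  by (induction rule: gen_ideal.induct) (auto simp: add.assoc[symmetric] intro: gen_ideal.intros)

lemma gi_ac: "add_closed (gen_ideal S J)"
  by (auto simp: add_closed_def intro: gen_ideal.gi0 gi_add)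

lemma gi_mult: "a \<in> gen_ideal S J \<Longrightarrow> is_subring S \<Longrightarrow> s \<in> S \<Longrightarrow> s * a \<in> gen_ideal S J"
proof (induction rule: gen_ideal.induct)
  case (gi1 a j t)
  have "s * (a + t * j) = s * a + (s * t) * j" by (simp add: algebra_simps)
  then show ?case using gen_ideal.gi1[OF gi1.IH[OF gi1.prems] gi1.hyps(2)] sringD(8)[OF gi1.prems gi1.hyps(3)] by metis
qed (simp add: gen_ideal.gi0)

lemma gi_J: "is_subring S \<Longrightarrow> j \<in> J \<Longrightarrow> J \<subseteq> K \<Longrightarrow> j \<in> gen_ideal S J"
  using gen_ideal.gi1[OF gen_ideal.gi0, of j J e S] sringD(2) by fastforce

lemma gi_S: "a \<in> gen_ideal S J \<Longrightarrow> is_subring S \<Longrightarrow> J \<subseteq> S \<Longrightarrow> a \<in> S"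
proof (induction rule: gen_ideal.induct)
  case (gi1 a j t)
  have "j \<in> S" using gi1 by blast
  then show ?case using sringD(6)[OF gi1.prems(1) gi1.IH[OF gi1.prems] sringD(8)[OF gi1.prems(1) gi1.hyps(3)]] by blast
qed (simp add: sringD(3))

lemma gi_mono: "a \<in> gen_ideal S J \<Longrightarrow> S \<subseteq> S' \<Longrightarrow> a \<in> gen_ideal S' J"
  by (induction rule: gen_ideal.induct) (auto intro: gen_ideal.intros)

lemma gi_adj:
  assumes "a \<in> gen_ideal (adjoin S x) J" "is_subring S" "J \<subseteq> S"
  shows "\<exists>n. a \<in> poly_values (gen_ideal S J) x n"
  using assms(1)
proof (induction rule: gen_ideal.induct)
  case gi0
  then show ?case using gen_ideal.gi0 by (metis poly_values.simps(1))
next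
  case (gi1 a j s)
  then obtain m n where m: "a \<in> poly_values (gen_ideal S J) x m" and n: "s \<in> poly_values S x n" by (auto simp: adjoin_def)
  have JK: "J \<subseteq> K" using assms sringD(1) by blast
  have "j * s \<in> poly_values (gen_ideal S J) x n"
    by (rule pl_mult_left[OF _ n]) (use gi_mult[OF gi_J[OF assms(2) gi1.hyps(2) JK] assms(2)] in \<open>simp add: mult.commute\<close>)
  then have "s * j \<in> poly_values (gen_ideal S J) x (max m n)" using pl_mono[OF gi_ac] by (metis max.cobounded2 mult.commute)
  moreover have "a \<in> poly_values (gen_ideal S J) x (max m n)" using pl_mono[OF gi_ac] m by (meson max.cobounded1)
  ultimately have "a + s * j \<in> poly_values (gen_ideal S J) x (max m n)" using pl_add[OF gi_ac] by blast
  then show ?case by blast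
qed

text \<open>Chevalley's extension theorem. A subring \<open>M\<close> maximal among those in which \<open>J\<close> generates a
proper ideal exists by Zorn's lemma. If neither \<open>x\<close> nor its inverse lay in \<open>M\<close>, adjoining
either would make the unit a polynomial value with coefficients in the ideal; of two such
relations of minimal degree, the one of smaller degree can be used to shorten the other.\<close>
lemma ex_dominating:
  assumes C: "is_subring C" and J: "J \<subseteq> C" "e \<notin> gen_ideal C J"
  shows "\<exists>U. val_ring U \<and> C \<subseteq> U \<and> J \<subseteq> nonunits_of U"
proof -
  define F where "F = {S. is_subring S \<and> C \<subseteq> S \<and> e \<notin> gen_ideal S J}"
  have "\<exists>M0\<in>F. (\<forall>X0\<in>F. M0 \<subseteq> X0 \<longrightarrow> X0 = M0)"
  proof (rule subset_Zorn_nonempty)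
    show "F \<noteq> {}" using C J F_def by blast
    fix \<C> assume "\<C> \<noteq> {}" and ch: "subset.chain F \<C>"
    then obtain S0 where S0: "S0 \<in> \<C>" by blast
    have F: "S \<in> F" if "S \<in> \<C>" for S using ch that by (auto simp: subset.chain_def)
    have S: "is_subring S" if "S \<in> \<C>" for S using F that F_def by blast
    have two: "\<exists>S\<in>\<C>. a \<in> S \<and> b \<in> S" if "a \<in> \<Union>\<C>" "b \<in> \<Union>\<C>" for a b
      using that ch unfolding subset.chain_def by blast
    have "is_subring (\<Union>\<C>)" unfolding is_subring_def
    proof (intro conjI ballI)
      show "\<Union>\<C> \<subseteq> K" using S sringD(1) by blast
      show "e \<in> \<Union>\<C>" using S0 S sringD(2) by blast
      fix a b assume "a \<in> \<Union>\<C>" "b \<in> \<Union>\<C>"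
      then obtain S1 where "S1 \<in> \<C>" "a \<in> S1" "b \<in> S1" using two by blast
      then show "a - b \<in> \<Union>\<C>" "a * b \<in> \<Union>\<C>" using sringD(7,8)[OF S] by blast+
    qed
    moreover have "e \<notin> gen_ideal (\<Union>\<C>) J"
    proof
      have "\<exists>S\<in>\<C>. a \<in> gen_ideal S J" if "a \<in> gen_ideal (\<Union>\<C>) J" for a
        using that
      proof (induction rule: gen_ideal.induct)
        case gi0 then show ?case using S0 gen_ideal.gi0 by blast
      next
        case (gi1 a j s)
        then obtain S1 S2 where S12: "S1 \<in> \<C>" "S2 \<in> \<C>" "a \<in> gen_ideal S1 J" "s \<in> S2" by blast
        then have "S1 \<subseteq> S2 \<or> S2 \<subseteq> S1" using ch unfolding subset.chain_def by blast
        then show ?case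
        proof
          assume "S1 \<subseteq> S2" then show ?thesis using gen_ideal.gi1[OF gi_mono[OF S12(3)] gi1.hyps(2) S12(4)] S12(2) by blast
        next
          assume "S2 \<subseteq> S1" then show ?thesis using gen_ideal.gi1[OF S12(3) gi1.hyps(2), of s] S12(1,4) by blast
        qed
      qed
      moreover assume "e \<in> gen_ideal (\<Union>\<C>) J"
      ultimately show False using F F_def by blast
    qed
    moreover have "C \<subseteq> \<Union>\<C>" using S0 F[OF S0] F_def by blast
    ultimately show "\<Union>\<C> \<in> F" using F_def by blast
  qed
  then obtain M where "M \<in> F" and max: "\<And>Y. Y \<in> F \<Longrightarrow> M \<subseteq> Y \<Longrightarrow> Y = M" by blast
  then have M: "is_subring M" "C \<subseteq> M" "e \<notin> gen_ideal M J" using F_def by auto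
  have JM: "J \<subseteq> M" using J M by blast
  have maxe: "e \<in> gen_ideal Y J" if "is_subring Y" "M \<subseteq> Y" "Y \<noteq> M" for Y
    using max[of Y] that M(2) F_def by blast
  \<comment> \<open>Inverting an element congruent to the unit modulo the ideal keeps the ideal proper, so by
    maximality such elements are already units of \<open>M\<close>.\<close>
  have unit: "unit_in M (e - j)" if j: "j \<in> gen_ideal M J" for j
  proof -
    define m where "m = e - j"
    have jM: "j \<in> M" using gi_S[OF j M(1) JM] .
    have mM: "m \<in> M" unfolding m_def using sringD(7)[OF M(1) sringD(2)[OF M(1)] jM] .
    have mK: "m \<in> K" using sringD(4)[OF M(1) mM] .
    have m0: "m \<noteq> 0" using M(3) j m_def by auto
    define Y where "Y = {z \<in> K. \<exists>n. z * pw m n \<in> M}"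
    have pwM: "pw m n \<in> M" for n using sringD(9)[OF M(1) mM] .
    have MY: "M \<subseteq> Y" using sringD(4)[OF M(1)] unfolding Y_def by (auto intro!: exI[of _ 0])
    have srY: "is_subring Y" unfolding is_subring_def
    proof (intro conjI ballI)
      show "Y \<subseteq> K" "e \<in> Y" using MY sringD(2)[OF M(1)] by (auto simp: Y_def)
      fix a b assume "a \<in> Y" "b \<in> Y"
      then obtain i n where ab: "a \<in> K" "b \<in> K" "a * pw m i \<in> M" "b * pw m n \<in> M" by (auto simp: Y_def)
      have "(a - b) * pw m (i + n) = (a * pw m i) * pw m n - (b * pw m n) * pw m i" 
        using pw_add[OF mK] by (simp add: algebra_simps)
      also have "\<dots> \<in> M" using sringD(7)[OF M(1) sringD(8)[OF M(1) ab(3) pwM] sringD(8)[OF M(1) ab(4) pwM]] .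
      finally show "a - b \<in> Y" unfolding Y_def using ab by blast
      have "(a * b) * pw m (i + n) = (a * pw m i) * (b * pw m n)" 
        using pw_add[OF mK] by (simp add: mult_ac)
      then have "(a * b) * pw m (i + n) \<in> M" using sringD(8)[OF M(1) ab(3,4)] by simp
      then show "a * b \<in> Y" unfolding Y_def using ab(1,2) by blast
    qed
    have "e \<notin> gen_ideal Y J"
    proof
      assume "e \<in> gen_ideal Y J"
      moreover have "\<exists>n. a * pw m n \<in> gen_ideal M J" if "a \<in> gen_ideal Y J" for a
        using that
      proof (induction rule: gen_ideal.induct)
        case gi0 then show ?case using gen_ideal.gi0 by auto
      next
        case (gi1 a j s)
        then obtain i n where i: "a * pw m i \<in> gen_ideal M J" "s * pw m n \<in> M" by (auto simp: Y_def)
        have 1: "(a + s * j) * pw m (i + n) = (pw m n * (a * pw m i)) + (pw m i * (s * pw m n)) * j"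
          using pw_add[OF mK] by (simp add: algebra_simps)
        show ?case unfolding 1[symmetric] 
          using gen_ideal.gi1[OF gi_mult[OF i(1) M(1) pwM] gi1.hyps(2) sringD(8)[OF M(1) pwM i(2)]] 1 by metis
      qed
      ultimately obtain n where n: "pw m n \<in> gen_ideal M J" using mK pw_K by fastforce
      have "e - pw m n \<in> gen_ideal M J" for n
      proof (induction n)
        case 0 then show ?case using gen_ideal.gi0 by simp
      next
        case (Suc n)
        have "pw m (Suc n) = pw m n * (e - j)" unfolding m_def[symmetric] by (simp add: mult.commute)
        also have "\<dots> = pw m n - pw m n * j" using pw_K[OF mK, of n] by (simp add: right_diff_distrib)
        finally have "e - pw m (Suc n) = (e - pw m n) + pw m n * j" by simp
        then show ?case using gi_add[OF gi_mult[OF j M(1) pwM] Suc.IH] by metis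
      qed
      then have "(e - pw m n) + pw m n \<in> gen_ideal M J" using gi_add[OF n] by blast
      then show False using M(3) by simp
    qed
    then have "Y = M" using maxe[OF srY MY] by blast
    moreover have "inverse_K m \<in> Y" unfolding Y_def using inverse_K(1,3)[OF mK m0] sringD(2)[OF M(1)] mK
      by (auto intro!: exI[of _ "Suc 0"])
    ultimately show ?thesis using inverse_K(2)[OF mK m0] mM unfolding unit_in_def m_def by blast
  qed
  have gK: "gen_ideal M J \<subseteq> K" using gi_S[OF _ M(1) JM] sringD(4)[OF M(1)] by blast
  define g where "g = gen_ideal M J"
  have gac: "add_closed g" unfolding g_def by (rule gi_ac)
  have tot: "x \<in> M \<or> x' \<in> M" if x: "x \<in> K" "x' \<in> K" "x * x' = e" for x x'
  proof (rule ccontr)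
    assume no: "\<not> ?thesis"
    have ex: "\<exists>n. e \<in> poly_values g x n" if "x \<in> K" "x \<notin> M" for x
      using gi_adj[OF maxe[OF sring_adj(1,2)[OF M(1) that(1)]] M(1) JM] sring_adj(3)[OF M(1) that(1)] that g_def by blast
    define n where "n = (LEAST n. e \<in> poly_values g x n)"
    define m where "m = (LEAST n. e \<in> poly_values g x' n)"
    have n: "e \<in> poly_values g x n" "\<And>i. i < n \<Longrightarrow> e \<notin> poly_values g x i"
      unfolding n_def using LeastI_ex[OF ex[OF x(1)]] not_less_Least no by blast+
    have m: "e \<in> poly_values g x' m" "\<And>i. i < m \<Longrightarrow> e \<notin> poly_values g x' i"
      unfolding m_def using LeastI_ex[OF ex[OF x(2)]] not_less_Least no by blast+
    have False if x: "x \<in> K" "x' \<in> K" "x * x' = e" and n: "e \<in> poly_values g x n" "\<And>i. i < n \<Longrightarrow> e \<notin> poly_values g x i"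
      and m: "e \<in> poly_values g x' m" and mn: "m \<le> n" for x x' m n
    proof -
      have "m \<noteq> 0" using m M(3) g_def by (cases m) auto
      then obtain m' where m': "m = Suc m'" by (cases m) auto
      obtain n' where n': "n = Suc n'" using mn m' by (cases n) auto
      obtain c q where cq: "c \<in> g" "q \<in> poly_values g x' m'" "e = c + x' * q" using plE[OF m[unfolded m']] by metis
      obtain v where v: "v \<in> M" "(e - c) * v = e" using unit cq(1) g_def by (auto simp: unit_in_def)
      have q2: "v * q \<in> poly_values g x' m'" 
        by (rule pl_mult_left[OF _ cq(2)]) (use gi_mult[OF _ M(1) v(1)] g_def in blast)
      have xq: "x' * q = e - c" unfolding cq(3)[symmetric] using cq(3) by (metis add_diff_cancel_left')
      have qK: "v * q \<in> K"
      proof -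
        have "e = x' * (v * q)" using v(2) xq by (metis mult.commute mult.left_commute)
        have "q = x * (e - c)"
        proof (rule cancel[of x'])
          have "q \<in> adjoin M x'" 
          proof -
            have "p \<in> poly_values g x' i \<Longrightarrow> p \<in> poly_values M x' i" for p i
            proof (induction i arbitrary: p)
              case 0 then show ?case using gi_S[OF _ M(1) JM] g_def by auto
            next
              case (Suc i)
              then obtain c q where "c \<in> g" "q \<in> poly_values g x' i" "p = c + x' * q" by (metis plE)
              then show ?case using plI Suc.IH gi_S[OF _ M(1) JM] g_def by blast
            qed
            then show ?thesis using cq(2) by (auto simp: adjoin_def)
          qed
          then show "q \<in> K" using sringD(4)[OF sring_adj(1)[OF M(1) x(2)]] by blast
          show "x' \<noteq> 0" using x by auto
          have "x' * (x * (e - c)) = (x * x') * (e - c)" by (simp only: mult_ac)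
          then show "x' * q = x' * (x * (e - c))" unfolding xq x(3) using gK cq(1) g_def by auto
        qed (use x gK cq(1) g_def in auto)
        then show ?thesis using x gK cq(1) g_def sringD(4)[OF M(1) v(1)] by auto
      qed
      have x'vq: "x' * (v * q) = e" using v(2) xq by (metis mult.commute mult.left_commute)
      have "x = x * (x' * (v * q))" unfolding x'vq using x by simp
      also have "\<dots> = (x * x') * (v * q)" by (simp only: mult_ac)
      also have "\<dots> = v * q" unfolding x(3) using qK by simp
      finally have xvq: "x = v * q" .
      have "pw x m' * x \<in> poly_values g x m'" 
        using pl_reverse[OF gac _ x q2] gK g_def xvq by metis
      then have "pw x m \<in> poly_values g x m'" unfolding m' by (simp add: mult.commute)
      then have xn: "pw x i * pw x m \<in> poly_values g x (m' + i)" for i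
      proof (induction i)
        case 0 then show ?case using x by simp
      next
        case (Suc i)
        then have "x * (pw x i * pw x m) \<in> poly_values g x (Suc (m' + i))" using pl_x[OF gac] by blast
        then show ?case by (simp add: mult.assoc)
      qed
      have "pw x (n - m) * pw x m = pw x n" using pw_add[OF x(1), of "n - m" m] mn by simp
      moreover have "m' + (n - m) = n'" using m' n' mn by simp
      ultimately have top: "pw x n \<in> poly_values g x n'" using xn[of "n - m"] by simp
      obtain q a where qa: "q \<in> poly_values g x n'" "a \<in> g" "e = q + pw x (Suc n') * a"
        using pl_top[OF gac _ x(1), of e n'] n(1) n' gK g_def by metis
      have "a * pw x n \<in> poly_values g x n'" 
        by (rule pl_mult_left[OF _ top]) (use gi_mult[OF _ M(1)] gi_S[OF _ M(1) JM] qa(2) g_def in blast)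
      then have "e \<in> poly_values g x n'" using qa pl_add[OF gac qa(1)] n' by (metis mult.commute)
      then show False using n(2) n' by blast
    qed
    from this[OF x n m(1)] this[OF x(2,1) _ m n(1)] show False using x(3) by (metis mult.commute nat_le_linear)
  qed
  have "val_ring M" unfolding val_ring_def
  proof (intro conjI ballI)
    fix a b assume a: "a \<in> K" and b: "b \<in> K"
    show "le M a b \<or> le M b a"
    proof (cases "a = 0 \<or> b = 0")
      case True then show ?thesis using le_zero[OF M(1)] by auto
    next
      case False
      have "(a * inverse_K b) * (b * inverse_K a) = (a * inverse_K a) * (b * inverse_K b)" by (simp only: mult_ac)
      then have "(a * inverse_K b) * (b * inverse_K a) = e" using inverse_K a b False by simp
      then have "a * inverse_K b \<in> M \<or> b * inverse_K a \<in> M" using tot[of "a * inverse_K b" "b * inverse_K a"] inverse_K a b False by simp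
      moreover have "a = b * (a * inverse_K b)" using inverse_K[OF b] a False by (metis mult.left_commute mult_e)
      moreover have "b = a * (b * inverse_K a)" using inverse_K[OF a] b False by (metis mult.left_commute mult_e)
      ultimately show ?thesis unfolding le_def by metis
    qed
  qed (rule M(1))
  moreover have "J \<subseteq> nonunits_of M"
  proof
    fix j assume j: "j \<in> J"
    have "\<not> unit_in M j"
    proof
      assume "unit_in M j"
      then obtain b where b: "b \<in> M" "j * b = e" by (auto simp: unit_in_def)
      have "b * j \<in> gen_ideal M J" using gi_mult[OF gi_J[OF M(1) j] M(1) b(1)] JM sringD(1)[OF M(1)] by blast
      then show False using b M(3) by (simp add: mult.commute)
    qed
    then show "j \<in> nonunits_of M" using j JM by (auto simp: nonunits_of_def)
  qed
  ultimately show ?thesis using M(2) by blast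
qed

end

section \<open>Intersections of dominating valuation rings\<close>

context field_in_ring begin

lemma gi_idl: 
  assumes "ideal_in C J" "a \<in> gen_ideal C J" shows "a \<in> J"
  using assms(2)
proof (induction rule: gen_ideal.induct)
  case (gi1 a j s)
  then show ?case using idlD(3)[OF assms(1) gi1.IH idlD(4)[OF assms(1) gi1.hyps(2,3)]] by blast
qed (rule idlD(2)[OF assms(1)])

lemma zero_mx: "is_subring A \<Longrightarrow> 0 \<in> nonunits_of A"
  using sringD(3) by (auto simp: nonunits_of_def unit_in_def)

lemma mx_mult': "is_subring D \<Longrightarrow> a \<in> nonunits_of D \<Longrightarrow> b \<in> D \<Longrightarrow> b * a \<in> nonunits_of D"
  using mx_mult by (metis mult.commute)

definition is_local :: "'r set \<Rightarrow> bool" where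
  "is_local A \<longleftrightarrow> is_subring A \<and> (\<forall>a\<in>nonunits_of A. \<forall>b\<in>nonunits_of A. a + b \<in> nonunits_of A)"

text \<open>Integral equations are expressed by values: \<open>z^(n+1)\<close> is a polynomial value of degree at most
\<open>n\<close>.\<close>
definition int_closed :: "'r set \<Rightarrow> bool" where
  "int_closed A \<longleftrightarrow> (\<forall>z\<in>K. \<forall>n. pw z (Suc n) \<in> poly_values A z n \<longrightarrow> z \<in> A)"

lemma mx_mem: "a \<in> nonunits_of A \<Longrightarrow> a \<in> A" by (simp add: nonunits_of_def)

lemma local_un_diff: 
  assumes "is_local A" "m \<in> nonunits_of A" shows "unit_in A (e - m)"
proof (rule ccontr)
  assume "\<not> unit_in A (e - m)"
  moreover have A: "is_subring A" using assms by (simp add: is_local_def)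
  moreover have "e - m \<in> A" using sringD(2,7)[OF A] mx_mem[OF assms(2)] by blast
  ultimately have "e - m \<in> nonunits_of A" by (simp add: nonunits_of_def)
  then have "e - m + m \<in> nonunits_of A" using assms unfolding is_local_def by blast
  then show False using un_e[OF A] by (simp add: nonunits_of_def)
qed

text \<open>If \<open>z\<close> is not integral over \<open>A\<close>, then the maximal ideal of \<open>A\<close> and \<open>1/z\<close> generate a proper
ideal of \<open>A[1/z]\<close>: an equation for the unit, multiplied by a power of \<open>z\<close>, would be an
integral equation. A valuation ring obtained from this ideal contains \<open>1/z\<close> as a nonunit.\<close>
lemma ex_Dom:
  assumes A: "is_local A" "int_closed A" and z: "z \<in> K" "z \<notin> A"
  shows "\<exists>U\<in>dominators A. z \<notin> U"
proof -
  have sA: "is_subring A" using A by (simp add: is_local_def)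
  have z0: "z \<noteq> 0" using z sringD(3)[OF sA] by auto
  define z' where "z' = inverse_K z"
  have z': "z' \<in> K" "z * z' = e" "z' * z = e" unfolding z'_def using inverse_K[OF z(1) z0] by auto
  define C where "C = adjoin A z'"
  have C: "is_subring C" "A \<subseteq> C" "z' \<in> C" unfolding C_def using sring_adj[OF sA z'(1)] by auto
  define J where "J = {m + z' * p | m p. m \<in> nonunits_of A \<and> p \<in> C}"
  have JI: "m + z' * p \<in> J" if "m \<in> nonunits_of A" "p \<in> C" for m p using that J_def by blast
  have split: "\<exists>c\<in>A. \<exists>q\<in>C. d = c + z' * q" if d: "d \<in> C" for d
  proof -
    obtain n where n: "d \<in> poly_values A z' n" using d by (auto simp: C_def adjoin_def)
    show ?thesis
    proof (cases n)
      case 0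
      then have "d \<in> A" using n by auto
      then show ?thesis using sringD(3)[OF C(1)] by (intro bexI[of _ d] bexI[of _ 0]) auto
    next
      case (Suc m)
      obtain c q where "c \<in> A" "q \<in> poly_values A z' m" "d = c + z' * q" by (rule plE[OF n[unfolded Suc]])
      moreover from this have "q \<in> C" unfolding C_def adjoin_def by blast
      ultimately show ?thesis by blast
    qed
  qed
  have idlJ: "ideal_in C J" unfolding ideal_in_def
  proof (intro conjI ballI)
    show "J \<subseteq> C" unfolding J_def using C(2) mx_mem sringD(6)[OF C(1)] sringD(8)[OF C(1) C(3)] by blast
    show "0 \<in> J" using JI[OF zero_mx[OF sA] sringD(3)[OF C(1)]] by simp
    show "a + b \<in> J" if ab: "a \<in> J" "b \<in> J" for a b
    proof -
      obtain m p m' p' where *: "m \<in> nonunits_of A" "p \<in> C" "a = m + z' * p" "m' \<in> nonunits_of A" "p' \<in> C" "b = m' + z' * p'"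
        using ab J_def by blast
      have "a + b = (m + m') + z' * (p + p')" unfolding * by (simp add: algebra_simps)
      moreover have "m + m' \<in> nonunits_of A" using * A(1) by (auto simp: is_local_def)
      ultimately show ?thesis using JI sringD(6)[OF C(1) *(2,5)] by metis
    qed
    show "d * a \<in> J" if a: "a \<in> J" "d \<in> C" for a d
    proof -
      obtain m p where *: "m \<in> nonunits_of A" "p \<in> C" "a = m + z' * p" using a J_def by blast
      obtain c q where cq: "c \<in> A" "q \<in> C" "d = c + z' * q" using split[OF a(2)] by blast
      have "d * a = d * m + z' * (d * p)" unfolding *(3) by (simp add: algebra_simps)
      also have "d * m = c * m + z' * (q * m)" unfolding cq(3) by (simp add: algebra_simps)
      finally have "d * a = c * m + z' * (q * m + d * p)" by (simp add: algebra_simps)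
      moreover have "q * m + d * p \<in> C" 
        using sringD(6)[OF C(1) sringD(8)[OF C(1) cq(2)] sringD(8)[OF C(1) a(2) *(2)]] C(2) mx_mem[OF *(1)] by blast
      ultimately show ?thesis using JI[OF mx_mult'[OF sA *(1) cq(1)]] by metis
    qed
  qed
  have "e \<notin> J"
  proof
    assume "e \<in> J"
    then obtain m p where m: "m \<in> nonunits_of A" "p \<in> C" "e = m + z' * p" using J_def by blast
    obtain v where v: "v \<in> A" "(e - m) * v = e" using local_un_diff[OF A(1) m(1)] by (auto simp: unit_in_def)
    obtain n where n: "p \<in> poly_values A z' n" using m(2) by (auto simp: C_def adjoin_def)
    have q: "v * p \<in> poly_values A z' n" by (rule pl_mult_left[OF sringD(8)[OF sA v(1)] n])
    have zp: "z' * p = e - m" using m(3) by (metis add_diff_cancel_left')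
    have "z' * (v * p) = (z' * p) * v" by (simp only: mult_ac)
    then have zq: "z' * (v * p) = e" unfolding zp v(2) .
    have pK: "v * p \<in> K" using sringD(4)[OF C(1) m(2)] sringD(4)[OF sA v(1)] by simp
    have "v * p = (z * z') * (v * p)" unfolding z'(2) using pK by simp
    also have "\<dots> = z * (z' * (v * p))" by (simp only: mult_ac)
    finally have vp: "v * p = z" unfolding zq using z by simp
    have "add_closed A" using sringD(3,6)[OF sA] by (auto simp: add_closed_def)
    then have "pw z n * z \<in> poly_values A z n" using pl_reverse[OF _ sringD(1)[OF sA] z(1) z'(1,2) q] vp by simp
    then have "pw z (Suc n) \<in> poly_values A z n" by (simp add: mult.commute)
    then show False using A(2) z by (auto simp: int_closed_def)
  qed
  then have "e \<notin> gen_ideal C J" using gi_idl[OF idlJ] by blast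
  then obtain U where U: "val_ring U" "C \<subseteq> U" "J \<subseteq> nonunits_of U" using ex_dominating[OF C(1) idlD(1)[OF idlJ]] by blast
  have "nonunits_of A \<subseteq> J"
  proof
    fix m assume "m \<in> nonunits_of A"
    then show "m \<in> J" using JI[of m 0] sringD(3)[OF C(1)] by simp
  qed
  then have "U \<in> dominators A" using U C(2) by (auto simp: dominators_def)
  moreover have "z' \<in> J" using JI[OF zero_mx[OF sA] sringD(2)[OF C(1)]] z' by simp
  then have "\<not> unit_in U z'" using U by (auto simp: nonunits_of_def)
  then have "z \<notin> U" using z'(3) U(2) C(3) unfolding unit_in_def by blast
  ultimately show ?thesis by blast
qed

lemma Dom_nonempty: assumes A: "is_local A" shows "dominators A \<noteq> {}"
proof -
  have sA: "is_subring A" using A by (simp add: is_local_def)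
  have "ideal_in A (nonunits_of A)" unfolding ideal_in_def using A zero_mx[OF sA] mx_mem mx_mult'[OF sA] by (auto simp: is_local_def)
  moreover have "e \<notin> nonunits_of A" using un_e[OF sA] by (simp add: nonunits_of_def)
  ultimately have "e \<notin> gen_ideal A (nonunits_of A)" using gi_idl by blast
  then show ?thesis using ex_dominating[OF sA, of "nonunits_of A"] mx_mem by (auto simp: dominators_def)
qed

lemma Dom_un: 
  assumes "is_subring A" "U \<in> dominators A" "c \<in> A" "unit_in U c" shows "unit_in A c"
  using assms DomD(6)[OF assms(2)] by (auto simp: nonunits_of_def)

lemma le_sum: 
  assumes "is_subring U" "\<And>i. i \<in> S \<Longrightarrow> le U a (f i)" shows "le U a (\<Sum>i\<in>S. f i)"
  using assms(2)
proof (induction S rule: infinite_finite_induct)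
  case (insert i S)
  then show ?case using le_add[OF assms(1)] by simp
qed (use le_zero[OF assms(1)] in auto)

lemma sum_K: "(\<And>i. i \<in> S \<Longrightarrow> f i \<in> K) \<Longrightarrow> (\<Sum>i\<in>S. f i) \<in> K"
  by (induction S rule: infinite_finite_induct) auto

text \<open>The argument is due to Kaplansky. The element \<open>d = c (n+1) * (y/x)\<close> lies in every ring of the family: either \<open>x\<close>
divides \<open>y\<close> there, or the relation itself expresses \<open>d\<close> through powers of \<open>x/y\<close>. Hence \<open>d\<close> is in
\<open>A\<close>, and the relation can be shortened by moving \<open>d\<close> into the preceding coefficient. Neither \<open>d\<close> nor the
last coefficient is a unit, as otherwise \<open>x/y\<close> or \<open>y/x\<close> would be in \<open>A\<close>.\<close>
lemma form_zero_mx: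
  assumes A: "is_subring A" and ne: "\<V> \<subseteq> dominators A" "\<V> \<noteq> {}" "A = \<Inter>\<V>"
    and x: "x \<in> K" "x \<noteq> 0" and y: "y \<in> K" "y \<noteq> 0"
    and no: "\<not> (\<exists>u\<in>A. y = x * u \<or> x = y * u)"
  shows "(\<And>i. i \<le> n \<Longrightarrow> c i \<in> A) \<Longrightarrow> (\<Sum>i\<le>n. c i * (pw x (n - i) * pw y i)) = 0 \<Longrightarrow> i \<le> n \<Longrightarrow> c i \<in> nonunits_of A"
proof (induction n arbitrary: c i)
  case 0
  have "c 0 \<in> K" using 0(1) sringD(4)[OF A] by blast
  then show ?case using 0 zero_mx[OF A] by simp
next
  case (Suc n)
  obtain V0 where V0: "V0 \<in> \<V>" using ne by blast
  have addm: "a + b \<in> nonunits_of A" if ab: "a \<in> nonunits_of A" "b \<in> nonunits_of A" for a b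
  proof -
    have V0D: "V0 \<in> dominators A" using V0 ne by blast
    have "a + b \<in> nonunits_of V0" using mx_add_vr[OF DomD(1)[OF V0D]] DomD(6)[OF V0D] ab by blast
    moreover have "unit_in V0 (a + b)" if "unit_in A (a + b)" using that DomD(3)[OF V0D] by (auto simp: unit_in_def)
    ultimately show ?thesis using sringD(6)[OF A] ab by (auto simp: nonunits_of_def)
  qed
  have cK: "c i \<in> K" if "i \<le> Suc n" for i using Suc.prems(1)[OF that] sringD(4)[OF A] by blast
  define \<tau> where "\<tau> = (\<Sum>i\<le>n. c i * (pw x (n - i) * pw y i))"
  have \<tau>K: "\<tau> \<in> K" unfolding \<tau>_def by (rule sum_K) (use cK x y in auto)
  have "(\<Sum>i\<le>n. c i * (pw x (Suc n - i) * pw y i)) = (\<Sum>i\<le>n. x * (c i * (pw x (n - i) * pw y i)))"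
    by (rule sum.cong) (auto simp: Suc_diff_le mult_ac)
  then have "x * \<tau> = (\<Sum>i\<le>n. c i * (pw x (Suc n - i) * pw y i))" unfolding \<tau>_def by (simp add: sum_distrib_left)
  then have rel: "x * \<tau> + c (Suc n) * pw y (Suc n) = 0" using Suc.prems(2) y(1) by simp
  define cc where "cc = c (Suc n)"
  have ccA: "cc \<in> A" "cc \<in> K" unfolding cc_def using Suc.prems(1) cK by auto
  obtain d where d: "d \<in> K" "d * x = cc * y" using ex_quot[of "cc * y" x] ccA y x by auto
  have rel': "x * \<tau> = - (d * x * pw y n)" 
    unfolding d(2) using rel cc_def by (simp add: add_eq_0_iff mult.assoc)
  have "x * (\<tau> + d * pw y n) = 0" using rel' by (simp add: algebra_simps)
  then have \<tau>d: "\<tau> + d * pw y n = 0" using mult_eq_zero[OF x(1)] \<tau>K d y x by simp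
  have dU: "d \<in> U" if "U \<in> \<V>" for U
  proof -
    have UD: "U \<in> dominators A" using that ne by blast
    note vU = DomD(1)[OF UD] and sU = DomD(2)[OF UD]
    show ?thesis
    proof (cases "le U x y")
      case True
      then obtain u where u: "u \<in> U" "y = x * u" by (auto simp: le_def)
      have "x * d = x * (cc * u)" using d(2) u(2) by (simp add: mult_ac)
      then have "d = cc * u" using cancel[of x] x d ccA sringD(4)[OF sU u(1)] by auto
      then show ?thesis using sringD(8)[OF sU _ u(1)] DomD(5)[OF UD ccA(1)] by simp
    next
      case False
      then have yx: "le U y x" using lt_imp_le[OF vU y(1) x(1)] by blast
      have "le U (pw y n) \<tau>" unfolding \<tau>_def
      proof (rule le_sum[OF sU])
        fix i assume i: "i \<in> {..n}"
        have "le U (pw y (n - i) * pw y i) (pw x (n - i) * pw y i)"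
          by (intro le_mult_same[OF sU] le_pw[OF sU] yx pw_K y)
        then have "le U (pw y n) (pw x (n - i) * pw y i)" using i pw_add[OF y(1), of "n - i" i] by simp
        then show "le U (pw y n) (c i * (pw x (n - i) * pw y i))" 
          using le_mult_left[OF sU] DomD(5)[OF UD Suc.prems(1)] i by auto
      qed
      then obtain v where v: "v \<in> U" "\<tau> = pw y n * v" by (auto simp: le_def)
      have "pw y n * (v + d) = 0" using \<tau>d v by (simp add: algebra_simps)
      then have "v + d = 0" using mult_eq_zero[of "pw y n" "v + d"] pw_nonzero[OF y] y d sringD(4)[OF sU v(1)] by simp
      then have "d = - v" by (simp add: add_eq_0_iff)
      then show ?thesis using sringD(5)[OF sU v(1)] by simp
    qed
  qed
  have dA: "d \<in> A" using dU ne by blast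
  define c' where "c' = (\<lambda>i. if i = n then c n + d else c i)"
  have c'A: "c' i \<in> A" if "i \<le> n" for i unfolding c'_def using that Suc.prems(1) sringD(6)[OF A _ dA] by auto
  have "(\<Sum>i\<le>n. c' i * (pw x (n - i) * pw y i)) = (\<Sum>i\<le>n. c i * (pw x (n - i) * pw y i) + (if i = n then d * pw y n else 0))"
    by (rule sum.cong) (use y x in \<open>auto simp: c'_def distrib_right\<close>)
  also have "\<dots> = \<tau> + d * pw y n" by (simp add: sum.distrib \<tau>_def)
  finally have sum0: "(\<Sum>i\<le>n. c' i * (pw x (n - i) * pw y i)) = 0" using \<tau>d by simp
  have IH: "c' i \<in> nonunits_of A" if "i \<le> n" for i using Suc.IH[OF c'A sum0 that] by blast
  have cmx: "cc \<in> nonunits_of A"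
  proof (rule ccontr)
    assume "cc \<notin> nonunits_of A"
    then obtain b where b: "b \<in> A" "cc * b = e" using ccA by (auto simp: nonunits_of_def unit_in_def)
    have "x * (b * d) = b * (d * x)" by (simp only: mult_ac)
    also have "\<dots> = (cc * b) * y" unfolding d(2) by (simp only: mult_ac)
    finally have "y = x * (b * d)" unfolding b(2) using y by simp
    then show False using no sringD(8)[OF A b(1) dA] by blast
  qed
  have dmx: "d \<in> nonunits_of A"
  proof (rule ccontr)
    assume "d \<notin> nonunits_of A"
    then obtain b where b: "b \<in> A" "d * b = e" using dA by (auto simp: nonunits_of_def unit_in_def)
    have "y * (cc * b) = (cc * y) * b" by (simp only: mult_ac)
    also have "\<dots> = (d * b) * x" unfolding d(2)[symmetric] by (simp only: mult_ac)
    finally have "x = y * (cc * b)" unfolding b(2) using x by simp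
    then show False using no sringD(8)[OF A ccA(1) b(1)] by blast
  qed
  show ?case
  proof (cases "i = Suc n")
    case True then show ?thesis using cmx cc_def by simp
  next
    case False
    then have i: "i \<le> n" using Suc.prems(3) by simp
    show ?thesis
    proof (cases "i = n")
      case True
      have "- e * d \<in> nonunits_of A" using mx_mult'[OF A dmx] sringD(5)[OF A sringD(2)[OF A]] by blast
      then have "- d \<in> nonunits_of A" using d(1) by simp
      moreover have "c n + d \<in> nonunits_of A" using IH[OF i] True c'_def by simp
      ultimately have "(c n + d) + - d \<in> nonunits_of A" by (metis addm)
      then show ?thesis using True by simp
    next
      case False
      then show ?thesis using IH[OF i] c'_def by simp
    qed
  qed
qed

end

context regular2 begin

lemma sum_I: "(\<And>i. i \<in> S \<Longrightarrow> f i \<in> I n) \<Longrightarrow> (\<Sum>i\<in>S. f i) \<in> I n"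
  by (induction S rule: infinite_finite_induct) (auto intro: I_add)

lemma I_form:
  "h \<in> I n \<Longrightarrow> \<exists>c. (\<forall>i. c i \<in> D) \<and> h = (\<Sum>i\<le>n. c i * (pw x (n - i) * pw y i))"
proof (induction n arbitrary: h)
  case 0
  then show ?case using D_K by (intro exI[of _ "\<lambda>_. h"]) auto
next
  case (Suc n)
  obtain b d where b: "b \<in> I n" "d \<in> D" "h = x * b + pw y (Suc n) * d" using I_Suc_decomp[OF Suc.prems] by metis
  obtain c where c: "\<forall>i. c i \<in> D" "b = (\<Sum>i\<le>n. c i * (pw x (n - i) * pw y i))" using Suc.IH[OF b(1)] by blast
  define c' where "c' = (\<lambda>i. if i = Suc n then d else c i)"
  have "(\<Sum>i\<le>n. c' i * (pw x (Suc n - i) * pw y i)) = (\<Sum>i\<le>n. x * (c i * (pw x (n - i) * pw y i)))"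
    by (rule sum.cong) (auto simp: c'_def Suc_diff_le mult_ac)
  also have "\<dots> = x * b" unfolding c(2) by (simp add: sum_distrib_left)
  finally have "h = (\<Sum>i\<le>Suc n. c' i * (pw x (Suc n - i) * pw y i))"
    unfolding b(3) using D_K[OF b(2)] by (simp add: c'_def mult.commute)
  moreover have "\<forall>i. c' i \<in> D" using c b by (simp add: c'_def)
  ultimately show ?case by blast
qed

lemma form_I:
  assumes "\<And>i. i \<le> n \<Longrightarrow> c i \<in> I 1" shows "(\<Sum>i\<le>n. c i * (pw x (n - i) * pw y i)) \<in> I (Suc n)"
proof (rule sum_I)
  fix i assume "i \<in> {..n}"
  then have "c i * (pw x (n - i) * pw y i) \<in> I (1 + (n - i + i))"
    by (intro I_mult2 I_pw_x I_pw_y assms) simp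
  then show "c i * (pw x (n - i) * pw y i) \<in> I (Suc n)" using \<open>i \<in> {..n}\<close> by simp
qed

text \<open>Writing \<open>\<alpha>\<close> as a quotient of two forms over \<open>D\<close> gives a relation with coefficients
\<open>c i - \<alpha> * c' i\<close>, which are nonunits by \<open>form_zero_mx\<close>. A unit \<open>c' i\<close> then shows that \<open>\<alpha>\<close> is
congruent to an element of \<open>D\<close>, while a unit \<open>c i\<close> without such a \<open>c' i\<close> is impossible.\<close>
lemma residue_trivial:
  assumes A: "is_subring A" "D \<subseteq> A" and ne: "\<V> \<subseteq> dominators A" "\<V> \<noteq> {}" "A = \<Inter>\<V>" and dom: "nonunits_of D \<subseteq> nonunits_of A"
    and no: "\<not> (\<exists>u\<in>A. y = x * u \<or> x = y * u)"
    and \<alpha>: "\<alpha> \<in> A" and ab: "a \<in> D" "b \<in> D" "b \<noteq> 0" "\<alpha> * b = a"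
  shows "\<exists>d\<in>D. \<alpha> - d \<in> nonunits_of A"
proof (cases "a = 0")
  case True
  then have "\<alpha> = 0" using ab mult_eq_zero[of \<alpha> b] D_K sringD(4)[OF A(1) \<alpha>] by auto
  then show ?thesis using zero_mx[OF A(1)] by (intro bexI[of _ 0]) auto
next
  case False
  obtain s where s: "b \<in> I s" "b \<notin> I (Suc s)" using ex_order[OF ab(2,3)] by metis
  obtain t where t: "a \<in> I t" "a \<notin> I (Suc t)" using ex_order[OF ab(1) False] by metis
  define n where "n = min s t"
  have an: "a \<in> I n" "b \<in> I n" using I_antimono[OF _ s(1), of n] I_antimono[OF _ t(1), of n] n_def by auto
  obtain c where c: "\<forall>i. c i \<in> D" "a = (\<Sum>i\<le>n. c i * (pw x (n - i) * pw y i))" using I_form[OF an(1)] by blast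
  obtain c' where c': "\<forall>i. c' i \<in> D" "b = (\<Sum>i\<le>n. c' i * (pw x (n - i) * pw y i))" using I_form[OF an(2)] by blast
  have "(\<Sum>i\<le>n. (c i - \<alpha> * c' i) * (pw x (n - i) * pw y i)) = a - \<alpha> * b"
    unfolding c(2) c'(2) by (simp add: sum_distrib_left sum_subtractf algebra_simps)
  then have 0: "(\<Sum>i\<le>n. (c i - \<alpha> * c' i) * (pw x (n - i) * pw y i)) = 0" using ab(4) by simp
  have inA: "c i - \<alpha> * c' i \<in> A" for i 
    using sringD(7)[OF A(1) _ sringD(8)[OF A(1) \<alpha>]] c c' A(2) by blast
  have nonunits_of: "c i - \<alpha> * c' i \<in> nonunits_of A" if "i \<le> n" for i
    using form_zero_mx[OF A(1) ne x_K x_nonzero y_K y_nonzero no inA 0 that] .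
  show ?thesis
  proof (cases "\<exists>i\<le>n. unit_in D (c' i)")
    case True
    then obtain i v where i: "i \<le> n" "v \<in> D" "c' i * v = e" by (auto simp: unit_in_def)
    have vA: "- v \<in> A" using A(2) i D_uminus by blast
    have "(c i - \<alpha> * c' i) * (- v) = \<alpha> * (c' i * v) - c i * v" by (simp add: algebra_simps)
    then have "(c i - \<alpha> * c' i) * (- v) = \<alpha> - c i * v" unfolding i(3) using sringD(4)[OF A(1) \<alpha>] by simp
    then have "\<alpha> - c i * v \<in> nonunits_of A" using mx_mult[OF A(1) nonunits_of[OF i(1)] vA] by simp
    then show ?thesis using D_mult[of "c i" v] c i by blast
  next
    case False
    then have "b \<in> I (Suc n)" unfolding c'(2) using form_I[of n c'] loc c' by blast
    then have "n \<noteq> s" using s by blast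
    then have "n = t" using n_def by (auto simp: min_def split: if_splits)
    then have "\<not> (\<forall>i\<le>n. c i \<in> I 1)" using t(2) form_I[of n c] c(2) by auto
    then obtain i where i: "i \<le> n" "unit_in D (c i)" using loc c by blast
    have "\<alpha> * c' i \<in> nonunits_of A" using mx_mult'[OF A(1) _ \<alpha>] dom c' False i(1) by (auto simp: nonunits_of_def)
    then have cm: "\<alpha> * c' i \<in> nonunits_of V" "c i - \<alpha> * c' i \<in> nonunits_of V" if "V \<in> \<V>" for V using nonunits_of[OF i(1)] ne that DomD(6) by blast+
    obtain V where V: "V \<in> \<V>" using ne by blast
    then have VD: "V \<in> dominators A" using ne by blast
    have "c i \<in> nonunits_of V" using mx_add_vr[OF DomD(1)[OF VD] cm(2)[OF V] cm(1)[OF V]] by simp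
    moreover have "unit_in V (c i)" using i(2) A(2) DomD(3)[OF VD] by (auto simp: unit_in_def)
    ultimately show ?thesis by (simp add: nonunits_of_def)
  qed
qed

text \<open>In the graded ring, a homogeneous divisor of a power of \<open>x\<close> is a constant times a power of \<open>x\<close>.
A factor divisible by \<open>x\<close> is reduced by cancelling, and two factors monic in \<open>y\<close> have a
product monic in \<open>y\<close>.\<close>
lemma dvd_pw_x:
  assumes "q \<in> I s" "p \<in> I t" "pw x (s + t) - q * p \<in> I (Suc (s + t))"
  shows "\<exists>c\<in>D. q - c * pw x s \<in> I (Suc s)"
  using assms
proof (induction "s + t" arbitrary: s t q p rule: less_induct)
  case less
  show ?case
  proof (cases s)
    case 0
    then have "q - q * pw x s = 0" "q \<in> D" using I_K[OF less.prems(1)] less.prems(1) by auto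
    then show ?thesis using I_zero[of "Suc s"] by metis
  next
    case s: (Suc s')
    show ?thesis
    proof (cases t)
      case 0
      have "unit_in D p"
      proof (rule ccontr)
        assume "\<not> unit_in D p"
        then have "p \<in> I 1" using loc[of p] less.prems(2) 0 by auto
        then have "q * p \<in> I (Suc s)" using I_mult2[OF less.prems(1), of p 1] by simp
        then have "(pw x s - q * p) + q * p \<in> I (Suc s)" using I_add less.prems(3) 0 by (metis add_0_right)
        then show False using pw_x_notin by simp
      qed
      then obtain v where v: "v \<in> D" "p * v = e" by (auto simp: unit_in_def)
      have "q - v * pw x s = (pw x s - q * p) * (- v)" 
      proof -
        have "(pw x s - q * p) * (- v) = q * (p * v) - v * pw x s" by (simp add: algebra_simps)
        then show ?thesis unfolding v(2) using I_K[OF less.prems(1)] by simp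
      qed
      also have "\<dots> \<in> I (Suc s)" using I_mult'[OF less.prems(3) D_uminus[OF v(1)]] 0 by simp
      finally show ?thesis using v by blast
    next
      case t: (Suc t')
      note qI = less.prems(1)[unfolded s] and pI = less.prems(2)[unfolded t]
      show ?thesis
      proof (cases rule: lead_cases[OF qI])
        case (1 q' w)
        have "w * p \<in> I (Suc (s + t))" using I_mult2[OF 1(2) less.prems(2)] s by simp
        moreover have "x * (pw x (s' + t) - q' * p) = (pw x (s + t) - q * p) + w * p"
          unfolding 1(3) s by (simp add: algebra_simps)
        ultimately have "x * (pw x (s' + t) - q' * p) \<in> I (Suc (s + t))" using I_add[OF less.prems(3)] by metis
        moreover have "pw x (s' + t) - q' * p \<in> D" 
          using D_diff[OF D_pw[OF x] D_mult[OF I_D[OF 1(1)] I_D[OF less.prems(2)]]] .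
        ultimately have "pw x (s' + t) - q' * p \<in> I (Suc (s' + t))" using x_cancel s by simp
        then obtain c where c: "c \<in> D" "q' - c * pw x s' \<in> I (Suc s')" using less.hyps[OF _ 1(1) less.prems(2)] s by auto
        have "q - c * pw x s = x * (q' - c * pw x s') + w" unfolding 1(3) s by (simp add: algebra_simps)
        also have "\<dots> \<in> I (Suc s)" using I_add[OF I_x[OF c(2)] 1(2)] s by simp
        finally show ?thesis using c by blast
      next
        case q2: (2 q' c)
        show ?thesis
        proof (cases rule: lead_cases[OF pI])
          case (1 p' w)
          have "q * w \<in> I (Suc (s + t))" using I_mult2[OF less.prems(1) 1(2)] t by simp
          moreover have "x * (pw x (s + t') - q * p') = (pw x (s + t) - q * p) + q * w"
            unfolding 1(3) t by (simp add: algebra_simps)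
          ultimately have "x * (pw x (s + t') - q * p') \<in> I (Suc (s + t))" using I_add[OF less.prems(3)] by metis
          moreover have "pw x (s + t') - q * p' \<in> D" 
            using D_diff[OF D_pw[OF x] D_mult[OF I_D[OF less.prems(1)] I_D[OF 1(1)]]] .
          ultimately have "pw x (s + t') - q * p' \<in> I (Suc (s + t'))" using x_cancel t by simp
          then show ?thesis using less.hyps[OF _ less.prems(1) 1(1)] t by simp
        next
          case p2: (2 p' d)
          obtain v where v: "v \<in> D" "(c * d) * v = e" using un_mult[OF is_subring q2(2) p2(2)] by (auto simp: unit_in_def)
          have cd: "c \<in> D" "d \<in> D" using q2 p2 by (auto simp: unit_in_def)
          define r where "r = pw x (s' + t) - (q' * p + pw y s * c * p')"
          have rD: "r \<in> D" unfolding r_def using D_diff[OF D_pw[OF x] D_add[OF D_mult[OF I_D[OF q2(1)] I_D[OF less.prems(2)]] 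
            D_mult[OF D_mult[OF D_pw[OF y] cd(1)] I_D[OF p2(1)]]]] .
          have "pw x (s + t) - q * p = x * r - pw y (s + t) * (c * d)"
          proof -
            have "q * p = x * (q' * p) + (pw y s * c) * p" unfolding q2(3) s by (simp add: algebra_simps)
            also have "(pw y s * c) * p = x * (pw y s * c * p') + pw y (s + t) * (c * d)"
              unfolding p2(3) pw_add[OF y_K] t by (simp add: algebra_simps)
            finally have "q * p = x * (q' * p) + (x * (pw y s * c * p') + pw y (s + t) * (c * d))" .
            then show ?thesis unfolding r_def s by (simp add: algebra_simps)
          qed
          then have "(x * r - pw y (s + t) * (c * d)) * (- v) \<in> I (Suc (s + t))"
            using I_mult'[OF less.prems(3) D_uminus[OF v(1)]] by simp
          moreover have "(x * r - pw y (s + t) * (c * d)) * (- v) = pw y (s + t) * ((c * d) * v) - x * (r * v)"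
            by (simp add: algebra_simps)
          ultimately have "pw y (s + t) - x * (r * v) \<in> I (Suc (s + t))" unfolding v(2) by simp
          then show ?thesis using nx[OF D_mult[OF rD v(1)]] by blast
        qed
      qed
    qed
  qed
qed

end

section \<open>Sequences of quadratic transforms\<close>

context field_in_ring begin

definition coprime_fractions :: "'r set \<Rightarrow> bool" where
  "coprime_fractions D \<longleftrightarrow> (\<forall>z\<in>K. \<exists>a b n. colength_le D a b n \<and> b \<noteq> 0 \<and> z * b = a)"

text \<open>What is retained of a composition of quadratic transforms \<open>D \<subseteq> D'\<close>; in particular confined
poles over \<open>D'\<close> can be pulled back to \<open>D\<close>.\<close>
definition good_extension :: "'r set \<Rightarrow> 'r set \<Rightarrow> bool" where
  "good_extension D D' \<longleftrightarrow> (\<exists>x y. regular2 K e D' x y) \<and> coprime_fractions D' \<and> D \<subseteq> D' \<and> dominators D' \<subseteq> dominators D \<and> 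
     (\<forall>V\<in>dominators D'. \<forall>W. pole_within D' V W \<longrightarrow> pole_within D V W)"

text \<open>The value of an element of order \<open>n\<close> is \<open>n\<close> times the value of \<open>m\<close>, for a suitable choice of the
first parameter.\<close>
definition is_order_valuation :: "'r set \<Rightarrow> 'r set \<Rightarrow> bool" where
  "is_order_valuation D V \<longleftrightarrow> (\<exists>x y. regular2 K e D x y \<and> le V x y \<and> 
     (\<forall>n. \<forall>G\<in>max_power D x y n - max_power D x y (Suc n). le V G (pw x n)))"

text \<open>In this case \<open>A\<close> contains neither of the coordinate rings \<open>D[y/x]\<close> and \<open>D[x/y]\<close> of the blowup.\<close>
definition incomparable_parameters :: "'r set \<Rightarrow> 'r set \<Rightarrow> bool" where
  "incomparable_parameters D A \<longleftrightarrow> (\<exists>x y. regular2 K e D x y \<and> \<not> (\<exists>u\<in>A. y = x * u \<or> x = y * u))"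

lemma good_trans: "good_extension D D' \<Longrightarrow> good_extension D' D'' \<Longrightarrow> good_extension D D''"
  unfolding good_extension_def by blast

lemma good_refl: "regular2 K e D x y \<Longrightarrow> coprime_fractions D \<Longrightarrow> good_extension D D"
  unfolding good_extension_def by blast

end

context quadratic begin

lemma fin_D1: assumes "coprime_fractions D" shows "coprime_fractions D1"
  unfolding coprime_fractions_def
proof
  fix z assume z: "z \<in> K"
  then obtain a b n where ab: "colength_le D a b n" "b \<noteq> 0" "z * b = a" using assms coprime_fractions_def by blast
  then obtain a1 b1 t where t: "t \<in> K" "t \<noteq> 0" "a = t * a1" "b = t * b1" "colength_le D1 a1 b1 (n - 1)"
    using co_step by blast
  have K: "a1 \<in> K" "b1 \<in> K" using t(5) D1_K by (auto simp: colength_le_def)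
  have "t * (z * b1) = t * a1" using ab(3) unfolding t(3,4) by (simp add: mult_ac)
  then have "z * b1 = a1" using cancel[OF t(1,2)] K z by simp
  moreover have "b1 \<noteq> 0" using ab(2) t(4) by auto
  ultimately show "\<exists>a b n. colength_le D1 a b n \<and> b \<noteq> 0 \<and> z * b = a" using t(5) by blast
qed

lemma good_D1: "coprime_fractions D \<Longrightarrow> good_extension D D1"
  unfolding good_extension_def using reg_D1 fin_D1 D_D1 Dom_D1_sub sep_pull by blast

end

context field_in_ring begin

text \<open>What one transform along \<open>V\<close> provides, stated without reference to parameters. If \<open>y\<close> does not lie in
\<open>xV\<close>, the roles of the parameters are exchanged.\<close>
theorem quadratic_transform:
  assumes regular2: "regular2 K e D x y" and coprime_fractions: "coprime_fractions D" and V: "V \<in> dominators D" and ord: "\<not> is_order_valuation D V"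
  obtains D1 where "good_extension D D1" "V \<in> dominators D1" "\<And>V' W. V' \<in> dominators D1 \<Longrightarrow> dominators D1 \<subseteq> W \<Longrightarrow> pole_within D V' W"
    "\<And>a b n. colength_le D a b n \<Longrightarrow> \<exists>a1 b1 t. t \<in> K \<and> t \<noteq> 0 \<and> a = t * a1 \<and> b = t * b1 \<and> colength_le D1 a1 b1 (n - 1)"
    "\<And>A. is_subring A \<Longrightarrow> D \<subseteq> A \<Longrightarrow> A \<subseteq> V \<Longrightarrow> \<forall>c\<in>A. unit_in V c \<longrightarrow> unit_in A c \<Longrightarrow> \<not> incomparable_parameters D A \<Longrightarrow> D1 \<subseteq> A"
proof -
  have "\<exists>x y. regular2 K e D x y \<and> le V x y"
  proof (cases "le V x y")
    case True then show ?thesis using regular2 by blast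
  next
    case False
    interpret r: regular2 K e D x y by fact
    show ?thesis using r.swap lt_imp_le[OF DomD(1)[OF V] r.y_K r.x_K False] by blast
  qed
  then obtain x y where r: "regular2 K e D x y" and xy: "le V x y" by blast
  interpret r: regular2 K e D x y by fact
  obtain n G where "G \<in> max_power D x y n" "G \<notin> max_power D x y (Suc n)" "lt V (pw x n) G"
    using ord r xy unfolding is_order_valuation_def by blast
  then obtain k G where "quadratic K e D x y V k G" using r.ex_quad[OF V xy] by blast
  then interpret q: quadratic K e D x y V k G .
  have A: "q.D1 \<subseteq> A" if A: "is_subring A" "D \<subseteq> A" "A \<subseteq> V" "\<forall>c\<in>A. unit_in V c \<longrightarrow> unit_in A c" "\<not> incomparable_parameters D A" for A
  proof -
    obtain u where u: "u \<in> A" "y = x * u \<or> x = y * u" using A(5) r unfolding incomparable_parameters_def by blast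
    have "\<exists>u\<in>A. y = x * u"
    proof (cases "y = x * u")
      case True then show ?thesis using u by blast
    next
      case False
      then have xu: "x = y * u" using u by blast
      obtain v where v: "v \<in> V" "y = x * v" using xy by (auto simp: le_def)
      have uK: "u \<in> K" "v \<in> K" using sringD(4)[OF A(1) u(1)] sringD(4)[OF q.srV v(1)] by auto
      have "x * e = x" by simp
      also have "\<dots> = (x * v) * u" using xu v(2) by metis
      finally have "x * (u * v) = x * e" by (simp add: mult_ac)
      then have "u * v = e" using cancel[OF r.x_K r.x_nonzero] uK by simp
      then have "unit_in V u" using v(1) u(1) A(3) by (auto simp: unit_in_def)
      then obtain u' where u': "u' \<in> A" "u * u' = e" using A(4) u(1) by (auto simp: unit_in_def)
      have "y = y * (u * u')" unfolding u'(2) by simp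
      also have "\<dots> = x * u'" using xu by (metis mult.assoc)
      finally show ?thesis using u' by blast
    qed
    then obtain u where "u \<in> A" "y = x * u" by blast
    then show ?thesis using q.D1_subset_A[OF A(1-3)] A(4) by blast
  qed
  show ?thesis
    by (rule that[OF q.good_D1[OF coprime_fractions] _ q.sep_base q.co_step A]) (simp_all add: q.V_Q q.Dom_D1)
qed

text \<open>Each quadratic transform lowers the colength of the pair representing \<open>z\<close>, so after finitely
many steps one of them is a unit and \<open>z\<close> is in the ring, unless the process stops before because
\<open>V\<close> has become an order valuation or \<open>A\<close> may fail to contain the next transform.\<close>
theorem reach:
  assumes "regular2 K e D x y" "coprime_fractions D" "V \<in> dominators D" "is_subring A" "D \<subseteq> A" "A \<subseteq> V" "\<And>c. c \<in> A \<Longrightarrow> unit_in V c \<Longrightarrow> unit_in A c"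
    and "colength_le D a b n" "b \<noteq> 0" "z * b = a" "z \<in> V"
  shows "\<exists>D'. good_extension D D' \<and> V \<in> dominators D' \<and> D' \<subseteq> A \<and> (z \<in> D' \<or> is_order_valuation D' V \<or> incomparable_parameters D' A)"
  using assms
proof (induction n arbitrary: D x y a b)
  case (Suc n)
  show ?case
  proof (cases "is_order_valuation D V \<or> incomparable_parameters D A")
    case True
    then show ?thesis using Suc.prems good_refl by blast
  next
    case False
    have all: "\<forall>c\<in>A. unit_in V c \<longrightarrow> unit_in A c" using Suc.prems(7) by blast
    obtain D1 where D1: "good_extension D D1" "V \<in> dominators D1" 
      "\<And>a b n. colength_le D a b n \<Longrightarrow> \<exists>a1 b1 t. t \<in> K \<and> t \<noteq> 0 \<and> a = t * a1 \<and> b = t * b1 \<and> colength_le D1 a1 b1 (n - 1)"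
      and sub: "\<And>A. is_subring A \<Longrightarrow> D \<subseteq> A \<Longrightarrow> A \<subseteq> V \<Longrightarrow> \<forall>c\<in>A. unit_in V c \<longrightarrow> unit_in A c \<Longrightarrow> \<not> incomparable_parameters D A \<Longrightarrow> D1 \<subseteq> A"
      by (rule quadratic_transform[OF Suc.prems(1-3)]) (use False in blast)+
    have D1A: "D1 \<subseteq> A" by (rule sub[OF Suc.prems(4-6) all]) (use False in blast)
    obtain a1 b1 t where t: "t \<in> K" "t \<noteq> 0" "a = t * a1" "b = t * b1" "colength_le D1 a1 b1 n"
      using D1(3)[OF Suc.prems(8)] by auto
    have sV: "is_subring V" using Suc.prems(3) DomD by blast
    have K: "a1 \<in> K" "b1 \<in> K" "z \<in> K" using t(5) sringD(4)[OF Suc.prems(4) subsetD[OF D1A]] sringD(4)[OF sV Suc.prems(11)] by (auto simp: colength_le_def)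
    have "t * (z * b1) = t * a1" using Suc.prems(10) unfolding t(3,4) by (simp add: mult_ac)
    then have z: "z * b1 = a1" using cancel[OF t(1,2)] K by simp
    have b1: "b1 \<noteq> 0" using Suc.prems(9) t(4) by auto
    obtain x1 y1 where r1: "regular2 K e D1 x1 y1" "coprime_fractions D1" using D1(1) good_extension_def by blast
    show ?thesis 
      using Suc.IH[OF r1 D1(2) Suc.prems(4) D1A Suc.prems(6,7) t(5) b1 z Suc.prems(11)] good_trans[OF D1(1)] by blast
  qed
next
  case 0
  interpret r: regular2 K e D x y by fact
  have ab: "a \<in> D" "b \<in> D" and ch: "chain_bound_pair D a b 0" using 0 by (auto simp: colength_le_def)
  have sV: "is_subring V" using 0(3) DomD by blast
  have "unit_in D a \<or> unit_in D b"
  proof (rule ccontr)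
    assume no: "\<not> ?thesis"
    define C where "C i = (if i = 0 then r.I 1 else D)" for i :: nat
    have "ideal_in D (C i) \<and> a \<in> C i \<and> b \<in> C i" for i
      using no r.loc ab r.I_add r.I_mult r.I_D r.I_zero r.D_add r.D_mult r.D_0 by (auto simp: C_def ideal_in_def)
    moreover have "C 0 \<subset> C (Suc 0)" using r.I_D r.nonunit un_e[OF r.is_subring] r.D_e by (auto simp: C_def)
    ultimately have "Suc 0 \<le> 0" using ch unfolding chain_bound_pair_def by (metis One_nat_def less_one)
    then show False by simp
  qed
  then have "unit_in D b"
  proof
    assume "unit_in D a"
    then obtain v where v: "v \<in> D" "a * v = e" by (auto simp: unit_in_def)
    have "b * (z * v) = e" using 0(10) v(2) by (metis mult.assoc mult.commute)
    moreover have "z * v \<in> V" using sringD(8)[OF sV 0(11)] DomD(5)[OF 0(3) v(1)] by blast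
    ultimately have "unit_in V b" using DomD(5)[OF 0(3) ab(2)] by (auto simp: unit_in_def)
    then show "unit_in D b" using DomD(6)[OF 0(3), of b] ab(2) by (auto simp: nonunits_of_def)
  qed
  then obtain v where v: "v \<in> D" "b * v = e" by (auto simp: unit_in_def)
  have "z = z * (b * v)" unfolding v(2) using sringD(4)[OF sV 0(11)] by simp
  also have "\<dots> = a * v" using 0(10) by (metis mult.assoc)
  finally have "z \<in> D" using r.D_mult ab v by simp
  then show ?case using good_refl[OF 0(1,2)] 0 by blast
qed

text \<open>Since values of \<open>V\<close> are determined by orders, a numerator over an element of order \<open>t\<close> has order
at least \<open>t\<close>.\<close>
lemma isord_frac:
  assumes "regular2 K e D x y" "coprime_fractions D" "V \<in> dominators D" "le V x y" 
    and ord: "\<And>n G. G \<in> max_power D x y n \<Longrightarrow> G \<notin> max_power D x y (Suc n) \<Longrightarrow> le V G (pw x n)"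
    and w: "w \<in> V"
  shows "\<exists>t a b. a \<in> max_power D x y t \<and> b \<in> max_power D x y t \<and> b \<notin> max_power D x y (Suc t) \<and> w * b = a"
proof -
  interpret r: regular2 K e D x y by fact
  have sV: "is_subring V" using assms(3) DomD by blast
  have wK: "w \<in> K" using sringD(4)[OF sV w] .
  obtain a b n where ab: "colength_le D a b n" "b \<noteq> 0" "w * b = a" using assms(2) wK coprime_fractions_def by blast
  then have abD: "a \<in> D" "b \<in> D" by (auto simp: colength_le_def)
  obtain t where t: "b \<in> r.I t" "b \<notin> r.I (Suc t)" using r.ex_order[OF abD(2) ab(2)] .
  have "a \<in> r.I t"
  proof (rule ccontr)
    assume "a \<notin> r.I t"
    then have "a \<noteq> 0" by auto
    then obtain s where s: "a \<in> r.I s" "a \<notin> r.I (Suc s)" using r.ex_order[OF abD(1)] by blast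
    then have st: "Suc s \<le> t" using \<open>a \<notin> r.I t\<close> r.I_antimono[of t s a] by (metis not_less_eq_eq)
    have 1: "le V (pw x t) b" using r.le_x[OF assms(3,4) t(1)] .
    have 2: "le V b a" using ab(3) w unfolding le_def by (metis mult.commute)
    have 3: "le V a (pw x s)" using ord[OF s] .
    have "le V (pw x t) (pw x s)" using le_trans[OF sV le_trans[OF sV 1 2] 3] .
    moreover have "lt V (pw x s) (pw x t)" using r.lt_x[OF assms(3,4) r.I_antimono[OF st r.I_pw_x]] .
    ultimately show False by blast
  qed
  then show ?thesis using t ab by blast
qed

text \<open>If \<open>y/x\<close> is in \<open>A\<close>, so are all fractions of forms by powers of \<open>x\<close>, and the denominators that
occur for \<open>V\<close> are units of \<open>V\<close>, hence of \<open>A\<close>.\<close>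
lemma isord_subset:
  assumes "coprime_fractions D" "V \<in> dominators D" "is_order_valuation D V" "is_subring A" "D \<subseteq> A" "A \<subseteq> V" 
    and dom: "\<And>c. c \<in> A \<Longrightarrow> unit_in V c \<Longrightarrow> unit_in A c" and incomparable_parameters: "\<not> incomparable_parameters D A"
  shows "V \<subseteq> A"
proof
  fix w assume w: "w \<in> V"
  obtain x y where xy: "regular2 K e D x y" "le V x y" 
    "\<And>n G. G \<in> max_power D x y n \<Longrightarrow> G \<notin> max_power D x y (Suc n) \<Longrightarrow> le V G (pw x n)"
    using assms(3) unfolding is_order_valuation_def by blast
  interpret r: regular2 K e D x y by fact
  have sV: "is_subring V" and vV: "val_ring V" using assms(2) DomD by blast+
  obtain v where v: "v \<in> V" "y = x * v" using xy(2) by (auto simp: le_def)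
  have vK: "v \<in> K" using sringD(4)[OF sV v(1)] .
  obtain u where u: "u \<in> A" "y = x * u \<or> x = y * u" using incomparable_parameters xy(1) unfolding incomparable_parameters_def by blast
  have "\<exists>u\<in>A. y = x * u"
  proof (cases "y = x * u")
    case True then show ?thesis using u by blast
  next
    case False
    then have xu: "x = y * u" using u by blast
    have uK: "u \<in> K" using sringD(4)[OF assms(4) u(1)] .
    have "x * e = x" by simp
    also have "\<dots> = (x * v) * u" using xu v(2) by metis
    finally have "x * (u * v) = x * e" by (simp add: mult_ac)
    then have "u * v = e" using cancel[OF r.x_K r.x_nonzero] uK vK by simp
    then have "unit_in V u" using v(1) u(1) assms(6) by (auto simp: unit_in_def)
    then obtain u' where u': "u' \<in> A" "u * u' = e" using dom[OF u(1)] by (auto simp: unit_in_def)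
    have "y = y * (u * u')" unfolding u'(2) by simp
    also have "\<dots> = x * u'" using xu by (metis mult.assoc)
    finally show ?thesis using u' by blast
  qed
  then obtain u where u: "u \<in> A" "y = x * u" by blast
  obtain t a b where ab: "a \<in> r.I t" "b \<in> r.I t" "b \<notin> r.I (Suc t)" "w * b = a"
    using isord_frac[OF xy(1) assms(1,2) xy(2,3) w] by blast
  obtain \<alpha> where \<alpha>: "\<alpha> \<in> r.fr t" "\<alpha> * pw x t = a" using r.I_eq_fr[OF ab(1)] .
  obtain \<beta> where \<beta>: "\<beta> \<in> r.fr t" "\<beta> * pw x t = b" using r.I_eq_fr[OF ab(2)] .
  have AA: "\<alpha> \<in> A" "\<beta> \<in> A" using r.fr_subset[OF assms(4,5) u] \<alpha> \<beta> by blast+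
  have wK: "w \<in> K" using sringD(4)[OF sV w] .
  have "pw x t * \<alpha> = w * b" using \<alpha>(2) ab(4) by (simp add: mult.commute)
  also have "\<dots> = pw x t * (w * \<beta>)" unfolding \<beta>(2)[symmetric] by (simp add: mult_ac)
  finally have w\<beta>: "\<alpha> = w * \<beta>" using r.pwx_cancel r.fr_K[OF \<alpha>(1)] r.fr_K[OF \<beta>(1)] wK by blast
  have "le V (pw x t * \<beta>) (pw x t * e)" using xy(3)[OF ab(2,3)] \<beta>(2) r.x_K by (simp add: mult.commute)
  then have "le V \<beta> e" using le_cancel[OF sV pw_K[OF r.x_K] pw_nonzero[OF r.x_K r.x_nonzero]] r.fr_K[OF \<beta>(1)] by blast
  then have "unit_in V \<beta>" using un_iff_le[OF sV] AA(2) assms(6) by blast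
  then obtain v where v: "v \<in> A" "\<beta> * v = e" using dom AA(2) by (auto simp: unit_in_def)
  have "w = w * (\<beta> * v)" unfolding v(2) using wK by simp
  then have "w = \<alpha> * v" unfolding w\<beta> by (simp add: mult.assoc)
  then show "w \<in> A" using sringD(8)[OF assms(4) AA(1) v(1)] by simp
qed

lemma vr_not_nq: "val_ring V \<Longrightarrow> \<not> incomparable_parameters D V"
proof
  assume V: "val_ring V" and "incomparable_parameters D V"
  then obtain x y where r: "regular2 K e D x y" and no: "\<not> (\<exists>u\<in>V. y = x * u \<or> x = y * u)" unfolding incomparable_parameters_def by blast
  interpret r: regular2 K e D x y by fact
  have "le V x y \<or> le V y x" using V by (auto simp: val_ring_def)
  then show False using no by (auto simp: le_def)
qed

text \<open>Applying \<open>reach\<close> with \<open>A = V\<close>: the parameters are always comparable in a valuation ring.\<close>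
theorem reach_finite:
  assumes "good_extension D0 D0'" "V \<in> dominators D0'" "finite S" "S \<subseteq> V"
  shows "\<exists>D'. good_extension D0' D' \<and> V \<in> dominators D' \<and> (S \<subseteq> D' \<or> is_order_valuation D' V)"
  using assms(3,4)
proof (induction S rule: finite_induct)
  case empty
  then show ?case using assms good_refl unfolding good_extension_def by blast
next
  case (insert z S)
  then obtain D' where D': "good_extension D0' D'" "V \<in> dominators D'" "S \<subseteq> D' \<or> is_order_valuation D' V" by blast
  show ?case
  proof (cases "is_order_valuation D' V")
    case True then show ?thesis using D' by blast
  next
    case False
    obtain x y where r: "regular2 K e D' x y" "coprime_fractions D'" using D'(1) good_extension_def by blast
    have vV: "val_ring V" "is_subring V" "D' \<subseteq> V" using D'(2) DomD by blast+
    have z: "z \<in> V" "z \<in> K" using insert.prems sringD(4)[OF vV(2)] by auto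
    obtain a b n where "colength_le D' a b n" "b \<noteq> 0" "z * b = a" using r(2) z(2) coprime_fractions_def by blast
    then obtain D'' where D'': "good_extension D' D''" "V \<in> dominators D''" "z \<in> D'' \<or> is_order_valuation D'' V"
      using reach[OF r D'(2) vV(2,3) subset_refl _ _ _ _ z(1)] vr_not_nq[OF vV(1)] by blast
    moreover have "D' \<subseteq> D''" using D''(1) good_extension_def by blast
    ultimately show ?thesis using good_trans[OF D'(1) D''(1)] D'(3) False by blast
  qed
qed

end

context regular2 begin

text \<open>All forms have the expected value in the order valuation \<open>V\<close>, so there is no quadratic transform along
it; it is approximated by a composite valuation ring \<open>V'\<close> contained in it, along which there is one. The
residues of polynomials in \<open>y/x\<close> form a polynomial ring, and a point of this line avoiding the poles of
the finitely many elements of \<open>S\<close> is a zero of \<open>h = 1 + (y/x) * \<beta>\<close>, where \<open>\<beta>\<close> is a common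
denominator: \<open>\<beta>\<close> is a unit wherever \<open>h\<close> vanishes. The quadratic transform along \<open>V'\<close> then contains \<open>S\<close>, and \<open>sep_base\<close> applies.\<close>
lemma near_order_valuation:
  assumes coprime_fractions: "coprime_fractions D" and V: "V \<in> dominators D" "le V x y" 
    and ord: "\<And>n G. G \<in> I n \<Longrightarrow> G \<notin> I (Suc n) \<Longrightarrow> le V G (pw x n)"
    and S: "finite S" "S \<subseteq> V"
  shows "\<exists>V'\<in>dominators D. V' \<subseteq> V \<and> nonunits_of V \<subseteq> nonunits_of V' \<and> pole_within D V' {U. S \<subseteq> U \<and> S \<inter> nonunits_of V \<subseteq> nonunits_of U}"
proof -
  note vV = DomD(1)[OF V(1)] and sV = DomD(2)[OF V(1)]
  obtain u where u: "u \<in> V" "y = x * u" using V(2) by (auto simp: le_def)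
  have uK: "u \<in> K" using sringD(4)[OF sV u(1)] .
  have u1: "u \<in> fr 1" using uK I_y[of e 0] u(2) by (intro frI) (auto simp: mult.commute)
  have frV: "fr n \<subseteq> V" for n using fr_subset[OF sV DomD(3)[OF V(1)] u] by blast
  have "\<exists>N B. B \<in> I N \<and> B \<notin> I (Suc N) \<and> (\<forall>z\<in>S. \<exists>t a b c m. a \<in> I t \<and> b \<in> I t \<and> z * b = a \<and> c \<in> I m \<and> B = b * c \<and> N = t + m)"
    using S
  proof (induction S rule: finite_induct)
    case empty
    then show ?case using nonunit un_e[OF is_subring] D_e by (intro exI[of _ 0] exI[of _ e]) auto
  next
    case (insert z S)
    then obtain N B where NB: "B \<in> I N" "B \<notin> I (Suc N)" 
      "\<And>z. z \<in> S \<Longrightarrow> \<exists>t a b c m. a \<in> I t \<and> b \<in> I t \<and> z * b = a \<and> c \<in> I m \<and> B = b * c \<and> N = t + m" by blast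
    obtain t a b where b: "a \<in> I t" "b \<in> I t" "b \<notin> I (Suc t)" "z * b = a"
      using isord_frac[OF regular2_axioms coprime_fractions V ord, of z] insert.prems by blast
    have 1: "b * B \<in> I (t + N)" "b * B \<notin> I (Suc (t + N))" using I_mult2[OF b(2) NB(1)] gr[OF b(2,3) NB(1,2)] .
    have "\<exists>t' a' b' c m. a' \<in> I t' \<and> b' \<in> I t' \<and> w * b' = a' \<and> c \<in> I m \<and> b * B = b' * c \<and> t + N = t' + m" 
      if w: "w \<in> insert z S" for w
    proof (cases "w = z")
      case True then show ?thesis using b NB(1) by blast
    next
      case False
      then obtain t' a' b' c m where *: "a' \<in> I t'" "b' \<in> I t'" "w * b' = a'" "c \<in> I m" "B = b' * c" "N = t' + m"
        using NB(3) w by blast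
      have "b * B = b' * (b * c)" "t + N = t' + (t + m)" using * by (simp_all add: mult_ac)
      then show ?thesis using * I_mult2[OF b(2) *(4)] by blast
    qed
    then show ?case using 1 by blast
  qed
  then obtain N B where NB: "B \<in> I N" "B \<notin> I (Suc N)" 
      "\<And>z. z \<in> S \<Longrightarrow> \<exists>t a b c m. a \<in> I t \<and> b \<in> I t \<and> z * b = a \<and> c \<in> I m \<and> B = b * c \<and> N = t + m" by blast
  obtain \<beta> where \<beta>: "\<beta> \<in> fr N" "\<beta> * pw x N = B" using I_eq_fr[OF NB(1)] .
  define h where "h = e + u * \<beta>"
  define s where "s = Suc N"
  have efr: "e \<in> fr n" for n using I_pw_x by (intro frI) auto
  have hfr: "h \<in> fr s" unfolding h_def s_def using fr_add[OF efr fr_mult[OF u1 \<beta>(1)]] by simp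
  have hK: "h \<in> K" using fr_K[OF hfr] .
  define q where "q = pw x s + y * B"
  have "(e + u * \<beta>) * pw x s = pw x s + (x * u) * (\<beta> * pw x N)"
    unfolding distrib_right e_mult[OF pw_K[OF x_K]] unfolding s_def by (simp add: mult_ac)
  then have hq: "h * pw x s = q" unfolding h_def q_def \<beta>(2) u(2) .
  have qI: "q \<in> I s" using fr_I[OF hfr] hq by simp
  have qnI: "q \<notin> I (Suc s)" using ny[of "- B" s] D_uminus[OF I_D[OF NB(1)]] unfolding q_def by simp
  \<comment> \<open>The elements of \<open>V\<close> whose residue is a polynomial in the residue of \<open>y/x\<close>.\<close>
  define C where "C = {z \<in> K. \<exists>n. \<exists>p\<in>fr n. z - p \<in> nonunits_of V}"
  have CI: "z \<in> C" if "p \<in> fr n" "z - p \<in> nonunits_of V" "z \<in> K" for z p n using that C_def by blast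
  have mxK: "m \<in> K" if "m \<in> nonunits_of V" for m using that sringD(4)[OF sV] by (simp add: nonunits_of_def)
  have CV: "C \<subseteq> V"
  proof
    fix z assume "z \<in> C"
    then obtain n p where p: "p \<in> fr n" "z - p \<in> nonunits_of V" by (auto simp: C_def)
    then have "(z - p) + p \<in> V" using sringD(6)[OF sV mx_mem] frV by blast
    then show "z \<in> V" by simp
  qed
  have frC: "p \<in> C" if "p \<in> fr n" for p n using CI[OF that] zero_mx[OF sV] fr_K[OF that] by simp
  have mxC: "m \<in> C" if "m \<in> nonunits_of V" for m using CI[OF fr_zero, of m] that mxK by simp
  have addm: "a + b \<in> nonunits_of V" if "a \<in> nonunits_of V" "b \<in> nonunits_of V" for a b using mx_add_vr[OF vV that] .
  have negm: "- a \<in> nonunits_of V" if "a \<in> nonunits_of V" for a 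
    using mx_mult'[OF sV that sringD(5)[OF sV sringD(2)[OF sV]]] mxK[OF that] by simp
  have sC: "is_subring C" unfolding is_subring_def
  proof (intro conjI ballI)
    show "C \<subseteq> K" by (auto simp: C_def)
    show "e \<in> C" using frC efr by blast
    fix z w assume zC: "z \<in> C" and wC: "w \<in> C"
    then obtain n p n' p' where p: "p \<in> fr n" "z - p \<in> nonunits_of V" "z \<in> K" and p': "p' \<in> fr n'" "w - p' \<in> nonunits_of V" "w \<in> K" 
      unfolding C_def by blast
    have mono: "p \<in> fr (n + n')" "p' \<in> fr (n + n')" using fr_mono[OF _ p(1)] fr_mono[OF _ p'(1)] by auto
    have "(z - w) - (p - p') = (z - p) + - (w - p')" by simp
    also have "\<dots> \<in> nonunits_of V" using addm[OF p(2) negm[OF p'(2)]] .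
    finally show "z - w \<in> C" using CI[of "p - p'" "n + n'" "z - w"] fr_add[OF mono(1) fr_uminus[OF mono(2)]] p(3) p'(3) by simp
    have "z * w - p * p' = z * (w - p') + p' * (z - p)" by (simp add: algebra_simps)
    also have "\<dots> \<in> nonunits_of V" using addm mx_mult'[OF sV] p p' CV zC frV by blast
    finally show "z * w \<in> C" using CI[OF fr_mult[OF p(1) p'(1)]] p(3) p'(3) by simp
  qed
  define J where "J = {h * c + m | c m. c \<in> C \<and> m \<in> nonunits_of V}"
  have JI: "h * c + m \<in> J" if "c \<in> C" "m \<in> nonunits_of V" for c m using that J_def by blast
  have hC: "h \<in> C" using frC hfr by blast
  have idlJ: "ideal_in C J" unfolding ideal_in_def
  proof (intro conjI ballI)
    show "J \<subseteq> C" unfolding J_def using sringD(6)[OF sC] sringD(8)[OF sC hC] mxC by blast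
    show "0 \<in> J" using JI[OF sringD(3)[OF sC] zero_mx[OF sV]] by simp
    show "a + b \<in> J" if ab: "a \<in> J" "b \<in> J" for a b
    proof -
      obtain c m c' m' where *: "c \<in> C" "m \<in> nonunits_of V" "a = h * c + m" "c' \<in> C" "m' \<in> nonunits_of V" "b = h * c' + m'"
        using ab unfolding J_def by blast
      have "a + b = h * (c + c') + (m + m')" unfolding * by (simp add: algebra_simps)
      then show ?thesis using JI[OF sringD(6)[OF sC *(1,4)] addm[OF *(2,5)]] by simp
    qed
    show "d * a \<in> J" if a: "a \<in> J" "d \<in> C" for a d
    proof -
      obtain c m where *: "c \<in> C" "m \<in> nonunits_of V" "a = h * c + m" using a(1) unfolding J_def by blast
      have "d * a = h * (d * c) + d * m" unfolding * by (simp add: algebra_simps)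
      then show ?thesis using JI[OF sringD(8)[OF sC a(2) *(1)] mx_mult'[OF sV *(2)]] a(2) CV by auto
    qed
  qed
  \<comment> \<open>If \<open>h\<close> were invertible modulo the nonunits of \<open>V\<close>, its form \<open>q\<close> would divide a power
    of \<open>x\<close> in the graded ring and hence be a multiple of \<open>x^s\<close>, but \<open>y * B\<close> prevents this.\<close>
  have "e \<notin> J"
  proof
    assume "e \<in> J"
    then obtain c m where cm: "c \<in> C" "m \<in> nonunits_of V" "e = h * c + m" unfolding J_def by blast
    then obtain t p where p: "p \<in> fr t" "c - p \<in> nonunits_of V" unfolding C_def by blast
    have hV: "h \<in> V" using hC CV by blast
    have "e - h * p = h * (c - p) + m" using cm(3) by (simp add: algebra_simps)
    then have em: "e - h * p \<in> nonunits_of V" using addm[OF mx_mult'[OF sV p(2) hV] cm(2)] by simp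
    define P where "P = p * pw x t"
    have PI: "P \<in> I t" using fr_I[OF p(1)] P_def by simp
    have "lt V e (e - h * p)" using em mx_iff_lt[OF vV mxK[OF em]] by blast
    then have "lt V (e * pw x (s + t)) ((e - h * p) * pw x (s + t))"
      by (rule lt_mult[OF vV e_K mxK[OF em] pw_K[OF x_K] pw_K[OF x_K] _ le_refl[OF sV pw_K[OF x_K]] pw_nonzero[OF x_K x_nonzero]])
    moreover have "(e - h * p) * pw x (s + t) = pw x (s + t) - (h * pw x s) * P"
      unfolding P_def left_diff_distrib e_mult[OF pw_K[OF x_K]] by (simp add: pw_add mult_ac)
    ultimately have lt: "lt V (pw x (s + t)) (pw x (s + t) - q * P)" unfolding hq by simp
    have "pw x (s + t) - q * P \<in> I (s + t)" using I_diff[OF I_pw_x I_mult2[OF qI PI]] .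
    then have "pw x (s + t) - q * P \<in> I (Suc (s + t))" using ord lt by blast
    then obtain c where c: "c \<in> D" "q - c * pw x s \<in> I (Suc s)" using dvd_pw_x[OF qI PI] by blast
    have eq: "q - c * pw x s = y * B + (e - c) * pw x s" unfolding q_def left_diff_distrib e_mult[OF pw_K[OF x_K]] by simp
    have ecD: "e - c \<in> D" using D_diff c by simp
    show False
    proof (cases "unit_in D (e - c)")
      case True
      then obtain v where v: "v \<in> D" "(e - c) * v = e" by (auto simp: unit_in_def)
      have "(y * B + (e - c) * pw x s) * v = ((e - c) * v) * pw x s - y * (- (B * v))" 
        unfolding distrib_right by (simp add: mult_ac)
      then have "pw x s - y * (- (B * v)) \<in> I (Suc s)" using I_mult'[OF c(2) v(1)] unfolding eq v(2) by simp
      then show False using ny D_uminus[OF D_mult[OF I_D[OF NB(1)] v(1)]] by blast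
    next
      case False
      then have "e - c \<in> I 1" using loc ecD by blast
      then have "(e - c) * pw x s \<in> I (Suc s)" using I_mult2[OF _ I_pw_x, of "e - c" 1 s] by simp
      then have "(q - c * pw x s) - (e - c) * pw x s \<in> I (Suc s)" using I_diff[OF c(2)] by blast
      then have "y * B \<in> I (Suc s)" unfolding eq by simp
      then show False using y_cancel[OF I_D[OF NB(1)]] NB(2) s_def by blast
    qed
  qed
  then have "e \<notin> gen_ideal C J" using gi_idl[OF idlJ] by blast
  then obtain V' where V': "val_ring V'" "C \<subseteq> V'" "J \<subseteq> nonunits_of V'" using ex_dominating[OF sC idlD(1)[OF idlJ]] by blast
  have sV': "is_subring V'" using V' by simp
  have hJ: "h \<in> J" using JI[OF sringD(2)[OF sC] zero_mx[OF sV]] hK by simp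
  have mV: "nonunits_of V \<subseteq> nonunits_of V'"
  proof
    fix m assume m: "m \<in> nonunits_of V"
    then have "m \<in> J" using JI[OF sringD(3)[OF sC] m] by simp
    then show "m \<in> nonunits_of V'" using V' by blast
  qed
  have V'V: "V' \<subseteq> V"
  proof
    fix z assume z: "z \<in> V'"
    have zK: "z \<in> K" using sringD(4)[OF sV' z] .
    show "z \<in> V"
    proof (rule ccontr)
      assume "z \<notin> V"
      then have "lt V z e" using mem_iff_le[OF sV] by blast
      then have "le V z e" using lt_imp_le[OF vV zK e_K] mem_iff_le[OF sV] \<open>z \<notin> V\<close> vV zK by (auto simp: val_ring_def)
      then obtain w where w: "w \<in> V" "e = z * w" by (auto simp: le_def)
      have "w \<in> nonunits_of V"
      proof (rule ccontr)
        assume "w \<notin> nonunits_of V"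
        then obtain w' where w': "w' \<in> V" "w * w' = e" using w(1) by (auto simp: nonunits_of_def unit_in_def)
        have "z = z * (w * w')" unfolding w'(2) using zK by simp
        also have "\<dots> = (z * w) * w'" by (simp only: mult_ac)
        also have "\<dots> = w'" unfolding w(2)[symmetric] using sringD(4)[OF sV w'(1)] by simp
        finally show False using w' \<open>z \<notin> V\<close> by simp
      qed
      then have w': "w \<in> nonunits_of V'" using mV by blast
      have "w * z = e" using w(2) by (metis mult.commute)
      then have "unit_in V' w" using z mx_mem[OF w'] unfolding unit_in_def by blast
      then show False using w' by (simp add: nonunits_of_def)
    qed
  qed
  have DC: "D \<subseteq> C"
  proof
    fix d assume "d \<in> D"
    then have "d \<in> fr 0" using D_K by (auto simp: fr_def)
    then show "d \<in> C" using frC by blast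
  qed
  have V'D: "V' \<in> dominators D" unfolding dominators_def using V'(1,2) DC mV DomD(4)[OF V(1)] by blast
  have uV': "u \<in> V'" using frC[OF u1] V'(2) by blast
  have xy': "le V' x y" using uV' u(2) by (auto simp: le_def)
  have hlt: "lt V' e h" using mx_iff_lt[OF V'(1) hK] hJ V'(3) by blast
  have "lt V' (e * pw x s) (h * pw x s)"
    by (rule lt_mult[OF V'(1) e_K hK pw_K[OF x_K] pw_K[OF x_K] hlt le_refl[OF sV' pw_K[OF x_K]] pw_nonzero[OF x_K x_nonzero]])
  then have qlt: "lt V' (pw x s) q" unfolding hq by simp
  obtain k G where "quadratic K e D x y V' k G" using ex_quad[OF V'D xy' qI qnI qlt] by blast
  then interpret q: quadratic K e D x y V' k G .
  have \<beta>V': "\<beta> \<in> V'" using frC[OF \<beta>(1)] V'(2) by blast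
  have "unit_in V' (u * \<beta>)"
  proof (rule ccontr)
    assume "\<not> unit_in V' (u * \<beta>)"
    then have "u * \<beta> \<in> nonunits_of V'" using sringD(8)[OF sV' uV' \<beta>V'] by (simp add: nonunits_of_def)
    moreover have "h \<in> nonunits_of V'" using hJ V' by blast
    moreover have "- e \<in> V'" using sringD(2,5)[OF sV'] by blast
    ultimately have "h + - e * (u * \<beta>) \<in> nonunits_of V'" using mx_add_vr[OF V'(1)] mx_mult'[OF sV'] by blast
    moreover have "- e * (u * \<beta>) = - (u * \<beta>)" using uK fr_K[OF \<beta>(1)] by simp
    ultimately have "e \<in> nonunits_of V'" unfolding h_def by simp
    then show False using un_e[OF sV'] by (simp add: nonunits_of_def)
  qed
  then have \<beta>unit_in: "unit_in V' \<beta>" using un_multD(2)[OF sV' _ uV' \<beta>V'] by blast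
  have SD1: "z \<in> q.D1" if z: "z \<in> S" for z
  proof -
    obtain t a b c m where *: "a \<in> I t" "b \<in> I t" "z * b = a" "c \<in> I m" "B = b * c" "N = t + m" using NB(3)[OF z] by blast
    obtain b1 where b1: "b1 \<in> fr t" "b1 * pw x t = b" using I_eq_fr[OF *(2)] .
    obtain c1 where c1: "c1 \<in> fr m" "c1 * pw x m = c" using I_eq_fr[OF *(4)] .
    have "pw x N * \<beta> = pw x N * (b1 * c1)" 
    proof -
      have "pw x N * (b1 * c1) = (b1 * pw x t) * (c1 * pw x m)" unfolding *(6) by (simp add: pw_add mult_ac)
      then show ?thesis unfolding b1(2) c1(2) *(5)[symmetric] \<beta>(2)[symmetric] by (simp add: mult.commute)
    qed
    then have "\<beta> = b1 * c1" using pwx_cancel fr_K[OF \<beta>(1)] fr_K[OF b1(1)] fr_K[OF c1(1)] by (metis mult_K)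
    then have "unit_in V' b1" using un_multD(1)[OF sV' _] \<beta>unit_in frC[OF b1(1)] frC[OF c1(1)] V'(2) by blast
    then have "le V' b1 e" using un_iff_le[OF sV'] by (auto simp: unit_in_def)
    then have "le V' (b1 * pw x t) (e * pw x t)" by (rule le_mult_same[OF sV' pw_K[OF x_K]])
    then have "le V' b (pw x t)" unfolding b1(2) by simp
    then show ?thesis using q.D1I[OF _ *(1,2) _ *(3)] sringD(4)[OF sV] S(2) z by blast
  qed
  have "dominators q.D1 \<subseteq> {U. S \<subseteq> U \<and> S \<inter> nonunits_of V \<subseteq> nonunits_of U}"
  proof
    fix U assume U: "U \<in> dominators q.D1"
    have "z \<in> nonunits_of U" if "z \<in> S" "z \<in> nonunits_of V" for z
    proof -
      have "\<not> unit_in V' z" using mV that(2) by (auto simp: nonunits_of_def)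
      then have "z \<in> nonunits_of q.D1" using SD1[OF that(1)] q.D1_subset[OF q.V_Q] by (auto simp: nonunits_of_def unit_in_def)
      then show ?thesis using DomD(6)[OF U] by blast
    qed
    then show "U \<in> {U. S \<subseteq> U \<and> S \<inter> nonunits_of V \<subseteq> nonunits_of U}" using SD1 DomD(5)[OF U] by blast
  qed
  then have "pole_within D V' {U. S \<subseteq> U \<and> S \<inter> nonunits_of V \<subseteq> nonunits_of U}" using q.sep_base q.V_Q q.Dom_D1 by blast
  then show ?thesis using V'D V'V mV by blast
qed

end

section \<open>Density of representations\<close>

context field_in_ring begin

text \<open>Let \<open>W\<close> be the set of all \<open>U\<close> satisfying the two conditions, and suppose that it contains no member of the
family. Then \<open>A\<close> is not a valuation ring, \<open>D\<close> is dominated by \<open>A\<close>, and following the transforms of \<open>D\<close> along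
\<open>V\<close> one reaches \<open>D'\<close> whose parameters are incomparable in \<open>A\<close>, whence \<open>A = D' + m_A\<close>. From there the
transforms along \<open>V\<close> either reach a ring containing \<open>S\<close>, all of whose dominating rings are in \<open>W\<close>,
or turn \<open>V\<close> into an order valuation, which is replaced by a nearby \<open>V'\<close>; by the decomposition of \<open>A\<close>,
\<open>V'\<close> still dominates \<open>A\<close>. In both cases there is a fraction outside a ring dominating \<open>A\<close>
whose poles are confined to \<open>W\<close>. It is in all members of the family and therefore in \<open>A\<close>, a
contradiction.\<close>
theorem density:
  assumes regular2: "regular2 K e D x y" and coprime_fractions: "coprime_fractions D" and A: "is_local A" "D \<subseteq> A" 
    and Z: "\<V> \<subseteq> dominators A" "\<V> \<noteq> {}" "A = \<Inter>\<V>" and V: "V \<in> dominators A" and S: "finite S" "S \<subseteq> V"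
  shows "\<exists>U\<in>\<V>. S \<subseteq> U \<and> S \<inter> nonunits_of V \<subseteq> nonunits_of U"
proof (rule ccontr)
  define W where "W = {U. S \<subseteq> U \<and> S \<inter> nonunits_of V \<subseteq> nonunits_of U}"
  assume "\<not> ?thesis"
  then have ZW: "U \<notin> W" if "U \<in> \<V>" for U using that W_def by blast
  have sA: "is_subring A" using A by (simp add: is_local_def)
  interpret r: regular2 K e D x y by fact
  have unA: "unit_in A c" if "c \<in> A" "unit_in V c" for c using Dom_un[OF sA V that] .
  have self: "U = A" if "val_ring A" "U \<in> dominators A" for U
  proof
    show "A \<subseteq> U" using that DomD by blast
    show "U \<subseteq> A"
    proof
      fix z assume z: "z \<in> U"
      have sU: "is_subring U" using that DomD by blast
      have zK: "z \<in> K" using z sringD(4)[OF sU] by blast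
      show "z \<in> A"
      proof (rule ccontr)
        assume "z \<notin> A"
        then have "le A z e" using that(1) zK mem_iff_le[OF sA] by (auto simp: val_ring_def)
        then obtain w where w: "w \<in> A" "e = z * w" by (auto simp: le_def)
        then have "w * z = e" "w \<in> U" using DomD(5)[OF that(2)] by (metis mult.commute)+
        then have "unit_in U w" using z unfolding unit_in_def by blast
        then have "unit_in A w" using Dom_un[OF sA that(2) w(1)] by blast
        then obtain w' where w': "w' \<in> A" "w * w' = e" by (auto simp: unit_in_def)
        have "z = z * (w * w')" unfolding w'(2) using zK by simp
        also have "\<dots> = (z * w) * w'" by (simp only: mult_ac)
        also have "\<dots> = w'" unfolding w(2)[symmetric] using sringD(4)[OF sA w'(1)] by simp
        finally show False using w' \<open>z \<notin> A\<close> by simp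
      qed
    qed
  qed
  have VW: "V \<in> W" using S W_def by blast
  have notvr: "\<not> val_ring A"
  proof
    assume "val_ring A"
    then have "V \<in> \<V>" using self V Z by blast
    then show False using ZW VW by blast
  qed
  have dom: "nonunits_of D \<subseteq> nonunits_of A"
  proof (rule ccontr)
    assume "\<not> ?thesis"
    then obtain c where c: "c \<in> nonunits_of D" "unit_in A c" using A(2) by (auto simp: nonunits_of_def)
    \<comment> \<open>A unit \<open>c\<close> of \<open>A\<close> that is a nonunit of \<open>D\<close> has a power in the ideal of any pair of finite
      colength, so that numerator or denominator of every fraction is a unit of \<open>A\<close>.\<close>
    have "val_ring A" unfolding val_ring_def
    proof (intro conjI ballI)
      fix a b assume ab: "a \<in> K" "b \<in> K"
      show "le A a b \<or> le A b a"
      proof (cases "a = 0")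
        case True then show ?thesis using le_zero[OF sA] by blast
      next
        case False
        obtain z where z: "z \<in> K" "z * a = b" using ex_quot[OF ab(2,1) False] by blast
        obtain p q n where pq: "colength_le D p q n" "q \<noteq> 0" "z * q = p" using coprime_fractions z(1) coprime_fractions_def by blast
        then obtain k s t where kst: "p \<in> D" "q \<in> D" "s \<in> D" "t \<in> D" "pw c k = p * s + q * t" using c(1) unfolding colength_le_def by blast
        have "unit_in A (pw c k)" by (induction k) (use c(2) un_e[OF sA] un_mult[OF sA] in auto)
        then have "\<not> (p * s \<in> nonunits_of A \<and> q * t \<in> nonunits_of A)" using A(1) kst(5) by (auto simp: is_local_def nonunits_of_def)
        moreover have "p \<in> A" "q \<in> A" "s \<in> A" "t \<in> A" using kst A(2) by auto
        ultimately have "unit_in A p \<or> unit_in A q" using un_multD(1)[OF sA] sringD(8)[OF sA] by (auto simp: nonunits_of_def)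
        then show ?thesis
        proof
          assume "unit_in A p"
          then obtain v where v: "v \<in> A" "p * v = e" by (auto simp: unit_in_def)
          have "a = a * (p * v)" unfolding v(2) using ab by simp
          also have "\<dots> = (z * a) * (q * v)" unfolding pq(3)[symmetric] by (simp only: mult_ac)
          finally show ?thesis using z(2) sringD(8)[OF sA \<open>q \<in> A\<close> v(1)] unfolding le_def by blast
        next
          assume "unit_in A q"
          then obtain v where v: "v \<in> A" "q * v = e" by (auto simp: unit_in_def)
          have "b = (z * a) * (q * v)" unfolding v(2) z(2) using ab by simp
          also have "\<dots> = a * ((z * q) * v)" by (simp only: mult_ac)
          finally show ?thesis using sringD(8)[OF sA \<open>p \<in> A\<close> v(1)] unfolding pq(3) le_def by blast
        qed
      qed
    qed (rule sA)
    then show False using notvr by blast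
  qed
  have DomAD: "dominators A \<subseteq> dominators D" unfolding dominators_def using A(2) dom by blast
  have VD: "V \<in> dominators D" using V DomAD by blast
  have AV: "A \<subseteq> V" using V DomD by blast
  have "\<not> V \<subseteq> A"
  proof
    assume "V \<subseteq> A"
    then have "A = V" using AV by blast
    then show False using notvr DomD(1)[OF V] by simp
  qed
  then obtain z where z: "z \<in> V" "z \<notin> A" by blast
  have zK: "z \<in> K" using z sringD(4) DomD(2)[OF V] by blast
  obtain a b n where ab: "colength_le D a b n" "b \<noteq> 0" "z * b = a" using coprime_fractions zK coprime_fractions_def by blast
  obtain D' where D': "good_extension D D'" "V \<in> dominators D'" "D' \<subseteq> A" "z \<in> D' \<or> is_order_valuation D' V \<or> incomparable_parameters D' A"
    using reach[OF regular2 coprime_fractions VD sA A(2) AV unA ab z(1)] by blast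
  have fD': "coprime_fractions D'" using D'(1) good_extension_def by blast
  have "incomparable_parameters D' A"
  proof (rule ccontr)
    assume incomparable_parameters: "\<not> incomparable_parameters D' A"
    then have "is_order_valuation D' V" using D' z by blast
    then have "V \<subseteq> A" using isord_subset[OF fD' D'(2) _ sA D'(3) AV unA incomparable_parameters] by blast
    then show False using z by blast
  qed
  then obtain x' y' where r': "regular2 K e D' x' y'" and no: "\<not> (\<exists>u\<in>A. y' = x' * u \<or> x' = y' * u)" unfolding incomparable_parameters_def by blast
  interpret r': regular2 K e D' x' y' by fact
  have domD': "nonunits_of D' \<subseteq> nonunits_of A"
  proof
    fix m assume m: "m \<in> nonunits_of D'"
    then have "m \<in> nonunits_of V" using DomD(6)[OF D'(2)] by blast
    then show "m \<in> nonunits_of A" using m D'(3) AV by (auto simp: nonunits_of_def unit_in_def)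
  qed
  have AD': "\<exists>d\<in>D'. \<alpha> - d \<in> nonunits_of A" if \<alpha>: "\<alpha> \<in> A" for \<alpha>
  proof -
    obtain a b n where ab: "colength_le D' a b n" "b \<noteq> 0" "\<alpha> * b = a" using fD' sringD(4)[OF sA \<alpha>] coprime_fractions_def by blast
    then have "a \<in> D'" "b \<in> D'" by (auto simp: colength_le_def)
    then show ?thesis using r'.residue_trivial[OF sA D'(3) Z domD' no \<alpha> _ _ ab(2,3)] by blast
  qed
  have "\<exists>V'\<in>dominators A. pole_within D V' W"
  proof -
    obtain D2 where D2: "good_extension D' D2" "V \<in> dominators D2" "S \<subseteq> D2 \<or> is_order_valuation D2 V"
      using reach_finite[OF D'(1,2) S] by blast
    have gD2: "good_extension D D2" using good_trans[OF D'(1) D2(1)] .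
    obtain x2 y2 where r2: "regular2 K e D2 x2 y2" and fD2: "coprime_fractions D2" using D2(1) good_extension_def by blast
    show ?thesis
    proof (cases "is_order_valuation D2 V")
      case False
      then have SD2: "S \<subseteq> D2" using D2 by blast
      have "dominators D2 \<subseteq> W"
      proof
        fix U assume U: "U \<in> dominators D2"
        have "w \<in> nonunits_of U" if "w \<in> S" "w \<in> nonunits_of V" for w
        proof -
          have "w \<in> nonunits_of D2" using that SD2 DomD(3)[OF D2(2)] by (auto simp: nonunits_of_def unit_in_def)
          then show ?thesis using DomD(6)[OF U] by blast
        qed
        then show "U \<in> W" using SD2 DomD(3)[OF U] W_def by blast
      qed
      moreover obtain D3 where "good_extension D2 D3" "V \<in> dominators D3" "\<And>W. dominators D3 \<subseteq> W \<Longrightarrow> pole_within D2 V W"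
        by (rule quadratic_transform[OF r2 fD2 D2(2) False]) blast
      moreover have "dominators D3 \<subseteq> dominators D2" using calculation good_extension_def by blast
      ultimately have "pole_within D2 V W" by blast
      then show ?thesis using gD2 D2(2) V unfolding good_extension_def by blast
    next
      case True
      then obtain x3 y3 where r3: "regular2 K e D2 x3 y3" "le V x3 y3" 
        "\<And>n G. G \<in> max_power D2 x3 y3 n \<Longrightarrow> G \<notin> max_power D2 x3 y3 (Suc n) \<Longrightarrow> le V G (pw x3 n)"
        unfolding is_order_valuation_def by blast
      obtain V' where V': "V' \<in> dominators D2" "V' \<subseteq> V" "nonunits_of V \<subseteq> nonunits_of V'" "pole_within D2 V' W"
        using regular2.near_order_valuation[OF r3(1) fD2 D2(2) r3(2,3) S] unfolding W_def by blast
      have "A \<subseteq> V'"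
      proof
        fix \<alpha> assume \<alpha>: "\<alpha> \<in> A"
        then obtain d where d: "d \<in> D'" "\<alpha> - d \<in> nonunits_of A" using AD' by blast
        have "d \<in> V'" using d(1) D2(1) DomD(3)[OF V'(1)] unfolding good_extension_def by blast
        moreover have "\<alpha> - d \<in> V'" using d(2) DomD(6)[OF V] V'(3) mx_mem by blast
        ultimately have "(\<alpha> - d) + d \<in> V'" using sringD(6)[OF DomD(2)[OF V'(1)]] by blast
        then show "\<alpha> \<in> V'" by simp
      qed
      then have "V' \<in> dominators A" unfolding dominators_def using DomD(1)[OF V'(1)] DomD(4)[OF V] V'(3) by blast
      moreover have "pole_within D V' W" using gD2 V'(1,4) unfolding good_extension_def by blast
      ultimately show ?thesis by blast
    qed
  qed
  then obtain V' p q where V': "V' \<in> dominators A" "p \<in> D" "q \<in> D" "lt V' q p" 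
    "\<And>U. U \<in> dominators D - W \<Longrightarrow> le U p q" unfolding pole_within_def by blast
  have le: "le U p q" if "U \<in> \<V>" for U using V'(5) Z(1) that DomAD ZW by blast
  have K: "p \<in> K" "q \<in> K" using V'(2,3) r.D_K by auto
  have p0: "p \<noteq> 0"
  proof
    assume "p = 0"
    then have "q = 0" using le Z(2) by (auto simp: le_def)
    then show False using V'(4) le_zero[OF DomD(2)[OF V'(1)]] by blast
  qed
  obtain f where f: "f \<in> K" "f * p = q" using ex_quot[OF K(2,1) p0] by blast
  have "f \<in> U" if U: "U \<in> \<V>" for U
  proof -
    obtain v where v: "v \<in> U" "q = p * v" using le[OF U] by (auto simp: le_def)
    have "v \<in> K" using v(1) U Z(1) sringD(4) DomD(2) by blast
    moreover have "p * f = p * v" using f(2) v(2) by (simp add: mult.commute)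
    ultimately have "f = v" using cancel[OF K(1) p0 f(1)] by blast
    then show ?thesis using v by simp
  qed
  then have "f \<in> V'" using Z(3) DomD(3)[OF V'(1)] by blast
  then have "le V' p q" using f(2) unfolding le_def by (metis mult.commute)
  then show False using V'(4) by blast
qed

end

section \<open>Two-dimensional Noetherian local rings\<close>

context field_in_ring begin

text \<open>The maximal condition on ideals, the form in which the Noetherian property is applied below.\<close>
definition ideals_noetherian :: "'r set \<Rightarrow> bool" where
  "ideals_noetherian D \<longleftrightarrow> (\<forall>\<F>. \<F> \<noteq> {} \<longrightarrow> (\<forall>E\<in>\<F>. ideal_in D E) \<longrightarrow> (\<exists>M\<in>\<F>. (\<forall>E\<in>\<F>. M \<subseteq> E \<longrightarrow> E = M)))"

text \<open>The length of \<open>D/J\<close> is at most \<open>n\<close>.\<close>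
definition chain_bound :: "'r set \<Rightarrow> 'r set \<Rightarrow> nat \<Rightarrow> bool" where
  "chain_bound D J n \<longleftrightarrow> (\<forall>C l. (\<forall>i\<le>l. ideal_in D (C i) \<and> J \<subseteq> C i) \<longrightarrow> (\<forall>i<l. C i \<subset> C (Suc i)) \<longrightarrow> l \<le> n)"

definition add_generator :: "'r set \<Rightarrow> 'r set \<Rightarrow> 'r \<Rightarrow> 'r set" where
  "add_generator D E a = {b + a * d | b d. b \<in> E \<and> d \<in> D}"

lemma isumI: "b \<in> E \<Longrightarrow> d \<in> D \<Longrightarrow> b + a * d \<in> add_generator D E a"
  by (auto simp: add_generator_def)

lemma isumE: assumes "c \<in> add_generator D E a" obtains b d where "b \<in> E" "d \<in> D" "c = b + a * d"
  using assms by (auto simp: add_generator_def)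

lemma idl_isum:
  assumes D: "is_subring D" and E: "ideal_in D E" and a: "a \<in> D"
  shows "ideal_in D (add_generator D E a)" "E \<subseteq> add_generator D E a" "a \<in> add_generator D E a"
proof -
  show "E \<subseteq> add_generator D E a"
  proof
    fix b assume "b \<in> E" then show "b \<in> add_generator D E a" using isumI[of b E 0 D a] sringD(3)[OF D] by simp
  qed
  show "a \<in> add_generator D E a" using isumI[OF idlD(2)[OF E] sringD(2)[OF D], of a] sringD(4)[OF D a] by simp
  show "ideal_in D (add_generator D E a)" unfolding ideal_in_def
  proof (intro conjI ballI)
    show "add_generator D E a \<subseteq> D" 
      using sringD(6)[OF D] idlD(6)[OF E] sringD(8)[OF D a] by (auto simp: add_generator_def)
    show "0 \<in> add_generator D E a" using isumI[OF idlD(2)[OF E] sringD(3)[OF D], of a] by simp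
    show "c + c' \<in> add_generator D E a" if c: "c \<in> add_generator D E a" "c' \<in> add_generator D E a" for c c'
    proof -
      obtain b d b' d' where *: "b \<in> E" "d \<in> D" "c = b + a * d" "b' \<in> E" "d' \<in> D" "c' = b' + a * d'"
        using c by (metis isumE)
      have "c + c' = (b + b') + a * (d + d')" unfolding * by (simp add: algebra_simps)
      then show ?thesis using isumI[OF idlD(3)[OF E *(1,4)] sringD(6)[OF D *(2,5)]] by simp
    qed
    show "f * c \<in> add_generator D E a" if c: "c \<in> add_generator D E a" "f \<in> D" for c f
    proof -
      obtain b d where *: "b \<in> E" "d \<in> D" "c = b + a * d" using c(1) by (metis isumE)
      have "f * c = (f * b) + a * (f * d)" unfolding * by (simp add: algebra_simps)
      then show ?thesis using isumI[OF idlD(4)[OF E *(1) c(2)] sringD(8)[OF D c(2) *(2)]] by simp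
    qed
  qed
qed

lemma idl_zero: "is_subring D \<Longrightarrow> ideal_in D {0}"
  using sringD(3) by (auto simp: ideal_in_def)

end

locale noeth_local = two_parameters +
  assumes ideals_noetherian: "ideals_noetherian D"
    and loc: "d \<in> D \<Longrightarrow> unit_in D d \<or> d \<in> I 1"
    and e_I: "e \<notin> I 1"
begin

lemma noeth_max:
  assumes "E0 \<in> F" "\<And>E. E \<in> F \<Longrightarrow> ideal_in D E"
  shows "\<exists>M\<in>F. (\<forall>E\<in>F. M \<subseteq> E \<longrightarrow> E = M)"
proof -
  have "F \<noteq> {}" "\<forall>E\<in>F. ideal_in D E" using assms by auto
  then show ?thesis using ideals_noetherian unfolding ideals_noetherian_def by metis
qed

lemma un_sub: assumes "m \<in> I 1" shows "unit_in D (e - m)"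
proof (rule ccontr)
  assume "\<not> unit_in D (e - m)"
  then have "e - m \<in> I 1" using loc D_diff[OF D_e I_D[OF assms]] by blast
  then have "(e - m) + m \<in> I 1" using I_add assms by blast
  then show False using e_I by simp
qed

text \<open>If \<open>Q\<close> is not contained in \<open>Q'\<close>, choose \<open>E\<close> maximal between them and different from \<open>Q\<close>. For
\<open>p\<close> in \<open>Q\<close>, enlarging \<open>E\<close> by \<open>m * p\<close> would give \<open>Q\<close>, and then \<open>p\<close> is in \<open>E\<close> because \<open>e - m * d\<close> is
a unit. So \<open>m Q \<subseteq> E\<close>, and the hypothesis yields \<open>Q \<subseteq> E\<close>.\<close>
lemma nakayama:
  assumes Q: "ideal_in D Q" "ideal_in D Q'" "Q' \<subseteq> Q" and m: "m \<in> I 1" 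
    and step: "\<And>q. q \<in> Q \<Longrightarrow> \<exists>q'\<in>Q'. \<exists>p\<in>Q. q = q' + m * p"
  shows "Q \<subseteq> Q'"
proof (rule ccontr)
  assume "\<not> Q \<subseteq> Q'"
  define F where "F = {E. ideal_in D E \<and> Q' \<subseteq> E \<and> E \<subset> Q}"
  have "Q' \<in> F" using Q \<open>\<not> Q \<subseteq> Q'\<close> F_def by blast
  then have "\<exists>M\<in>F. (\<forall>E\<in>F. M \<subseteq> E \<longrightarrow> E = M)" by (rule noeth_max) (simp add: F_def)
  then obtain E where E: "E \<in> F" and max: "\<And>E'. E' \<in> F \<Longrightarrow> E \<subseteq> E' \<Longrightarrow> E' = E" by blast
  then have E': "ideal_in D E" "Q' \<subseteq> E" "E \<subset> Q" using F_def by auto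
  have mD: "m \<in> D" using I_D m by blast
  have mE: "m * p \<in> E" if p: "p \<in> Q" for p
  proof (rule ccontr)
    assume no: "m * p \<notin> E"
    have mpQ: "m * p \<in> Q" using idlD(4)[OF Q(1) p mD] .
    note isE = idl_isum[OF is_subring E'(1) idlD(6)[OF Q(1) mpQ]]
    have "add_generator D E (m * p) \<subseteq> Q"
    proof
      fix c assume "c \<in> add_generator D E (m * p)"
      then obtain b d where "b \<in> E" "d \<in> D" "c = b + m * p * d" by (metis isumE)
      then show "c \<in> Q" using idlD(3)[OF Q(1) _ idlD(5)[OF Q(1) mpQ]] E'(3) by blast
    qed
    moreover have "add_generator D E (m * p) \<noteq> E" using isE(3) no by blast
    ultimately have "add_generator D E (m * p) = Q" using max[of "add_generator D E (m * p)"] isE E'(2) F_def by blast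
    then obtain b d where b: "b \<in> E" "d \<in> D" "p = b + m * p * d" using p by (metis isumE)
    have pD: "p \<in> D" using idlD(6)[OF Q(1) p] .
    obtain v where v: "v \<in> D" "(e - m * d) * v = e" using un_sub[OF I_mult'[OF m b(2)]] by (auto simp: unit_in_def)
    have "(e - m * d) * p = p - m * p * d" unfolding left_diff_distrib e_mult[OF D_K[OF pD]] by (simp add: mult_ac)
    moreover have "b = p - m * p * d" using b(3) by (metis add_diff_cancel_right')
    ultimately have "b = (e - m * d) * p" by simp
    then have "v * b = ((e - m * d) * v) * p" by (simp only: mult_ac)
    then have "p = v * b" unfolding v(2) using D_K[OF pD] by simp
    then have "p \<in> E" using idlD(4)[OF E'(1) b(1) v(1)] by simp
    then show False using no idlD(4)[OF E'(1) _ mD] by blast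
  qed
  have "Q \<subseteq> E"
  proof
    fix q assume "q \<in> Q"
    then obtain q' p where "q' \<in> Q'" "p \<in> Q" "q = q' + m * p" using step by blast
    then show "q \<in> E" using idlD(3)[OF E'(1) _ mE] E'(2) by blast
  qed
  then show False using E'(3) by blast
qed

lemma last_notin:
  fixes f :: "nat \<Rightarrow> 'a"
  assumes "f 0 \<notin> J" "f n \<in> J" obtains i where "f i \<notin> J" "f (Suc i) \<in> J"
proof -
  define k where "k = (LEAST n. f n \<in> J)"
  have k: "f k \<in> J" unfolding k_def using assms(2) by (rule LeastI)
  then obtain i where i: "k = Suc i" using assms(1) by (cases k) auto
  then have "f i \<notin> J" using not_less_Least[of i "\<lambda>n. f n \<in> J"] k_def by auto
  then show ?thesis using that k i by blast
qed

text \<open>Noetherian induction. A maximal counterexample \<open>E\<close> admits an element \<open>d\<close> outside \<open>E\<close> with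
\<open>m d \<subseteq> E\<close>, and passing from \<open>E\<close> to \<open>E + dD\<close> shortens chains by at most one step.\<close>
lemma bounded:
  assumes J: "ideal_in D J" "pw x k \<in> J" "pw y l \<in> J"
  shows "\<exists>n. chain_bound D J n"
proof (rule ccontr)
  assume "\<not> ?thesis"
  define F where "F = {J. ideal_in D J \<and> pw x k \<in> J \<and> pw y l \<in> J \<and> \<not> (\<exists>n. chain_bound D J n)}"
  have "J \<in> F" using J \<open>\<not> _\<close> F_def by blast
  then have "\<exists>M\<in>F. (\<forall>E\<in>F. M \<subseteq> E \<longrightarrow> E = M)" by (rule noeth_max) (simp add: F_def)
  then obtain E where "E \<in> F" and max: "\<And>E'. E' \<in> F \<Longrightarrow> E \<subseteq> E' \<Longrightarrow> E' = E" by blast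
  then have E: "ideal_in D E" "pw x k \<in> E" "pw y l \<in> E" "\<And>n. \<not> chain_bound D E n" using F_def by auto
  have eE: "e \<notin> E"
  proof
    assume "e \<in> E"
    then have DE: "C = D" if "ideal_in D C" "E \<subseteq> C" for C
    proof -
      have "d \<in> C" if "d \<in> D" for d 
        using idlD(4)[OF \<open>ideal_in D C\<close>, of e d] \<open>e \<in> E\<close> \<open>E \<subseteq> C\<close> that D_K[OF that] by auto
      then show ?thesis using idlD(1)[OF \<open>ideal_in D C\<close>] by blast
    qed
    have "chain_bound D E 0" unfolding chain_bound_def
    proof (intro allI impI)
      fix C m assume C: "\<forall>i\<le>m. ideal_in D (C i) \<and> E \<subseteq> C i" "\<forall>i<m. C i \<subset> C (Suc i)"
      show "m \<le> 0"
      proof (cases m)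
        case (Suc m')
        then show ?thesis using C DE[of "C 0"] DE[of "C (Suc 0)"] by auto
      qed simp
    qed
    then show False using E by blast
  qed
  obtain i where i: "pw x i \<notin> E" "pw x (Suc i) \<in> E" using last_notin[of "pw x" E k] eE E(2) by auto
  have "pw y l * pw x i \<in> E" using idlD(5)[OF E(1,3) D_pw[OF x]] .
  then obtain j where j: "pw y j * pw x i \<notin> E" "pw y (Suc j) * pw x i \<in> E"
    using last_notin[of "\<lambda>j. pw y j * pw x i" E l] i(1) pw_K[OF x_K] by auto
  define d where "d = pw y j * pw x i"
  have dD: "d \<in> D" unfolding d_def using D_mult[OF D_pw[OF y] D_pw[OF x]] .
  have "x * d = pw y j * pw x (Suc i)" "y * d = pw y (Suc j) * pw x i" unfolding d_def by (simp_all add: mult_ac)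
  then have xyd: "x * d \<in> E" "y * d \<in> E" using idlD(4)[OF E(1) i(2) D_pw[OF y]] j(2) by simp_all
  have mE: "d * m \<in> E" if m: "m \<in> I 1" for m
  proof -
    obtain b c where "b \<in> D" "c \<in> D" "m = x * b + y * c" using m I_1_iff by blast
    then have "d * m = b * (x * d) + c * (y * d)" by (simp add: algebra_simps)
    then show ?thesis using idlD(3)[OF E(1) idlD(4)[OF E(1) xyd(1) \<open>b \<in> D\<close>] idlD(4)[OF E(1) xyd(2) \<open>c \<in> D\<close>]] by simp
  qed
  note isE = idl_isum[OF is_subring E(1) dD]
  have "add_generator D E d \<noteq> E" using isE(3) j(1) d_def by blast
  then have "add_generator D E d \<notin> F" using max isE(2) by blast
  then obtain n where n: "chain_bound D (add_generator D E d) n" using isE E F_def by blast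
  have "chain_bound D E (Suc n)" unfolding chain_bound_def
  proof (intro allI impI)
    fix C l assume C: "\<forall>i\<le>l. ideal_in D (C i) \<and> E \<subseteq> C i" and st: "\<forall>i<l. C i \<subset> C (Suc i)"
    show "l \<le> Suc n"
    proof (cases l)
      case (Suc l')
      define B where "B i = (if d \<in> C i then C (Suc i) else add_generator D (C i) d)" for i
      have mono: "C i \<subseteq> C (Suc i)" if "i < l" for i using st that by blast
      have Bi: "ideal_in D (B i) \<and> add_generator D E d \<subseteq> B i" if "i \<le> l'" for i
      proof -
        have Ci: "ideal_in D (C i)" "E \<subseteq> C i" "ideal_in D (C (Suc i))" "C i \<subseteq> C (Suc i)" using C that Suc mono by auto
        show ?thesis
        proof (cases "d \<in> C i")
          case True
          have "c \<in> C (Suc i)" if "c \<in> add_generator D E d" for c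
          proof -
            obtain b f where "b \<in> E" "f \<in> D" "c = b + d * f" using \<open>c \<in> _\<close> by (metis isumE)
            then show ?thesis using idlD(3)[OF Ci(3) _ idlD(5)[OF Ci(3) _ \<open>f \<in> D\<close>]] Ci True by blast
          qed
          then show ?thesis using True Ci by (auto simp: B_def)
        next
          case False
          then show ?thesis using idl_isum[OF is_subring Ci(1) dD] Ci(2) by (auto simp: B_def add_generator_def)
        qed
      qed
      have "B i \<subset> B (Suc i)" if "i < l'" for i
      proof -
        have Ci: "ideal_in D (C i)" "E \<subseteq> C i" "ideal_in D (C (Suc i))" "C i \<subset> C (Suc i)" "C (Suc i) \<subset> C (Suc (Suc i))" 
          using C that Suc st by auto
        show ?thesis
        proof (cases "d \<in> C (Suc i)")
          case True
          have "B i \<subseteq> C (Suc i)"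
          proof (cases "d \<in> C i")
            case False
            have "c \<in> C (Suc i)" if "c \<in> add_generator D (C i) d" for c
            proof -
              obtain b f where "b \<in> C i" "f \<in> D" "c = b + d * f" using \<open>c \<in> _\<close> by (metis isumE)
              then show ?thesis using idlD(3)[OF Ci(3) _ idlD(5)[OF Ci(3) True \<open>f \<in> D\<close>]] Ci by blast
            qed
            then show ?thesis using False by (auto simp: B_def)
          qed (simp add: B_def)
          then show ?thesis using True Ci(5) by (auto simp: B_def)
        next
          case False
          then have F2: "d \<notin> C i" using Ci(4) by blast
          obtain c where c: "c \<in> C (Suc i)" "c \<notin> C i" using Ci(4) by blast
          have "c \<notin> add_generator D (C i) d"
          proof
            assume "c \<in> add_generator D (C i) d"
            then obtain b f where bf: "b \<in> C i" "f \<in> D" "c = b + d * f" by (metis isumE)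
            show False
            proof (cases "unit_in D f")
              case True
              then obtain v where v: "v \<in> D" "f * v = e" by (auto simp: unit_in_def)
              have "d * f = c - b" using bf(3) by simp
              then have "d * f \<in> C (Suc i)" using idl_diff[OF is_subring Ci(3) c(1)] bf(1) Ci(4) by auto
              then have "d * f * v \<in> C (Suc i)" using idlD(5)[OF Ci(3) _ v(1)] by blast
              then show False using False v(2) D_K[OF dD] by (simp add: mult.assoc)
            next
              case False
              then have "d * f \<in> C i" using mE loc bf(2) Ci(2) by blast
              then show False using c bf idlD(3)[OF Ci(1)] by blast
            qed
          qed
          moreover have "c \<in> add_generator D (C (Suc i)) d" using c idl_isum(2)[OF is_subring Ci(3) dD] by blast
          moreover have "add_generator D (C i) d \<subseteq> add_generator D (C (Suc i)) d" using Ci(4) by (auto simp: add_generator_def)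
          ultimately show ?thesis using False F2 by (auto simp: B_def)
        qed
      qed
      then have "\<forall>i<l'. B i \<subset> B (Suc i)" by blast
      moreover have "\<forall>i\<le>l'. ideal_in D (B i) \<and> add_generator D E d \<subseteq> B i" using Bi by blast
      ultimately have "l' \<le> n" using n[unfolded chain_bound_def, THEN spec, THEN spec, of l' B] by blast
      then show ?thesis using Suc by simp
    qed simp
  qed
  then show False using E by blast
qed

text \<open>Reversing a strictly descending sequence gives chains of every length.\<close>
lemma dcc:
  assumes "chain_bound D J n" "\<And>i. ideal_in D (E i)" "\<And>i. J \<subseteq> E i" "\<And>i. E (Suc i) \<subseteq> E i"
  shows "\<exists>i. E i = E (Suc i)"
proof (rule ccontr)
  assume "\<not> ?thesis"
  then have "E (Suc i) \<subset> E i" for i using assms(4) by blast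
  define C where "C i = E (Suc n - i)" for i
  have "C i \<subset> C (Suc i)" if "i < Suc n" for i
  proof -
    have "Suc n - i = Suc (Suc n - Suc i)" using that by simp
    then show ?thesis unfolding C_def using \<open>\<And>i. E (Suc i) \<subset> E i\<close> by metis
  qed
  then have "\<forall>i<Suc n. C i \<subset> C (Suc i)" by blast
  moreover have "\<forall>i\<le>Suc n. ideal_in D (C i) \<and> J \<subseteq> C i" using assms(2,3) unfolding C_def by blast
  ultimately have "Suc n \<le> n" using assms(1)[unfolded chain_bound_def, THEN spec, THEN spec, of "Suc n" C] by blast
  then show False by simp
qed

text \<open>A form of Krull's principal ideal theorem: if \<open>s\<close> is a nonzerodivisor modulo \<open>q\<close> and
\<open>D/(q, x)\<close> has finite length, then \<open>(q, s)\<close> contains a power of \<open>x\<close>. As in Krull's proof, the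
ideals \<open>Q i\<close> of elements multiplied into \<open>(s^i, q)\<close> by a power of \<open>x\<close> become stationary modulo
\<open>x\<close>, hence stationary by Nakayama's lemma; an equation for \<open>x^k * s^i\<close> modulo \<open>s^(i+1)\<close> results, and
\<open>s^i\<close> is cancelled modulo \<open>q\<close>.\<close>
lemma principal_ideal:
  assumes q: "q \<in> D" and s: "s \<in> D" and nzd: "\<And>d. d \<in> D \<Longrightarrow> \<exists>f\<in>D. s * d = q * f \<Longrightarrow> \<exists>f\<in>D. d = q * f"
    and bdd: "chain_bound D {q * a + x * b | a b. a \<in> D \<and> b \<in> D} n"
  shows "\<exists>k. \<exists>a\<in>D. \<exists>b\<in>D. pw x k = q * a + s * b"
proof -
  define Q where "Q i = {d \<in> D. \<exists>k. \<exists>a\<in>D. \<exists>b\<in>D. pw x k * d = pw s i * a + q * b}" for i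
  have sp: "pw s i \<in> D" for i using D_pw[OF s] .
  have xp: "pw x i \<in> D" for i using D_pw[OF x] .
  have idlQ: "ideal_in D (Q i)" for i unfolding ideal_in_def
  proof (intro conjI ballI)
    show "Q i \<subseteq> D" by (auto simp: Q_def)
    have "pw x 0 * 0 = pw s i * 0 + q * 0" by simp
    then show "0 \<in> Q i" unfolding Q_def using D_0 by blast
    show "c + c' \<in> Q i" if c: "c \<in> Q i" "c' \<in> Q i" for c c'
    proof -
      obtain k a b k' a' b' where *: "c \<in> D" "a \<in> D" "b \<in> D" "pw x k * c = pw s i * a + q * b"
        "c' \<in> D" "a' \<in> D" "b' \<in> D" "pw x k' * c' = pw s i * a' + q * b'" using c unfolding Q_def by blast
      have "pw x (k + k') * (c + c') = pw x k' * (pw x k * c) + pw x k * (pw x k' * c')"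
        by (simp add: pw_add algebra_simps)
      also have "\<dots> = pw s i * (pw x k' * a + pw x k * a') + q * (pw x k' * b + pw x k * b')"
        unfolding *(4,8) by (simp add: algebra_simps)
      finally show ?thesis unfolding Q_def 
        using D_add[OF *(1,5)] D_add[OF D_mult[OF xp *(2)] D_mult[OF xp *(6)]] D_add[OF D_mult[OF xp *(3)] D_mult[OF xp *(7)]] by blast
    qed
    show "f * c \<in> Q i" if c: "c \<in> Q i" "f \<in> D" for c f
    proof -
      obtain k a b where *: "c \<in> D" "a \<in> D" "b \<in> D" "pw x k * c = pw s i * a + q * b" using c unfolding Q_def by blast
      have "pw x k * (f * c) = f * (pw x k * c)" by (simp only: mult_ac)
      also have "\<dots> = pw s i * (f * a) + q * (f * b)" unfolding *(4) by (simp add: algebra_simps)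
      finally show ?thesis unfolding Q_def using D_mult[OF c(2) *(1)] D_mult[OF c(2) *(2)] D_mult[OF c(2) *(3)] by blast
    qed
  qed
  have Qdec: "Q (Suc i) \<subseteq> Q i" for i
  proof
    fix c assume "c \<in> Q (Suc i)"
    then obtain k a b where *: "c \<in> D" "a \<in> D" "b \<in> D" "pw x k * c = pw s (Suc i) * a + q * b" unfolding Q_def by blast
    have "pw x k * c = pw s i * (s * a) + q * b" unfolding *(4) by (simp add: mult_ac)
    then show "c \<in> Q i" unfolding Q_def using *(1,3) D_mult[OF s *(2)] by blast
  qed
  have qQ: "q \<in> Q i" for i
  proof -
    have "pw x 0 * q = pw s i * 0 + q * e" using D_K[OF q] by simp
    then show ?thesis unfolding Q_def using q D_0 D_e by blast
  qed
  have Qx: "f \<in> Q i" if f: "f \<in> D" "x * f \<in> Q i" for f i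
  proof -
    obtain k a b where *: "a \<in> D" "b \<in> D" "pw x k * (x * f) = pw s i * a + q * b" using f unfolding Q_def by blast
    have "pw x (Suc k) * f = pw x k * (x * f)" by (simp add: mult_ac)
    then have "pw x (Suc k) * f = pw s i * a + q * b" unfolding *(3) .
    then show ?thesis unfolding Q_def using *(1,2) f(1) by blast
  qed
  define E where "E i = add_generator D (Q i) x" for i
  note isE = idl_isum[OF is_subring idlQ x, folded E_def]
  have "{q * a + x * b | a b. a \<in> D \<and> b \<in> D} \<subseteq> E i" for i
    unfolding E_def using isumI idlD(5)[OF idlQ qQ] by blast
  moreover have "E (Suc i) \<subseteq> E i" for i using Qdec[of i] by (auto simp: E_def add_generator_def)
  ultimately have "\<exists>i. E i = E (Suc i)" by (rule dcc[OF bdd isE(1)])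
  then obtain i where i: "E i = E (Suc i)" by (rule exE)
  have "Q i \<subseteq> Q (Suc i)"
  proof (rule nakayama[OF idlQ idlQ Qdec])
    show "x \<in> I 1" using I_x[of e 0] by simp
    fix d assume d: "d \<in> Q i"
    then have "d \<in> E (Suc i)" using isE(2) i by blast
    then obtain d' f where df: "d' \<in> Q (Suc i)" "f \<in> D" "d = d' + x * f" unfolding E_def by (metis isumE)
    then have "x * f = d - d'" by simp
    then have "x * f \<in> Q i" using idl_diff[OF is_subring idlQ d] Qdec df(1) by auto
    then show "\<exists>q'\<in>Q (Suc i). \<exists>p\<in>Q i. d = q' + x * p" using df Qx by blast
  qed
  moreover have "pw s i \<in> Q i"
  proof -
    have "pw x 0 * pw s i = pw s i * e + q * 0" using D_K[OF sp] by simp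
    then show ?thesis unfolding Q_def using sp D_e D_0 by blast
  qed
  ultimately have "pw s i \<in> Q (Suc i)" by blast
  then obtain k a b where *: "a \<in> D" "b \<in> D" "pw x k * pw s i = pw s (Suc i) * a + q * b" unfolding Q_def by blast
  define w where "w = pw x k - s * a"
  have wD: "w \<in> D" unfolding w_def using D_diff[OF xp D_mult[OF s *(1)]] .
  have "pw s i * w = q * b" using *(3) unfolding w_def by (simp add: algebra_simps)
  moreover have "\<exists>f\<in>D. w = q * f" if "\<exists>f\<in>D. pw s i * w = q * f" for i
    using that
  proof (induction i)
    case 0 then show ?case using D_K[OF wD] by simp
  next
    case (Suc i)
    then have "\<exists>f\<in>D. s * (pw s i * w) = q * f" by (simp add: mult.assoc)
    then show ?case using nzd[OF D_mult[OF sp wD]] Suc.IH by blast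
  qed
  ultimately obtain f where f: "f \<in> D" "w = q * f" using *(2) by blast
  have "pw x k = w + s * a" unfolding w_def by simp
  then have "pw x k = q * f + s * a" using f(2) by simp
  then show ?thesis using f *(1) by blast
qed

lemma noeth_swap: "noeth_local K e D y x"
  using ideals_noetherian loc e_I by unfold_locales (simp_all add: I_swap is_subring)

end

text \<open>Dimension at least two enters through a prime \<open>P\<close> that is nonzero and not maximal.\<close>
locale noeth_dim2 = noeth_local +
  fixes P s
  assumes P: "ideal_in D P" and prime: "a \<in> D \<Longrightarrow> b \<in> D \<Longrightarrow> a * b \<in> P \<Longrightarrow> a \<in> P \<or> b \<in> P"
    and s: "s \<in> P" "s \<noteq> 0" and P_not: "\<not> I 1 \<subseteq> P"
begin

lemma e_P: "e \<notin> P"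
proof
  assume "e \<in> P"
  then have "d \<in> P" if "d \<in> D" for d using idlD(4)[OF P _ that, of e] D_K[OF that] by simp
  then show False using P_not I_D by blast
qed

lemma pw_P: "a \<in> D \<Longrightarrow> pw a n \<in> P \<Longrightarrow> a \<in> P"
  by (induction n) (use e_P prime D_pw in auto)

text \<open>If \<open>y^r\<close> were a multiple of \<open>x\<close>, then \<open>D/xD\<close> would have finite length and the principal ideal
theorem with \<open>q = 0\<close> would put a power of \<open>x\<close>, and then all of \<open>m\<close>, into \<open>P\<close>.\<close>
lemma pw_y: assumes "d \<in> D" shows "pw y r \<noteq> x * d"
proof
  assume eq: "pw y r = x * d"
  define J where "J = {0 * a + x * b | a b. a \<in> D \<and> b \<in> D}"
  have J: "J = add_generator D {0} x" by (auto simp: J_def add_generator_def)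
  have idlJ: "ideal_in D J" "x \<in> J" unfolding J using idl_isum[OF is_subring idl_zero[OF is_subring] x] by auto
  have "pw y r \<in> J" unfolding eq using idlD(5)[OF idlJ assms] .
  moreover have "pw x 1 \<in> J" using idlJ by simp
  ultimately obtain n where "chain_bound D J n" using bounded[OF idlJ(1)] by blast
  then have bdd: "chain_bound D {0 * a + x * b | a b. a \<in> D \<and> b \<in> D} n" unfolding J_def .
  have sD: "s \<in> D" using idlD(6)[OF P s(1)] .
  have "\<exists>f\<in>D. d = 0 * f" if "d \<in> D" "\<exists>f\<in>D. s * d = 0 * f" for d
    using that mult_eq_zero[of s d] s(2) D_K sD by auto
  then obtain k a b where *: "a \<in> D" "b \<in> D" "pw x k = 0 * a + s * b" using principal_ideal[OF D_0 sD _ bdd] by blast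
  then have "pw x k \<in> P" using idlD(5)[OF P s(1)] by simp
  then have xP: "x \<in> P" using pw_P x by blast
  then have "pw y r \<in> P" unfolding eq using idlD(5)[OF P _ assms] by blast
  then have yP: "y \<in> P" using pw_P y by blast
  have "I 1 \<subseteq> P" 
  proof
    fix m assume "m \<in> I 1"
    then obtain b c where "b \<in> D" "c \<in> D" "m = x * b + y * c" using I_1_iff by blast
    then show "m \<in> P" using idlD(3)[OF P idlD(5)[OF P xP] idlD(5)[OF P yP]] by blast
  qed
  then show False using P_not by blast
qed

lemma dim2_swap: "noeth_dim2 K e D y x P s"
proof -
  interpret n: noeth_local K e D y x by (rule noeth_swap)
  show ?thesis using P prime s P_not by unfold_locales (simp_all add: I_swap)
qed

lemma x_nz: "x \<noteq> 0"
proof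
  assume "x = 0"
  interpret n: noeth_dim2 K e D y x P s by (rule dim2_swap)
  have "pw x 1 = y * 0" using \<open>x = 0\<close> by simp
  then show False using n.pw_y[OF D_0] by blast
qed

text \<open>Krull's intersection theorem: the intersection \<open>B\<close> of the ideals \<open>x^n D\<close> satisfies \<open>B = xB\<close>.\<close>
lemma sep_x:
  assumes "\<And>n. \<exists>d\<in>D. a = pw x n * d" shows "a = 0"
proof -
  define B where "B = {a \<in> D. \<forall>n. \<exists>d\<in>D. a = pw x n * d}"
  have idlB: "ideal_in D B" unfolding ideal_in_def
  proof (intro conjI ballI)
    show "B \<subseteq> D" by (auto simp: B_def)
    show "0 \<in> B" unfolding B_def using D_0 by (auto intro!: bexI[of _ 0])
    show "c + c' \<in> B" if c: "c \<in> B" "c' \<in> B" for c c'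
    proof -
      have "\<exists>d\<in>D. c + c' = pw x n * d" for n
      proof -
        obtain d d' where "d \<in> D" "c = pw x n * d" "d' \<in> D" "c' = pw x n * d'" using c unfolding B_def by blast
        then show ?thesis using D_add[of d d'] by (auto simp: distrib_left intro!: bexI[of _ "d + d'"])
      qed
      then show ?thesis using c D_add unfolding B_def by blast
    qed
    show "f * c \<in> B" if c: "c \<in> B" "f \<in> D" for c f
    proof -
      have "\<exists>d\<in>D. f * c = pw x n * d" for n
      proof -
        obtain d where "d \<in> D" "c = pw x n * d" using c unfolding B_def by blast
        then show ?thesis using D_mult[of f d] c(2) by (intro bexI[of _ "f * d"]) (simp_all add: mult_ac)
      qed
      then show ?thesis using c D_mult unfolding B_def by blast
    qed
  qed
  have "B \<subseteq> {0}"
  proof (rule nakayama[OF idlB idl_zero[OF is_subring]])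
    show "{0} \<subseteq> B" using idlD(2)[OF idlB] by blast
    show "x \<in> I 1" using I_x[of e 0] by simp
    fix q assume q: "q \<in> B"
    then have "\<exists>d\<in>D. q = pw x 1 * d" unfolding B_def by blast
    then obtain b where b: "b \<in> D" "q = x * b" by auto
    have "\<exists>d\<in>D. b = pw x n * d" for n
    proof -
      obtain d where d: "d \<in> D" "q = pw x (Suc n) * d" using q unfolding B_def by blast
      then have "x * b = x * (pw x n * d)" using b(2) by (simp add: mult.assoc)
      then have "b = pw x n * d" using cancel[OF x_K x_nz D_K[OF b(1)] D_K[OF D_mult[OF D_pw[OF x] d(1)]]] by blast
      then show ?thesis using d by blast
    qed
    then have "b \<in> B" using b unfolding B_def by blast
    then show "\<exists>q'\<in>{0}. \<exists>p\<in>B. q = q' + x * p" using b by auto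
  qed
  moreover have "a \<in> D" using assms[of 0] D_mult D_e by auto
  ultimately show ?thesis using assms unfolding B_def by blast
qed

text \<open>An element not in \<open>xD\<close> is a unit times a power of \<open>y\<close> modulo \<open>x\<close>, unless it is in
\<open>xD + y^r D\<close> for all \<open>r\<close>. To exclude this without knowing that \<open>xD\<close> is prime, the quotient by the
stationary value \<open>T0\<close> of the ascending ideals \<open>T r\<close> is used, in which \<open>y\<close> is cancellable, so that the
intersection theorem holds there.\<close>
lemma dvr:
  assumes a: "a \<in> D"
  shows "(\<exists>d\<in>D. a = x * d) \<or> (\<exists>r c d. unit_in D c \<and> d \<in> D \<and> a = c * pw y r + x * d)"
proof (cases "\<forall>r. \<exists>b\<in>D. \<exists>d\<in>D. a = pw y r * b + x * d")
  case False
  define f where "f r = (\<exists>b\<in>D. \<exists>d\<in>D. a = pw y r * b + x * d)" for r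
  define k where "k = (LEAST r. \<not> f r)"
  have "\<exists>r. \<not> f r" using False by (simp add: f_def)
  then have k: "\<not> f k" unfolding k_def by (rule LeastI_ex)
  have "a = pw y 0 * a + x * 0" using D_K[OF a] by simp
  then have "f 0" unfolding f_def using a D_0 by blast
  then obtain r where r: "k = Suc r" using k by (cases k) auto
  then have "f r" using not_less_Least[of r "\<lambda>r. \<not> f r"] k_def by auto
  then obtain b d where chain_bound: "b \<in> D" "d \<in> D" "a = pw y r * b + x * d" unfolding f_def by blast
  have "unit_in D b"
  proof (rule ccontr)
    assume "\<not> unit_in D b"
    then obtain b1 b2 where b12: "b1 \<in> D" "b2 \<in> D" "b = x * b1 + y * b2" using loc[OF chain_bound(1)] I_1_iff by blast
    have "a = pw y (Suc r) * b2 + x * (d + pw y r * b1)" unfolding chain_bound(3) b12(3) by (simp add: algebra_simps)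
    then have "f (Suc r)" unfolding f_def using b12 D_add[OF chain_bound(2) D_mult[OF D_pw[OF y] b12(1)]] by blast
    then show False using k r by simp
  qed
  moreover have "a = b * pw y r + x * d" unfolding chain_bound(3) by (simp only: mult.commute)
  ultimately show ?thesis using chain_bound(2) by blast
next
  case True
  define T where "T r = {b \<in> D. \<exists>d\<in>D. pw y r * b = x * d}" for r
  have idlT: "ideal_in D (T r)" for r unfolding ideal_in_def
  proof (intro conjI ballI)
    show "T r \<subseteq> D" by (auto simp: T_def)
    show "0 \<in> T r" unfolding T_def using D_0 by (auto intro!: bexI[of _ 0])
    show "c + c' \<in> T r" if c: "c \<in> T r" "c' \<in> T r" for c c'
    proof -
      obtain d d' where "c \<in> D" "c' \<in> D" "d \<in> D" "pw y r * c = x * d" "d' \<in> D" "pw y r * c' = x * d'" using c unfolding T_def by blast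
      then show ?thesis unfolding T_def using D_add[of d d'] D_add[of c c'] by (auto simp: distrib_left intro!: bexI[of _ "d + d'"])
    qed
    show "f * c \<in> T r" if c: "c \<in> T r" "f \<in> D" for c f
    proof -
      obtain d where *: "c \<in> D" "d \<in> D" "pw y r * c = x * d" using c unfolding T_def by blast
      have "pw y r * (f * c) = f * (pw y r * c)" by (simp only: mult_ac)
      also have "\<dots> = x * (f * d)" unfolding *(3) by (simp only: mult_ac)
      finally show ?thesis unfolding T_def using D_mult[OF c(2) *(1)] D_mult[OF c(2) *(2)] by blast
    qed
  qed
  have Tinc: "T r \<subseteq> T (r + j)" for r j
  proof
    fix b assume "b \<in> T r"
    then obtain d where *: "b \<in> D" "d \<in> D" "pw y r * b = x * d" unfolding T_def by blast
    have "pw y (r + j) * b = pw y j * (pw y r * b)" by (simp add: pw_add mult_ac)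
    also have "\<dots> = x * (pw y j * d)" unfolding *(3) by (simp only: mult_ac)
    finally show "b \<in> T (r + j)" unfolding T_def using * D_mult[OF D_pw[OF y] *(2)] by blast
  qed
  have "ideal_in D E" if "E \<in> range T" for E using idlT that by blast
  then have "\<exists>M\<in>range T. (\<forall>E\<in>range T. M \<subseteq> E \<longrightarrow> E = M)" by (intro noeth_max[OF rangeI[of T 0]])
  then obtain M where M: "M \<in> range T" "\<forall>E\<in>range T. M \<subseteq> E \<longrightarrow> E = M" by (elim bexE)
  obtain r0 where "M = T r0" using M(1) by (elim rangeE)
  then have r0: "T r = T r0" if "T r0 \<subseteq> T r" for r using M(2) that by simp
  define T0 where "T0 = T r0"
  note idlT0 = idlT[of r0, folded T0_def]
  have T0_y: "b \<in> T0" if b: "b \<in> D" "y * b \<in> T0" for b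
  proof -
    obtain d where d: "d \<in> D" "pw y r0 * (y * b) = x * d" using b unfolding T0_def T_def by blast
    then have "pw y (r0 + 1) * b = x * d" by (simp add: mult_ac)
    then have "b \<in> T (r0 + 1)" unfolding T_def using b d by blast
    then show ?thesis using r0[OF Tinc, of 1] T0_def by blast
  qed
  define B where "B = {b \<in> D. \<forall>j. \<exists>t\<in>T0. \<exists>c\<in>D. b = t + pw y j * c}"
  have idlB: "ideal_in D B" unfolding ideal_in_def
  proof (intro conjI ballI)
    show "B \<subseteq> D" by (auto simp: B_def)
    have "\<exists>t\<in>T0. \<exists>c\<in>D. 0 = t + pw y j * c" for j using idlD(2)[OF idlT0] D_0 by (intro bexI[of _ 0]) auto
    then show "0 \<in> B" unfolding B_def using D_0 by blast
    show "c + c' \<in> B" if c: "c \<in> B" "c' \<in> B" for c c'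
    proof -
      have "\<exists>t\<in>T0. \<exists>d\<in>D. c + c' = t + pw y j * d" for j
      proof -
        obtain t d t' d' where *: "t \<in> T0" "d \<in> D" "c = t + pw y j * d" "t' \<in> T0" "d' \<in> D" "c' = t' + pw y j * d'" 
          using c unfolding B_def by blast
        have "c + c' = (t + t') + pw y j * (d + d')" unfolding *(3,6) by (simp add: algebra_simps)
        then show ?thesis using idlD(3)[OF idlT0 *(1,4)] D_add[OF *(2,5)] by blast
      qed
      then show ?thesis using c D_add unfolding B_def by blast
    qed
    show "f * c \<in> B" if c: "c \<in> B" "f \<in> D" for c f
    proof -
      have "\<exists>t\<in>T0. \<exists>d\<in>D. f * c = t + pw y j * d" for j
      proof -
        obtain t d where *: "t \<in> T0" "d \<in> D" "c = t + pw y j * d" using c unfolding B_def by blast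
        have "f * c = f * t + pw y j * (f * d)" unfolding *(3) by (simp add: algebra_simps)
        then show ?thesis using idlD(4)[OF idlT0 *(1) c(2)] D_mult[OF c(2) *(2)] by blast
      qed
      then show ?thesis using c D_mult unfolding B_def by blast
    qed
  qed
  have "B \<subseteq> T0"
  proof (rule nakayama[OF idlB idlT0])
    show "T0 \<subseteq> B"
    proof
      fix t assume t: "t \<in> T0"
      have "\<exists>t'\<in>T0. \<exists>c\<in>D. t = t' + pw y j * c" for j using t D_0 by (intro bexI[of _ t] bexI[of _ 0]) auto
      then show "t \<in> B" unfolding B_def using idlD(6)[OF idlT0 t] by blast
    qed
    show "y \<in> I 1" using I_y[of e 0] by simp
    fix b assume b: "b \<in> B"
    then have "\<exists>t\<in>T0. \<exists>c\<in>D. b = t + pw y 1 * c" unfolding B_def by blast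
    then obtain t c where tc: "t \<in> T0" "c \<in> D" "b = t + y * c" by auto
    have "\<exists>t\<in>T0. \<exists>c'\<in>D. c = t + pw y j * c'" for j
    proof -
      obtain t' c' where *: "t' \<in> T0" "c' \<in> D" "b = t' + pw y (Suc j) * c'" using b unfolding B_def by blast
      have "y * (c - pw y j * c') = (b - t) - (b - t')" unfolding tc(3) by (subst *(3)[unfolded tc(3)]) (simp add: algebra_simps)
      then have "y * (c - pw y j * c') = t' - t" by simp
      then have "y * (c - pw y j * c') \<in> T0" using idl_diff[OF is_subring idlT0 *(1) tc(1)] by simp
      then have "c - pw y j * c' \<in> T0" using T0_y[OF D_diff[OF tc(2) D_mult[OF D_pw[OF y] *(2)]]] by blast
      moreover have "c = (c - pw y j * c') + pw y j * c'" by simp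
      ultimately show ?thesis using *(2) by blast
    qed
    then have "c \<in> B" using tc(2) unfolding B_def by blast
    then show "\<exists>q'\<in>T0. \<exists>p\<in>B. b = q' + y * p" using tc by blast
  qed
  moreover obtain b0 d0 where b0: "b0 \<in> D" "d0 \<in> D" "a = pw y r0 * b0 + x * d0" using True by blast
  moreover have "b0 \<in> B"
  proof -
    have "\<exists>t\<in>T0. \<exists>c\<in>D. b0 = t + pw y j * c" for j
    proof -
      obtain b d where *: "b \<in> D" "d \<in> D" "a = pw y (r0 + j) * b + x * d" using True by blast
      have "pw y r0 * (b0 - pw y j * b) = (a - x * d0) - (a - x * d)" 
        using b0(3) *(3) by (simp add: pw_add algebra_simps)
      then have "pw y r0 * (b0 - pw y j * b) = x * (d - d0)" by (simp add: algebra_simps)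
      then have "b0 - pw y j * b \<in> T0" unfolding T0_def T_def 
        using D_diff[OF b0(1) D_mult[OF D_pw[OF y] *(1)]] D_diff[OF *(2) b0(2)] by blast
      moreover have "b0 = (b0 - pw y j * b) + pw y j * b" by simp
      ultimately show ?thesis using *(1) by blast
    qed
    then show ?thesis using b0 unfolding B_def by blast
  qed
  ultimately have "b0 \<in> T r0" using T0_def by blast
  then obtain d where "d \<in> D" "pw y r0 * b0 = x * d" unfolding T_def by blast
  then have "a = x * (d + d0)" "d + d0 \<in> D" using b0 D_add by (auto simp: distrib_left)
  then show ?thesis by blast
qed

sublocale regular2_criterion
  using loc e_I x_nz dvr pw_y sep_x by unfold_locales blast+

lemma x_prime:
  assumes "a \<in> D" "c \<in> D" "\<not> (\<exists>d\<in>D. a = x * d)" "a * c = x * f" "f \<in> D"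
  shows "\<exists>d\<in>D. c = x * d"
proof -
  obtain r u d where *: "unit_in D u" "d \<in> D" "a = u * pw y r + x * d" using dvr[OF assms(1)] assms(3) by blast
  obtain v where v: "v \<in> D" "u * v = e" using *(1) by (auto simp: unit_in_def)
  have "(u * v) * (pw y r * c) = (a * c - x * (d * c)) * v" unfolding *(3) by (simp add: algebra_simps)
  also have "\<dots> = x * ((f - d * c) * v)" unfolding assms(4) by (simp add: algebra_simps)
  finally have "pw y r * c = x * ((f - d * c) * v)" unfolding v(2) using D_K[OF D_mult[OF D_pw[OF y] assms(2)]] by simp
  moreover have "(f - d * c) * v \<in> D" using D_mult[OF D_diff[OF assms(5) D_mult[OF *(2) assms(2)]] v(1)] .
  ultimately show ?thesis using y_reg[OF assms(2)] by metis
qed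

text \<open>Reduction of the fraction \<open>b/a\<close> to lowest terms. The ideal of its denominators is principal: a
denominator \<open>q\<close> of least \<open>y\<close>-value modulo \<open>x\<close> generates it by Nakayama's lemma. Then \<open>s = q b / a\<close>
is a nonzerodivisor modulo \<open>q\<close>, and \<open>(q, s)\<close> has finite colength by the principal ideal theorem.\<close>
lemma ex_coprime:
  assumes a: "a \<in> D" "\<not> (\<exists>d\<in>D. a = x * d)" and b: "b \<in> D"
  shows "\<exists>q s n. colength_le D q s n \<and> a * s = b * q \<and> q \<noteq> 0"
proof -
  define Q where "Q = {d \<in> D. \<exists>c\<in>D. d * b = a * c}"
  have idlQ: "ideal_in D Q" unfolding ideal_in_def
  proof (intro conjI ballI)
    show "Q \<subseteq> D" by (auto simp: Q_def)
    have "0 * b = a * 0" by simp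
    then show "0 \<in> Q" unfolding Q_def using D_0 by blast
    show "c + c' \<in> Q" if c: "c \<in> Q" "c' \<in> Q" for c c'
    proof -
      obtain d d' where *: "c \<in> D" "c' \<in> D" "d \<in> D" "c * b = a * d" "d' \<in> D" "c' * b = a * d'" using c unfolding Q_def by blast
      have "(c + c') * b = a * (d + d')" using *(4,6) by (simp add: algebra_simps)
      then show ?thesis unfolding Q_def using D_add[OF *(1,2)] D_add[OF *(3,5)] by blast
    qed
    show "f * c \<in> Q" if c: "c \<in> Q" "f \<in> D" for c f
    proof -
      obtain d where *: "c \<in> D" "d \<in> D" "c * b = a * d" using c unfolding Q_def by blast
      have "(f * c) * b = f * (c * b)" by (simp only: mult_ac)
      also have "\<dots> = a * (f * d)" unfolding *(3) by (simp only: mult_ac)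
      finally show ?thesis unfolding Q_def using D_mult[OF c(2) *(1)] D_mult[OF c(2) *(2)] by blast
    qed
  qed
  have aQ: "a \<in> Q" unfolding Q_def using a b by blast
  have Qx: "d \<in> Q" if d: "d \<in> D" "x * d \<in> Q" for d
  proof -
    obtain c where c: "c \<in> D" "x * d * b = a * c" using d unfolding Q_def by blast
    then have "a * c = x * (d * b)" by (simp add: mult.assoc)
    then obtain c' where c': "c' \<in> D" "c = x * c'" using x_prime[OF a(1) c(1) a(2)] D_mult[OF d(1) b] by blast
    have "x * (d * b) = x * (a * c')" using c(2) c'(2) by (simp add: mult_ac)
    then have "d * b = a * c'" using cancel[OF x_K x_nz] D_K[OF D_mult[OF d(1) b]] D_K[OF D_mult[OF a(1) c'(1)]] by blast
    then show ?thesis unfolding Q_def using d c' by blast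
  qed
  define R where "R r = (\<exists>q\<in>Q. \<exists>c d. unit_in D c \<and> d \<in> D \<and> q = c * pw y r + x * d)" for r
  have "\<exists>r. R r" unfolding R_def using dvr[OF a(1)] a(2) aQ by blast
  define r where "r = (LEAST r. R r)"
  have "R r" unfolding r_def using \<open>\<exists>r. R r\<close> by (rule LeastI_ex)
  then obtain q c d where q: "q \<in> Q" "unit_in D c" "d \<in> D" "q = c * pw y r + x * d" unfolding R_def by blast
  have qD: "q \<in> D" using idlD(6)[OF idlQ q(1)] .
  obtain c' where c': "c' \<in> D" "c * c' = e" using q(2) by (auto simp: unit_in_def)
  have q0: "q \<noteq> 0"
  proof
    assume "q = 0"
    then have "c * pw y r = x * (- d)" using q(4) by (simp add: add_eq_0_iff2)
    then show False using un_pw_y[OF q(2) D_uminus[OF q(3)]] by blast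
  qed
  have yr: "pw y r = q * c' - x * (d * c')"
  proof -
    have "pw y r = (c * c') * pw y r" unfolding c'(2) by simp
    also have "\<dots> = q * c' - x * (d * c')" unfolding q(4) by (simp add: algebra_simps)
    finally show ?thesis .
  qed
  define Q' where "Q' = add_generator D {0} q"
  note isQ' = idl_isum[OF is_subring idl_zero[OF is_subring] qD, folded Q'_def]
  have Q'I: "q * f \<in> Q'" if "f \<in> D" for f using isumI[of 0 "{0}" f D q] that Q'_def by simp
  have Q'E: "\<exists>f\<in>D. p = q * f" if "p \<in> Q'" for p using that unfolding Q'_def add_generator_def by auto
  have "Q \<subseteq> Q'"
  proof (rule nakayama[OF idlQ isQ'(1)])
    show "Q' \<subseteq> Q" using Q'E idlD(5)[OF idlQ q(1)] by blast
    show "x \<in> I 1" using I_x[of e 0] by simp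
    fix p assume p: "p \<in> Q"
    have pD: "p \<in> D" using idlD(6)[OF idlQ p] .
    show "\<exists>q'\<in>Q'. \<exists>p'\<in>Q. p = q' + x * p'"
    proof (cases "\<exists>f\<in>D. p = x * f")
      case True
      then obtain f where "f \<in> D" "p = x * f" by blast
      then show ?thesis using Qx p idlD(2)[OF isQ'(1)] by (intro bexI[of _ 0] bexI[of _ f]) auto
    next
      case False
      then obtain r' u f where *: "unit_in D u" "f \<in> D" "p = u * pw y r' + x * f" using dvr[OF pD] by blast
      then have "R r'" unfolding R_def using p by blast
      then have "r \<le> r'" unfolding r_def by (rule Least_le)
      then have "pw y r' = pw y r * pw y (r' - r)" using pw_add[OF y_K, of r "r' - r"] by simp
      have uD: "u \<in> D" using * by (simp add: unit_in_def)
      define w where "w = u * pw y (r' - r)"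
      have wD: "w \<in> D" unfolding w_def using D_mult[OF uD D_pw[OF y]] .
      have "p = pw y r * w + x * f" unfolding *(3) \<open>pw y r' = _\<close> w_def by (simp add: mult_ac)
      then have pe: "p = q * (c' * w) + x * (f - d * c' * w)" unfolding yr by (simp add: algebra_simps)
      have gD: "f - d * c' * w \<in> D" using D_diff[OF *(2) D_mult[OF D_mult[OF q(3) c'(1)] wD]] .
      have cw: "c' * w \<in> D" using D_mult[OF c'(1) wD] .
      have "x * (f - d * c' * w) = p - q * (c' * w)" using pe by (metis add_diff_cancel_left')
      then have "x * (f - d * c' * w) \<in> Q" using idl_diff[OF is_subring idlQ p idlD(5)[OF idlQ q(1) cw]] by simp
      then show ?thesis using Qx[OF gD] pe Q'I[OF cw] by blast
    qed
  qed
  then have Qq: "\<exists>f\<in>D. p = q * f" if "p \<in> Q" for p using that Q'E by blast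
  obtain c0 where c0: "c0 \<in> D" "a = q * c0" using Qq[OF aQ] by blast
  obtain s where s: "s \<in> D" "q * b = a * s" using q(1) unfolding Q_def by blast
  have "q * b = q * (c0 * s)" using s(2) c0(2) by (simp add: mult.assoc)
  then have bs: "b = c0 * s" using cancel[OF D_K[OF qD] q0 D_K[OF b] D_K[OF D_mult[OF c0(1) s(1)]]] by blast
  have nzd: "\<exists>f\<in>D. p = q * f" if p: "p \<in> D" "\<exists>f\<in>D. s * p = q * f" for p
  proof -
    obtain f where f: "f \<in> D" "s * p = q * f" using p by blast
    have "p * b = c0 * (s * p)" unfolding bs by (simp only: mult_ac)
    also have "\<dots> = a * f" unfolding f(2) c0(2) by (simp only: mult_ac)
    finally have "p \<in> Q" unfolding Q_def using p(1) f(1) by blast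
    then show ?thesis using Qq by blast
  qed
  define J where "J = add_generator D Q' x"
  note isJ = idl_isum[OF is_subring isQ'(1) x, folded J_def]
  have Jeq: "J = {q * a + x * b | a b. a \<in> D \<and> b \<in> D}"
    unfolding J_def Q'_def add_generator_def by auto
  have "pw y r \<in> J" unfolding yr 
    using idl_diff[OF is_subring isJ(1)] Q'I[OF c'(1)] isJ(2) idlD(5)[OF isJ(1,3) D_mult[OF q(3) c'(1)]] by blast
  moreover have "pw x 1 \<in> J" using isJ(3) by simp
  ultimately obtain n where "chain_bound D J n" using bounded[OF isJ(1)] by blast
  then obtain k \<alpha> \<beta> where k: "\<alpha> \<in> D" "\<beta> \<in> D" "pw x k = q * \<alpha> + s * \<beta>"
    using principal_ideal[OF qD s(1) nzd] Jeq by metis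
  define H where "H = add_generator D Q' s"
  note isH = idl_isum[OF is_subring isQ'(1) s(1), folded H_def]
  have HE: "\<exists>a\<in>D. \<exists>b\<in>D. h = q * a + s * b" if "h \<in> H" for h
    using that unfolding H_def Q'_def add_generator_def by auto
  have qH: "q \<in> H" using isQ'(3) isH(2) by blast
  have xH: "pw x k \<in> H" unfolding k(3) using idlD(3)[OF isH(1) idlD(5)[OF isH(1) qH k(1)] idlD(5)[OF isH(1,3) k(2)]] .
  have pwH: "\<exists>i. pw m i \<in> H" if m: "m \<in> I 1" for m
  proof -
    obtain m1 m2 where m12: "m1 \<in> D" "m2 \<in> D" "m = x * m1 + y * m2" using m I_1_iff by blast
    have xm: "x * m1 \<in> D" "y * m2 \<in> D" using D_mult m12 by auto
    obtain t where t: "t \<in> D" "pw m r = pw (y * m2) r + x * m1 * t" 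
      using ex_pw_add[OF is_subring xm, of r] m12(3) by blast
    define M2 where "M2 = pw m2 r"
    have M2: "M2 \<in> D" unfolding M2_def using D_pw[OF m12(2)] .
    have "pw (y * m2) r = pw y r * M2" unfolding M2_def using pw_times D_K[OF m12(2)] by simp
    then have mr: "pw m r = q * (c' * M2) + x * (m1 * t - d * c' * M2)" unfolding t(2) yr by (simp add: algebra_simps)
    define w where "w = m1 * t - d * c' * M2"
    have wD: "w \<in> D" unfolding w_def using D_diff[OF D_mult[OF m12(1) t(1)] D_mult[OF D_mult[OF q(3) c'(1)] M2]] .
    have qc: "q * (c' * M2) \<in> D" using D_mult[OF qD D_mult[OF c'(1) M2]] .
    obtain t' where t': "t' \<in> D" "pw (pw m r) k = pw (x * w) k + q * (c' * M2) * t'"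
      using ex_pw_add[OF is_subring qc D_mult[OF x wD], of k] mr w_def by metis
    have "pw (x * w) k \<in> H" using pw_times[OF x_K D_K[OF wD], of k] idlD(5)[OF isH(1) xH D_pw[OF wD]] by simp
    moreover have "q * (c' * M2) * t' \<in> H" using idlD(5)[OF isH(1) idlD(5)[OF isH(1) qH D_mult[OF c'(1) M2]] t'(1)] .
    ultimately have "pw (pw m r) k \<in> H" unfolding t'(2) using idlD(3)[OF isH(1)] by blast
    then show ?thesis using pw_mult[of m r k] I_K[OF m] by metis
  qed
  obtain l where "pw y l \<in> H" using pwH[of y] I_y[of e 0] by auto
  then obtain n where n: "chain_bound D H n" using bounded[OF isH(1) xH] by blast
  have "chain_bound_pair D q s n" unfolding chain_bound_pair_def
  proof (intro allI impI)
    fix C l assume C: "\<forall>i\<le>l. ideal_in D (C i) \<and> q \<in> C i \<and> s \<in> C i" "\<forall>i<l. C i \<subset> C (Suc i)"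
    have "H \<subseteq> C i" if "i \<le> l" for i
    proof
      fix h assume "h \<in> H"
      then obtain a b where "a \<in> D" "b \<in> D" "h = q * a + s * b" using HE by blast
      then show "h \<in> C i" using C(1) that idlD(3)[of D "C i"] idlD(5)[of D "C i"] by blast
    qed
    then have "\<forall>i\<le>l. ideal_in D (C i) \<and> H \<subseteq> C i" using C(1) by blast
    then show "l \<le> n" using n[unfolded chain_bound_def, THEN spec, THEN spec, of l C] C(2) by blast
  qed
  moreover have "\<exists>k. \<exists>a\<in>D. \<exists>b\<in>D. pw m k = q * a + s * b" if "m \<in> nonunits_of D" for m
  proof -
    have "m \<in> I 1" using loc that by (auto simp: nonunits_of_def)
    then obtain i where "pw m i \<in> H" using pwH by blast
    then show ?thesis using HE by blast
  qed
  ultimately have "colength_le D q s n" unfolding colength_le_def using qD s(1) by blast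
  moreover have "a * s = b * q" using s(2) by (simp add: mult.commute)
  ultimately show ?thesis using q0 by blast
qed

lemma co_sym: "colength_le D a b n \<Longrightarrow> colength_le D b a n"
  unfolding colength_le_def chain_bound_pair_def by (metis add.commute)

text \<open>For \<open>ex_coprime\<close> the denominator must be prime to \<open>x\<close>; common powers of \<open>x\<close> are cancelled first,
and afterwards the numerator or the denominator qualifies.\<close>
lemma fin_of_fractions:
  assumes frac: "\<And>z. z \<in> K \<Longrightarrow> \<exists>a\<in>D. \<exists>b\<in>D. b \<noteq> 0 \<and> z * b = a"
  shows "coprime_fractions D"
  unfolding coprime_fractions_def
proof
  fix z assume z: "z \<in> K"
  have div: "\<exists>i a'. a' \<in> D \<and> a = pw x i * a' \<and> \<not> (\<exists>d\<in>D. a' = x * d)" if a: "a \<in> D" "a \<noteq> 0" for a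
  proof -
    define f where "f i = (\<exists>d\<in>D. a = pw x i * d)" for i
    have "\<exists>i. \<not> f i" using sep_x[of a] a(2) f_def by blast
    define k where "k = (LEAST i. \<not> f i)"
    have k: "\<not> f k" unfolding k_def using \<open>\<exists>i. \<not> f i\<close> by (rule LeastI_ex)
    have "f 0" unfolding f_def using a D_K by auto
    then obtain i where i: "k = Suc i" using k by (cases k) auto
    then have "f i" using not_less_Least[of i "\<lambda>r. \<not> f r"] k_def by auto
    then obtain a' where a': "a' \<in> D" "a = pw x i * a'" unfolding f_def by blast
    moreover have "\<not> (\<exists>d\<in>D. a' = x * d)"
    proof
      assume "\<exists>d\<in>D. a' = x * d"
      then obtain d where "d \<in> D" "a' = x * d" by blast
      then have "a = pw x (Suc i) * d" using a'(2) by (simp add: mult_ac)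
      then show False using k i \<open>d \<in> D\<close> unfolding f_def by blast
    qed
    ultimately show ?thesis by blast
  qed
  show "\<exists>a b n. colength_le D a b n \<and> b \<noteq> 0 \<and> z * b = a"
  proof (cases "z = 0")
    case True
    then show ?thesis using co_unit[OF is_subring D_0 D_e] un_e[OF is_subring] by (intro exI[of _ 0] exI[of _ e]) auto
  next
    case False
    obtain a b where ab: "a \<in> D" "b \<in> D" "b \<noteq> 0" "z * b = a" using frac[OF z] by blast
    have a0: "a \<noteq> 0" using ab False z D_K mult_eq_zero by metis
    obtain i a' where a': "a' \<in> D" "a = pw x i * a'" "\<not> (\<exists>d\<in>D. a' = x * d)" using div[OF ab(1) a0] by blast
    obtain j b' where b': "b' \<in> D" "b = pw x j * b'" "\<not> (\<exists>d\<in>D. b' = x * d)" using div[OF ab(2,3)] by blast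
    have K: "a' \<in> K" "b' \<in> K" using a' b' D_K by auto
    have nz: "a' \<noteq> 0" "b' \<noteq> 0" using a0 ab(3) a'(2) b'(2) by auto
    have quot: "z * d = c" if "a * d = b * c" "c \<in> K" "d \<in> K" for c d
    proof (rule cancel[OF D_K[OF ab(2)] ab(3)])
      have "b * (z * d) = (z * b) * d" by (simp only: mult_ac)
      then show "b * (z * d) = b * c" unfolding ab(4) that(1) .
    qed (use that z in auto)
    show ?thesis
    proof (cases "i \<le> j")
      case True
      have bD: "pw x (j - i) * b' \<in> D" using D_mult[OF D_pw[OF x] b'(1)] .
      obtain q s n where *: "colength_le D q s n" "a' * s = pw x (j - i) * b' * q" "q \<noteq> 0" using ex_coprime[OF a'(1,3) bD] by blast
      have qs: "q \<in> K" "s \<in> K" using *(1) D_K by (auto simp: colength_le_def)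
      have ij: "pw x j = pw x i * pw x (j - i)" using pw_add[OF x_K, of i "j - i"] True by simp
      have "a * s = b * q" unfolding a'(2) b'(2) ij mult.assoc using *(2) by (simp add: mult_ac)
      then have "z * s = q" using quot qs by blast
      moreover have "s \<noteq> 0" using calculation *(3) by auto
      ultimately show ?thesis using *(1) by blast
    next
      case False
      have aD: "pw x (i - j) * a' \<in> D" using D_mult[OF D_pw[OF x] a'(1)] .
      obtain q s n where *: "colength_le D q s n" "b' * s = pw x (i - j) * a' * q" "q \<noteq> 0" using ex_coprime[OF b'(1,3) aD] by blast
      have qs: "q \<in> K" "s \<in> K" using *(1) D_K by (auto simp: colength_le_def)
      have ij: "pw x i = pw x j * pw x (i - j)" using pw_add[OF x_K, of j "i - j"] False by simp
      have "a * q = b * s" unfolding a'(2) b'(2) ij mult.assoc using *(2) by (simp add: mult_ac)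
      then have "z * q = s" using quot qs by blast
      then show ?thesis using *(3) co_sym[OF *(1)] by blast
    qed
  qed
qed

end

section \<open>Maximal ideals of commutative rings\<close>

lemma (in cring) ideal_of_closed:
  assumes "C \<subseteq> carrier R" "\<zero> \<in> C" "\<And>a b. a \<in> C \<Longrightarrow> b \<in> C \<Longrightarrow> a \<oplus> b \<in> C" 
    "\<And>a r. a \<in> C \<Longrightarrow> r \<in> carrier R \<Longrightarrow> r \<otimes> a \<in> C"
  shows "ideal C R"
proof (rule idealI[OF ring_axioms])
  show "subgroup C (add_monoid R)"
  proof (rule add.subgroupI)
    show "\<ominus> a \<in> C" if a: "a \<in> C" for a
    proof -
      have "(\<ominus> \<one>) \<otimes> a = \<ominus> a" using assms(1) a by (simp add: l_minus subsetD)
      then show ?thesis using assms(4)[OF a, of "\<ominus> \<one>"] by simp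
    qed
  qed (use assms in auto)
  show "r \<otimes> a \<in> C" "a \<otimes> r \<in> C" if "a \<in> C" "r \<in> carrier R" for a r
    using that assms(1,4) m_comm[of a r] by auto
qed

text \<open>Zorn's lemma applied to the proper ideals containing the element.\<close>
lemma (in cring) ex_maximalideal:
  assumes a: "a \<in> carrier R" "a \<notin> Units R"
  shows "\<exists>M. maximalideal M R \<and> a \<in> M"
proof -
  define F where "F = {J. ideal J R \<and> a \<in> J \<and> \<one> \<notin> J}"
  have "\<one> \<notin> PIdl a"
  proof
    assume "\<one> \<in> PIdl a"
    then obtain b where "b \<in> carrier R" "\<one> = b \<otimes> a" by (auto simp: cgenideal_def)
    then show False using a m_comm[of a b] unfolding Units_def by auto
  qed
  then have "PIdl a \<in> F" using cgenideal_ideal[OF a(1)] cgenideal_self[OF a(1)] F_def by blast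
  moreover have "\<Union>\<C> \<in> F" if \<C>: "\<C> \<noteq> {}" "subset.chain F \<C>" for \<C>
  proof -
    have F: "J \<in> F" if "J \<in> \<C>" for J using \<C>(2) that by (auto simp: subset.chain_def)
    have ch: "subset.chain {J. ideal J R} \<C>" using \<C>(2) by (auto simp: subset.chain_def F_def)
    have "ideal (\<Union>\<C>) R" using chain_Union_is_ideal[OF ch] \<C>(1) by simp
    then show ?thesis using F \<C>(1) F_def by blast
  qed
  ultimately have "\<exists>M0\<in>F. (\<forall>J\<in>F. M0 \<subseteq> J \<longrightarrow> J = M0)"
    by (intro subset_Zorn_nonempty) auto
  then obtain M where M: "M \<in> F" "\<And>J. J \<in> F \<Longrightarrow> M \<subseteq> J \<Longrightarrow> J = M" by blast
  have "maximalideal M R"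
  proof (rule maximalidealI)
    show "ideal M R" using M F_def by blast
    show "carrier R \<noteq> M" using M(1) F_def by auto
    fix J assume J: "ideal J R" "M \<subseteq> J" "J \<subseteq> carrier R"
    show "J = M \<or> J = carrier R"
    proof (cases "\<one> \<in> J")
      case True then show ?thesis using ideal.one_imp_carrier[OF J(1)] by blast
    next
      case False
      then have "J \<in> F" using J M(1) F_def by blast
      then show ?thesis using M(2) J(2) by blast
    qed
  qed
  then show ?thesis using M(1) F_def by blast
qed

lemma (in cring) maximalideal_nonunits:
  assumes "maximalideal M R" "a \<in> M" shows "a \<in> carrier R - Units R"
proof -
  interpret M: maximalideal M R by fact
  have "a \<notin> Units R"
  proof
    assume "a \<in> Units R"
    then obtain b where "b \<in> carrier R" "b \<otimes> a = \<one>" unfolding Units_def by auto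
    then have "\<one> \<in> M" using M.I_l_closed[OF assms(2), of b] by simp
    then show False using M.one_imp_carrier M.I_notcarr by blast
  qed
  then show ?thesis using assms(2) M.Icarr by blast
qed

lemma (in cring) the_max_ideal_local:
  assumes "local_ring R" shows "the_max_ideal R = carrier R - Units R" "maximalideal (the_max_ideal R) R"
proof -
  have ex: "\<exists>!M. maximalideal M R" using assms by (simp add: local_ring_def)
  show max: "maximalideal (the_max_ideal R) R" unfolding the_max_ideal_def using theI'[OF ex] .
  show "the_max_ideal R = carrier R - Units R"
    using maximalideal_nonunits[OF max] ex_maximalideal ex max by blast
qed

lemma (in cring) the_max_ideal_nonunits:
  assumes nz: "\<one> \<noteq> \<zero>" and add: "\<And>a b. a \<in> carrier R - Units R \<Longrightarrow> b \<in> carrier R - Units R \<Longrightarrow> a \<oplus> b \<notin> Units R"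
  shows "the_max_ideal R = carrier R - Units R"
proof -
  define N where "N = carrier R - Units R"
  have idN: "ideal N R"
  proof (rule ideal_of_closed)
    show "N \<subseteq> carrier R" by (auto simp: N_def)
    show "\<zero> \<in> N" using nz by (auto simp: N_def Units_def)
    show "a \<oplus> b \<in> N" if "a \<in> N" "b \<in> N" for a b using add that by (auto simp: N_def)
    show "r \<otimes> a \<in> N" if "a \<in> N" "r \<in> carrier R" for a r
    proof -
      have aC: "a \<in> carrier R" "a \<notin> Units R" using that by (auto simp: N_def)
      have "r \<otimes> a \<notin> Units R"
      proof
        assume "r \<otimes> a \<in> Units R"
        then obtain b where b: "b \<in> carrier R" "b \<otimes> (r \<otimes> a) = \<one>" unfolding Units_def by auto
        then have 1: "(b \<otimes> r) \<otimes> a = \<one>" using aC that(2) by (simp add: m_assoc)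
        then have "a \<otimes> (b \<otimes> r) = \<one>" using m_comm[of a "b \<otimes> r"] aC that(2) b(1) by simp
        then have "a \<in> Units R" unfolding Units_def using 1 aC(1) that(2) b(1) by blast
        then show False using aC by blast
      qed
      then show ?thesis using aC that(2) by (simp add: N_def)
    qed
  qed
  have oneN: "\<one> \<notin> N" by (simp add: N_def)
  have maxN: "maximalideal N R"
  proof (rule maximalidealI[OF idN])
    show "carrier R \<noteq> N" using oneN by auto
    fix J assume J: "ideal J R" "N \<subseteq> J" "J \<subseteq> carrier R"
    show "J = N \<or> J = carrier R"
    proof (cases "J \<subseteq> N")
      case False
      then obtain a where a: "a \<in> J" "a \<in> Units R" using J(3) by (auto simp: N_def)
      then obtain b where "b \<in> carrier R" "b \<otimes> a = \<one>" unfolding Units_def by auto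
      then have "\<one> \<in> J" using ideal.I_l_closed[OF J(1) a(1), of b] by simp
      then show ?thesis using ideal.one_imp_carrier[OF J(1)] by blast
    qed (use J in blast)
  qed
  have uniq: "M = N" if M: "maximalideal M R" for M
  proof -
    have "M \<subseteq> N" using maximalideal_nonunits[OF M] N_def by blast
    then show ?thesis using maximalideal.I_maximal[OF M idN] oneN idN N_def by auto
  qed
  have "the_max_ideal R = N" unfolding the_max_ideal_def by (rule the_equality) (rule maxN, erule uniq)
  then show ?thesis by (simp add: N_def)
qed

lemma (in noetherian_ring) ex_maximal_ideal_in_family:
  assumes "F \<noteq> {}" "\<And>J. J \<in> F \<Longrightarrow> ideal J R"
  shows "\<exists>M0\<in>F. (\<forall>J\<in>F. M0 \<subseteq> J \<longrightarrow> J = M0)"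
proof (rule subset_Zorn_nonempty[OF assms(1)])
  fix \<C> assume \<C>: "\<C> \<noteq> {}" "subset.chain F \<C>"
  then have "subset.chain {J. ideal J R} \<C>" using assms(2) by (auto simp: subset.chain_def)
  then have "\<Union>\<C> \<in> \<C>" using ideal_chain_is_trivial \<C>(1) by blast
  then show "\<Union>\<C> \<in> F" using \<C>(2) by (auto simp: subset.chain_def)
qed

section \<open>Embedding carrier-based rings into a ring type\<close>

text \<open>The product of all commutative rings with carrier in the type \<open>'a\<close>. Operations are componentwise,
so this type is a commutative ring in the sense of the type class, and every single ring of the product
embeds into it as an ideal, by extension with zero components. The unit of the embedded ring is not a
unit of the product.\<close>
typedef ('a, 'b) ring_family = "{\<phi> :: ('a, 'b) ring_scheme \<Rightarrow> 'a. \<forall>R. \<phi> R \<in> (if cring R then carrier R else {undefined})}"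
proof
  show "(\<lambda>R. if cring R then \<zero>\<^bsub>R\<^esub> else undefined) \<in> 
      {\<phi> :: ('a, 'b) ring_scheme \<Rightarrow> 'a. \<forall>R. \<phi> R \<in> (if cring R then carrier R else {undefined})}"
    by (auto intro: cring.cring_simprules)
qed

abbreviation component :: "('a, 'b) ring_family \<Rightarrow> ('a, 'b) ring_scheme \<Rightarrow> 'a" where "component \<equiv> Rep_ring_family"

definition family :: "(('a, 'b) ring_scheme \<Rightarrow> 'a) \<Rightarrow> ('a, 'b) ring_family" where
  "family \<phi> = Abs_ring_family (\<lambda>R. if cring R then \<phi> R else undefined)"

lemma component_closed: "cring R \<Longrightarrow> component u R \<in> carrier R"
  using Rep_ring_family[of u] by (auto split: if_splits)

lemma component_other: "\<not> cring R \<Longrightarrow> component u R = undefined"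
  using Rep_ring_family[of u] by (auto split: if_splits)

lemma component_family: "(\<And>R. cring R \<Longrightarrow> \<phi> R \<in> carrier R) \<Longrightarrow> cring R \<Longrightarrow> component (family \<phi>) R = \<phi> R"
  unfolding family_def by (subst Abs_ring_family_inverse) auto

lemma ring_family_eqI: "(\<And>R. cring R \<Longrightarrow> component u R = component v R) \<Longrightarrow> u = v"
  by (metis Rep_ring_family_inject component_other ext)

instantiation ring_family :: (type, type) comm_ring
begin

definition "0 = family (\<lambda>R. \<zero>\<^bsub>R\<^esub>)"
definition "u + v = family (\<lambda>R. component u R \<oplus>\<^bsub>R\<^esub> component v R)"
definition "- u = family (\<lambda>R. \<ominus>\<^bsub>R\<^esub> component u R)"
definition "u - v = family (\<lambda>R. component u R \<ominus>\<^bsub>R\<^esub> component v R)"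
definition "u * v = family (\<lambda>R. component u R \<otimes>\<^bsub>R\<^esub> component v R)"

lemma component_ops: 
  assumes "cring R"
  shows "component 0 R = \<zero>\<^bsub>R\<^esub>" "component (u + v) R = component u R \<oplus>\<^bsub>R\<^esub> component v R" "component (- u) R = \<ominus>\<^bsub>R\<^esub> component u R"
    "component (u - v) R = component u R \<ominus>\<^bsub>R\<^esub> component v R" "component (u * v) R = component u R \<otimes>\<^bsub>R\<^esub> component v R"
  unfolding zero_ring_family_def plus_ring_family_def uminus_ring_family_def minus_ring_family_def times_ring_family_def
  by (subst component_family; use assms in \<open>simp add: cring.cring_simprules component_closed\<close>)+

instance
proof
  fix u v w :: "('a, 'b) ring_family"
  show "u + v + w = u + (v + w)" "u + v = v + u" "0 + u = u" "- u + u = 0" "u - v = u + - v"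
    "u * v * w = u * (v * w)" "u * v = v * u" "(u + v) * w = u * w + v * w"
    by (rule ring_family_eqI; simp add: component_ops component_closed cring.cring_simprules)+
qed

end

definition emb :: "('a, 'b) ring_scheme \<Rightarrow> 'a \<Rightarrow> ('a, 'b) ring_family" where
  "emb F a = family (\<lambda>R. if R = F then a else \<zero>\<^bsub>R\<^esub>)"

context
  fixes F :: "('a, 'b) ring_scheme" assumes F: "cring F"
begin

lemma component_emb: 
  assumes "a \<in> carrier F" "cring R" shows "component (emb F a) R = (if R = F then a else \<zero>\<^bsub>R\<^esub>)"
  unfolding emb_def by (subst component_family) (use assms in \<open>auto simp: cring.cring_simprules\<close>)

lemma emb_ops:
  assumes "a \<in> carrier F" "b \<in> carrier F"
  shows "emb F (a \<oplus>\<^bsub>F\<^esub> b) = emb F a + emb F b" "emb F (a \<ominus>\<^bsub>F\<^esub> b) = emb F a - emb F b"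
    "emb F (a \<otimes>\<^bsub>F\<^esub> b) = emb F a * emb F b" "emb F (\<ominus>\<^bsub>F\<^esub> a) = - emb F a" "emb F \<zero>\<^bsub>F\<^esub> = 0"
  by (rule ring_family_eqI; use assms F in \<open>simp add: component_ops component_emb cring.cring_simprules\<close>)+

lemma emb_inj: "a \<in> carrier F \<Longrightarrow> b \<in> carrier F \<Longrightarrow> emb F a = emb F b \<longleftrightarrow> a = b"
  using component_emb[OF _ F] by metis

end

section \<open>From rings on carriers to subsets of a ring type\<close>

locale embedded_field = field F for F :: "('a, 'b) ring_scheme" (structure)
begin

abbreviation h :: "'a \<Rightarrow> ('a, 'b) ring_family" where "h \<equiv> emb F"

lemmas h_ops [simp] = emb_ops[OF is_cring] and h_inj [simp] = emb_inj[OF is_cring]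

sublocale K: field_in_ring "h ` carrier F" "h \<one>"
proof unfold_locales
  show "0 \<in> h ` carrier F" using h_ops(5)[OF zero_closed zero_closed] zero_closed by (metis imageI)
  show "h \<one> \<noteq> 0" using h_ops(5)[OF zero_closed zero_closed] h_inj[OF one_closed zero_closed] one_not_zero by simp
  fix u assume "u \<in> h ` carrier F"
  then obtain a where a: "a \<in> carrier F" "u = h a" by blast
  show "- u \<in> h ` carrier F" using a h_ops(4)[OF a(1) a(1)] by (metis a_inv_closed imageI)
  show "h \<one> * u = u" using a h_ops(3)[OF one_closed a(1)] by simp
  show "\<exists>v\<in>h ` carrier F. u * v = h \<one>" if "u \<noteq> 0"
  proof -
    have "a \<noteq> \<zero>" using that a(2) h_ops(5)[OF zero_closed zero_closed] by metis
    then have "a \<in> Units F" using a(1) field_Units by blast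
    then have i: "inv a \<in> carrier F" "a \<otimes> inv a = \<one>" by auto
    then have "h a * h (inv a) = h \<one>" using h_ops(3)[OF a(1) i(1)] by simp
    then show ?thesis using i a by blast
  qed
  fix v assume "v \<in> h ` carrier F"
  then obtain b where b: "b \<in> carrier F" "v = h b" by blast
  show "u + v \<in> h ` carrier F" using a b h_ops(1)[OF a(1) b(1)] by (metis a_closed imageI)
  show "u * v \<in> h ` carrier F" using a b h_ops(3)[OF a(1) b(1)] by (metis m_closed imageI)
qed simp

lemma h_zero: "h \<zero> = 0" using h_ops(5)[OF zero_closed zero_closed] .

lemma h_mem: "S \<subseteq> carrier F \<Longrightarrow> a \<in> carrier F \<Longrightarrow> h a \<in> h ` S \<longleftrightarrow> a \<in> S"
proof
  assume S: "S \<subseteq> carrier F" and a: "a \<in> carrier F" and "h a \<in> h ` S"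
  then obtain b where "b \<in> S" "h a = h b" by blast
  then show "a \<in> S" using h_inj[of a b] a S by blast
qed blast

lemma h_subset: "S \<subseteq> carrier F \<Longrightarrow> T \<subseteq> carrier F \<Longrightarrow> h ` S \<subseteq> h ` T \<longleftrightarrow> S \<subseteq> T"
proof
  assume S: "S \<subseteq> carrier F" and T: "T \<subseteq> carrier F" and "h ` S \<subseteq> h ` T"
  then have "h a \<in> h ` T" if "a \<in> S" for a using that by blast
  then show "S \<subseteq> T" using h_mem[OF T] S by blast
qed blast

definition pre :: "('a, 'b) ring_family set \<Rightarrow> 'a set" where
  "pre U = {a \<in> carrier F. h a \<in> U}"

lemma pre: "pre U \<subseteq> carrier F" "U \<subseteq> h ` carrier F \<Longrightarrow> h ` pre U = U"
  by (auto simp: pre_def)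

lemma sring_iff:
  assumes S: "S \<subseteq> carrier F" shows "K.is_subring (h ` S) \<longleftrightarrow> subring S F"
proof
  assume s: "subring S F"
  note E = subringE[OF s]
  show "K.is_subring (h ` S)" unfolding K.is_subring_def
  proof (intro conjI ballI)
    show "h ` S \<subseteq> h ` carrier F" "h \<one> \<in> h ` S" using E by auto
    fix u v assume "u \<in> h ` S" "v \<in> h ` S"
    then obtain a b where ab: "a \<in> S" "b \<in> S" "u = h a" "v = h b" by blast
    have C: "a \<in> carrier F" "b \<in> carrier F" using ab S by auto
    have "a \<ominus> b \<in> S" unfolding minus_eq using E(5,7) ab by blast
    then show "u - v \<in> h ` S" using h_ops(2)[OF C] ab by (metis imageI)
    show "u * v \<in> h ` S" using h_ops(3)[OF C] E(6) ab by (metis imageI)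
  qed
next
  assume s: "K.is_subring (h ` S)"
  note E = K.sringD[OF s]
  show "subring S F"
  proof (rule subringI[OF S])
    show "\<one> \<in> S" using E(2) h_mem[OF S] by simp
    show "\<ominus> a \<in> S" if "a \<in> S" for a
    proof -
      have "a \<in> carrier F" using that S by blast
      then show ?thesis using E(5)[of "h a"] h_ops(4)[of a a] h_mem[OF S, of "\<ominus> a"] that by simp
    qed
    fix a b assume "a \<in> S" "b \<in> S"
    then have ab: "a \<in> carrier F" "b \<in> carrier F" "h a \<in> h ` S" "h b \<in> h ` S" using S by auto
    show "a \<otimes> b \<in> S" using E(8)[OF ab(3,4)] h_ops(3)[OF ab(1,2)] h_mem[OF S, of "a \<otimes> b"] ab by simp
    show "a \<oplus> b \<in> S" using E(6)[OF ab(3,4)] h_ops(1)[OF ab(1,2)] h_mem[OF S, of "a \<oplus> b"] ab by simp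
  qed
qed

definition nonunits :: "'a set \<Rightarrow> 'a set" where
  "nonunits S = carrier (F\<lparr>carrier := S\<rparr>) - Units (F\<lparr>carrier := S\<rparr>)"

lemma nonunits_iff: "S \<subseteq> carrier F \<Longrightarrow> a \<in> nonunits S \<longleftrightarrow> a \<in> S \<and> \<not> (\<exists>b\<in>S. a \<otimes> b = \<one>)"
  unfolding nonunits_def Units_def using m_comm by (auto simp: subset_iff)

lemma un_iff: "S \<subseteq> carrier F \<Longrightarrow> a \<in> carrier F \<Longrightarrow> K.unit_in (h ` S) (h a) \<longleftrightarrow> a \<in> S \<and> (\<exists>b\<in>S. a \<otimes> b = \<one>)"
proof -
  assume S: "S \<subseteq> carrier F" and a: "a \<in> carrier F"
  have "h a * h b = h \<one> \<longleftrightarrow> a \<otimes> b = \<one>" if "b \<in> S" for b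
  proof -
    have b: "b \<in> carrier F" using that S by blast
    show ?thesis using h_ops(3)[OF a b] h_inj[of "a \<otimes> b" \<one>] a b by simp
  qed
  then show ?thesis unfolding K.unit_in_def using h_mem[OF S a] by auto
qed

lemma mx_eq: "S \<subseteq> carrier F \<Longrightarrow> K.nonunits_of (h ` S) = h ` nonunits S"
  unfolding K.nonunits_of_def using un_iff nonunits_iff[of S] by (auto simp: subset_iff) 

lemma nonunits_sub: "nonunits S \<subseteq> S" by (auto simp: nonunits_def)

lemma subring_cring: "subring S F \<Longrightarrow> cring (F\<lparr>carrier := S\<rparr>)"
  using subcring_iff[of S] subcringI'[of S] subringE(1)[of S F] by blast

lemma inv_eq: "a \<in> carrier F \<Longrightarrow> a \<noteq> \<zero> \<Longrightarrow> inv a \<in> carrier F \<and> a \<otimes> inv a = \<one>"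
  using field_Units by (metis DiffI Units_inv_closed Units_r_inv singletonD)

lemma vr_iff: 
  assumes V: "V \<subseteq> carrier F" shows "K.val_ring (h ` V) \<longleftrightarrow> valuation_ring_of F V"
proof
  assume v: "K.val_ring (h ` V)"
  have "a \<in> V \<or> inv a \<in> V" if a: "a \<in> carrier F" "a \<noteq> \<zero>" for a
  proof -
    note i = inv_eq[OF a]
    have "K.le (h ` V) (h \<one>) (h a) \<or> K.le (h ` V) (h a) (h \<one>)" using v a unfolding K.val_ring_def by blast
    then show ?thesis
    proof
      assume "K.le (h ` V) (h \<one>) (h a)"
      then have "h a \<in> h ` V" using K.mem_iff_le[of "h ` V"] v by simp
      then show ?thesis using h_mem[OF V a(1)] by blast
    next
      assume "K.le (h ` V) (h a) (h \<one>)"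
      then obtain b where b: "b \<in> V" "h \<one> = h a * h b" unfolding K.le_def by blast
      have bC: "b \<in> carrier F" using b V by blast
      have "h \<one> = h (a \<otimes> b)" using b(2) h_ops(3)[OF a(1) bC] by simp
      then have "\<one> = a \<otimes> b" using h_inj[of \<one> "a \<otimes> b"] a bC by simp
      then have "inv a = b" using comm_inv_char[OF a(1) bC] by simp
      then show ?thesis using b by simp
    qed
  qed
  then show "valuation_ring_of F V" unfolding valuation_ring_of_def using sring_iff[OF V] v by auto
next
  assume v: "valuation_ring_of F V"
  have s: "K.is_subring (h ` V)" using v sring_iff[OF V] by (simp add: valuation_ring_of_def)
  show "K.val_ring (h ` V)" unfolding K.val_ring_def
  proof (intro conjI ballI)
    fix u w assume "u \<in> h ` carrier F" "w \<in> h ` carrier F"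
    then obtain a b where ab: "a \<in> carrier F" "b \<in> carrier F" "u = h a" "w = h b" by blast
    show "K.le (h ` V) u w \<or> K.le (h ` V) w u"
    proof (cases "a = \<zero> \<or> b = \<zero>")
      case True
      then show ?thesis using ab h_zero K.le_zero[OF s] by auto
    next
      case False
      note ia = inv_eq[OF ab(1)] and ib = inv_eq[OF ab(2)]
      define c where "c = a \<otimes> inv b"
      have c: "c \<in> carrier F" "c \<noteq> \<zero>" "b \<otimes> c = a" "inv c \<in> carrier F" "a \<otimes> inv c = b"
      proof -
        show cC: "c \<in> carrier F" unfolding c_def using ab ib False by simp
        have "b \<otimes> c = a \<otimes> (b \<otimes> inv b)" unfolding c_def using ab ib False by (simp add: m_lcomm)
        then show bc: "b \<otimes> c = a" using ib ab False by simp
        show c0: "c \<noteq> \<zero>" using bc False ab by auto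
        note ic = inv_eq[OF cC c0]
        show "inv c \<in> carrier F" using ic by simp
        have "a \<otimes> inv c = b \<otimes> (c \<otimes> inv c)" unfolding bc[symmetric] using ab cC ic by (simp add: m_assoc)
        then show "a \<otimes> inv c = b" using ic ab by simp
      qed
      have "c \<in> V \<or> inv c \<in> V" using v c unfolding valuation_ring_of_def by blast
      moreover have "u = w * h c" using ab(3,4) h_ops(3)[OF ab(2) c(1)] c(3) by simp
      moreover have "w = u * h (inv c)" using ab(3,4) h_ops(3)[OF ab(1) c(4)] c(5) by simp
      ultimately show ?thesis unfolding K.le_def by blast
    qed
  qed (rule s)
qed

lemma the_max_vr:
  assumes "valuation_ring_of F V" shows "the_max_ideal (F\<lparr>carrier := V\<rparr>) = nonunits V"
proof -
  have s: "subring V F" using assms by (simp add: valuation_ring_of_def)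
  have V: "V \<subseteq> carrier F" using subringE(1)[OF s] .
  interpret R: cring "F\<lparr>carrier := V\<rparr>" using subring_cring[OF s] .
  have val_ring: "K.val_ring (h ` V)" using vr_iff[OF V] assms by simp
  show ?thesis unfolding nonunits_def
  proof (rule R.the_max_ideal_nonunits)
    show "\<one>\<^bsub>F\<lparr>carrier := V\<rparr>\<^esub> \<noteq> \<zero>\<^bsub>F\<lparr>carrier := V\<rparr>\<^esub>" by simp
    fix a b assume "a \<in> carrier (F\<lparr>carrier := V\<rparr>) - Units (F\<lparr>carrier := V\<rparr>)" 
      "b \<in> carrier (F\<lparr>carrier := V\<rparr>) - Units (F\<lparr>carrier := V\<rparr>)"
    then have ab: "a \<in> nonunits V" "b \<in> nonunits V" by (simp_all add: nonunits_def)
    then have C: "a \<in> carrier F" "b \<in> carrier F" using nonunits_sub V by blast+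
    have "h a + h b \<in> K.nonunits_of (h ` V)" using K.mx_add_vr[OF val_ring] mx_eq[OF V] ab by blast
    then have "h (a \<oplus> b) \<in> h ` nonunits V" using h_ops(1)[OF C] mx_eq[OF V] by simp
    then have "a \<oplus> b \<in> nonunits V" using h_mem[of "nonunits V" "a \<oplus> b"] C nonunits_sub V by blast
    then show "a \<oplus>\<^bsub>F\<lparr>carrier := V\<rparr>\<^esub> b \<notin> Units (F\<lparr>carrier := V\<rparr>)" by (simp add: nonunits_def)
  qed
qed

lemma local_transfer:
  assumes s: "subring A F" and l: "local_ring (F\<lparr>carrier := A\<rparr>)"
  shows "the_max_ideal (F\<lparr>carrier := A\<rparr>) = nonunits A" "K.is_local (h ` A)"
proof -
  have A: "A \<subseteq> carrier F" using subringE(1)[OF s] .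
  interpret R: cring "F\<lparr>carrier := A\<rparr>" using subring_cring[OF s] .
  show 1: "the_max_ideal (F\<lparr>carrier := A\<rparr>) = nonunits A" unfolding nonunits_def using R.the_max_ideal_local(1)[OF l] .
  interpret M: ideal "nonunits A" "F\<lparr>carrier := A\<rparr>" 
    using R.the_max_ideal_local(2)[OF l] unfolding 1 by (rule maximalideal.axioms(1))
  show "K.is_local (h ` A)" unfolding K.is_local_def
  proof (intro conjI ballI)
    show "K.is_subring (h ` A)" using sring_iff[OF A] s by simp
    fix u v assume "u \<in> K.nonunits_of (h ` A)" "v \<in> K.nonunits_of (h ` A)"
    then obtain a b where ab: "a \<in> nonunits A" "b \<in> nonunits A" "u = h a" "v = h b" using mx_eq[OF A] by auto
    then have C: "a \<in> carrier F" "b \<in> carrier F" using nonunits_sub A by blast+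
    have "a \<oplus> b \<in> nonunits A" using M.a_closed[OF ab(1,2)] by simp
    then have "h (a \<oplus> b) \<in> K.nonunits_of (h ` A)" using mx_eq[OF A] by blast
    then show "u + v \<in> K.nonunits_of (h ` A)" using h_ops(1)[OF C] ab by simp
  qed
qed

text \<open>Domination is defined by maximal ideals on one side and by nonunits on the other; for local rings these
agree.\<close>
lemma Val_iff:
  assumes s: "subring A F" and l: "local_ring (F\<lparr>carrier := A\<rparr>)"
  shows "V \<in> Val F A \<longleftrightarrow> V \<subseteq> carrier F \<and> h ` V \<in> K.dominators (h ` A)"
proof -
  have A: "A \<subseteq> carrier F" using subringE(1)[OF s] .
  show ?thesis
  proof (cases "V \<subseteq> carrier F \<and> valuation_ring_of F V")
    case True
    then have V: "V \<subseteq> carrier F" "valuation_ring_of F V" by auto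
    have "nonunits A \<subseteq> carrier F" "nonunits V \<subseteq> carrier F" using nonunits_sub A V by blast+
    then show ?thesis unfolding Val_def K.dominators_def 
      using V h_subset[OF A V(1)] h_subset vr_iff[OF V(1)] mx_eq[OF A] mx_eq[OF V(1)] local_transfer(1)[OF s l] the_max_vr[OF V(2)] by auto
  next
    case False
    then show ?thesis unfolding Val_def K.dominators_def using vr_iff[of V] subringE(1)[of V F] 
      by (auto simp: valuation_ring_of_def)
  qed
qed

lemma idl_iff:
  assumes s: "subring D F" and J: "J \<subseteq> D"
  shows "K.ideal_in (h ` D) (h ` J) \<longleftrightarrow> ideal J (F\<lparr>carrier := D\<rparr>)"
proof -
  have D: "D \<subseteq> carrier F" and JC: "J \<subseteq> carrier F" using subringE(1)[OF s] J by auto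
  interpret R: cring "F\<lparr>carrier := D\<rparr>" using subring_cring[OF s] .
  show ?thesis
  proof
    assume i: "K.ideal_in (h ` D) (h ` J)"
    note E = K.idlD[OF i]
    show "ideal J (F\<lparr>carrier := D\<rparr>)"
    proof (rule R.ideal_of_closed)
      show "J \<subseteq> carrier (F\<lparr>carrier := D\<rparr>)" using J by simp
      show "\<zero>\<^bsub>F\<lparr>carrier := D\<rparr>\<^esub> \<in> J" using E(2) h_zero h_mem[OF JC zero_closed] by simp
      show "a \<oplus>\<^bsub>F\<lparr>carrier := D\<rparr>\<^esub> b \<in> J" if "a \<in> J" "b \<in> J" for a b
      proof -
        have C: "a \<in> carrier F" "b \<in> carrier F" using that JC by auto
        then show ?thesis using E(3)[of "h a" "h b"] that h_ops(1)[OF C] h_mem[OF JC, of "a \<oplus> b"] by simp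
      qed
      show "r \<otimes>\<^bsub>F\<lparr>carrier := D\<rparr>\<^esub> a \<in> J" if "a \<in> J" "r \<in> carrier (F\<lparr>carrier := D\<rparr>)" for a r
      proof -
        have C: "r \<in> carrier F" "a \<in> carrier F" "r \<in> D" using that JC D by auto
        then show ?thesis using E(4)[of "h a" "h r"] that h_ops(3)[OF C(1,2)] h_mem[OF JC, of "r \<otimes> a"] by simp
      qed
    qed
  next
    assume i: "ideal J (F\<lparr>carrier := D\<rparr>)"
    interpret J: ideal J "F\<lparr>carrier := D\<rparr>" by fact
    show "K.ideal_in (h ` D) (h ` J)" unfolding K.ideal_in_def
    proof (intro conjI ballI)
      show "h ` J \<subseteq> h ` D" using J by blast
      have "\<zero> \<in> J" using J.zero_closed by simp
      then show "0 \<in> h ` J" unfolding h_zero[symmetric] by (rule imageI)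
      show "u + v \<in> h ` J" if uv: "u \<in> h ` J" "v \<in> h ` J" for u v
      proof -
        obtain a b where ab: "a \<in> J" "b \<in> J" "u = h a" "v = h b" using uv by blast
        then have C: "a \<in> carrier F" "b \<in> carrier F" using JC by auto
        have "a \<oplus> b \<in> J" using J.a_closed[OF ab(1,2)] by simp
        then show ?thesis using h_ops(1)[OF C] ab by (metis imageI)
      qed
      show "v * u \<in> h ` J" if uv: "u \<in> h ` J" "v \<in> h ` D" for u v
      proof -
        obtain a b where ab: "a \<in> J" "b \<in> D" "u = h a" "v = h b" using uv by blast
        then have C: "b \<in> carrier F" "a \<in> carrier F" using JC D by auto
        have "b \<otimes> a \<in> J" using J.I_l_closed[OF ab(1), of b] ab(2) by simp
        then show ?thesis using h_ops(3)[OF C] ab by (metis imageI)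
      qed
    qed
  qed
qed

lemma idl_pre:
  assumes s: "subring D F" and i: "K.ideal_in (h ` D) E"
  shows "h ` pre E = E" "pre E \<subseteq> D" "ideal (pre E) (F\<lparr>carrier := D\<rparr>)"
proof -
  have D: "D \<subseteq> carrier F" using subringE(1)[OF s] .
  have E: "E \<subseteq> h ` D" using K.idlD(1)[OF i] .
  then have "E \<subseteq> h ` carrier F" using D by blast
  then show 1: "h ` pre E = E" by (rule pre(2))
  show 2: "pre E \<subseteq> D" using E h_mem[OF D] by (auto simp: pre_def)
  show "ideal (pre E) (F\<lparr>carrier := D\<rparr>)" using idl_iff[OF s 2] i 1 by simp
qed

lemma noeth_transfer:
  assumes s: "subring D F" and n: "noetherian_ring (F\<lparr>carrier := D\<rparr>)"
  shows "K.ideals_noetherian (h ` D)"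
  unfolding K.ideals_noetherian_def
proof (intro allI impI)
  fix \<F> assume F: "\<F> \<noteq> {}" "\<forall>E\<in>\<F>. K.ideal_in (h ` D) E"
  interpret R: noetherian_ring "F\<lparr>carrier := D\<rparr>" by fact
  have "\<exists>M0\<in>pre ` \<F>. (\<forall>J\<in>pre ` \<F>. M0 \<subseteq> J \<longrightarrow> J = M0)"
    by (rule R.ex_maximal_ideal_in_family) (use F idl_pre[OF s] in auto)
  then obtain M0 where M0: "M0 \<in> pre ` \<F>" "\<forall>J\<in>pre ` \<F>. M0 \<subseteq> J \<longrightarrow> J = M0" by (elim bexE)
  obtain M where M: "M \<in> \<F>" "M0 = pre M" using M0(1) by (elim imageE)
  have max: "pre E = pre M" if "E \<in> \<F>" "pre M \<subseteq> pre E" for E using M0(2) that M(2) by simp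
  have "E = M" if E: "E \<in> \<F>" "M \<subseteq> E" for E
  proof -
    have "pre M \<subseteq> pre E" using E(2) by (auto simp: pre_def)
    then have eq: "pre E = pre M" using max E(1) by blast
    have "E = h ` pre E" by (rule idl_pre(1)[OF s, symmetric]) (use F(2) E(1) in blast)
    also have "\<dots> = M" unfolding eq by (rule idl_pre(1)[OF s]) (use F(2) M(1) in blast)
    finally show ?thesis .
  qed
  then have "\<forall>E\<in>\<F>. M \<subseteq> E \<longrightarrow> E = M" by (intro ballI impI)
  then show "\<exists>M\<in>\<F>. (\<forall>E\<in>\<F>. M \<subseteq> E \<longrightarrow> E = M)" using M(1) by (rule bexI)
qed

lemma eval_snoc:
  assumes "z \<in> carrier F" "set p \<subseteq> carrier F" "c \<in> carrier F"
  shows "eval (p @ [c]) z = z \<otimes> eval p z \<oplus> c"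
  using assms(2)
proof (induction p)
  case Nil then show ?case using assms by simp
next
  case (Cons a p)
  have e: "eval p z \<in> carrier F" using eval_in_carrier[of p z] Cons.prems assms(1) by simp
  have a: "a \<in> carrier F" using Cons.prems by simp
  have "eval ((a # p) @ [c]) z = a \<otimes> z [^] (Suc (length p)) \<oplus> (z \<otimes> eval p z \<oplus> c)"
    using Cons by simp
  also have "a \<otimes> z [^] (Suc (length p)) = z \<otimes> (a \<otimes> z [^] length p)"
    using a assms(1) by (simp add: m_ac)
  finally show ?case using a assms e by (simp add: r_distr a_assoc)
qed

text \<open>Here polynomials are coefficient lists with the leading coefficient first, whereas \<open>K.poly_values\<close> is
built up from the constant coefficient; hence appending an element to a list is the relevant
step.\<close>
lemma pl_eval:
  assumes A: "A \<subseteq> carrier F" and z: "z \<in> carrier F"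
  shows "w \<in> K.poly_values (h ` A) (h z) n \<Longrightarrow> \<exists>p. set p \<subseteq> A \<and> length p = Suc n \<and> w = h (eval p z)"
proof (induction n arbitrary: w)
  case 0
  then obtain a where "a \<in> A" "w = h a" by auto
  then show ?case using A z by (intro exI[of _ "[a]"]) auto
next
  case (Suc n)
  then obtain u v where uv: "u \<in> h ` A" "v \<in> K.poly_values (h ` A) (h z) n" "w = u + h z * v" by (metis K.plE)
  obtain c where c: "c \<in> A" "u = h c" using uv(1) by blast
  obtain p where p: "set p \<subseteq> A" "length p = Suc n" "v = h (eval p z)" using Suc.IH[OF uv(2)] by blast
  have C: "c \<in> carrier F" "set p \<subseteq> carrier F" "eval p z \<in> carrier F" using c p A z eval_in_carrier[of p z] by auto
  have "w = h (z \<otimes> eval p z \<oplus> c)" unfolding uv(3) c(2) p(3) using C z by (simp add: add.commute)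
  then have "w = h (eval (p @ [c]) z)" using eval_snoc[OF z C(2,1)] by simp
  then show ?case using p c by (intro exI[of _ "p @ [c]"]) auto
qed

lemma pw_h: "z \<in> carrier F \<Longrightarrow> K.pw (h z) n = h (z [^] n)"
proof (induction n)
  case (Suc n)
  then have "K.pw (h z) (Suc n) = h (z \<otimes> z [^] n)" by simp
  then show ?case using Suc.prems m_comm[of z "z [^] n"] by simp
qed simp

lemma eval_uminus:
  assumes "z \<in> carrier F" "set p \<subseteq> carrier F" shows "eval (map (\<lambda>c. \<ominus> c) p) z = \<ominus> eval p z"
  using assms(2)
proof (induction p)
  case (Cons a p)
  have e: "eval p z \<in> carrier F" using eval_in_carrier[of p z] Cons.prems assms(1) by simp
  then show ?case using Cons assms(1) by (simp add: l_minus minus_add)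
qed simp

lemma intc_transfer:
  assumes s: "subring A F" and i: "integrally_closed_in F A" shows "K.int_closed (h ` A)"
  unfolding K.int_closed_def
proof (intro ballI allI impI)
  have A: "A \<subseteq> carrier F" using subringE(1)[OF s] .
  fix u n assume "u \<in> h ` carrier F" and poly_values: "K.pw u (Suc n) \<in> K.poly_values (h ` A) u n"
  then obtain z where z: "z \<in> carrier F" "u = h z" by blast
  obtain p where p: "set p \<subseteq> A" "length p = Suc n" "K.pw u (Suc n) = h (eval p z)" 
    using pl_eval[OF A z(1)] poly_values z(2) by blast
  have pC: "set p \<subseteq> carrier F" "eval p z \<in> carrier F" using p A z eval_in_carrier[of p z] by auto
  have "h (z [^] Suc n) = h (eval p z)" using p(3) pw_h[OF z(1), of "Suc n"] z(2) by simp
  then have zp: "z [^] Suc n = eval p z" using h_inj[of "z [^] Suc n" "eval p z"] z(1) pC by simp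
  define q where "q = \<one> # map (\<lambda>c. \<ominus> c) p"
  have "polynomial A q" unfolding polynomial_def q_def using p(1) subringE(3,5)[OF s] by auto
  moreover have "eval q z = \<zero>" unfolding q_def using eval_uminus[OF z(1) pC(1)] p(2) zp z(1) pC(2) by (simp add: r_neg)
  ultimately have "integral_over F A z" unfolding integral_over_def q_def by (intro exI[of _ q]) (auto simp: q_def)
  then show "u \<in> h ` A" using i z unfolding integrally_closed_in_def by blast
qed

lemma prime_chain:
  assumes "krull_dim R = 2"
  shows "\<exists>P0 P1 P2. primeideal P0 R \<and> primeideal P1 R \<and> primeideal P2 R \<and> P0 \<subset> P1 \<and> P1 \<subset> P2"
proof -
  let ?S = "{enat n | n. \<exists>P :: nat \<Rightarrow> 'c set. (\<forall>i\<le>n. primeideal (P i) R) \<and> (\<forall>i<n. P i \<subset> P (Suc i))}"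
  have "\<not> (\<forall>v\<in>?S. v \<le> 1)"
  proof
    assume "\<forall>v\<in>?S. v \<le> 1"
    then have "krull_dim R \<le> 1" unfolding krull_dim_def by (intro Sup_least) blast
    then show False using assms by simp
  qed
  then obtain n P where n: "\<not> enat n \<le> 1" and P: "\<forall>i\<le>n. primeideal (P i) R" "\<forall>i<n. P i \<subset> P (Suc i)" by blast
  have "n \<ge> 2" using n by (simp add: one_enat_def)
  then show ?thesis using P by (intro exI[of _ "P 0"] exI[of _ "P (Suc 0)"] exI[of _ "P (Suc (Suc 0))"]) auto
qed

text \<open>The number two of generators of the maximal ideal provides the parameters, and the middle term of a
chain of three primes is the prime required by \<open>noeth_dim2\<close>.\<close>
lemma regular_transfer:
  assumes q: "is_quotient_field F D" and r: "regular_local_ring (F\<lparr>carrier := D\<rparr>)" and d: "krull_dim (F\<lparr>carrier := D\<rparr>) = 2"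
  shows "\<exists>x y. regular2 (h ` carrier F) (h \<one>) (h ` D) x y" "K.coprime_fractions (h ` D)"
proof -
  let ?R = "F\<lparr>carrier := D\<rparr>"
  have s: "subring D F" using q by (simp add: is_quotient_field_def)
  have D: "D \<subseteq> carrier F" using subringE(1)[OF s] .
  interpret R: cring ?R using subring_cring[OF s] .
  interpret R: noetherian_ring ?R using r by (simp add: regular_local_ring_def)
  have l: "local_ring ?R" using r by (simp add: regular_local_ring_def)
  define m where "m = the_max_ideal ?R"
  have m: "m = nonunits D" "maximalideal m ?R"
    unfolding m_def using local_transfer(1)[OF s l] R.the_max_ideal_local(2)[OF l] by auto
  have mD: "m \<subseteq> D" using m(1) nonunits_sub by blast
  interpret m: maximalideal m ?R by fact
  have "enat (min_num_generators ?R m) = 2" using r d unfolding regular_local_ring_def m_def by simp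
  then have mn: "min_num_generators ?R m = 2" by (metis enat_ord_number(1) numeral_eq_enat enat.inject)
  have "\<exists>n. \<exists>S \<subseteq> carrier ?R. finite S \<and> card S = n \<and> m = Idl\<^bsub>?R\<^esub> S"
    using R.finetely_gen[OF m.is_ideal] by blast
  then have "\<exists>S \<subseteq> carrier ?R. finite S \<and> card S = min_num_generators ?R m \<and> m = Idl\<^bsub>?R\<^esub> S"
    unfolding min_num_generators_def by (rule LeastI_ex)
  then obtain S where S: "S \<subseteq> D" "card S = 2" "m = Idl\<^bsub>?R\<^esub> S" unfolding mn by auto
  obtain x y where xy: "S = {x, y}" using S(2) by (auto simp: card_2_iff)
  have xyD: "x \<in> D" "y \<in> D" using S xy by auto
  have sK: "K.is_subring (h ` D)" using sring_iff[OF D] s by simp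
  have hxy: "h x \<in> h ` D" "h y \<in> h ` D" using xyD by auto
  interpret g: two_parameters "h ` carrier F" "h \<one>" "h ` D" "h x" "h y" by unfold_locales (use sK hxy in auto)
  define J where "J = K.add_generator (h ` D) (K.add_generator (h ` D) {0} (h x)) (h y)"
  note i1 = K.idl_isum[OF sK K.idl_zero[OF sK] hxy(1)]
  note i2 = K.idl_isum[OF sK i1(1) hxy(2), folded J_def]
  have JI: "J \<subseteq> g.I 1"
  proof
    fix j assume "j \<in> J"
    then obtain u b where u: "u \<in> K.add_generator (h ` D) {0} (h x)" "b \<in> h ` D" "j = u + h y * b" unfolding J_def by (metis K.isumE)
    then obtain v c where "v \<in> {0 :: ('a, 'b) ring_family}" "c \<in> h ` D" "u = v + h x * c" by (metis K.isumE)
    then show "j \<in> g.I 1" unfolding g.I_1_iff using u by auto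
  qed
  note pJ = idl_pre[OF s i2(1)]
  have "h x \<in> J" "h y \<in> J" using i1(3) i2(2,3) by auto
  then have "{x, y} \<subseteq> pre J" using xyD D by (auto simp: pre_def)
  then have mJ: "m \<subseteq> pre J" unfolding S(3) xy using R.genideal_minimal[OF pJ(3)] by blast
  have xym: "x \<in> m" "y \<in> m" unfolding S(3) using R.genideal_self[of S] S(1) xy by auto
  have im: "K.ideal_in (h ` D) (h ` m)" using idl_iff[OF s mD] m.is_ideal by blast
  have Im: "g.I 1 \<subseteq> h ` m"
  proof
    fix j assume "j \<in> g.I 1"
    then obtain b c where bc: "b \<in> h ` D" "c \<in> h ` D" "j = h x * b + h y * c" using g.I_1_iff by blast
    show "j \<in> h ` m" unfolding bc(3)
      using K.idlD(3)[OF im K.idlD(5)[OF im imageI[OF xym(1)] bc(1)] K.idlD(5)[OF im imageI[OF xym(2)] bc(2)]] .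
  qed
  have oneD: "\<one> \<in> D" using subringE(3)[OF s] .
  have onem: "\<one> \<notin> m" using m(1) nonunits_iff[OF D, of \<one>] oneD l_one[OF one_closed] by blast
  obtain P0 P1 P2 where P: "primeideal P0 ?R" "primeideal P1 ?R" "primeideal P2 ?R" "P0 \<subset> P1" "P1 \<subset> P2"
    using prime_chain[OF d] by blast
  interpret P0: primeideal P0 ?R by fact
  interpret P1: primeideal P1 ?R by fact
  interpret P2: primeideal P2 ?R by fact
  have PD: "P1 \<subseteq> D" "P2 \<subseteq> D" "P0 \<subseteq> D" using P0.a_subset P1.a_subset P2.a_subset by auto
  have P2m: "P2 \<subseteq> m"
  proof
    fix a assume a: "a \<in> P2"
    have "\<not> (\<exists>b\<in>D. a \<otimes> b = \<one>)"
    proof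
      assume "\<exists>b\<in>D. a \<otimes> b = \<one>"
      then obtain b where b: "b \<in> D" "a \<otimes> b = \<one>" by blast
      then have "\<one>\<^bsub>?R\<^esub> \<in> P2" using P2.I_r_closed[OF a, of b] by simp
      then show False using P2.one_imp_carrier P2.I_notcarr by blast
    qed
    then show "a \<in> m" using m(1) nonunits_iff[OF D] a PD by blast
  qed
  obtain t where t: "t \<in> P1" "t \<notin> P0" using P(4) by blast
  have tC: "t \<in> carrier F" using t PD D by blast
  have "\<zero> \<in> P0" using P0.zero_closed by simp
  then have t0: "t \<noteq> \<zero>" using t by blast
  have iP: "K.ideal_in (h ` D) (h ` P1)" using idl_iff[OF s PD(1)] P1.is_ideal by blast
  interpret n: noeth_dim2 "h ` carrier F" "h \<one>" "h ` D" "h x" "h y" "h ` P1" "h t"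
  proof unfold_locales
    show "K.ideals_noetherian (h ` D)" using noeth_transfer[OF s R.noetherian_ring_axioms] .
    show "K.unit_in (h ` D) u \<or> u \<in> g.I 1" if u: "u \<in> h ` D" for u
    proof (cases "K.unit_in (h ` D) u")
      case False
      then have "u \<in> h ` nonunits D" using mx_eq[OF D] u by (auto simp: K.nonunits_of_def)
      then have "u \<in> h ` pre J" using m(1) mJ by blast
      then show ?thesis using pJ(1) JI by blast
    qed simp
    show "h \<one> \<notin> g.I 1"
    proof
      assume "h \<one> \<in> g.I 1"
      then have "h \<one> \<in> h ` m" using Im by blast
      then show False using h_mem[of m \<one>] mD D onem by auto
    qed
    show "K.ideal_in (h ` D) (h ` P1)" by fact
    show "u \<in> h ` P1 \<or> v \<in> h ` P1" if uv: "u \<in> h ` D" "v \<in> h ` D" "u * v \<in> h ` P1" for u v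
    proof -
      obtain a b where ab: "a \<in> D" "b \<in> D" "u = h a" "v = h b" using uv by blast
      then have C: "a \<in> carrier F" "b \<in> carrier F" using D by auto
      have "h (a \<otimes> b) \<in> h ` P1" using uv(3) ab h_ops(3)[OF C] by simp
      then have "a \<otimes> b \<in> P1" using h_mem[of P1 "a \<otimes> b"] PD D C by simp
      then show ?thesis using P1.I_prime[of a b] ab by auto
    qed
    show "h t \<in> h ` P1" using t by blast
    show "h t \<noteq> 0" using h_inj[OF tC zero_closed] t0 h_zero by simp
    show "\<not> g.I 1 \<subseteq> h ` P1"
    proof
      assume I: "g.I 1 \<subseteq> h ` P1"
      obtain w where w: "w \<in> P2" "w \<notin> P1" using P(5) by blast
      then have "h w \<in> h ` pre J" using P2m mJ by blast
      then have "h w \<in> h ` P1" using pJ(1) JI I by blast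
      then show False using h_mem[of P1 w] PD D w by blast
    qed
  qed
  show "\<exists>x y. regular2 (h ` carrier F) (h \<one>) (h ` D) x y" using n.is_reg by blast
  show "K.coprime_fractions (h ` D)"
  proof (rule n.fin_of_fractions)
    fix u assume "u \<in> h ` carrier F"
    then obtain z where z: "z \<in> carrier F" "u = h z" by blast
    obtain a b where ab: "a \<in> D" "b \<in> D" "b \<noteq> \<zero>" "z = a \<otimes> inv b" 
      using q z unfolding is_quotient_field_def by blast
    have C: "a \<in> carrier F" "b \<in> carrier F" using ab D by auto
    note ib = inv_eq[OF C(2) ab(3)]
    have "z \<otimes> b = a \<otimes> (b \<otimes> inv b)" unfolding ab(4) using C ib by (simp add: m_ac)
    then have "z \<otimes> b = a" using ib C by simp
    then have "u * h b = h a" using z h_ops(3)[OF z(1) C(2)] by simp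
    moreover have "h b \<noteq> 0" using h_inj[OF C(2) zero_closed] ab(3) h_zero by simp
    ultimately show "\<exists>a\<in>h ` D. \<exists>b\<in>h ` D. b \<noteq> 0 \<and> u * b = a" using ab by blast
  qed
qed

text \<open>The condition \<open>y \<notin> V\<close> of a basic patch open set says that the inverse of \<open>y\<close> is a nonunit of \<open>V\<close>. So a
neighbourhood is described by finitely many elements of \<open>V\<close> that are to remain in the ring, and
to remain nonunits if they are nonunits.\<close>
lemma patch_neighbourhood:
  assumes "openin (patch_topology F D) W" "V \<in> W"
  shows "\<exists>S. finite S \<and> S \<subseteq> V \<and> (\<forall>U\<in>Zar F D. S \<subseteq> U \<longrightarrow> S \<inter> nonunits V \<subseteq> nonunits U \<longrightarrow> U \<in> W)"
proof -
  let ?B = "{{V \<in> Zar F D. S \<subseteq> V \<and> y \<notin> V} | S y. finite S \<and> S \<subseteq> carrier F \<and> y \<in> carrier F} \<union>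
      {{V \<in> Zar F D. S \<subseteq> V} | S. finite S \<and> S \<subseteq> carrier F}"
  have "generate_topology_on ?B W" 
    using assms(1) unfolding patch_topology_def openin_topology_generated_by_iff .
  then show ?thesis using assms(2)
  proof (induction rule: generate_topology_on.induct)
    case (Int a b)
    then obtain S T where 
      "finite S \<and> S \<subseteq> V \<and> (\<forall>U\<in>Zar F D. S \<subseteq> U \<longrightarrow> S \<inter> nonunits V \<subseteq> nonunits U \<longrightarrow> U \<in> a)"
      "finite T \<and> T \<subseteq> V \<and> (\<forall>U\<in>Zar F D. T \<subseteq> U \<longrightarrow> T \<inter> nonunits V \<subseteq> nonunits U \<longrightarrow> U \<in> b)" by blast
    then show ?case by (intro exI[of _ "S \<union> T"]) blast
  next
    case (UN \<K>)
    from UN.prems obtain k where k: "k \<in> \<K>" "V \<in> k" by (elim UnionE)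
    obtain S where S: "finite S \<and> S \<subseteq> V \<and> (\<forall>U\<in>Zar F D. S \<subseteq> U \<longrightarrow> S \<inter> nonunits V \<subseteq> nonunits U \<longrightarrow> U \<in> k)" 
      using UN.IH[OF k] by (elim exE)
    have "U \<in> \<Union>\<K>" if "U \<in> k" for U using that k(1) by (rule UnionI[rotated])
    then show ?case using S by (intro exI[of _ S]) simp
  next
    case (Basis W)
    from Basis.hyps show ?case
    proof (elim UnE)
      assume "W \<in> {{V \<in> Zar F D. S \<subseteq> V \<and> y \<notin> V} | S y. finite S \<and> S \<subseteq> carrier F \<and> y \<in> carrier F}"
      then obtain S y where W: "W = {V \<in> Zar F D. S \<subseteq> V \<and> y \<notin> V}" "finite S" "y \<in> carrier F" by blast
      have V: "V \<in> Zar F D" "S \<subseteq> V" "y \<notin> V" using Basis.prems W(1) by auto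
      have vV: "valuation_ring_of F V" and sV: "subring V F" using V(1) by (auto simp: Zar_def valuation_ring_of_def)
      have VC: "V \<subseteq> carrier F" using subringE(1)[OF sV] .
      have y0: "y \<noteq> \<zero>" using V(3) subringE(2)[OF sV] by blast
      note iy = inv_eq[OF W(3) y0]
      have iV: "inv y \<in> V" using vV V(3) W(3) y0 unfolding valuation_ring_of_def by blast
      have inU: "inv y \<in> nonunits U \<longleftrightarrow> y \<notin> U" if U: "valuation_ring_of F U" "inv y \<in> U" for U
      proof -
        have sU: "subring U F" using U by (simp add: valuation_ring_of_def)
        have UC: "U \<subseteq> carrier F" using subringE(1)[OF sU] .
        have "b = y" if b: "b \<in> U" "inv y \<otimes> b = \<one>" for b
        proof -
          have bC: "b \<in> carrier F" using b UC by blast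
          have "y = y \<otimes> (inv y \<otimes> b)" using b W(3) by simp
          also have "\<dots> = b" using iy bC W(3) by (simp add: m_assoc[symmetric])
          finally show ?thesis by simp
        qed
        moreover have "inv y \<otimes> y = \<one>" using iy m_comm[of y "inv y"] W(3) by simp
        ultimately show ?thesis using nonunits_iff[OF UC] U(2) by blast
      qed
      have "U \<in> W" if U: "U \<in> Zar F D" "insert (inv y) S \<subseteq> U" "insert (inv y) S \<inter> nonunits V \<subseteq> nonunits U" for U
      proof -
        have "inv y \<in> nonunits V" using inU[OF vV iV] V(3) by blast
        then have "inv y \<in> nonunits U" using U(3) by blast
        then have "y \<notin> U" using inU U(1,2) by (auto simp: Zar_def)
        then show ?thesis using W(1) U by blast
      qed
      then show ?thesis using W(2) V(2) iV by (intro exI[of _ "insert (inv y) S"]) auto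
    next
      assume "W \<in> {{V \<in> Zar F D. S \<subseteq> V} | S. finite S \<and> S \<subseteq> carrier F}"
      then obtain S where W: "W = {V \<in> Zar F D. S \<subseteq> V}" "finite S" by blast
      then show ?thesis using Basis.prems by (intro exI[of _ S]) auto
    qed
  qed simp
qed

end

section \<open>Patch closed representations\<close>

theorem theorem4p3:
  fixes F :: "('a, 'b) ring_scheme" and D A :: "'a set"
  assumes "is_quotient_field F D"
    and "regular_local_ring (F\<lparr>carrier := D\<rparr>)"
    and "krull_dim (F\<lparr>carrier := D\<rparr>) = 2"
    and "overring F D A"
    and "local_ring (F\<lparr>carrier := A\<rparr>)"
    and "integrally_closed_in F A"
  shows "{Z. Z \<noteq> {} \<and> closedin (subtopology (patch_topology F D) (Val F A)) Z \<and> A = \<Inter>Z} =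
    {Val F A}"
proof -
  interpret embedded_field F using assms(1) by (simp add: embedded_field_def is_quotient_field_def)
  have sA: "subring A F" and DA: "D \<subseteq> A" using assms(4) by (auto simp: overring_def)
  have sD: "subring D F" using assms(1) by (simp add: is_quotient_field_def)
  have AC: "A \<subseteq> carrier F" and DC: "D \<subseteq> carrier F" using subringE(1) sA sD by blast+
  note Vi = Val_iff[OF sA assms(5)]
  have lA: "K.is_local (h ` A)" and iA: "K.int_closed (h ` A)" 
    using local_transfer(2)[OF sA assms(5)] intc_transfer[OF sA assms(6)] .
  obtain x y where xy: "regular2 (h ` carrier F) (h \<one>\<^bsub>F\<^esub>) (h ` D) x y" and coprime_fractions: "K.coprime_fractions (h ` D)"
    using regular_transfer[OF assms(1-3)] by blast
  have ValI: "pre U \<in> Val F A" if "U \<in> K.dominators (h ` A)" for U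
  proof -
    have "U \<subseteq> h ` carrier F" using K.sringD(1)[OF K.DomD(2)[OF that]] .
    then show ?thesis using Vi[of "pre U"] pre that by simp
  qed
  have ne: "Val F A \<noteq> {}" using K.Dom_nonempty[OF lA] ValI by blast
  have VC: "V \<subseteq> carrier F" "A \<subseteq> V" "V \<in> Zar F D" if "V \<in> Val F A" for V
    using that DA subringE(1) by (auto simp: Val_def Zar_def valuation_ring_of_def)
  have Int: "A = \<Inter>(Val F A)"
  proof
    show "\<Inter>(Val F A) \<subseteq> A"
    proof
      fix z assume z: "z \<in> \<Inter>(Val F A)"
      obtain V where "V \<in> Val F A" using ne by blast
      then have zC: "z \<in> carrier F" using z VC by blast
      show "z \<in> A"
      proof (rule ccontr)
        assume "z \<notin> A"
        then have "h z \<notin> h ` A" using h_mem[OF AC zC] by blast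
        then obtain U where U: "U \<in> K.dominators (h ` A)" "h z \<notin> U" using K.ex_Dom[OF lA iA] zC by blast
        have "z \<in> pre U" using ValI[OF U(1)] z by (rule InterD[rotated])
        then show False using U(2) by (simp add: pre_def)
      qed
    qed
  qed (use VC in blast)
  have top: "topspace (patch_topology F D) = Zar F D"
  proof -
    have "{V \<in> Zar F D. {} \<subseteq> V} \<in> {{V \<in> Zar F D. S \<subseteq> V} | S. finite S \<and> S \<subseteq> carrier F}"
      by (intro CollectI exI[of _ "{}"]) simp
    then show ?thesis unfolding patch_topology_def topology_generated_by_topspace by fast
  qed
  have clVal: "closedin (subtopology (patch_topology F D) (Val F A)) (Val F A)"
  proof -
    have "topspace (subtopology (patch_topology F D) (Val F A)) = Val F A"
      unfolding topspace_subtopology top using VC by blast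
    then show ?thesis by (metis closedin_topspace)
  qed
  have "Z = Val F A" if Z: "Z \<noteq> {}" "closedin (subtopology (patch_topology F D) (Val F A)) Z" "A = \<Inter>Z" for Z
  proof (rule ccontr)
    assume "Z \<noteq> Val F A"
    have ZV: "Z \<subseteq> Val F A" using closedin_subset[OF Z(2)] by (simp add: topspace_subtopology)
    then obtain V where V: "V \<in> Val F A" "V \<notin> Z" using \<open>Z \<noteq> Val F A\<close> by blast
    have "openin (subtopology (patch_topology F D) (Val F A)) (topspace (subtopology (patch_topology F D) (Val F A)) - Z)"
      using Z(2) by (simp add: closedin_def)
    then obtain W where W: "openin (patch_topology F D) W" 
      "topspace (subtopology (patch_topology F D) (Val F A)) - Z = W \<inter> Val F A"
      unfolding openin_subtopology by auto
    have WZ: "W \<inter> Val F A = Val F A - Z" using W(2) VC unfolding topspace_subtopology top by blast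
    then have VW: "V \<in> W" using V by blast
    obtain S where S: "finite S" "S \<subseteq> V" 
      "\<forall>U\<in>Zar F D. S \<subseteq> U \<longrightarrow> S \<inter> nonunits V \<subseteq> nonunits U \<longrightarrow> U \<in> W"
      using patch_neighbourhood[OF W(1) VW] by (elim exE conjE)
    let ?\<V> = "(\<lambda>V. h ` V) ` Z"
    have ZD: "?\<V> \<subseteq> K.dominators (h ` A)" using ZV Vi by blast
    have AZ: "h ` A = \<Inter>?\<V>"
    proof
      show "h ` A \<subseteq> \<Inter>?\<V>" using Z(3) by blast
      show "\<Inter>?\<V> \<subseteq> h ` A"
      proof
        fix u assume u: "u \<in> \<Inter>?\<V>"
        obtain V0 where V0: "V0 \<in> Z" using Z(1) by blast
        then obtain a where a: "a \<in> V0" "u = h a" using u by blast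
        have aC: "a \<in> carrier F" using a V0 ZV VC by blast
        have "a \<in> U" if "U \<in> Z" for U
        proof -
          have "h a \<in> h ` U" using u a that by blast
          then show ?thesis using h_mem[OF _ aC, of U] VC ZV that by blast
        qed
        then show "u \<in> h ` A" using a Z(3) by blast
      qed
    qed
    have VD: "h ` V \<in> K.dominators (h ` A)" using V(1) Vi by blast
    have Zne: "?\<V> \<noteq> {}" using Z(1) by simp
    obtain U' where U': "U' \<in> ?\<V>" "h ` S \<subseteq> U'" "h ` S \<inter> K.nonunits_of (h ` V) \<subseteq> K.nonunits_of U'"
      using K.density[OF xy coprime_fractions lA image_mono[OF DA] ZD Zne AZ VD finite_imageI[OF S(1)] image_mono[OF S(2)]]
      by (elim bexE conjE)
    then obtain U where U: "U \<in> Z" "U' = h ` U" by blast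
    have UV: "U \<in> Val F A" using U ZV by blast
    have SC: "S \<subseteq> carrier F" using S VC V by blast
    have "S \<subseteq> U" using U'(2) U(2) h_subset[OF SC VC(1)[OF UV]] by simp
    moreover have "S \<inter> nonunits V \<subseteq> nonunits U"
    proof
      fix a assume a: "a \<in> S \<inter> nonunits V"
      then have "h a \<in> h ` nonunits U" using U'(3) U(2) mx_eq[OF VC(1)[OF V(1)]] mx_eq[OF VC(1)[OF UV]] by blast
      moreover have "nonunits U \<subseteq> carrier F" using nonunits_sub VC(1)[OF UV] by blast
      ultimately show "a \<in> nonunits U" using h_mem a SC by blast
    qed
    ultimately have "U \<in> W" using S(3) VC(3)[OF UV] by simp
    then show False using WZ U UV by blast
  qed
  then show ?thesis using ne clVal Int by blast
qed

end
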